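(* Let $\Gamma$ be a compact metric graph with vertex partition $\mathcal{V}=\mathcal{V}_K\sqcup\mathcal{V}_D$. Let $a,\kappa\in\mathbb{L}_\infty(\Gamma)$ with $\inf_\Gamma a>0$, $\inf_\Gamma\kappa>0$, $a$ Lipschitz on $\Gamma$, and assume that $a\in\bigoplus_{e}C^{1,1}(e)$ and $\kappa^2\in\bigoplus_{e}C^{0,1}(e)$. Let $\mathcal{L}=\kappa^2-\nabla(a\nabla)$ with Kirchhoff conditions on $\mathcal{V}_K$ and Dirichlet conditions on $\mathcal{V}_D$. Let $(\alpha,\beta)\in(-5,5)\times\big((-\frac52,\frac52)\setminus\{\pm\frac12,\pm\frac32\}\big)$ be such that $\alpha+\beta\in(-\frac52,\frac52)\setminus\{\pm\frac12,\pm\frac32\}$, and let $f\in H^\beta_{K,D}(\Gamma)$. Then the fractional PDE $\mathcal{L}^{\alpha/2}u=f$ has a unique solution $u\in H^{\beta+\alpha}_{K,D}(\Gamma)$. Furthermore, there is a constant $C$ depending only on $\alpha$ and $\beta$ (for fixed $\Gamma,a,\kappa,\mathcal{V}_K,\mathcal{V}_D$) such that $$\|u\|_{H^{\alpha+\beta}_{K,D}(\Gamma)}\le C\|f\|_{H^\beta_{K,D}(\Gamma)}.$$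
   Context: Graph. $\Gamma$ is a compact metric graph: it is obtained from a finite connected graph (loops and multiple edges allowed) by identifying every edge $e\in\mathcal{E}$ with an interval $[0,l_e]$, $0<l_e<\infty$, and gluing together the interval endpoints that correspond to the same vertex. "Lipschitz on $\Gamma$" is with respect to the geodesic distance. Each edge has two natural parameterizations $\zeta:[0,l_e]\to e$ (the two orientations); functions on $e$ are identified with functions on $[0,l_e]$. $\mathbb{L}_2(\Gamma)=\bigoplus_e\mathbb{L}_2(e)$ (real-valued), $H^s(e)=H^s(0,l_e)$. $D=\nabla$ is the edgewise weak derivative (odd orders depend on the orientation only up to sign). A function given edgewise is continuous on $\Gamma$ if it has a representative continuous on each closed edge with the same limit at each vertex along all incident edge ends. $C^{k,1}(e)$: functions $f$ on $e$ with $f\circ\zeta\in C^{k,1}([0,l_e])$ and, if $e$ is a loop, also $f\circ\xi\in C^{k,1}([-l_e/2,l_e/2])$, where $\xi(t)=\zeta(t)$ for $t\in[0,l_e/2]$ and $\xi(t)=\zeta(l_e+t)$ for $t\in[-l_e/2,0]$. Spaces $H^s(\Gamma)$, $0<s<\frac52$. $H^1(\Gamma)$ and $H^2(\Gamma)$ are the spaces of continuous functions on $\Gamma$ that are in $H^1(e)$, resp. $H^2(e)$, on each edge, with norm$^2$ $\sum_e\|\cdot\|_{H^k(e)}^2$. For $s\in(0,1)$, $H^s(\Gamma)=[\mathbb{L}_2(\Gamma),H^1(\Gamma)]_s$ (real interpolation, parameters $(s,2)$). For $s\in(1,2)$, $H^s(\Gamma)$ is the space of $\varphi\in H^1(\Gamma)$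 with $D\varphi\in[\mathbb{L}_2(\Gamma),\bigoplus_eH^1(e)]_{s-1}$; for $s\in(2,\frac52)$, the space of $\varphi\in H^2(\Gamma)$ with $D^2\varphi\in H^{s-2}(\Gamma)$; the norms$^2$ are the sums of the squared norms of $\varphi$ in $H^{\lfloor s\rfloor}(\Gamma)$ and of $D^{\lfloor s\rfloor}\varphi$ in the indicated space. Vertex conditions. $u\in K(\Gamma)$: $u\in\mathbb{L}_2(\Gamma)$ is in $H^r$ for some $r>\frac32$ on all edges incident to $\mathcal{V}_K$ and $\sum_{(e,\zeta):\zeta(0)=v}(u\circ\zeta)'(0^+)=0$ for every $v\in\mathcal{V}_K$ (a loop contributes two terms). $u\in D(\Gamma)$: $u\in\mathbb{L}_2(\Gamma)$ is in $H^r$ for some $r>\frac12$ on all edges incident to $\mathcal{V}_D$ and $u(v)=0$ for every $v\in\mathcal{V}_D$. For $0<\beta<\frac52$, $\beta\ne\frac12,\frac32$: $H^\beta_{K,D}(\Gamma)$ equals $H^\beta(\Gamma)$ if $\beta<\frac12$, $H^\beta(\Gamma)\cap D(\Gamma)$ if $\frac12<\beta<\frac32$, and $H^\beta(\Gamma)\cap K(\Gamma)\cap D(\Gamma)$ if $\frac32<\beta<\frac52$, with the norm of $H^\beta(\Gamma)$. For $\beta<0$, $H^\beta_{K,D}(\Gamma)$ is the dual of $H^{-\beta}_{K,D}(\Gamma)$ (pairing extending the $\mathbb{L}_2(\Gamma)$ inner product); $H^0_{K,D}(\Gamma)=\mathbb{L}_2(\Gamma)$. Operator. $\mathcal{L}u=\kappa^2u-\nabla(a\nabla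 u)$ with domain $H^2(\Gamma)\cap K(\Gamma)\cap D(\Gamma)$ is self-adjoint, positive, with compact inverse; let $\{\psi_i\}$ be an orthonormal eigenbasis with eigenvalues $\mu_i>0$. For $s\ge0$, $\dot H^s_{\mathcal{L}}=\{u\in\mathbb{L}_2(\Gamma):\sum_i\mu_i^s\langle u,\psi_i\rangle^2<\infty\}$, $\dot H^{-s}_{\mathcal{L}}$ is its dual, with norm$^2$ $\sum_i\mu_i^{\pm s}\langle u,\psi_i\rangle^2$. For $\alpha,s\in\mathbb{R}$, $\mathcal{L}^{\alpha/2}u=\sum_i\mu_i^{\alpha/2}\langle u,\psi_i\rangle\psi_i$ is an isometric isomorphism $\dot H^s_{\mathcal{L}}\to\dot H^{s-\alpha}_{\mathcal{L}}$; for the orders $s$ considered, $\dot H^s_{\mathcal{L}}$ and $H^s_{K,D}(\Gamma)$ are identified and the equation is understood in this sense. *)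

theory Defs
  imports "HOL-Analysis.Analysis" "HOL-Library.Function_Algebras"
begin

section \<open>Compact metric graphs\<close>

text \<open>
  Every edge \<open>e\<close> comes with one of its two natural parameterizations: it is the interval
  \<open>[0, len e]\<close>, running from \<open>tail e\<close> to \<open>head e\<close>.  Loops and multiple edges are allowed.
  An orientation of \<open>e\<close> is a Boolean; \<open>True\<close> is the chosen parameterization, \<open>False\<close> the reversed one.
\<close>

record ('v, 'e) mgraph =
  verts :: "'v set"
  edges :: "'e set"
  tail :: "'e \<Rightarrow> 'v"
  head :: "'e \<Rightarrow> 'v"
  len :: "'e \<Rightarrow> real"

definition origin :: "('v, 'e) mgraph \<Rightarrow> 'e \<Rightarrow> bool \<Rightarrow> 'v" where
  "origin G e b = (if b then tail G e else head G e)"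

definition param :: "('v, 'e) mgraph \<Rightarrow> 'e \<Rightarrow> bool \<Rightarrow> real \<Rightarrow> real" where
  "param G e b t = (if b then t else len G e - t)"

inductive walk :: "('v, 'e) mgraph \<Rightarrow> 'v \<Rightarrow> 'v \<Rightarrow> real \<Rightarrow> bool" for G where
  walk_refl: "v \<in> verts G \<Longrightarrow> walk G v v 0"
| walk_step: "e \<in> edges G \<Longrightarrow> walk G (origin G e (\<not> b)) w L \<Longrightarrow> walk G (origin G e b) w (len G e + L)"

definition metric_graph :: "('v, 'e) mgraph \<Rightarrow> bool" where
  "metric_graph G \<longleftrightarrow>
     finite (verts G) \<and> verts G \<noteq> {} \<and> finite (edges G) \<and>
     (\<forall>e\<in>edges G. tail G e \<in> verts G \<and> head G e \<in> verts G \<and> 0 < len G e) \<and>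
     (\<forall>v\<in>verts G. \<forall>w\<in>verts G. \<exists>L. walk G v w L)"

text \<open>
  Geodesic distance between the points \<open>x\<close> of \<open>e\<close> and \<open>y\<close> of \<open>e'\<close>: a path either stays in
  \<open>e = e'\<close>, or leaves \<open>e\<close> through one of its ends, follows a walk, and enters \<open>e'\<close> through one of
  its ends.  Note that \<open>param G e b x\<close> is also the distance inside \<open>e\<close> from \<open>x\<close> to \<open>origin G e b\<close>.
\<close>

definition geodist :: "('v, 'e) mgraph \<Rightarrow> 'e \<times> real \<Rightarrow> 'e \<times> real \<Rightarrow> real" where
  "geodist G p q = (case (p, q) of ((e, x), (e', y)) \<Rightarrow>
     Inf ((if e = e' then {\<bar>x - y\<bar>} else {}) \<union>
          {param G e b x + L + param G e' b' y | b b' L. walk G (origin G e b) (origin G e' b') L}))"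

text \<open>
  Functions on the graph are curried: \<open>u e x\<close> is the value at the point \<open>x\<close> of the edge \<open>e\<close>; values
  with \<open>e \<notin> edges G\<close> or \<open>x \<notin> {0..len G e}\<close> are irrelevant.  Lebesgue-type functions are represented
  by actual functions; \<open>aeq\<close> is equality of the classes they represent, and all function spaces
  below are closed under it.
\<close>

type_synonym 'e gfn = "'e \<Rightarrow> real \<Rightarrow> real"

definition aeq :: "('v, 'e) mgraph \<Rightarrow> 'e gfn \<Rightarrow> 'e gfn \<Rightarrow> bool" where
  "aeq G u v \<longleftrightarrow> (\<forall>e\<in>edges G. AE x in lebesgue_on {0..len G e}. u e x = v e x)"

definition has_rep :: "('v, 'e) mgraph \<Rightarrow> ('e gfn \<Rightarrow> bool) \<Rightarrow> 'e gfn \<Rightarrow> bool" where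
  "has_rep G P u \<longleftrightarrow> (\<exists>v. aeq G u v \<and> P v)"

definition Linf :: "('v, 'e) mgraph \<Rightarrow> 'e gfn \<Rightarrow> bool" where
  "Linf G u \<longleftrightarrow>
     (\<forall>e\<in>edges G. u e \<in> borel_measurable (lebesgue_on {0..len G e})) \<and>
     (\<exists>B. \<forall>e\<in>edges G. AE x in lebesgue_on {0..len G e}. \<bar>u e x\<bar> \<le> B)"

definition ess_inf_pos :: "('v, 'e) mgraph \<Rightarrow> 'e gfn \<Rightarrow> bool" where
  "ess_inf_pos G u \<longleftrightarrow>
     (\<exists>c>0. \<forall>e\<in>edges G. AE x in lebesgue_on {0..len G e}. c \<le> u e x)"

definition lipschitz_on_graph :: "('v, 'e) mgraph \<Rightarrow> 'e gfn \<Rightarrow> bool" where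
  "lipschitz_on_graph G u \<longleftrightarrow>
     (\<exists>C. \<forall>e\<in>edges G. \<forall>e'\<in>edges G. \<forall>x\<in>{0..len G e}. \<forall>y\<in>{0..len G e'}.
        \<bar>u e x - u e' y\<bar> \<le> C * geodist G (e, x) (e', y))"

definition Ck1 :: "nat \<Rightarrow> real set \<Rightarrow> (real \<Rightarrow> real) \<Rightarrow> bool" where
  "Ck1 k I f \<longleftrightarrow>
     (\<exists>d. (\<forall>x\<in>I. d 0 x = f x) \<and>
          (\<forall>j<k. \<forall>x\<in>I. (d j has_real_derivative d (Suc j) x) (at x within I)) \<and>
          (\<exists>C. C-lipschitz_on I (d k)))"

text \<open>
  On a loop, \<open>Ck1\<close> is also required across the vertex.  Continuity there forces
  \<open>u e 0 = u e (len G e)\<close>, so the choice of the value at \<open>t = 0\<close> is immaterial.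
\<close>

definition edgewise_Ck1 :: "('v, 'e) mgraph \<Rightarrow> nat \<Rightarrow> 'e gfn \<Rightarrow> bool" where
  "edgewise_Ck1 G k u \<longleftrightarrow>
     (\<forall>e\<in>edges G. Ck1 k {0..len G e} (u e) \<and>
        (tail G e = head G e \<longrightarrow>
           Ck1 k {- len G e / 2..len G e / 2} (\<lambda>t. if 0 \<le> t then u e t else u e (len G e + t))))"

section \<open>Real interpolation (K-method with parameters \<open>(s, 2)\<close>)\<close>

definition K_functional ::
  "'a::plus set \<Rightarrow> ('a \<Rightarrow> real) \<Rightarrow> 'a set \<Rightarrow> ('a \<Rightarrow> real) \<Rightarrow> real \<Rightarrow> 'a \<Rightarrow> real" where
  "K_functional X0 N0 X1 N1 t u =
     Inf {N0 v + t * N1 w | v w. v \<in> X0 \<and> w \<in> X1 \<and> u = v + w}"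

definition interp_nsq ::
  "real \<Rightarrow> 'a::plus set \<Rightarrow> ('a \<Rightarrow> real) \<Rightarrow> 'a set \<Rightarrow> ('a \<Rightarrow> real) \<Rightarrow> 'a \<Rightarrow> ennreal" where
  "interp_nsq s X0 N0 X1 N1 u =
     (\<integral>\<^sup>+ t\<in>{0<..}. ennreal ((t powr (- s) * K_functional X0 N0 X1 N1 t u)\<^sup>2 / t) \<partial>lborel)"

definition interp_space ::
  "real \<Rightarrow> 'a::plus set \<Rightarrow> ('a \<Rightarrow> real) \<Rightarrow> 'a set \<Rightarrow> ('a \<Rightarrow> real) \<Rightarrow> 'a set" where
  "interp_space s X0 N0 X1 N1 =
     {v + w | v w. v \<in> X0 \<and> w \<in> X1} \<inter> {u. interp_nsq s X0 N0 X1 N1 u < \<infinity>}"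

definition interp_norm ::
  "real \<Rightarrow> 'a::plus set \<Rightarrow> ('a \<Rightarrow> real) \<Rightarrow> 'a set \<Rightarrow> ('a \<Rightarrow> real) \<Rightarrow> 'a \<Rightarrow> real" where
  "interp_norm s X0 N0 X1 N1 u = sqrt (enn2real (interp_nsq s X0 N0 X1 N1 u))"

section \<open>Sobolev spaces on an interval \<open>(0, l)\<close>\<close>

definition L2_int :: "real \<Rightarrow> (real \<Rightarrow> real) set" where
  "L2_int l = {u \<in> borel_measurable (lebesgue_on {0..l}).
                 integrable (lebesgue_on {0..l}) (\<lambda>x. (u x)\<^sup>2)}"

definition test_fun :: "real \<Rightarrow> (real \<Rightarrow> real) \<Rightarrow> bool" where
  "test_fun l \<phi> \<longleftrightarrow>
     (\<forall>k x. (deriv ^^ k) \<phi> differentiable (at x)) \<and>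
     (\<exists>c d. 0 < c \<and> d < l \<and> (\<forall>x. x \<notin> {c..d} \<longrightarrow> \<phi> x = 0))"

definition weak_deriv :: "real \<Rightarrow> (real \<Rightarrow> real) \<Rightarrow> (real \<Rightarrow> real) \<Rightarrow> bool" where
  "weak_deriv l u w \<longleftrightarrow> w \<in> L2_int l \<and>
     (\<forall>\<phi>. test_fun l \<phi> \<longrightarrow>
        integral\<^sup>L (lebesgue_on {0..l}) (\<lambda>x. u x * deriv \<phi> x) =
        - integral\<^sup>L (lebesgue_on {0..l}) (\<lambda>x. w x * \<phi> x))"

text \<open>The weak derivative is unique up to null sets; \<open>wD\<close> picks a representative.\<close>

definition wD :: "real \<Rightarrow> (real \<Rightarrow> real) \<Rightarrow> real \<Rightarrow> real" where
  "wD l u = (SOME w. weak_deriv l u w)"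

primrec Hk_int :: "real \<Rightarrow> nat \<Rightarrow> (real \<Rightarrow> real) set" where
  "Hk_int l 0 = L2_int l"
| "Hk_int l (Suc k) = {u \<in> L2_int l. (\<exists>w. weak_deriv l u w) \<and> wD l u \<in> Hk_int l k}"

primrec Hk_int_nsq :: "real \<Rightarrow> nat \<Rightarrow> (real \<Rightarrow> real) \<Rightarrow> real" where
  "Hk_int_nsq l 0 u = integral\<^sup>L (lebesgue_on {0..l}) (\<lambda>x. (u x)\<^sup>2)"
| "Hk_int_nsq l (Suc k) u =
     integral\<^sup>L (lebesgue_on {0..l}) (\<lambda>x. (u x)\<^sup>2) + Hk_int_nsq l k (wD l u)"

text \<open>For \<open>r \<ge> 0\<close>; the fractional part of the order is obtained by real interpolation.\<close>

definition Hs_int :: "real \<Rightarrow> real \<Rightarrow> (real \<Rightarrow> real) set" where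
  "Hs_int l r = {u \<in> Hk_int l (nat \<lfloor>r\<rfloor>).
     0 < frac r \<longrightarrow>
       (wD l ^^ nat \<lfloor>r\<rfloor>) u \<in> interp_space (frac r)
          (Hk_int l 0) (\<lambda>v. sqrt (Hk_int_nsq l 0 v)) (Hk_int l 1) (\<lambda>v. sqrt (Hk_int_nsq l 1 v))}"

section \<open>Sobolev spaces on the graph\<close>

definition D_graph :: "('v, 'e) mgraph \<Rightarrow> 'e gfn \<Rightarrow> 'e gfn" where
  "D_graph G u = (\<lambda>e. wD (len G e) (u e))"

text \<open>The direct sum of the spaces \<open>H\<^sup>k(e)\<close>; in particular \<open>HkE G 0\<close> is \<open>L\<^sub>2\<close> of the graph.\<close>

definition HkE :: "('v, 'e) mgraph \<Rightarrow> nat \<Rightarrow> 'e gfn set" where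
  "HkE G k = {u. \<forall>e\<in>edges G. u e \<in> Hk_int (len G e) k}"

definition HkE_norm :: "('v, 'e) mgraph \<Rightarrow> nat \<Rightarrow> 'e gfn \<Rightarrow> real" where
  "HkE_norm G k u = sqrt (\<Sum>e\<in>edges G. Hk_int_nsq (len G e) k (u e))"

abbreviation L2 :: "('v, 'e) mgraph \<Rightarrow> 'e gfn set" where
  "L2 G \<equiv> HkE G 0"

abbreviation L2_norm :: "('v, 'e) mgraph \<Rightarrow> 'e gfn \<Rightarrow> real" where
  "L2_norm G \<equiv> HkE_norm G 0"

definition L2_inner :: "('v, 'e) mgraph \<Rightarrow> 'e gfn \<Rightarrow> 'e gfn \<Rightarrow> real" where
  "L2_inner G u v = (\<Sum>e\<in>edges G. integral\<^sup>L (lebesgue_on {0..len G e}) (\<lambda>x. u e x * v e x))"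

definition cont_graph :: "('v, 'e) mgraph \<Rightarrow> 'e gfn \<Rightarrow> bool" where
  "cont_graph G u \<longleftrightarrow>
     (\<forall>e\<in>edges G. continuous_on {0..len G e} (u e)) \<and>
     (\<exists>c. \<forall>e\<in>edges G. u e 0 = c (tail G e) \<and> u e (len G e) = c (head G e))"

definition HkG :: "('v, 'e) mgraph \<Rightarrow> nat \<Rightarrow> 'e gfn set" where
  "HkG G k = {u \<in> HkE G k. has_rep G (cont_graph G) u}"

definition Hs :: "('v, 'e) mgraph \<Rightarrow> real \<Rightarrow> 'e gfn set" where
  "Hs G s =
    (if s = 0 then L2 G
     else if s < 1 then interp_space s (L2 G) (L2_norm G) (HkG G 1) (HkE_norm G 1)
     else if s = 1 then HkG G 1
     else if s < 2 then
       {u \<in> HkG G 1. D_graph G u \<in> interp_space (s - 1) (L2 G) (L2_norm G) (HkE G 1) (HkE_norm G 1)}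
     else if s = 2 then HkG G 2
     else {u \<in> HkG G 2. D_graph G (D_graph G u) \<in>
             interp_space (s - 2) (L2 G) (L2_norm G) (HkG G 1) (HkE_norm G 1)})"

definition Hs_norm :: "('v, 'e) mgraph \<Rightarrow> real \<Rightarrow> 'e gfn \<Rightarrow> real" where
  "Hs_norm G s u =
    (if s = 0 then L2_norm G u
     else if s < 1 then interp_norm s (L2 G) (L2_norm G) (HkG G 1) (HkE_norm G 1) u
     else if s = 1 then HkE_norm G 1 u
     else if s < 2 then
       sqrt ((HkE_norm G 1 u)\<^sup>2 +
         (interp_norm (s - 1) (L2 G) (L2_norm G) (HkE G 1) (HkE_norm G 1) (D_graph G u))\<^sup>2)
     else if s = 2 then HkE_norm G 2 u
     else
       sqrt ((HkE_norm G 2 u)\<^sup>2 +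
         (interp_norm (s - 2) (L2 G) (L2_norm G) (HkG G 1) (HkE_norm G 1)
            (D_graph G (D_graph G u)))\<^sup>2))"

section \<open>Vertex conditions\<close>

text \<open>
  Pointwise values and one-sided derivatives at the vertices are those of a representative that is
  continuous on the closed incident edges; on such an edge it is unique.
\<close>

definition incident :: "('v, 'e) mgraph \<Rightarrow> 'v set \<Rightarrow> 'e set" where
  "incident G W = {e \<in> edges G. tail G e \<in> W \<or> head G e \<in> W}"

definition Kirchhoff :: "('v, 'e) mgraph \<Rightarrow> 'v set \<Rightarrow> 'e gfn set" where
  "Kirchhoff G VK = {u \<in> L2 G.
     (\<exists>r>3/2. \<forall>e\<in>incident G VK. u e \<in> Hs_int (len G e) r) \<and>
     has_rep G (\<lambda>v.
       (\<forall>e\<in>incident G VK. continuous_on {0..len G e} (v e)) \<and>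
       (\<exists>d. (\<forall>e\<in>edges G. \<forall>b. origin G e b \<in> VK \<longrightarrow>
               ((\<lambda>t. v e (param G e b t)) has_real_derivative d e b) (at 0 within {0..len G e})) \<and>
            (\<forall>p\<in>VK. (\<Sum>(e, b) \<in> {(e, b). e \<in> edges G \<and> origin G e b = p}. d e b) = 0))) u}"

definition Dirichlet :: "('v, 'e) mgraph \<Rightarrow> 'v set \<Rightarrow> 'e gfn set" where
  "Dirichlet G VD = {u \<in> L2 G.
     (\<exists>r>1/2. \<forall>e\<in>incident G VD. u e \<in> Hs_int (len G e) r) \<and>
     has_rep G (\<lambda>v.
       (\<forall>e\<in>incident G VD. continuous_on {0..len G e} (v e)) \<and>
       (\<forall>e\<in>edges G. \<forall>b. origin G e b \<in> VD \<longrightarrow> v e (param G e b 0) = 0)) u}"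

definition Hs_KD :: "('v, 'e) mgraph \<Rightarrow> 'v set \<Rightarrow> 'v set \<Rightarrow> real \<Rightarrow> 'e gfn set" where
  "Hs_KD G VK VD s =
    (if s < 1/2 then Hs G s
     else if s < 3/2 then Hs G s \<inter> Dirichlet G VD
     else Hs G s \<inter> Kirchhoff G VK \<inter> Dirichlet G VD)"

section \<open>Spaces of negative order\<close>

text \<open>
  Functionals on a space \<open>S\<close> are set to \<open>0\<close> outside \<open>S\<close>, so that equal elements of the dual are
  equal in the logic.  Since \<open>N\<close> vanishes on functions that are zero almost everywhere,
  boundedness makes them independent of the choice of representatives.
\<close>

definition dual :: "'e gfn set \<Rightarrow> ('e gfn \<Rightarrow> real) \<Rightarrow> ('e gfn \<Rightarrow> real) set" where
  "dual S N = {T.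
     (\<forall>u\<in>S. \<forall>v\<in>S. T (u + v) = T u + T v) \<and>
     (\<forall>c. \<forall>u\<in>S. T (\<lambda>e x. c * u e x) = c * T u) \<and>
     (\<exists>C. \<forall>u\<in>S. \<bar>T u\<bar> \<le> C * N u) \<and>
     (\<forall>u. u \<notin> S \<longrightarrow> T u = 0)}"

definition dual_norm :: "'e gfn set \<Rightarrow> ('e gfn \<Rightarrow> real) \<Rightarrow> ('e gfn \<Rightarrow> real) \<Rightarrow> real" where
  "dual_norm S N T = Sup {\<bar>T u\<bar> | u. u \<in> S \<and> N u \<le> 1}"

text \<open>Elements of spaces of order \<open>\<ge> 0\<close> are functions, those of negative order are functionals.\<close>

datatype 'e elem = Fn "'e gfn" | Functional "'e gfn \<Rightarrow> real"

fun elem_eq :: "('v, 'e) mgraph \<Rightarrow> 'e elem \<Rightarrow> 'e elem \<Rightarrow> bool" where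
  "elem_eq G (Fn u) (Fn v) = aeq G u v"
| "elem_eq G (Functional S) (Functional T) = (S = T)"
| "elem_eq G _ _ = False"

fun pairing :: "('v, 'e) mgraph \<Rightarrow> 'e elem \<Rightarrow> 'e gfn \<Rightarrow> real" where
  "pairing G (Fn u) v = L2_inner G u v"
| "pairing G (Functional T) v = T v"

definition H_KD :: "('v, 'e) mgraph \<Rightarrow> 'v set \<Rightarrow> 'v set \<Rightarrow> real \<Rightarrow> 'e elem set" where
  "H_KD G VK VD \<beta> =
    (if 0 \<le> \<beta> then Fn ` Hs_KD G VK VD \<beta>
     else Functional ` dual (Hs_KD G VK VD (- \<beta>)) (Hs_norm G (- \<beta>)))"

fun H_KD_norm :: "('v, 'e) mgraph \<Rightarrow> 'v set \<Rightarrow> 'v set \<Rightarrow> real \<Rightarrow> 'e elem \<Rightarrow> real" where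
  "H_KD_norm G VK VD \<beta> (Fn u) = Hs_norm G \<beta> u"
| "H_KD_norm G VK VD \<beta> (Functional T) = dual_norm (Hs_KD G VK VD (- \<beta>)) (Hs_norm G (- \<beta>)) T"

section \<open>The operator and its fractional powers\<close>

definition L_dom :: "('v, 'e) mgraph \<Rightarrow> 'v set \<Rightarrow> 'v set \<Rightarrow> 'e gfn set" where
  "L_dom G VK VD = HkG G 2 \<inter> Kirchhoff G VK \<inter> Dirichlet G VD"

definition L_op :: "('v, 'e) mgraph \<Rightarrow> 'e gfn \<Rightarrow> 'e gfn \<Rightarrow> 'e gfn \<Rightarrow> 'e gfn" where
  "L_op G a \<kappa> u =
     (\<lambda>e x. (\<kappa> e x)\<^sup>2 * u e x - D_graph G (\<lambda>e x. a e x * D_graph G u e x) e x)"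

definition lin_comb :: "nat \<Rightarrow> (nat \<Rightarrow> real) \<Rightarrow> (nat \<Rightarrow> 'e gfn) \<Rightarrow> 'e gfn" where
  "lin_comb n c \<psi> = (\<lambda>e x. \<Sum>i<n. c i * \<psi> i e x)"

definition eigenbasis ::
  "('v, 'e) mgraph \<Rightarrow> 'v set \<Rightarrow> 'v set \<Rightarrow> 'e gfn \<Rightarrow> 'e gfn \<Rightarrow> (nat \<Rightarrow> 'e gfn) \<Rightarrow> (nat \<Rightarrow> real) \<Rightarrow> bool" where
  "eigenbasis G VK VD a \<kappa> \<psi> \<mu> \<longleftrightarrow>
     (\<forall>i. \<psi> i \<in> L_dom G VK VD \<and> 0 < \<mu> i \<and> aeq G (L_op G a \<kappa> (\<psi> i)) (\<lambda>e x. \<mu> i * \<psi> i e x)) \<and>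
     (\<forall>i j. L2_inner G (\<psi> i) (\<psi> j) = (if i = j then 1 else 0)) \<and>
     (\<forall>u\<in>L2 G. (\<lambda>n. L2_norm G (u - lin_comb n (\<lambda>i. L2_inner G u (\<psi> i)) \<psi>)) \<longlonglongrightarrow> 0)"

text \<open>The norm of order \<open>s\<close>, as a function of the coefficients \<open>c i\<close> with respect to the eigenbasis.\<close>

definition dot_norm :: "(nat \<Rightarrow> real) \<Rightarrow> real \<Rightarrow> (nat \<Rightarrow> real) \<Rightarrow> real" where
  "dot_norm \<mu> s c = sqrt (\<Sum>i. \<mu> i powr s * (c i)\<^sup>2)"

definition dot_fn :: "('v, 'e) mgraph \<Rightarrow> (nat \<Rightarrow> 'e gfn) \<Rightarrow> (nat \<Rightarrow> real) \<Rightarrow> real \<Rightarrow> 'e gfn set" where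
  "dot_fn G \<psi> \<mu> s = {u \<in> L2 G. summable (\<lambda>i. \<mu> i powr s * (L2_inner G u (\<psi> i))\<^sup>2)}"

definition dot_H :: "('v, 'e) mgraph \<Rightarrow> (nat \<Rightarrow> 'e gfn) \<Rightarrow> (nat \<Rightarrow> real) \<Rightarrow> real \<Rightarrow> 'e elem set" where
  "dot_H G \<psi> \<mu> s =
    (if 0 \<le> s then Fn ` dot_fn G \<psi> \<mu> s
     else Functional ` dual (dot_fn G \<psi> \<mu> (- s)) (\<lambda>u. dot_norm \<mu> (- s) (\<lambda>i. L2_inner G u (\<psi> i))))"

text \<open>
  \<open>frac_eq G \<psi> \<mu> \<alpha> s u f\<close> says that the power \<open>\<alpha>/2\<close> of the operator, acting from the space of order
  \<open>s\<close> to the space of order \<open>s - \<alpha>\<close>, maps \<open>u\<close> to \<open>f\<close>: the series with terms \<open>\<mu> i powr (\<alpha> / 2) * \<langle>u, \<psi> i\<rangle> * \<psi> i\<close> converges to \<open>f\<close>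
  in the norm of order \<open>s - \<alpha>\<close>.
\<close>

definition frac_eq ::
  "('v, 'e) mgraph \<Rightarrow> (nat \<Rightarrow> 'e gfn) \<Rightarrow> (nat \<Rightarrow> real) \<Rightarrow> real \<Rightarrow> real \<Rightarrow> 'e elem \<Rightarrow> 'e elem \<Rightarrow> bool" where
  "frac_eq G \<psi> \<mu> \<alpha> s u f \<longleftrightarrow>
     u \<in> dot_H G \<psi> \<mu> s \<and> f \<in> dot_H G \<psi> \<mu> (s - \<alpha>) \<and>
     (\<lambda>n. dot_norm \<mu> (s - \<alpha>) (\<lambda>j. pairing G f (\<psi> j) -
        L2_inner G (lin_comb n (\<lambda>i. \<mu> i powr (\<alpha> / 2) * pairing G u (\<psi> i)) \<psi>) (\<psi> j))) \<longlonglongrightarrow> 0"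

end

theory Submission
  imports Defs
begin

text \<open>
  All powers of the operator are diagonal in the eigenbasis, so the theorem says that for
  \<open>0 \<le> s < 5/2\<close>, \<open>s \<noteq> 1/2, 3/2\<close>, the space of order \<open>s\<close> with its vertex conditions is the domain
  of the power \<open>s/2\<close>, with equivalent norms; negative orders follow by duality.  For \<open>s = 1\<close> and
  \<open>s = 2\<close> this is Green's formula and elliptic regularity.  In between, the \<open>K\<close>-functional between
  \<open>L\<^sub>2\<close> and the \<open>H\<^sup>1\<close> functions satisfying the vertex conditions weights the squared coefficient
  at \<open>\<mu>\<close> by \<open>min 1 (t\<^sup>2 \<mu>)\<close> up to constants.  Without the vertex conditions, it
  differs at scale \<open>t\<close> by the \<open>L\<^sub>2\<close> norm of the offending combination of edge values over the collars
  of width \<open>t\<close> at the vertices.  A Hardy inequality absorbs this term for fractional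
  orders below \<open>1/2\<close> and, above \<open>1/2\<close>, for functions whose collar means vanish in the limit, which
  is what the vertex conditions say.  Differentiation
  reduces orders in \<open>(1, 2)\<close> to the flux condition on the derivative, and for orders above \<open>2\<close> the
  Lipschitz coefficients act as multipliers of order less than one.
\<close>

section \<open>Square-integrable functions\<close>

text \<open>The spaces are interpolated between L2 and functions with fewer vertex conditions than
  the operator imposes, and each condition is added only once the order gives it a meaning; that
  mismatch is the obstacle. No reiteration theorem is invoked: every comparison is an inequality
  between K-functionals at a fixed \<open>t\<close>, squared and integrated, so the constants depend
  only on the graph, the coefficients and the order. The constant of the theorem has to precede the
  eigenbasis, which is why the data are split between \<open>kop\<close> (coefficients) and
  \<open>eigl\<close> (eigenbasis). At 1/2 and 3/2 the contraction factor
  \<open>2 powr (\<theta> - 1/2)\<close> of the dyadic Hardy recursion becomes 1. The bound 5/2 is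
  the same threshold: above order 2 the operator lowers the order by two, and below 1/2 the vertex
  conditions on the image cost nothing. In the converse direction, membership in
  \<open>Dirichlet\<close> and \<open>Kirchhoff\<close> asks for actual values and one-sided
  derivatives; they are obtained from the uniform convergence of the eigenfunction expansion, or of
  its derivative, whose partial sums already satisfy the conditions.\<close>

abbreviation Lb :: "real => real measure" where "Lb l \<equiv> lebesgue_on {0..l}"

definition sqi :: "'a measure => ('a => real) => bool" where
 "sqi M u \<longleftrightarrow> u \<in> borel_measurable M \<and> integrable M (\<lambda>x. (u x)^2)"

definition nm :: "'a measure => ('a => real) => real" where
 "nm M u = sqrt (integral\<^sup>L M (\<lambda>x. (u x)^2))"

lemma sqi_meas[measurable_dest]: "sqi M u ==> u \<in> borel_measurable M"
 by (simp add: sqi_def)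

lemma nm_nonneg[simp]: "0 \<le> nm M u"
 by (simp add: nm_def)

lemma nm_sq: "(nm M u)^2 = integral\<^sup>L M (\<lambda>x. (u x)^2)"
 by (simp add: nm_def)

lemma sqi_mult:
 assumes "sqi M u" "sqi M v"
 shows "integrable M (\<lambda>x. u x * v x)"
proof (rule Bochner_Integration.integrable_bound[where f="\<lambda>x. (u x)^2 + (v x)^2"])
 show "integrable M (\<lambda>x. (u x)^2 + (v x)^2)" using assms by (simp add: sqi_def)
 show "(\<lambda>x. u x * v x) \<in> borel_measurable M" using assms by (auto simp: sqi_def)
 have "\<bar>a*b\<bar> \<le> a^2 + b^2" for a b :: real
 proof -
  have "2*\<bar>a\<bar>*\<bar>b\<bar> \<le> a^2 + b^2" using sum_squares_bound[of "\<bar>a\<bar>" "\<bar>b\<bar>"] by simp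
  moreover have "0 \<le> \<bar>a\<bar>*\<bar>b\<bar>" by simp
  ultimately show ?thesis unfolding abs_mult by linarith
 qed
 thus "AE x in M. norm (u x * v x) \<le> norm ((u x)^2 + (v x)^2)" by simp
qed

lemma sqi_add: assumes "sqi M u" "sqi M v" shows "sqi M (\<lambda>x. u x + v x)"
proof -
 have "integrable M (\<lambda>x. (u x)^2 + (v x)^2 + 2*(u x * v x))"
  using assms sqi_mult[OF assms] by (simp add: sqi_def)
 thus ?thesis using assms by (auto simp: sqi_def power2_sum algebra_simps)
qed

lemma sqi_scale: assumes "sqi M u" shows "sqi M (\<lambda>x. c*u x)"
 using assms by (auto simp: sqi_def power_mult_distrib)

lemma sqi_uminus: assumes "sqi M u" shows "sqi M (\<lambda>x. - u x)"
 using assms by (auto simp: sqi_def)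

lemma sqi_diff: assumes "sqi M u" "sqi M v" shows "sqi M (\<lambda>x. u x - v x)"
 using sqi_add[OF assms(1) sqi_uminus[OF assms(2)]] by simp

lemma sqi_zero[simp]: "sqi M (\<lambda>x. 0)" by (simp add: sqi_def)

lemma sqi_sum: "(\<And>i. i \<in> I ==> sqi M (u i)) ==> sqi M (\<lambda>x. \<Sum>i\<in>I. u i x)"
 by (induction I rule: infinite_finite_induct) (auto intro: sqi_add)

lemma sqi_bounded_mult:
 assumes "sqi M u" "m \<in> borel_measurable M" "\<And>x. x \<in> space M ==> \<bar>m x\<bar> \<le> B"
 shows "sqi M (\<lambda>x. m x*u x)" "integral\<^sup>L M (\<lambda>x. (m x*u x)^2) \<le> B^2*integral\<^sup>L M (\<lambda>x. (u x)^2)"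
proof -
 have le: "(m x*u x)^2 \<le> B^2*(u x)^2" if "x \<in> space M" for x
  using assms(3)[OF that] by (auto simp: power_mult_distrib intro!: mult_right_mono simp: abs_le_square_iff[symmetric])
 have i: "integrable M (\<lambda>x. B^2*(u x)^2)" using assms by (simp add: sqi_def)
 have j: "integrable M (\<lambda>x. (m x*u x)^2)"
  by (rule Bochner_Integration.integrable_bound[OF i]) (use assms le in \<open>auto simp: sqi_def\<close>)
 show "sqi M (\<lambda>x. m x*u x)" using assms j by (auto simp: sqi_def)
 show "integral\<^sup>L M (\<lambda>x. (m x*u x)^2) \<le> B^2*integral\<^sup>L M (\<lambda>x. (u x)^2)"
  using integral_mono[OF j i le] by simp
qed

lemma sqi_CS_sq:
 assumes "sqi M u" "sqi M v"
 shows "(integral\<^sup>L M (\<lambda>x. u x * v x))^2 \<le> integral\<^sup>L M (\<lambda>x. (u x)^2)*integral\<^sup>L M (\<lambda>x. (v x)^2)"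
proof -
 define A B C where "A = integral\<^sup>L M (\<lambda>x. (u x)^2)" and "B = integral\<^sup>L M (\<lambda>x. (v x)^2)"
  and "C = integral\<^sup>L M (\<lambda>x. u x * v x)"
 have iu: "integrable M (\<lambda>x. (u x)^2)" and iv: "integrable M (\<lambda>x. (v x)^2)" and iuv: "integrable M (\<lambda>x. u x * v x)"
  using assms sqi_mult by (auto simp: sqi_def)
 \<comment> \<open>The coefficients \<open>B\<close> and \<open>C\<close> produce the discriminant
   without a division; the case \<open>B = 0\<close>, where \<open>v\<close> vanishes almost
   everywhere, is settled separately.\<close>
 have "0 \<le> integral\<^sup>L M (\<lambda>x. (B*u x - C * v x)^2)" by simp
 also have "(\<lambda>x. (B*u x - C * v x)^2) = (\<lambda>x. B^2*(u x)^2 + C^2*(v x)^2 - 2*B*C*(u x * v x))"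
  by (auto simp: power2_eq_square algebra_simps)
 also have "integral\<^sup>L M ... = B^2*A + C^2*B - 2*B*C*C"
  using iu iv iuv by (simp add: A_def B_def C_def)
 finally have *: "0 \<le> B*(A*B - C^2)" by (simp add: power2_eq_square algebra_simps)
 have "B \<ge> 0" by (simp add: B_def)
 show ?thesis
 proof (cases "B = 0")
  case True
  hence "AE x in M. (v x)^2 = 0"
   using integral_nonneg_eq_0_iff_AE[OF iv] by (simp add: B_def)
  hence "C = 0" unfolding C_def by (intro integral_eq_zero_AE) auto
  thus ?thesis by (simp add: C_def)
 next
  case False
  hence "0 \<le> A*B - C^2" using*\<open>B \<ge> 0\<close> by (simp add: zero_le_mult_iff)
  thus ?thesis by (simp add: A_def B_def C_def)
 qed
qed

lemma sqi_CS:
 assumes "sqi M u" "sqi M v"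
 shows "\<bar>integral\<^sup>L M (\<lambda>x. u x * v x)\<bar> \<le> nm M u*nm M v"
proof -
 have "(integral\<^sup>L M (\<lambda>x. u x * v x))^2 \<le> (nm M u*nm M v)^2"
  using sqi_CS_sq[OF assms] by (simp add: power_mult_distrib nm_sq)
 thus ?thesis by (metis abs_le_square_iff abs_of_nonneg mult_nonneg_nonneg nm_nonneg)
qed

lemma nm_add:
 assumes "sqi M u" "sqi M v"
 shows "nm M (\<lambda>x. u x + v x) \<le> nm M u + nm M v"
proof -
 have "(nm M (\<lambda>x. u x + v x))^2 = (nm M u)^2 + (nm M v)^2 + 2*integral\<^sup>L M (\<lambda>x. u x * v x)"
  using assms sqi_mult[OF assms]
  by (simp add: nm_sq sqi_def power2_sum mult.assoc)
 also have "... \<le> (nm M u + nm M v)^2" using sqi_CS[OF assms] by (simp add: power2_sum)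
 finally show ?thesis by (meson add_nonneg_nonneg nm_nonneg power2_le_imp_le)
qed

lemma nm_scale: "nm M (\<lambda>x. c*u x) = \<bar>c\<bar>*nm M u"
 by (simp add: nm_def power_mult_distrib real_sqrt_mult)

lemma nm_uminus: "nm M (\<lambda>x. - u x) = nm M u" by (simp add: nm_def)

lemma nm_diff:
 assumes "sqi M u" "sqi M v"
 shows "nm M (\<lambda>x. u x - v x) \<le> nm M u + nm M v"
 using nm_add[OF assms(1) sqi_uminus[OF assms(2)]] by (simp add: nm_uminus)

lemma nm_zero[simp]: "nm M (\<lambda>x. 0) = 0" by (simp add: nm_def)

lemma nm_sum: "(\<And>i. i \<in> I ==> sqi M (u i)) ==> nm M (\<lambda>x. \<Sum>i\<in>I. u i x) \<le> (\<Sum>i\<in>I. nm M (u i))"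
proof (induction I rule: infinite_finite_induct)
 case (insert i I)
 have "nm M (\<lambda>x. u i x + (\<Sum>i\<in>I. u i x)) \<le> nm M (u i) + nm M (\<lambda>x. \<Sum>i\<in>I. u i x)"
  by (intro nm_add sqi_sum) (use insert in auto)
 thus ?case using insert by auto
qed auto

lemma nm_cong_AE:
 assumes "AE x in M. u x = v x" "u \<in> borel_measurable M" "v \<in> borel_measurable M"
 shows "nm M u = nm M v"
 unfolding nm_def by (rule arg_cong[where f=sqrt], rule integral_cong_AE) (use assms in auto)

lemma sqi_integrable:
 assumes "finite_measure M" "sqi M u" shows "integrable M u"
proof -
 interpret finite_measure M by fact
 have "sqi M (\<lambda>x. 1)" by (simp add: sqi_def)
 from sqi_mult[OF assms(2) this] show ?thesis by simp
qed

lemma sqi_abs: "sqi M u ==> sqi M (\<lambda>x. \<bar>u x\<bar>)"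
 by (auto simp: sqi_def)

lemma nm_L1:
 assumes "finite_measure M" "sqi M u"
 shows "integral\<^sup>L M (\<lambda>x. \<bar>u x\<bar>) \<le> nm M u * sqrt (measure M (space M))"
proof -
 interpret finite_measure M by fact
 have 1: "sqi M (\<lambda>x. 1)" by (simp add: sqi_def)
 have "nm M (\<lambda>x. 1) = sqrt (measure M (space M))" by (simp add: nm_def)
 thus ?thesis
  using sqi_CS[OF sqi_abs[OF assms(2)] 1] by (simp add: nm_def)
qed

text \<open>On a finite measure space a Cauchy sequence in L2 is Cauchy in L1 and so has a
  subsequence converging almost everywhere; Fatou's lemma then bounds the distance of the limit from
  every late member.\<close>

lemma Riesz_Fischer:
 fixes S :: "nat => 'a => real"
 assumes fm: "finite_measure M" and S: "\<And>n. sqi M (S n)"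
  and C: "\<And>e. e > 0 ==> \<exists>N. \<forall>m\<ge>N. \<forall>n\<ge>N. nm M (\<lambda>x. S m x - S n x) < e"
 obtains u where "sqi M u" "(\<lambda>n. nm M (\<lambda>x. S n x - u x)) \<longlonglongrightarrow> 0"
proof -
 interpret finite_measure M by fact
 have Sm[measurable]: "\<And>n. S n \<in> borel_measurable M" using S by (simp add: sqi_def)
 \<comment> \<open>The added 1 keeps \<open>k\<close> positive even on a space of measure zero, so
   that \<open>e/k\<close> makes sense.\<close>
 define k where "k = sqrt (measure M (space M)) + 1"
 have k: "k > 0" "sqrt (measure M (space M)) \<le> k" by (auto simp: k_def intro: add_nonneg_pos)
 have "\<exists>N. \<forall>i\<ge>N. \<forall>j\<ge>N. LINT x|M. norm (S i x - S j x) < e" if "e > 0" for e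
 proof -
  obtain N where N: "\<forall>m\<ge>N. \<forall>n\<ge>N. nm M (\<lambda>x. S m x - S n x) < e/k"
   using C[of "e/k"] \<open>e > 0\<close> k by auto
  have "LINT x|M. norm (S i x - S j x) < e" if "i \<ge> N" "j \<ge> N" for i j
  proof -
   have "LINT x|M. norm (S i x - S j x) \<le> nm M (\<lambda>x. S i x - S j x) * sqrt (measure M (space M))"
    using nm_L1[OF fm sqi_diff[OF S S], of i j] by simp
   also have "... \<le> nm M (\<lambda>x. S i x - S j x) * k" using k by (intro mult_left_mono) auto
   also have "... < e" using N that k by (simp add: pos_less_divide_eq)
   finally show ?thesis .
  qed
  thus ?thesis by blast
 qed
 then obtain r where r: "strict_mono r" "AE x in M. Cauchy (\<lambda>i. S (r i) x)"
  using cauchy_L1_AE_cauchy_subseq[of M S] sqi_integrable[OF fm S] by blast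
 define u where "u x = lim (\<lambda>i. S (r i) x)" for x
 have um[measurable]: "u \<in> borel_measurable M" unfolding u_def by measurable
 have conv: "AE x in M. (\<lambda>i. S (r i) x) \<longlonglongrightarrow> u x"
  using r(2) unfolding u_def by eventually_elim (simp add: Cauchy_convergent_iff convergent_LIMSEQ_iff)
 have key: "(\<integral>\<^sup>+x. ennreal ((u x - S n x)^2) \<partial>M) \<le> ennreal (e^2)"
  if e: "e > 0" and N: "\<forall>m\<ge>N. \<forall>n\<ge>N. nm M (\<lambda>x. S m x - S n x) < e" and n: "n \<ge> N" for e N n
 proof -
  have "(\<integral>\<^sup>+x. ennreal ((u x - S n x)^2) \<partial>M) = (\<integral>\<^sup>+x. liminf (\<lambda>i. ennreal ((S (r i) x - S n x)^2)) \<partial>M)"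
  proof (rule nn_integral_cong_AE, use conv in eventually_elim)
   fix x assume "(\<lambda>i. S (r i) x) \<longlonglongrightarrow> u x"
   hence "(\<lambda>i. ennreal ((S (r i) x - S n x)^2)) \<longlonglongrightarrow> ennreal ((u x - S n x)^2)"
    by (intro tendsto_intros)
   thus "ennreal ((u x - S n x)^2) = liminf (\<lambda>i. ennreal ((S (r i) x - S n x)^2))"
    by (intro lim_imp_Liminf[symmetric]) auto
  qed
  also have "... \<le> liminf (\<lambda>i. \<integral>\<^sup>+x. ennreal ((S (r i) x - S n x)^2) \<partial>M)"
   by (intro nn_integral_liminf) measurable
  also have "... \<le> ennreal (e^2)"
  proof (rule order_trans[OF Liminf_le_Limsup Limsup_bounded], simp, rule eventually_sequentiallyI[of N])
   fix i assume "i \<ge> N"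
   hence "r i \<ge> N" using seq_suble[OF r(1), of i] by linarith
   hence "(nm M (\<lambda>x. S (r i) x - S n x))^2 \<le> e^2"
    using N n by (intro power_mono) (auto intro: less_imp_le)
   thus "(\<integral>\<^sup>+x. ennreal ((S (r i) x - S n x)^2) \<partial>M) \<le> ennreal (e^2)"
    using sqi_diff[OF S S, of "r i" n] by (subst nn_integral_eq_integral) (auto simp: sqi_def nm_sq ennreal_leI)
  qed
  finally show ?thesis .
 qed
 have d: "sqi M (\<lambda>x. u x - S n x) \<and> nm M (\<lambda>x. u x - S n x) \<le> e"
  if e: "e > 0" and N: "\<forall>m\<ge>N. \<forall>n\<ge>N. nm M (\<lambda>x. S m x - S n x) < e" and n: "n \<ge> N" for e N n
 proof -
  have i: "integrable M (\<lambda>x. (u x - S n x)^2)"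
   by (rule integrableI_bounded) (use key[OF that] in \<open>auto simp: less_top[symmetric] top_unique\<close>)
  hence "ennreal (integral\<^sup>L M (\<lambda>x. (u x - S n x)^2)) \<le> ennreal (e^2)"
   using key[OF that] nn_integral_eq_integral[OF i] by simp
  hence "integral\<^sup>L M (\<lambda>x. (u x - S n x)^2) \<le> e^2" by (simp add: ennreal_le_iff)
  hence "nm M (\<lambda>x. u x - S n x) \<le> e" unfolding nm_def using e real_sqrt_le_iff[of _ "e^2"] by simp
  thus ?thesis using i by (simp add: sqi_def)
 qed
 obtain N1 where "\<forall>m\<ge>N1. \<forall>n\<ge>N1. nm M (\<lambda>x. S m x - S n x) < 1" using C[of 1] by auto
 from d[OF _ this order_refl] have "sqi M (\<lambda>x. u x - S N1 x)" by simp
 from sqi_add[OF this S[of N1]] have su: "sqi M u" by simp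
 moreover have "(\<lambda>n. nm M (\<lambda>x. S n x - u x)) \<longlonglongrightarrow> 0"
 proof (rule LIMSEQ_I)
  fix e :: real assume "e > 0"
  then obtain N where N: "\<forall>m\<ge>N. \<forall>n\<ge>N. nm M (\<lambda>x. S m x - S n x) < e/2" using C[of "e/2"] by auto
  have "norm (nm M (\<lambda>x. S n x - u x) - 0) < e" if "n \<ge> N" for n
   using d[OF _ N that] \<open>e > 0\<close> by (simp add: nm_def power2_commute)
  thus "\<exists>no. \<forall>n\<ge>no. norm (nm M (\<lambda>x. S n x - u x) - 0) < e" by blast
 qed
 ultimately show ?thesis using that by blast
qed

section \<open>Smooth functions with compact support\<close>

text \<open>The powers of \<open>1/y\<close> make the family closed under differentiation. As
  \<open>n\<close> tends to infinity, \<open>flat n 0\<close> tends to the indicator of the positive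
  half-line.\<close>

definition flat :: "real => nat => real => real" where
 "flat n m y = (if 0 < y then (1/y)^m*exp (- (1/(n*y))) else 0)"

text \<open>The term of order \<open>m + 2\<close> of the exponential series at
  \<open>1/(n*y)\<close> dominates the pole; the two orders to spare leave the factor
  \<open>y^2\<close>, which gives \<open>flat\<close> the derivative 0 at the origin.\<close>

lemma flat_bound:
 assumes n: "0 < n"
 shows "\<bar>flat n m y\<bar> \<le> fact (m + 2)*n^(m + 2)*y^2"
proof (cases "0 < y")
 case True
 define z where "z = 1/(n*y)"
 have z: "z > 0" using n True by (simp add: z_def)
 have "z^(m + 2)/fact (m + 2) \<le> exp z"
  using sum_le_suminf[OF summable_exp_generic[of z], of "{m + 2}"] z
  by (simp add: exp_def divide_inverse mult.commute)
 hence "exp (- z) \<le> fact (m + 2)/z^(m + 2)"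
 proof -
  assume *: "z^(m + 2)/fact (m + 2) \<le> exp z"
  have "0 < z^(m + 2)/fact (m + 2)" using z by (intro divide_pos_pos zero_less_power) auto
  from le_imp_inverse_le[OF*this] show ?thesis
   by (simp add: exp_minus inverse_eq_divide del: fact_Suc power_Suc add_2_eq_Suc')
 qed
 also have "... = fact (m + 2)*(n*y)^(m + 2)" by (simp add: z_def power_divide)
 finally have "(1/y)^m*exp (- z) \<le> (1/y)^m*(fact (m + 2)*(n*y)^(m + 2))"
  using True by (intro mult_left_mono) auto
 also have "... = fact (m + 2)*n^(m + 2)*y^2"
  using True by (simp add: power_mult_distrib power_add power_divide power2_eq_square)
 finally show ?thesis using True by (simp add: flat_def z_def)
qed (use n in \<open>auto simp: flat_def intro!: mult_nonneg_nonneg\<close>)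

lemma DERIV_local:
 "(f has_real_derivative D) (at x) ==> \<forall>\<^sub>F y in nhds x. f y = g y ==> (g has_real_derivative D) (at x)"
 using DERIV_cong_ev[of x x f g D D] by simp

lemma flat_deriv:
 assumes n: "0 < n"
 shows "(flat n m has_real_derivative (- real m*flat n (m + 1) y + 1/n*flat n (m + 2) y)) (at y)"
proof (cases "y = 0")
 case True
 have "((\<lambda>h. (flat n m (0 + h) - flat n m 0)/h) \<longlongrightarrow> 0) (at 0)"
 proof (rule Lim_null_comparison[where g="\<lambda>h. fact (m + 2)*n^(m + 2)*\<bar>h\<bar>"])
  have "norm ((flat n m (0 + h) - flat n m 0)/h) \<le> fact (m + 2)*n^(m + 2)*\<bar>h\<bar>" for h
  proof (cases "h = 0")
   case False
   define K :: real where "K = fact (m + 2)*n^(m + 2)"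
   have "\<bar>flat n m h\<bar>/\<bar>h\<bar> \<le> K*h^2/\<bar>h\<bar>"
    unfolding K_def by (intro divide_right_mono flat_bound[OF n]) simp
   also have "... = K*\<bar>h\<bar>" using False by (cases "h > 0") (auto simp: power2_eq_square)
   finally show ?thesis by (simp add: flat_def[of n m 0] K_def del: fact_Suc power_Suc add_2_eq_Suc')
  qed simp
  thus "\<forall>\<^sub>F h in at 0. norm ((flat n m (0 + h) - flat n m 0)/h) \<le> fact (m + 2)*n^(m + 2)*\<bar>h\<bar>" by simp
  show "((\<lambda>h. fact (m + 2)*n^(m + 2)*\<bar>h\<bar>) \<longlongrightarrow> 0) (at 0)" by (auto intro!: tendsto_eq_intros)
 qed
 thus ?thesis using True by (simp add: DERIV_def flat_def[of _ _ 0])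
next
 case False
 show ?thesis
 proof (cases "y > 0")
  case True
  have "((\<lambda>y. (1/y)^m*exp (- (1/(n*y)))) has_real_derivative
    (- real m*flat n (m + 1) y + 1/n*flat n (m + 2) y)) (at y)"
  proof (cases m)
   case 0 thus ?thesis using True n unfolding flat_def
    by (auto intro!: derivative_eq_intros simp: field_simps power2_eq_square)
  next
   case (Suc k) thus ?thesis using True n unfolding flat_def
    by (auto intro!: derivative_eq_intros simp: field_simps power2_eq_square) (cases k, simp_all)
  qed
  moreover have "\<forall>\<^sub>F x in nhds y. (1/x)^m*exp (- (1/(n*x))) = flat n m x"
   by (rule eventually_mono[OF eventually_nhds_in_open[of "{0<..}" y]]) (use True in \<open>auto simp: flat_def\<close>)
  ultimately show ?thesis by (rule DERIV_local)
 next
  case neg: False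
  have "((\<lambda>y. 0) has_real_derivative (- real m*flat n (m + 1) y + 1/n*flat n (m + 2) y)) (at y)"
   using neg by (simp add: flat_def)
  moreover have "\<forall>\<^sub>F x in nhds y. 0 = flat n m x"
   by (rule eventually_mono[OF eventually_nhds_in_open[of "{..<0}" y]]) (use False neg in \<open>auto simp: flat_def\<close>)
  ultimately show ?thesis by (rule DERIV_local)
 qed
qed

text \<open>An algebra closed under differentiation: the iterated derivatives asked for by
  \<open>test_fun\<close> exist by one induction, and none of them has to be computed.\<close>

inductive_set bump_alg :: "(real => real) set" where
 flat: "0 < n ==> (\<lambda>x. flat n m (s*x + c)) \<in> bump_alg"
| scale: "f \<in> bump_alg ==> (\<lambda>x. k*f x) \<in> bump_alg"
| add: "f \<in> bump_alg ==> g \<in> bump_alg ==> (\<lambda>x. f x + g x) \<in> bump_alg"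
| mult: "f \<in> bump_alg ==> g \<in> bump_alg ==> (\<lambda>x. f x*g x) \<in> bump_alg"

lemma bump_alg_deriv: "f \<in> bump_alg ==> \<exists>f'\<in>bump_alg. \<forall>x. (f has_real_derivative f' x) (at x)"
proof (induction rule: bump_alg.induct)
 case (flat n m s c)
 let ?f = "\<lambda>x. s*(- real m*flat n (m + 1) (s*x + c) + 1/n*flat n (m + 2) (s*x + c))"
 have "((\<lambda>x. flat n m (s*x + c)) has_real_derivative ?f x) (at x)" for x
 proof -
  have 2: "((\<lambda>x. s*x + c) has_real_derivative s) (at x)" by (auto intro!: derivative_eq_intros)
  show ?thesis using DERIV_chain2[OF flat_deriv[OF flat] 2] by (simp add: mult.commute)
 qed
 moreover have "?f \<in> bump_alg" using flat by (intro bump_alg.intros)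
 ultimately show ?case by (intro bexI[of _ ?f] allI)
next
 case (scale f k)
 then obtain f' where "f' \<in> bump_alg" "\<forall>x. (f has_real_derivative f' x) (at x)" by auto
 thus ?case by (intro bexI[of _ "\<lambda>x. k*f' x"]) (auto intro!: bump_alg.intros derivative_eq_intros)
next
 case (add f g)
 then obtain f' g' where "f' \<in> bump_alg" "\<forall>x. (f has_real_derivative f' x) (at x)"
  "g' \<in> bump_alg" "\<forall>x. (g has_real_derivative g' x) (at x)" by auto
 thus ?case by (intro bexI[of _ "\<lambda>x. f' x + g' x"]) (auto intro!: bump_alg.intros derivative_intros)
next
 case (mult f g)
 then obtain f' g' where *: "f' \<in> bump_alg" "\<forall>x. (f has_real_derivative f' x) (at x)"
  "g' \<in> bump_alg" "\<forall>x. (g has_real_derivative g' x) (at x)" by auto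
 have "(\<lambda>x. f' x*g x + g' x*f x) \<in> bump_alg"
  using*mult by (intro bump_alg.add bump_alg.mult)
 thus ?case using*by (intro bexI[of _ "\<lambda>x. f' x*g x + g' x*f x"]) (auto intro!: derivative_eq_intros)
qed

lemma bump_alg_smooth:
 assumes "f \<in> bump_alg" shows "(deriv ^^ k) f \<in> bump_alg \<and> (\<forall>x. (deriv ^^ k) f differentiable (at x))"
proof (induction k)
 case 0
 show ?case using assms bump_alg_deriv[OF assms] real_differentiable_def by auto
next
 case (Suc k)
 then obtain f' where f': "f' \<in> bump_alg" "\<forall>x. ((deriv ^^ k) f has_real_derivative f' x) (at x)"
  using bump_alg_deriv by blast
 hence "(deriv ^^ Suc k) f = f'" by (auto simp: DERIV_imp_deriv)
 thus ?case using f' bump_alg_deriv[OF f'(1)] real_differentiable_def by auto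
qed

lemma bump_alg_continuous: "f \<in> bump_alg ==> continuous_on A f"
 using bump_alg_deriv by (meson DERIV_isCont continuous_at_imp_continuous_on)

lemma primitive_smooth:
 assumes "f \<in> bump_alg" "\<And>x. (F has_real_derivative f x) (at x)"
 shows "(deriv ^^ k) F differentiable (at x)"
proof (cases k)
 case 0
 thus ?thesis using assms(2) real_differentiable_def by auto
next
 case (Suc j)
 have "deriv F = f" using assms(2) by (auto simp: DERIV_imp_deriv)
 hence "(deriv ^^ k) F = (deriv ^^ j) f" by (simp add: Suc funpow_swap1)
 thus ?thesis using bump_alg_smooth[OF assms(1)] by simp
qed

lemma test_fun_continuous_deriv:
 assumes "test_fun l \<phi>"
 shows "(\<phi> has_real_derivative deriv \<phi> x) (at x)" "continuous_on A (deriv \<phi>)"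
proof -
 have "(deriv ^^ 0) \<phi> differentiable (at x)" using assms unfolding test_fun_def by blast
 thus "(\<phi> has_real_derivative deriv \<phi> x) (at x)"
  by (simp add: DERIV_deriv_iff_real_differentiable)
 have "(deriv ^^ 1) \<phi> differentiable (at x)" for x using assms unfolding test_fun_def by blast
 thus "continuous_on A (deriv \<phi>)"
  by (auto intro!: continuous_at_imp_continuous_on differentiable_imp_continuous_within)
qed

section \<open>Absolutely continuous functions on an interval\<close>

lemma L2_int_iff: "u \<in> L2_int l \<longleftrightarrow> sqi (Lb l) u"
 by (simp add: L2_int_def sqi_def)

lemma finite_Leb[simp]: "finite_measure (lebesgue_on {a..b::real})"
 by (rule finite_measure_lebesgue_on) simp

lemma sqi_integrable_Leb: "sqi (lebesgue_on {a..b::real}) u ==> integrable (lebesgue_on {a..b}) u"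
 by (rule sqi_integrable) auto

lemma sqi_subinterval:
 assumes "sqi (lebesgue_on {a..b::real}) u" "{c..d} \<subseteq> {a..b}"
 shows "sqi (lebesgue_on {c..d}) u"
 using assms integrable_subinterval[of a b "\<lambda>x. (u x)^2" c d]
 by (auto simp: sqi_def intro: measurable_restrict_mono)

lemma integral_sq_HK:
 assumes "sqi (lebesgue_on {a..b::real}) u"
 shows "integral\<^sup>L (lebesgue_on {a..b}) (\<lambda>x. (u x)^2) = integral {a..b} (\<lambda>x. (u x)^2)"
  "(\<lambda>x. (u x)^2) integrable_on {a..b}"
 using assms by (auto simp: sqi_def intro: lebesgue_integral_eq_integral integrable_on_lebesgue_on)

lemma integral_HK:
 fixes u :: "real => real"
 assumes "integrable (lebesgue_on {a..b::real}) u"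
 shows "integral\<^sup>L (lebesgue_on {a..b}) u = integral {a..b} u" "u integrable_on {a..b}"
  "(\<lambda>x. \<bar>u x\<bar>) integrable_on {a..b}"
 using assms by (auto intro: lebesgue_integral_eq_integral integrable_on_lebesgue_on)

lemma nm_subinterval:
 assumes "sqi (lebesgue_on {a..b::real}) u" "{c..d} \<subseteq> {a..b}"
 shows "nm (lebesgue_on {c..d}) u \<le> nm (lebesgue_on {a..b}) u"
 unfolding nm_def
 using integral_sq_HK[OF assms(1)] integral_sq_HK[OF sqi_subinterval[OF assms]] assms(2)
 by (auto intro!: integral_subset_le)

lemma sqi_continuous:
 fixes u :: "real => real"
 assumes "continuous_on {a..b} u" shows "sqi (lebesgue_on {a..b}) u"
 unfolding sqi_def
proof
 show "u \<in> borel_measurable (lebesgue_on {a..b})"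
  by (rule continuous_imp_measurable_on_sets_lebesgue[OF assms]) auto
 show "integrable (lebesgue_on {a..b}) (\<lambda>x. (u x)^2)"
  by (intro continuous_imp_integrable_real continuous_intros assms)
qed

lemma sqi_mult_continuous:
 fixes u m :: "real => real"
 assumes "sqi (lebesgue_on {a..b}) u" "continuous_on {a..b} m"
 shows "sqi (lebesgue_on {a..b}) (\<lambda>x. m x*u x)"
proof -
 have "compact (m ` {a..b})" using assms(2) by (intro compact_continuous_image) auto
 then obtain B where "\<And>x. x \<in> {a..b} ==> \<bar>m x\<bar> \<le> B"
  by (force dest: compact_imp_bounded simp: bounded_iff)
 thus ?thesis
  using sqi_bounded_mult(1)[OF assms(1), of m B] sqi_continuous[OF assms(2)] by (auto simp: sqi_def)
qed

lemma integral_le_nm: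
 assumes "sqi (lebesgue_on {a..b::real}) g" "{x..y} \<subseteq> {a..b}" "x \<le> y"
 shows "integral {x..y} (\<lambda>t. \<bar>g t\<bar>) \<le> nm (lebesgue_on {a..b}) g * sqrt (y - x)"
proof -
 have s: "sqi (lebesgue_on {x..y}) g" by (rule sqi_subinterval[OF assms(1,2)])
 have "integral {x..y} (\<lambda>t. \<bar>g t\<bar>) = integral\<^sup>L (lebesgue_on {x..y}) (\<lambda>t. \<bar>g t\<bar>)"
  using sqi_integrable_Leb[OF sqi_abs[OF s]] integral_HK by metis
 also have "... \<le> nm (lebesgue_on {x..y}) g * sqrt (measure (lebesgue_on {x..y}) (space (lebesgue_on {x..y})))"
  by (rule nm_L1[OF _ s]) simp
 also have "measure (lebesgue_on {x..y}) (space (lebesgue_on {x..y})) = y - x"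
  using assms by (simp add: measure_restrict_space)
 also have "nm (lebesgue_on {x..y}) g * sqrt (y - x) \<le> nm (lebesgue_on {a..b}) g * sqrt (y - x)"
  using assms by (intro mult_right_mono nm_subinterval) auto
 finally show ?thesis .
qed

text \<open>The pointwise form of membership in H^1: \<open>U\<close> is the continuous
  representative and \<open>g\<close> a version of its weak derivative. Working with
  \<open>U\<close> itself gives values at the end points, which a class modulo null sets does not
  have.\<close>

definition abscont :: "real => (real => real) => (real => real) => bool" where
 "abscont l U g \<longleftrightarrow> sqi (Lb l) g \<and> (\<forall>x\<in>{0..l}. U x = U 0 + integral {0..x} g)"

lemma abscont_sqi: "abscont l U g ==> sqi (Lb l) g"
 by (simp add: abscont_def)

lemma abscont_int: "abscont l U g ==> 0 \<le> x ==> y \<le> l ==> g integrable_on {x..y}"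
 by (rule integrable_on_subinterval[OF integral_HK(2)[OF sqi_integrable_Leb[OF abscont_sqi]]]) auto

lemma abscontD: "abscont l U g ==> 0 \<le> x ==> x \<le> l ==> U x = U 0 + integral {0..x} g"
 unfolding abscont_def by (metis atLeastAtMost_iff)

lemma abscont_increment:
 assumes "abscont l U g" "0 \<le> x" "x \<le> y" "y \<le> l"
 shows "U y - U x = integral {x..y} g"
proof -
 have "integral {0..x} g + integral {x..y} g = integral {0..y} g"
  using assms by (intro Henstock_Kurzweil_Integration.integral_combine abscont_int) auto
 thus ?thesis using abscontD[OF assms(1), of x] abscontD[OF assms(1), of y] assms(2-) by linarith
qed

lemma abscont_continuous:
 assumes "abscont l U g" shows "continuous_on {0..l} U"
proof (cases "0 \<le> l")
 case True
 have "continuous_on {0..l} (\<lambda>x. U 0 + integral {0..x} g)"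
  using abscont_int[OF assms, of 0 l] True by (intro continuous_intros indefinite_integral_continuous_1) auto
 moreover have "U 0 + integral {0..x} g = U x" if "x \<in> {0..l}" for x
  using abscontD[OF assms, of x] that by simp
 ultimately show ?thesis by (rule continuous_on_eq)
qed auto

lemma abscont_sqi_fun: "abscont l U g ==> sqi (Lb l) U"
 by (rule sqi_continuous[OF abscont_continuous])

lemma abscont_of_deriv:
 assumes "continuous_on {0..l} g" "\<And>x. x \<in> {0..l} ==> (U has_real_derivative g x) (at x within {0..l})"
 shows "abscont l U g"
 unfolding abscont_def
proof (intro conjI ballI sqi_continuous assms(1))
 fix x assume x: "x \<in> {0..l}"
 have "(g has_integral (U x - U 0)) {0..x}"
  by (rule fundamental_theorem_of_calculus)
   (use x in \<open>auto simp: has_real_derivative_iff_has_vector_derivative[symmetric] intro!: DERIV_subset[OF assms(2)]\<close>)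
 thus "U x = U 0 + integral {0..x} g" by (simp add: has_integral_iff)
qed

lemma abscont_add: "abscont l U g ==> abscont l V h ==> abscont l (\<lambda>x. U x + V x) (\<lambda>x. g x + h x)"
proof -
 assume *: "abscont l U g" "abscont l V h"
 have "U x + V x = U 0 + V 0 + integral {0..x} (\<lambda>x. g x + h x)" if "x \<in> {0..l}" for x
  using abscontD[OF *(1), of x] abscontD[OF *(2), of x] abscont_int[OF *(1), of 0 x] abscont_int[OF *(2), of 0 x] that
  by (simp add: Henstock_Kurzweil_Integration.integral_add)
 thus ?thesis unfolding abscont_def using sqi_add[OF abscont_sqi[OF *(1)] abscont_sqi[OF *(2)]] by blast
qed

lemma abscont_scale: "abscont l U g ==> abscont l (\<lambda>x. c*U x) (\<lambda>x. c*g x)"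
proof -
 assume *: "abscont l U g"
 have "c*U x = c*U 0 + integral {0..x} (\<lambda>x. c*g x)" if "x \<in> {0..l}" for x
  using abscontD[OF *, of x] that by (simp add: algebra_simps)
 thus ?thesis unfolding abscont_def using sqi_scale[OF abscont_sqi[OF *]] by blast
qed

lemma abscont_const: "abscont l (\<lambda>x. c) (\<lambda>x. 0)"
 by (simp add: abscont_def)

lemma abscont_uminus: "abscont l U g ==> abscont l (\<lambda>x. - U x) (\<lambda>x. - g x)"
 using abscont_scale[of l U g "-1"] by simp

lemma abscont_diff: "abscont l U g ==> abscont l V h ==> abscont l (\<lambda>x. U x - V x) (\<lambda>x. g x - h x)"
 using abscont_add[OF _ abscont_uminus, of l U g V h] by simp

lemma abscont_sum: "(\<And>i. i \<in> I ==> abscont l (U i) (g i)) ==> abscont l (\<lambda>x. \<Sum>i\<in>I. U i x) (\<lambda>x. \<Sum>i\<in>I. g i x)"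
 by (induction I rule: infinite_finite_induct) (auto intro: abscont_add abscont_const)

lemma abscont_restrict: "abscont l U g ==> k \<le> l ==> abscont k U g"
 unfolding abscont_def
proof (intro conjI ballI, goal_cases)
 case 1 thus ?case using sqi_subinterval[of 0 l g 0 k] by auto
next
 case (2 x) thus ?case by (metis atLeastAtMost_iff order_trans)
qed

text \<open>Telescoping over a partition of mesh below \<open>\<delta>\<close> bounds the total
  change of \<open>D\<close> by \<open>e\<close> times that of \<open>F\<close>. This takes the
  place of differentiation almost everywhere in the product rule below.\<close>

lemma const_by_partition:
 fixes D F :: "real => real"
 assumes l: "0 \<le> l" and *: "\<And>e. e > 0 ==> \<exists>\<delta>>0. \<forall>x y. 0 \<le> x \<and> x \<le> y \<and> y \<le> l \<and> y - x < \<delta> \<longrightarrow> \<bar>D y - D x\<bar> \<le> e*(F y - F x)"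
 shows "D l = D 0"
proof -
 have bd: "\<bar>D l - D 0\<bar> \<le> e*(F l - F 0)" if "e > 0" for e
 proof -
  obtain \<delta> where \<delta>: "\<delta> > 0" "\<And>x y. 0 \<le> x ==> x \<le> y ==> y \<le> l ==> y - x < \<delta> ==> \<bar>D y - D x\<bar> \<le> e*(F y - F x)"
   using *[OF \<open>e > 0\<close>] by blast
  obtain n :: nat where n: "l/\<delta> < real n" using reals_Archimedean2 by blast
  have n0: "0 < n" using n \<delta>(1) l by (metis divide_nonneg_pos le_less_trans of_nat_0_less_iff)
  have step: "l/n < \<delta>" using n n0 \<delta>(1) by (simp add: field_simps)
  have "\<bar>D (i*(l/n)) - D 0\<bar> \<le> e*(F (i*(l/n)) - F 0)" if "i \<le> n" for i :: nat
   using that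
  proof (induction i)
   case (Suc i)
   have eq: "real (Suc i)*(l/n) = i*(l/n) + l/n" by (simp add: algebra_simps add_divide_distrib)
   have ge: "0 \<le> l/n" using l by simp
   have "real (Suc i)*(l/n) \<le> real n*(l/n)"
    using Suc.prems l by (intro mult_right_mono) (auto simp del: of_nat_Suc)
   hence "real (Suc i)*(l/n) \<le> l" using n0 by simp
   hence "\<bar>D (real (Suc i)*(l/n)) - D (i*(l/n))\<bar> \<le> e*(F (real (Suc i)*(l/n)) - F (i*(l/n)))"
    unfolding eq by (intro \<delta>(2)) (use ge step mult_nonneg_nonneg[of "real i" "l/n"] in auto)
   thus ?case using Suc by (simp add: algebra_simps)
  qed simp
  from this[of n] show ?thesis using n0 by simp
 qed
 have "\<bar>D l - D 0\<bar> \<le> 0"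
 proof (rule field_le_epsilon)
  fix e :: real assume e: "e > 0"
  define c where "c = \<bar>F l - F 0\<bar> + 1"
  have c: "c > 0" "F l - F 0 \<le> c" by (auto simp: c_def)
  have "\<bar>D l - D 0\<bar> \<le> (e/c)*(F l - F 0)" using bd[of "e/c"] e c by simp
  also have "... \<le> (e/c)*c" using e c by (intro mult_left_mono) auto
  finally show "\<bar>D l - D 0\<bar> \<le> 0 + e" using c by simp
 qed
 thus ?thesis by simp
qed

text \<open>Over a short interval the increment of \<open>U*V\<close> differs from the integral of
  \<open>g*V + U*h\<close> only through the oscillation of \<open>U\<close> and \<open>V\<close>,
  which uniform continuity makes smaller than \<open>e\<close>; the defect is thus at most
  \<open>e\<close> times the integral of \<open>\<bar>g\<bar> + \<bar>h\<bar>\<close>.\<close>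

lemma abscont_mult:
 assumes U: "abscont l U g" and V: "abscont l V h"
 shows "abscont l (\<lambda>x. U x*V x) (\<lambda>x. g x*V x + U x*h x)"
 unfolding abscont_def
proof (intro conjI ballI)
 let ?f = "\<lambda>x. g x*V x + U x*h x"
 have s: "sqi (Lb l) (\<lambda>x. V x*g x)" "sqi (Lb l) (\<lambda>x. U x*h x)"
  by (intro sqi_mult_continuous abscont_sqi[OF U] abscont_sqi[OF V] abscont_continuous[OF V] abscont_continuous[OF U])+
 show sf: "sqi (Lb l) ?f"
  using sqi_add[OF s] by (simp add: mult.commute)
 fix l1 assume l1: "l1 \<in> {0..l}"
 have fi: "?f integrable_on {x..y}" "(\<lambda>x. g x*V x) integrable_on {x..y}" "(\<lambda>x. U x*h x) integrable_on {x..y}"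
  if "0 \<le> x" "y \<le> l1" for x y
  using integral_HK(2)[OF sqi_integrable_Leb[OF sf]] integral_HK(2)[OF sqi_integrable_Leb[OF s(1)]]
   integral_HK(2)[OF sqi_integrable_Leb[OF s(2)]] that l1
  by (auto simp: mult.commute intro: integrable_on_subinterval)
 have gi: "g integrable_on {x..y}" "h integrable_on {x..y}" "(\<lambda>x. \<bar>g x\<bar>) integrable_on {x..y}" "(\<lambda>x. \<bar>h x\<bar>) integrable_on {x..y}"
  if "0 \<le> x" "y \<le> l1" for x y
  using integral_HK[OF sqi_integrable_Leb[OF abscont_sqi[OF U]]] integral_HK[OF sqi_integrable_Leb[OF abscont_sqi[OF V]]] that l1
  by (auto intro: integrable_on_subinterval)
 define D where "D x = U x*V x - integral {0..x} ?f" for x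
 define F where "F x = integral {0..x} (\<lambda>x. \<bar>g x\<bar> + \<bar>h x\<bar>)" for x
 have "D l1 = D 0"
 proof (rule const_by_partition[of _ _ F])
  show "0 \<le> l1" using l1 by simp
  fix e :: real assume e: "e > 0"
  have "uniformly_continuous_on {0..l1} U" "uniformly_continuous_on {0..l1} V"
   using l1 by (auto intro!: compact_uniformly_continuous intro: continuous_on_subset[OF abscont_continuous[OF U]] continuous_on_subset[OF abscont_continuous[OF V]])
  then obtain d1 d2 where d: "d1 > 0" "\<And>x y. x \<in> {0..l1} ==> y \<in> {0..l1} ==> dist y x < d1 ==> dist (U y) (U x) < e"
   "d2 > 0" "\<And>x y. x \<in> {0..l1} ==> y \<in> {0..l1} ==> dist y x < d2 ==> dist (V y) (V x) < e"
   unfolding uniformly_continuous_on_def using e by metis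
  have "\<bar>D y - D x\<bar> \<le> e*(F y - F x)" if "0 \<le> x \<and> x \<le> y \<and> y \<le> l1 \<and> y - x < min d1 d2" for x y
  proof -
   have xy: "0 \<le> x" "x \<le> y" "y \<le> l1" "y \<le> l" using that l1 by auto
   have 1: "integral {0..x} ?f + integral {x..y} ?f = integral {0..y} ?f"
    using xy by (intro Henstock_Kurzweil_Integration.integral_combine fi) auto
   have 2: "integral {0..x} (\<lambda>x. \<bar>g x\<bar> + \<bar>h x\<bar>) + integral {x..y} (\<lambda>x. \<bar>g x\<bar> + \<bar>h x\<bar>) = integral {0..y} (\<lambda>x. \<bar>g x\<bar> + \<bar>h x\<bar>)"
    using xy by (intro Henstock_Kurzweil_Integration.integral_combine integrable_add gi) auto
   have "U y - U x = integral {x..y} g" "V y - V x = integral {x..y} h"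
    using abscont_increment[OF U] abscont_increment[OF V] xy by auto
   \<comment> \<open>The increment of the product is split so that \<open>V\<close> is frozen at the
     right end and \<open>U\<close> at the left end.\<close>
   hence "D y - D x = integral {x..y} g*V y + U x*integral {x..y} h - integral {x..y} ?f"
    using 1 unfolding D_def by (simp add: algebra_simps)
   also have "... = integral {x..y} (\<lambda>t. (g t*V y + U x*h t) - ?f t)"
   proof -
    have 1: "(\<lambda>t. g t*V y) integrable_on {x..y}"
     by (rule integrable_on_mult_left[OF gi(1)[OF xy(1,3)]])
    have 2: "(\<lambda>t. U x*h t) integrable_on {x..y}"
     by (rule integrable_on_mult_right[OF gi(2)[OF xy(1,3)]])
    have "integral {x..y} (\<lambda>t. (g t*V y + U x*h t) - ?f t) =
      integral {x..y} (\<lambda>t. g t*V y + U x*h t) - integral {x..y} ?f"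
     using 1 2 fi[of x y] xy by (intro Henstock_Kurzweil_Integration.integral_diff integrable_add) auto
    thus ?thesis using 1 2 by (simp add: Henstock_Kurzweil_Integration.integral_add)
   qed
   finally have *: "D y - D x = integral {x..y} (\<lambda>t. (g t*V y + U x*h t) - ?f t)" .
   have "norm (integral {x..y} (\<lambda>t. (g t*V y + U x*h t) - ?f t)) \<le> integral {x..y} (\<lambda>t. e*(\<bar>g t\<bar> + \<bar>h t\<bar>))"
   proof (rule integral_norm_bound_integral)
    show "(\<lambda>t. (g t*V y + U x*h t) - ?f t) integrable_on {x..y}"
     using gi[of x y] fi[of x y] xy by (intro integrable_diff integrable_add integrable_on_mult_left integrable_on_mult_right) auto
    show "(\<lambda>t. e*(\<bar>g t\<bar> + \<bar>h t\<bar>)) integrable_on {x..y}"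
     using gi[of x y] xy by (intro integrable_on_mult_right integrable_add) auto
    fix t assume t: "t \<in> {x..y}"
    have "\<bar>V y - V t\<bar> \<le> e" "\<bar>U x - U t\<bar> \<le> e"
     using d(2)[of t x] d(4)[of t y] t that by (auto simp: dist_real_def)
    hence "\<bar>g t\<bar>*\<bar>V y - V t\<bar> + \<bar>h t\<bar>*\<bar>U x - U t\<bar> \<le> \<bar>g t\<bar>*e + \<bar>h t\<bar>*e"
     by (intro add_mono mult_left_mono) auto
    moreover have "(g t*V y + U x*h t) - ?f t = g t*(V y - V t) + h t*(U x - U t)" by (simp add: algebra_simps)
    ultimately show "norm ((g t*V y + U x*h t) - ?f t) \<le> e*(\<bar>g t\<bar> + \<bar>h t\<bar>)"
     unfolding real_norm_def using abs_triangle_ineq[of "g t*(V y - V t)" "h t*(U x - U t)"]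
     by (simp only: abs_mult distrib_left mult.commute)
   qed
   moreover have "F y - F x = integral {x..y} (\<lambda>x. \<bar>g x\<bar> + \<bar>h x\<bar>)" using 2 by (simp add: F_def)
   ultimately show ?thesis using*by simp
  qed
  thus "\<exists>\<delta>>0. \<forall>x y. 0 \<le> x \<and> x \<le> y \<and> y \<le> l1 \<and> y - x < \<delta> \<longrightarrow> \<bar>D y - D x\<bar> \<le> e*(F y - F x)"
   using d(1,3) by (intro exI[of _ "min d1 d2"]) auto
 qed
 thus "U l1*V l1 = U 0*V 0 + integral {0..l1} ?f" by (simp add: D_def)
qed

lemma abscont_test:
 assumes "test_fun l \<phi>" shows "abscont l \<phi> (deriv \<phi>)"
 using test_fun_continuous_deriv[OF assms] by (intro abscont_of_deriv) (auto intro: has_field_derivative_at_within)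

text \<open>The product rule with a test function, which vanishes at both ends.\<close>

lemma abscont_weak_deriv:
 assumes "abscont l U g" "0 < l" shows "weak_deriv l U g"
 unfolding weak_deriv_def
proof (intro conjI allI impI)
 show "g \<in> L2_int l" using abscont_sqi[OF assms(1)] by (simp add: L2_int_iff)
 fix \<phi> assume t: "test_fun l \<phi>"
 note P = abscont_mult[OF assms(1) abscont_test[OF t]]
 obtain c d where "0 < c" "d < l" "\<And>x. x \<notin> {c..d} ==> \<phi> x = 0" using t unfolding test_fun_def by blast
 hence "\<phi> 0 = 0" "\<phi> l = 0" by auto
 hence "integral {0..l} (\<lambda>x. g x*\<phi> x + U x*deriv \<phi> x) = 0"
  using abscontD[OF P, of l] assms(2) by simp
 moreover have "integral\<^sup>L (Lb l) (\<lambda>x. g x*\<phi> x + U x*deriv \<phi> x) = integral {0..l} (\<lambda>x. g x*\<phi> x + U x*deriv \<phi> x)"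
  by (intro integral_HK(1) sqi_integrable_Leb abscont_sqi[OF P])
 moreover have "integrable (Lb l) (\<lambda>x. g x*\<phi> x)" "integrable (Lb l) (\<lambda>x. U x*deriv \<phi> x)"
  using abscont_sqi[OF assms(1)] abscont_sqi_fun[OF assms(1)] abscont_sqi[OF abscont_test[OF t]] abscont_sqi_fun[OF abscont_test[OF t]]
  by (auto intro: sqi_mult)
 ultimately show "(LINT x|Lb l. U x*deriv \<phi> x) = - (LINT x|Lb l. g x*\<phi> x)"
  by simp
qed

section \<open>The lemma of du Bois-Reymond\<close>

text \<open>The sets over which the integral vanishes include the intervals and are closed under
  complements and countable disjoint unions, hence include all Borel sets. The Borel version
  \<open>h'\<close> on the whole line makes this induction available.\<close>

lemma zero_integrals_imp_AE_zero:
 fixes h :: "real => real"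
 assumes h: "integrable (Lb l) h" and z: "\<And>x. x \<in> {0..l} ==> integral {0..x} h = 0"
 shows "AE x in Lb l. h x = 0"
proof (cases "0 \<le> l")
 case True
 define k where "k x = indicator {0..l} x *\<^sub>R h x" for x
 have k: "integrable lebesgue k"
  unfolding k_def using h by (subst (asm) integrable_restrict_space) auto
 then obtain h' where h'[measurable]: "h' \<in> borel_measurable lborel" and ae: "AE x in lborel. k x = h' x"
  using completion_ex_borel_measurable_real by blast
 have ae2: "AE x in lebesgue. k x = h' x" using ae by (rule AE_completion)
 have h'i: "integrable lebesgue h'"
  by (rule integrable_cong_AE_imp[OF k]) (use ae2 h' in \<open>auto simp: measurable_completion\<close>)
 hence h'b: "integrable lborel h'" by (simp add: integrable_completion)
 have I: "integral\<^sup>L lborel (\<lambda>x. indicator {a..b} x *\<^sub>R h' x) = 0" if "a \<le> b" for a b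
 proof -
  have "integral\<^sup>L lborel (\<lambda>x. indicator {a..b} x *\<^sub>R h' x) = integral\<^sup>L lebesgue (\<lambda>x. indicator {a..b} x *\<^sub>R h' x)"
   by (rule integral_completion[symmetric]) measurable
  also have "... = integral\<^sup>L lebesgue (\<lambda>x. indicator {a..b} x *\<^sub>R k x)"
   by (rule integral_cong_AE) (use ae2 k in \<open>auto intro!: borel_measurable_times borel_measurable_indicator simp: measurable_completion dest: borel_measurable_integrable\<close>)
  also have "(\<lambda>x. indicator {a..b} x *\<^sub>R k x) = (\<lambda>x. indicator {max a 0..min b l} x *\<^sub>R h x)"
   by (auto simp: k_def indicator_def fun_eq_iff)
  also have "integral\<^sup>L lebesgue ... = integral\<^sup>L (lebesgue_on {max a 0..min b l}) h"
   by (subst integral_restrict_space) auto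
  also have "... = integral {max a 0..min b l} h"
   by (rule integral_HK(1)[OF integrable_subinterval[OF h]]) auto
  also have "... = 0"
  proof (cases "max a 0 \<le> min b l")
   case True
   have "integral {0..max a 0} h + integral {max a 0..min b l} h = integral {0..min b l} h"
    using True integral_HK(2)[OF h] by (intro Henstock_Kurzweil_Integration.integral_combine) (auto intro: integrable_on_subinterval)
   thus ?thesis using z[of "max a 0"] z[of "min b l"] True by auto
  qed auto
  finally show ?thesis .
 qed
 have tot: "integral\<^sup>L lborel h' = 0"
 proof -
  have "integral\<^sup>L lborel (\<lambda>x. indicator {0..l} x *\<^sub>R h' x) = integral\<^sup>L lborel h'"
  proof (rule integral_cong_AE)
   show "AE x in lborel. indicator {0..l} x *\<^sub>R h' x = h' x"
    using ae by eventually_elim (metis (no_types, lifting) indicator_simps k_def scaleR_one scaleR_zero_left)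
  qed auto
  thus ?thesis using I[OF True] by simp
 qed
 have "set_lebesgue_integral lborel A h' = 0" if "A \<in> sets borel" for A
  using that
 proof (induction A rule: borel_set_induct)
  case (interval a b) thus ?case using I by (simp add: set_lebesgue_integral_def)
 next
  case (compl A)
  have "(\<lambda>x. indicator (- A) x *\<^sub>R h' x) = (\<lambda>x. h' x - indicator A x *\<^sub>R h' x)" by (auto simp: indicator_def)
  moreover have "integrable lborel (\<lambda>x. indicator A x *\<^sub>R h' x)"
   using compl h'b by (intro integrable_mult_indicator) auto
  ultimately show ?case using compl tot h'b by (simp add: set_lebesgue_integral_def)
 next
  case (union f)
  have "set_integrable lborel (\<Union>i. f i) h'"
   unfolding set_integrable_def using union h'b by (intro integrable_mult_indicator) auto
  hence "(LINT x:(\<Union>i. f i)|lborel. h' x) = (\<Sum>i. (LINT x:(f i)|lborel. h' x))"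
   using union by (intro lebesgue_integral_countable_add) (auto simp: disjoint_family_on_def)
  thus ?case using union by simp
 qed (simp add: set_lebesgue_integral_def)
 hence "AE x in lborel. h' x = 0" using h'b by (intro sigma_finite_measure.density_zero[OF sigma_finite_lborel]) auto
 hence "AE x in lebesgue. k x = 0" using AE_completion ae2 by force
 thus ?thesis
  by (subst AE_restrict_space_iff) (auto simp: k_def elim!: eventually_mono)
qed (auto intro!: AE_I2)

text \<open>Vanishing mean is what makes the primitive vanish to the right of the support as
  well.\<close>

lemma bump_primitive_test:
 assumes f: "f \<in> bump_alg" and cd: "0 < c" "c \<le> d" "d < l" and z: "\<And>x. x \<notin> {c..d} ==> f x = 0"
  and i: "integral {0..l} f = 0"
 obtains \<phi> where "test_fun l \<phi>" "deriv \<phi> = f"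
proof -
 define \<phi> where "\<phi> x = (if x \<le> 0 then 0 else integral {0..x} f)" for x
 have ci: "f integrable_on {x..y}" for x y
  using bump_alg_continuous[OF f] integrable_continuous_real by blast
 have zero_low: "\<phi> x = 0" if "x < c" for x
 proof -
  have "integral {0..x} f = integral {0..x} (\<lambda>x. 0)" using that z by (intro Henstock_Kurzweil_Integration.integral_cong) auto
  thus ?thesis by (simp add: \<phi>_def)
 qed
 have zero_high: "\<phi> x = 0" if "x > d" for x
 proof -
  have *: "integral {a..b} f = 0" if "d < a" for a b
  proof -
   have "integral {a..b} f = integral {a..b} (\<lambda>x. 0)" using that z by (intro Henstock_Kurzweil_Integration.integral_cong) auto
   thus ?thesis by simp
  qed
  have "integral {0..x} f = integral {0..l} f"
  proof (cases "x \<le> l")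
   case True
   thus ?thesis using Henstock_Kurzweil_Integration.integral_combine[of 0 x l f] ci that cd *[of x l] by auto
  next
   case False
   thus ?thesis using Henstock_Kurzweil_Integration.integral_combine[of 0 l x f] ci that cd *[of l x] by auto
  qed
  thus ?thesis using i by (simp add: \<phi>_def)
 qed
 have der: "(\<phi> has_real_derivative f x) (at x)" for x
 proof (cases "x < c")
  case True
  have "\<forall>\<^sub>F y in nhds x. 0 = \<phi> y"
   by (rule eventually_mono[OF eventually_nhds_in_open[of "{..<c}" x]]) (use True zero_low in auto)
  moreover have "((\<lambda>y. 0) has_real_derivative f x) (at x)" using z[of x] True by simp
  ultimately show ?thesis by (rule DERIV_local[rotated])
 next
  case False
  hence x: "0 < x" using cd by simp
  have "((\<lambda>u. integral {0..u} f) has_real_derivative f x) (at x within {0..x + 1})"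
   using x by (intro integral_has_real_derivative bump_alg_continuous[OF f]) auto
  hence "((\<lambda>u. integral {0..u} f) has_real_derivative f x) (at x)"
   using x by (simp add: at_within_Icc_at)
  moreover have "\<forall>\<^sub>F y in nhds x. integral {0..y} f = \<phi> y"
   by (rule eventually_mono[OF eventually_nhds_in_open[of "{0<..}" x]]) (use x in \<open>auto simp: \<phi>_def\<close>)
  ultimately show ?thesis by (rule DERIV_local)
 qed
 have "(deriv ^^ k) \<phi> differentiable at x" for k x by (rule primitive_smooth[OF f der])
 moreover have "\<phi> x = 0" if "x \<notin> {c..d}" for x using that zero_low zero_high by (cases "x < c") auto
 ultimately have "test_fun l \<phi>" unfolding test_fun_def using cd by blast
 moreover have "deriv \<phi> = f" using der by (auto simp: DERIV_imp_deriv)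
 ultimately show ?thesis using that by blast
qed

text \<open>Positive exactly between \<open>p\<close> and \<open>q\<close>, bounded by 1, and
  converging pointwise to the indicator as \<open>n\<close> grows; dominated convergence then turns
  tests against bumps into integrals over intervals.\<close>

definition bump :: "nat => real => real => real => real" where
 "bump n p q x = flat (real (Suc n)) 0 (x - p)*flat (real (Suc n)) 0 (q - x)"

lemma bump_alg_bump: "bump n p q \<in> bump_alg"
proof -
 have "(\<lambda>x. flat (real (Suc n)) 0 (1*x + (- p))*flat (real (Suc n)) 0 ((-1)*x + q)) \<in> bump_alg"
  by (intro bump_alg.mult bump_alg.flat) auto
 moreover have "bump n p q = (\<lambda>x. flat (real (Suc n)) 0 (1*x + (- p))*flat (real (Suc n)) 0 ((-1)*x + q))"
  by (auto simp: bump_def fun_eq_iff algebra_simps)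
 ultimately show ?thesis by metis
qed

lemma bump_props:
 "0 \<le> bump n p q x" "bump n p q x \<le> 1" "x \<notin> {p<..<q} ==> bump n p q x = 0"
 "p < x ==> x < q ==> 0 < bump n p q x"
 "(\<lambda>n. bump n p q x) \<longlonglongrightarrow> indicator {p<..<q} x"
proof -
 have f: "0 \<le> flat (real (Suc n)) 0 y" "flat (real (Suc n)) 0 y \<le> 1" for n y
  by (auto simp: flat_def)
 show "0 \<le> bump n p q x" unfolding bump_def by (intro mult_nonneg_nonneg f)
 show "bump n p q x \<le> 1" unfolding bump_def by (intro mult_le_one f)
 show z: "x \<notin> {p<..<q} ==> bump n p q x = 0" for n by (auto simp: bump_def flat_def)
 show "p < x ==> x < q ==> 0 < bump n p q x" by (auto simp: bump_def flat_def)
 have l: "(\<lambda>n. flat (real (Suc n)) 0 y) \<longlonglongrightarrow> 1" if "y > 0" for y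
 proof -
  have "(\<lambda>n. exp (- (inverse (real (Suc n))*(1/y)))) \<longlonglongrightarrow> exp (- (0*(1/y)))"
   by (intro tendsto_intros LIMSEQ_inverse_real_of_nat)
  thus ?thesis using that by (simp add: flat_def field_simps)
 qed
 show "(\<lambda>n. bump n p q x) \<longlonglongrightarrow> indicator {p<..<q} x"
 proof (cases "x \<in> {p<..<q}")
  case True
  hence "(\<lambda>n. flat (real (Suc n)) 0 (x - p)*flat (real (Suc n)) 0 (q - x)) \<longlonglongrightarrow> 1*1"
   by (intro tendsto_mult l) auto
  thus ?thesis using True by (simp add: bump_def)
 qed (simp add: z)
qed

lemma du_Bois_Reymond:
 assumes l: "0 < l" and h: "integrable (Lb l) h"
  and t: "\<And>\<phi>. test_fun l \<phi> ==> integral\<^sup>L (Lb l) (\<lambda>x. h x*deriv \<phi> x) = 0"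
 obtains c where "AE x in Lb l. h x = c"
proof -
 let ?M = "Lb l"
 have bm: "bump n p q \<in> borel_measurable ?M" for n p q
  using sqi_continuous[OF bump_alg_continuous[OF bump_alg_bump]] by (simp add: sqi_def)
 have bi: "integrable ?M (bump n p q)" for n p q
  by (intro sqi_integrable_Leb sqi_continuous bump_alg_continuous bump_alg_bump)
 have hbi: "integrable ?M (\<lambda>x. h x*bump n p q x)" for n p q
  by (rule Bochner_Integration.integrable_bound[OF h])
   (use bm h bump_props(1,2) in \<open>auto simp: abs_mult intro!: mult_left_le\<close>)
 \<comment> \<open>A fixed reference bump of positive integral. Subtracting a multiple of it from
   any other bump leaves a function of mean zero, hence the derivative of a test function.\<close>
 define r where "r = bump 0 (l/3) (2*l/3)"
 define R where "R = integral\<^sup>L ?M r"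
 have "R \<noteq> 0"
 proof
  assume "R = 0"
  hence "integral\<^sup>L ?M r = 0 \<longleftrightarrow> (\<forall>x\<in>{0..l}. r x = 0)"
   using l by (intro integralL_eq_0_iff) (auto simp: r_def bump_props intro: bump_alg_continuous bump_alg_bump)
  hence "r (l/2) = 0" using \<open>R = 0\<close> l by (auto simp: R_def)
  thus False using bump_props(4)[of "l/3" "l/2" "2*l/3" 0] l by (simp add: r_def)
 qed
 define c where "c = integral\<^sup>L ?M (\<lambda>x. h x*r x)/R"
 have step: "integral\<^sup>L ?M (\<lambda>x. h x*bump n p q x) = c*integral\<^sup>L ?M (bump n p q)" if pq: "0 < p" "p < q" "q < l" for n p q
 proof -
  define k where "k = integral\<^sup>L ?M (bump n p q)/R"
  define f where "f x = bump n p q x + (- k)*r x" for x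
  have fb: "f \<in> bump_alg" unfolding f_def r_def by (intro bump_alg.add bump_alg.scale bump_alg_bump)
  have "integral {0..l} f = integral\<^sup>L ?M f"
   by (intro integral_HK(1)[symmetric] sqi_integrable_Leb sqi_continuous bump_alg_continuous fb)
  also have "... = integral\<^sup>L ?M (bump n p q) - k*R"
   unfolding f_def R_def r_def using bi by simp
  also have "... = 0" using \<open>R \<noteq> 0\<close> by (simp add: k_def)
  finally have "integral {0..l} f = 0" .
  moreover have "f x = 0" if "x \<notin> {min p (l/3)..max q (2*l/3)}" for x
  proof -
   have "x \<notin> {p<..<q}" "x \<notin> {l/3<..<2*l/3}" using that by auto
   thus ?thesis by (simp add: f_def r_def bump_props(3))
  qed
  moreover have "min p (l/3) \<le> max q (2*l/3)" using pq by (simp add: min_le_iff_disj le_max_iff_disj)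
  ultimately obtain \<phi> where "test_fun l \<phi>" "deriv \<phi> = f"
   using bump_primitive_test[OF fb, of "min p (l/3)" "max q (2*l/3)" l] pq l by auto
  hence "0 = integral\<^sup>L ?M (\<lambda>x. h x*f x)" using t by metis
  also have "(\<lambda>x. h x*f x) = (\<lambda>x. h x*bump n p q x + (- k)*(h x*r x))" by (auto simp: f_def algebra_simps)
  also have "integral\<^sup>L ?M ... = integral\<^sup>L ?M (\<lambda>x. h x*bump n p q x) - k*integral\<^sup>L ?M (\<lambda>x. h x*r x)"
   using hbi by (simp add: r_def)
  finally show ?thesis using \<open>R \<noteq> 0\<close> by (simp add: k_def c_def)
 qed
 have int: "integral {p..q} h = c*(q - p)" if pq: "0 < p" "p < q" "q < l" for p q
 proof -
  have "(\<lambda>n. integral\<^sup>L ?M (\<lambda>x. h x*bump n p q x)) \<longlonglongrightarrow> integral\<^sup>L ?M (\<lambda>x. h x*indicator {p<..<q} x)"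
   by (rule integral_dominated_convergence[where w="\<lambda>x. \<bar>h x\<bar>"])
    (use h hbi bump_props in \<open>auto simp: abs_mult intro!: mult_left_le tendsto_mult borel_measurable_times borel_measurable_indicator' simp: sets_restrict_space_iff dest: borel_measurable_integrable\<close>)
  moreover have "(\<lambda>n. integral\<^sup>L ?M (bump n p q)) \<longlonglongrightarrow> integral\<^sup>L ?M (indicator {p<..<q})"
   by (rule integral_dominated_convergence[where w="\<lambda>x. 1"])
    (use bm bump_props in \<open>auto intro!: borel_measurable_indicator' simp: sets_restrict_space_iff\<close>)
  ultimately have eq: "integral\<^sup>L ?M (\<lambda>x. h x*indicator {p<..<q} x) = c*integral\<^sup>L ?M (indicator {p<..<q})"
   using step[OF pq] by (simp add: LIMSEQ_unique tendsto_mult_left)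
  have "integral\<^sup>L ?M (\<lambda>x. h x*indicator {p<..<q} x) = integral\<^sup>L ?M (\<lambda>x. if x \<in> {p<..<q} then h x else 0)"
   by (intro Bochner_Integration.integral_cong) auto
  also have "... = integral\<^sup>L (lebesgue_on {p<..<q}) h"
   using pq by (subst Lebesgue_Measure.integral_restrict) auto
  also have "... = integral {p<..<q} h"
  proof (rule lebesgue_integral_eq_integral)
   have "integrable lebesgue (\<lambda>x. indicator {0..l} x *\<^sub>R h x)" using h by (subst (asm) integrable_restrict_space) auto
   from integrable_mult_indicator[OF _ this, of "{p<..<q}"]
   have "integrable lebesgue (\<lambda>x. indicator {p<..<q} x *\<^sub>R indicator {0..l} x *\<^sub>R h x)" by simp
   also have "(\<lambda>x. indicator {p<..<q} x *\<^sub>R indicator {0..l} x *\<^sub>R h x) = (\<lambda>x. indicator {p<..<q} x *\<^sub>R h x)"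
    using pq by (auto simp: indicator_def)
   finally show "integrable (lebesgue_on {p<..<q}) h" by (subst integrable_restrict_space) auto
  qed simp
  also have "... = integral {p..q} h" by (simp add: integral_open_interval_real)
  finally have 1: "integral\<^sup>L ?M (\<lambda>x. h x*indicator {p<..<q} x) = integral {p..q} h" .
  have "integral\<^sup>L ?M (indicator {p<..<q}) = measure ?M {p<..<q}"
  proof -
   have "{p<..<q} \<inter> {0..l} = {p<..<q}" using pq by auto
   thus ?thesis by (simp add: Bochner_Integration.integral_indicator)
  qed
  also have "... = q - p" using pq by (subst measure_restrict_space) auto
  finally show ?thesis using eq 1 by simp
 qed
 define k where "k x = h x - c" for x
 have ki: "integrable ?M k" unfolding k_def using h by simp
 have kHK: "k integrable_on {x..y}" "h integrable_on {x..y}" if "0 \<le> x" "y \<le> l" for x y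
  using integral_HK(2)[OF ki] integral_HK(2)[OF h] that by (auto intro: integrable_on_subinterval)
 have cont: "continuous_on {0..l} (\<lambda>x. integral {0..x} k)"
  by (intro indefinite_integral_continuous_1 kHK) auto
 have kz: "integral {p..q} k = 0" if "0 < p" "p < q" "q < l" for p q
  using int[OF that] kHK(2)[of p q] that unfolding k_def
  by (subst Henstock_Kurzweil_Integration.integral_diff) auto
 have K: "integral {0..x} k = integral {0..l/2} k" if "x \<in> {0<..<l}" for x
 proof (cases "x \<le> l/2")
  case True
  hence "integral {0..x} k + integral {x..l/2} k = integral {0..l/2} k"
   using that l by (intro Henstock_Kurzweil_Integration.integral_combine kHK) auto
  thus ?thesis using kz[of x "l/2"] that True l by (cases "x = l/2") auto
 next
  case False
  hence "integral {0..l/2} k + integral {l/2..x} k = integral {0..x} k"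
   using that l by (intro Henstock_Kurzweil_Integration.integral_combine kHK) auto
  thus ?thesis using kz[of "l/2" x] that False l by auto
 qed
 \<comment> \<open>The identity is known at interior points; continuity of the primitive carries it
   to the end points, where \<open>x = 0\<close> identifies the constant as 0.\<close>
 have e: "integral {0..x} k = integral {0..l/2} k" if "x \<in> {0..l}" for x
 proof (rule continuous_constant_on_closure[of "{0<..<l}" "\<lambda>x. integral {0..x} k"])
  have cl: "closure {0<..<l} = {0..l}" using l by (intro closure_greaterThanLessThan)
  show "continuous_on (closure {0<..<l}) (\<lambda>x. integral {0..x} k)" unfolding cl by (rule cont)
  show "x \<in> closure {0<..<l}" unfolding cl by (rule that)
 qed (rule K)
 have e0: "integral {0..l/2} k = 0" using e[of 0] l by simp
 have "integral {0..x} k = 0" if "x \<in> {0..l}" for x using e[OF that] e0 by simp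
 hence "AE x in ?M. k x = 0" using ki by (intro zero_integrals_imp_AE_zero)
 thus ?thesis using that[of c] by (auto simp: k_def elim!: eventually_mono)
qed

section \<open>Weak derivatives on an interval\<close>

lemma sqi_borel: "sqi M u ==> u \<in> borel_measurable M"
 by (simp add: sqi_def)

lemma sqi_cong_AE:
 assumes "sqi M u" "v \<in> borel_measurable M" "AE x in M. u x = v x"
 shows "sqi M v"
 unfolding sqi_def
proof
 show "integrable M (\<lambda>x. (v x)^2)"
  by (rule integrable_cong_AE_imp[of M "\<lambda>x. (u x)^2"]) (use assms in \<open>auto simp: sqi_def\<close>)
qed fact

lemma nm_eq_AE: "AE x in M. u x = v x ==> sqi M u ==> sqi M v ==> nm M u = nm M v"
 by (rule nm_cong_AE) (auto simp: sqi_def)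

lemma nm_zero_AE:
 assumes "sqi M u" "nm M u = 0" shows "AE x in M. u x = 0"
proof -
 have "integral\<^sup>L M (\<lambda>x. (u x)^2) = 0" using assms(2) by (simp add: nm_def)
 hence "AE x in M. (u x)^2 = 0"
  using assms(1) integral_nonneg_eq_0_iff_AE[of M "\<lambda>x. (u x)^2"] by (simp add: sqi_def)
 thus ?thesis by simp
qed

lemma abscont_indefinite: "sqi (Lb l) g ==> abscont l (\<lambda>x. integral {0..x} g) g"
 by (simp add: abscont_def)

text \<open>The primitive \<open>W\<close> of the weak derivative has the same weak derivative as
  \<open>u\<close>, so the lemma of du Bois-Reymond makes the difference constant; \<open>U\<close>
  absorbs the constant.\<close>

lemma weak_deriv_imp_abscont:
 assumes l: "0 < l" and u: "sqi (Lb l) u" and w: "weak_deriv l u g"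
 obtains U where "abscont l U g" "AE x in Lb l. u x = U x"
proof -
 let ?M = "Lb l"
 have g: "sqi ?M g" using w by (simp add: weak_deriv_def L2_int_iff)
 define W where "W x = integral {0..x} g" for x
 have W: "abscont l W g" using abscont_indefinite[OF g] by (simp add: W_def[abs_def])
 note wW = abscont_weak_deriv[OF W l]
 have "integral\<^sup>L ?M (\<lambda>x. (u x - W x)*deriv \<phi> x) = 0" if t: "test_fun l \<phi>" for \<phi>
 proof -
  have "sqi ?M (deriv \<phi>)" using abscont_sqi[OF abscont_test[OF t]] .
  hence "integrable ?M (\<lambda>x. u x*deriv \<phi> x)" "integrable ?M (\<lambda>x. W x*deriv \<phi> x)"
   using u abscont_sqi_fun[OF W] by (auto intro: sqi_mult)
  thus ?thesis using w wW t by (simp add: weak_deriv_def left_diff_distrib)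
 qed
 then obtain c where c: "AE x in ?M. u x - W x = c"
  using du_Bois_Reymond[OF l sqi_integrable_Leb[OF sqi_diff[OF u abscont_sqi_fun[OF W]]]] by blast
 show ?thesis
 proof (rule that)
  show "abscont l (\<lambda>x. c + W x) g" using abscont_add[OF abscont_const W] by simp
  show "AE x in ?M. u x = c + W x" using c by eventually_elim simp
 qed
qed

lemma continuous_AE_zero:
 fixes F :: "real => real"
 assumes "continuous_on {0..l} F" "AE x in Lb l. F x = 0" "0 < l" "x \<in> {0..l}"
 shows "F x = 0"
proof -
 have "integral\<^sup>L (Lb l) (\<lambda>x. (F x)^2) = 0"
  using assms(2) by (intro integral_eq_zero_AE) auto
 thus ?thesis
  using integralL_eq_0_iff[of 0 l "\<lambda>x. (F x)^2"] assms continuous_on_power[OF assms(1), of 2] by auto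
qed

lemma abscont_AE_eq:
 assumes U: "abscont l U g" and V: "abscont l V h" and l: "0 < l"
  and ae: "AE x in Lb l. U x = V x"
 shows "x \<in> {0..l} ==> U x = V x" "AE x in Lb l. g x = h x"
proof -
 note D = abscont_diff[OF U V]
 have z: "U x - V x = 0" if "x \<in> {0..l}" for x
  by (rule continuous_AE_zero[OF abscont_continuous[OF D] _ l that]) (use ae in auto)
 thus "x \<in> {0..l} ==> U x = V x" by simp
 have "integral {0..x} (\<lambda>x. g x - h x) = 0" if "x \<in> {0..l}" for x
  using abscontD[OF D, of x] z[OF that] z[of 0] that l by simp
 hence "AE x in Lb l. g x - h x = 0"
  by (intro zero_integrals_imp_AE_zero sqi_integrable_Leb abscont_sqi[OF D])
 thus "AE x in Lb l. g x = h x" by simp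
qed

lemma AE_Leb_subset:
 assumes "AE x in lebesgue_on {a..b::real}. P x" "{c..d} \<subseteq> {a..b}"
 shows "AE x in lebesgue_on {c..d}. P x"
 using assms(1) by (subst AE_restrict_space_iff, simp, subst (asm) AE_restrict_space_iff, simp)
  (use assms(2) in \<open>auto elim!: eventually_mono\<close>)

lemma abscont_cong_deriv:
 assumes U: "abscont l U g" and h: "sqi (Lb l) h" and ae: "AE x in Lb l. g x = h x"
 shows "abscont l U h"
 unfolding abscont_def
proof (intro conjI ballI h)
 fix x assume x: "x \<in> {0..l}"
 have sg: "sqi (Lb x) g" "sqi (Lb x) h"
  using x by (auto intro: sqi_subinterval[OF abscont_sqi[OF U]] sqi_subinterval[OF h])
 have "AE x in Lb x. g x = h x"
  by (rule AE_Leb_subset[OF ae]) (use x in auto)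
 hence "integral\<^sup>L (Lb x) g = integral\<^sup>L (Lb x) h"
  by (intro integral_cong_AE) (use sg in \<open>auto simp: sqi_def\<close>)
 hence "integral {0..x} g = integral {0..x} h"
  using integral_HK(1)[OF sqi_integrable_Leb[OF sg(1)]] integral_HK(1)[OF sqi_integrable_Leb[OF sg(2)]] by simp
 thus "U x = U 0 + integral {0..x} h" using abscontD[OF U, of x] x by simp
qed

lemma weak_deriv_unique:
 assumes "0 < l" "sqi (Lb l) u" "weak_deriv l u g" "weak_deriv l u h"
 shows "AE x in Lb l. g x = h x"
proof -
 obtain U where U: "abscont l U g" "AE x in Lb l. u x = U x"
  using weak_deriv_imp_abscont assms by blast
 obtain V where V: "abscont l V h" "AE x in Lb l. u x = V x"
  using weak_deriv_imp_abscont assms by blast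
 have "AE x in Lb l. U x = V x" using U(2) V(2) by eventually_elim simp
 thus ?thesis using abscont_AE_eq(2)[OF U(1) V(1) assms(1)] by simp
qed

lemma weak_deriv_cong:
 assumes "sqi (Lb l) u" "sqi (Lb l) v" "AE x in Lb l. u x = v x"
 shows "weak_deriv l u = weak_deriv l v"
proof
 fix g
 have "integral\<^sup>L (Lb l) (\<lambda>x. u x*deriv \<phi> x) = integral\<^sup>L (Lb l) (\<lambda>x. v x*deriv \<phi> x)"
  if "test_fun l \<phi>" for \<phi>
 proof (rule integral_cong_AE)
  have "sqi (Lb l) (deriv \<phi>)" using abscont_sqi[OF abscont_test[OF that]] .
  thus "(\<lambda>x. u x*deriv \<phi> x) \<in> borel_measurable (Lb l)"
   "(\<lambda>x. v x*deriv \<phi> x) \<in> borel_measurable (Lb l)"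
   using assms by (auto intro!: borel_measurable_times sqi_borel)
  show "AE x in Lb l. u x*deriv \<phi> x = v x*deriv \<phi> x"
   using assms(3) by eventually_elim simp
 qed
 thus "weak_deriv l u g = weak_deriv l v g" by (auto simp: weak_deriv_def)
qed

lemma wD_cong:
 assumes "sqi (Lb l) u" "sqi (Lb l) v" "AE x in Lb l. u x = v x"
 shows "wD l u = wD l v"
 using weak_deriv_cong[OF assms] by (simp add: wD_def)

text \<open>\<open>wD\<close> is an arbitrary choice among the weak derivatives; uniqueness up to
  null sets lets it serve as the density of the continuous representative just as well as
  \<open>g\<close>.\<close>

lemma wD_abscont:
 assumes U: "abscont l U g" and l: "0 < l" and u: "sqi (Lb l) u"
  and ae: "AE x in Lb l. u x = U x"
 shows "weak_deriv l u (wD l u)" "AE x in Lb l. wD l u x = g x" "abscont l U (wD l u)"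
  "sqi (Lb l) (wD l u)"
proof -
 have w: "weak_deriv l u g"
  using abscont_weak_deriv[OF U l] weak_deriv_cong[OF u abscont_sqi_fun[OF U] ae] by simp
 thus *: "weak_deriv l u (wD l u)" unfolding wD_def by (rule someI[of "weak_deriv l u"])
 from weak_deriv_unique[OF l u this w] show ae: "AE x in Lb l. wD l u x = g x" .
 show s: "sqi (Lb l) (wD l u)" using*by (simp add: weak_deriv_def L2_int_iff)
 show "abscont l U (wD l u)" by (rule abscont_cong_deriv[OF U s]) (use ae in \<open>auto elim: eventually_mono\<close>)
qed

lemma Hk_int_1_iff:
 assumes "0 < l"
 shows "u \<in> Hk_int l 1 \<longleftrightarrow> sqi (Lb l) u \<and>
  (\<exists>U. abscont l U (wD l u) \<and> (AE x in Lb l. u x = U x))" (is "?L \<longleftrightarrow> ?R")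
proof
 assume L: ?L
 then obtain w where w: "weak_deriv l u w" and u: "sqi (Lb l) u"
  by (auto simp: L2_int_iff)
 from w have "weak_deriv l u (wD l u)" unfolding wD_def by (rule someI[of "weak_deriv l u"])
 from weak_deriv_imp_abscont[OF assms u this] u show ?R by blast
next
 assume ?R
 then obtain U where u: "sqi (Lb l) u" and U: "abscont l U (wD l u)" "AE x in Lb l. u x = U x"
  by blast
 from wD_abscont[OF U(1) assms u U(2)] u show ?L by (auto simp: L2_int_iff)
qed

text \<open>\<open>U^2\<close> has derivative \<open>2*U*g\<close>, so its values at any two points
  differ by at most \<open>N\<close>; averaging over the second point gives the bound. The product
  form, rather than a sum of squares, later yields the right power of the scale
  \<open>t\<close>.\<close>

lemma abscont_trace:
 assumes U: "abscont l U g" and l: "0 < l" and x: "x \<in> {0..l}"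
 shows "(U x)^2 \<le> (nm (Lb l) U)^2/l + 2*nm (Lb l) U*nm (Lb l) g"
proof -
 let ?M = "Lb l"
 define h where "h t = g t*U t + U t*g t" for t
 have W: "abscont l (\<lambda>x. U x*U x) h" using abscont_mult[OF U U] by (simp add: h_def[abs_def])
 note sU = abscont_sqi_fun[OF U] and sg = abscont_sqi[OF U]
 have hi: "integrable ?M (\<lambda>t. \<bar>h t\<bar>)" using sqi_integrable_Leb[OF abscont_sqi[OF W]] by simp
 define N where "N = 2*nm ?M U*nm ?M g"
 have tot: "integral {0..l} (\<lambda>t. \<bar>h t\<bar>) \<le> N"
 proof -
  have "integral {0..l} (\<lambda>t. \<bar>h t\<bar>) = integral\<^sup>L ?M (\<lambda>t. \<bar>h t\<bar>)" using integral_HK(1)[OF hi] by simp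
  also have "... = integral\<^sup>L ?M (\<lambda>t. 2*(\<bar>U t\<bar>*\<bar>g t\<bar>))"
   by (intro Bochner_Integration.integral_cong) (auto simp: h_def abs_mult mult.commute)
  also have "... = 2*integral\<^sup>L ?M (\<lambda>t. \<bar>U t\<bar>*\<bar>g t\<bar>)" by simp
  also have "... \<le> 2*(nm ?M (\<lambda>t. \<bar>U t\<bar>)*nm ?M (\<lambda>t. \<bar>g t\<bar>))"
   using sqi_CS[OF sqi_abs[OF sU] sqi_abs[OF sg]] by simp
  also have "... = N" by (simp add: nm_def N_def)
  finally show ?thesis .
 qed
 have sub: "\<bar>integral {a..b} h\<bar> \<le> N" if "0 \<le> a" "a \<le> b" "b \<le> l" for a b
 proof -
  have hab: "h integrable_on {a..b}" "(\<lambda>t. \<bar>h t\<bar>) integrable_on {a..b}" "(\<lambda>t. \<bar>h t\<bar>) integrable_on {0..l}"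
   using abscont_int[OF W, of a b] integral_HK(2)[OF hi] that by (auto intro: integrable_on_subinterval)
  have "\<bar>integral {a..b} h\<bar> \<le> integral {a..b} (\<lambda>t. \<bar>h t\<bar>)"
   using integral_norm_bound_integral[OF hab(1,2)] by simp
  also have "... \<le> integral {0..l} (\<lambda>t. \<bar>h t\<bar>)"
   using that hab by (intro integral_subset_le) auto
  finally show ?thesis using tot by simp
 qed
 have "(U x)^2 - N \<le> (U y)^2" if y: "y \<in> {0..l}" for y
 proof (cases "x \<le> y")
  case True
  thus ?thesis using abscont_increment[OF W, of x y] sub[of x y] x y by (auto simp: power2_eq_square)
 next
  case False
  thus ?thesis using abscont_increment[OF W, of y x] sub[of y x] x y by (auto simp: power2_eq_square)
 qed
 hence "integral\<^sup>L ?M (\<lambda>y. (U x)^2 - N) \<le> integral\<^sup>L ?M (\<lambda>y. (U y)^2)"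
  using sU by (intro integral_mono) (auto simp: sqi_def finite_measure.integrable_const)
 moreover have "measure ?M {0..l} = l" using l by (simp add: measure_restrict_space)
 ultimately have "l*((U x)^2 - N) \<le> (nm ?M U)^2" by (simp add: nm_sq)
 hence "(U x)^2 - N \<le> (nm ?M U)^2/l" using l by (simp add: field_simps)
 thus ?thesis by (simp add: N_def)
qed

section \<open>Reflection, scaling and extension\<close>

lemma sqi_affine:
 fixes u :: "real => real"
 assumes c: "c \<noteq> 0" and u: "sqi (lebesgue_on S) u" and S: "S \<in> sets lebesgue" "T \<in> sets lebesgue"
  and ST: "\<And>x. x \<in> T \<longleftrightarrow> t + c*x \<in> S"
 shows "sqi (lebesgue_on T) (\<lambda>x. u (t + c*x))"
  "integral\<^sup>L (lebesgue_on T) (\<lambda>x. (u (t + c*x))^2) = integral\<^sup>L (lebesgue_on S) (\<lambda>x. (u x)^2)/\<bar>c\<bar>"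
proof -
 have ind: "indicator S (t + c*x) = (indicator T x :: real)" for x using ST by (auto simp: indicator_def)
 have "has_bochner_integral lebesgue (\<lambda>x. indicator S x *\<^sub>R (u x)\<^sup>2) (integral\<^sup>L (lebesgue_on S) (\<lambda>x. (u x)^2))"
  using u S by (simp add: sqi_def has_bochner_integral_iff integral_restrict_space integrable_restrict_space)
 hence 1: "has_bochner_integral lebesgue (\<lambda>x. indicator T x *\<^sub>R (u (t + c*x))\<^sup>2) (integral\<^sup>L (lebesgue_on S) (\<lambda>x. (u x)^2)/\<bar>c\<bar>)"
  using has_bochner_integral_lebesgue_real_affine_iff[OF c, of "\<lambda>x. indicator S x *\<^sub>R (u x)\<^sup>2" _ t]
  by (simp add: ind divide_inverse mult.commute[of _ "inverse _"])
 thus "integral\<^sup>L (lebesgue_on T) (\<lambda>x. (u (t + c*x))^2) = integral\<^sup>L (lebesgue_on S) (\<lambda>x. (u x)^2)/\<bar>c\<bar>"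
  using S by (simp add: integral_restrict_space has_bochner_integral_iff)
 have "(\<lambda>x. indicator S x *\<^sub>R u x) \<in> borel_measurable lebesgue"
  using u S by (simp add: sqi_def borel_measurable_restrict_space_iff)
 moreover have "(\<lambda>x. t + c*x) \<in> lebesgue \<rightarrow>\<^sub>M lebesgue"
  using lebesgue_affine_measurable[of "\<lambda>x::real. c" t] c by simp
 ultimately have "(\<lambda>x. indicator S (t + c*x) *\<^sub>R u (t + c*x)) \<in> borel_measurable lebesgue"
  by (rule measurable_compose_rev)
 hence "(\<lambda>x. u (t + c*x)) \<in> borel_measurable (lebesgue_on T)"
  using S by (simp add: ind borel_measurable_restrict_space_iff)
 thus "sqi (lebesgue_on T) (\<lambda>x. u (t + c*x))"
  using 1 S by (simp add: sqi_def integrable_restrict_space has_bochner_integral_iff)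
qed

lemma sqi_reflect:
 fixes u :: "real => real"
 assumes "sqi (Lb l) u"
 shows "sqi (Lb l) (\<lambda>x. u (l - x))" "nm (Lb l) (\<lambda>x. u (l - x)) = nm (Lb l) u"
 using sqi_affine[of "-1" "{0..l}" u "{0..l}" l] assms by (auto simp: nm_def)

lemma abscont_reflect:
 assumes U: "abscont l U g" shows "abscont l (\<lambda>x. U (l - x)) (\<lambda>x. - g (l - x))"
 unfolding abscont_def
proof (intro conjI ballI sqi_uminus sqi_reflect abscont_sqi[OF U])
 fix x assume x: "x \<in> {0..l}"
 have "(g has_integral (U l - U (l - x))) {l - x..l}"
  using abscont_increment[OF U, of "l - x" l] abscont_int[OF U, of "l - x" l] x by (auto simp: has_integral_iff)
 hence "((\<lambda>y. g (l - y)) has_integral (U l - U (l - x))) {0..x}"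
  using has_integral_affinity[of g "U l - U (l - x)" "l - x" l "-1" l] x
  by (simp add: image_affinity_atLeastAtMost)
 hence "integral {0..x} (\<lambda>y. - g (l - y)) = - (U l - U (l - x))"
  by (auto simp: has_integral_iff)
 thus "U (l - x) = U (l - 0) + integral {0..x} (\<lambda>x. - g (l - x))" by simp
qed

lemma sqi_extend_zero:
 fixes u :: "real => real"
 assumes "sqi (Lb k) u" "0 \<le> k" "k \<le> l"
 shows "sqi (Lb l) (\<lambda>x. if x \<le> k then u x else 0)"
  "nm (Lb l) (\<lambda>x. if x \<le> k then u x else 0) = nm (Lb k) u"
proof -
 have i: "indicator {0..l} x*(if x \<le> k then f x else 0) = indicator {0..k} x*f x" for x and f :: "real => real"
  using assms by (auto simp: indicator_def)
 have sq: "(\<lambda>x. (if x \<le> k then u x else 0)^2) = (\<lambda>x. if x \<le> k then (u x)^2 else 0)" by auto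
 show "sqi (Lb l) (\<lambda>x. if x \<le> k then u x else 0)"
  using assms unfolding sqi_def sq
  by (simp add: borel_measurable_restrict_space_iff integrable_restrict_space i[of _ u] i[of _ "\<lambda>x. (u x)^2"])
 show "nm (Lb l) (\<lambda>x. if x \<le> k then u x else 0) = nm (Lb k) u"
  unfolding nm_def sq by (simp add: integral_restrict_space i[of _ "\<lambda>x. (u x)^2"])
qed

text \<open>Gluing with zero creates no jump because \<open>U k = 0\<close>.\<close>

lemma abscont_extend_zero:
 assumes U: "abscont k U g" "U k = 0" "0 \<le> k" "k \<le> l"
 shows "abscont l (\<lambda>x. if x \<le> k then U x else 0) (\<lambda>x. if x \<le> k then g x else 0)"
 unfolding abscont_def
proof (intro conjI ballI sqi_extend_zero abscont_sqi[OF U(1)] U(3,4))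
 let ?g = "\<lambda>x. if x \<le> k then g x else 0"
 fix x assume x: "x \<in> {0..l}"
 have low: "integral {0..y} ?g = integral {0..y} g" if "y \<le> k" for y
  using that by (intro Henstock_Kurzweil_Integration.integral_cong) auto
 show "(if x \<le> k then U x else 0) = (if 0 \<le> k then U 0 else 0) + integral {0..x} ?g"
 proof (cases "x \<le> k")
  case True
  thus ?thesis using abscontD[OF U(1), of x] x U(3) low[of x] by simp
 next
  case False
  have gi: "?g integrable_on {0..l}"
   using sqi_extend_zero[OF abscont_sqi[OF U(1)] U(3,4)] by (intro integral_HK(2) sqi_integrable_Leb)
  have "integral {0..k} ?g + integral {k..x} ?g = integral {0..x} ?g"
   using False U(3,4) x by (intro Henstock_Kurzweil_Integration.integral_combine integrable_on_subinterval[OF gi]) auto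
  moreover have "integral {k..x} ?g = integral {k..x} (\<lambda>x. 0)"
   by (rule integral_spike[of "{k}"]) auto
  ultimately have "integral {0..x} ?g = integral {0..k} g" using low[of k] by simp
  thus ?thesis using abscontD[OF U(1), of k] U(2,3) False by simp
 qed
qed

section \<open>Function spaces on the graph\<close>

abbreviation scl :: "real => 'e gfn => 'e gfn" where
 "scl c u \<equiv> (\<lambda>e x. c*u e x)"

abbreviation leb :: "('v, 'e) mgraph => 'e => real measure" where
 "leb G e \<equiv> lebesgue_on {0..len G e}"

lemma gfn_plus: "(u + v :: 'e gfn) = (\<lambda>e x. u e x + v e x)" by (simp add: fun_eq_iff)
lemma gfn_minus: "(u - v :: 'e gfn) = (\<lambda>e x. u e x - v e x)" by (simp add: fun_eq_iff)
lemma gfn_zero: "(0 :: 'e gfn) = (\<lambda>e x. 0)" by (simp add: fun_eq_iff)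

locale mgr =
 fixes G :: "('v, 'e) mgraph"
 assumes mg: "metric_graph G"
begin

abbreviation seg :: "'e => real set" where "seg e \<equiv> {0..len G e}"
abbreviation nL :: "'e gfn => real" where "nL \<equiv> L2_norm G"
abbreviation nH :: "'e gfn => real" where "nH \<equiv> HkE_norm G 1"
abbreviation nHH :: "'e gfn => real" where "nHH \<equiv> HkE_norm G 2"
abbreviation ip :: "'e gfn => 'e gfn => real" where "ip \<equiv> L2_inner G"
abbreviation DG :: "'e gfn => 'e gfn" where "DG \<equiv> D_graph G"
abbreviation H1E :: "'e gfn set" where "H1E \<equiv> HkE G 1"

lemma fin_edges: "finite (edges G)" and fin_verts: "finite (verts G)"
 and len_pos: "e \<in> edges G ==> 0 < len G e"
 and origin_vert: "e \<in> edges G ==> origin G e b \<in> verts G"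
 using mg by (auto simp: metric_graph_def origin_def)

section \<open>The space L2 of the graph\<close>

lemma L2_iff: "u \<in> L2 G \<longleftrightarrow> (\<forall>e\<in>edges G. sqi (leb G e) (u e))"
 by (simp add: HkE_def L2_int_iff)

lemma L2D: "u \<in> L2 G ==> e \<in> edges G ==> sqi (leb G e) (u e)"
 by (simp add: L2_iff)

lemma L2_add: "u \<in> L2 G ==> v \<in> L2 G ==> u + v \<in> L2 G"
 by (auto simp: L2_iff gfn_plus intro: sqi_add)
lemma L2_diff: "u \<in> L2 G ==> v \<in> L2 G ==> u - v \<in> L2 G"
 by (auto simp: L2_iff gfn_minus intro: sqi_diff)
lemma L2_scl: "u \<in> L2 G ==> scl c u \<in> L2 G"
 by (auto simp: L2_iff intro: sqi_scale)
lemma L2_zero: "0 \<in> L2 G"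
 by (auto simp: L2_iff gfn_zero)
lemma L2_lin_comb: "(\<And>i. i < n ==> \<psi> i \<in> L2 G) ==> lin_comb n c \<psi> \<in> L2 G"
 by (auto simp: L2_iff lin_comb_def intro!: sqi_sum sqi_scale)

lemma L2_norm_set: "nL u = L2_set (\<lambda>e. nm (leb G e) (u e)) (edges G)"
 by (simp add: HkE_norm_def L2_set_def nm_sq)

lemma L2_norm_nonneg[simp]: "0 \<le> nL u"
 by (simp add: L2_norm_set)

lemma L2_norm_sq: "(nL u)^2 = (\<Sum>e\<in>edges G. (nm (leb G e) (u e))^2)"
 by (simp add: L2_norm_set L2_set_def sum_nonneg)

lemma nm_le_L2_norm: "e \<in> edges G ==> nm (leb G e) (u e) \<le> nL u"
 unfolding L2_norm_set by (rule member_le_L2_set[OF fin_edges])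

lemma inner_self: "ip u u = (nL u)^2"
 unfolding L2_inner_def L2_norm_sq nm_sq by (simp add: power2_eq_square)

lemma inner_sym: "ip u v = ip v u"
 by (simp add: L2_inner_def mult.commute)

lemma inner_add_left: "u \<in> L2 G ==> v \<in> L2 G ==> w \<in> L2 G ==> ip (u + v) w = ip u w + ip v w"
 by (simp add: L2_inner_def gfn_plus distrib_right sum.distrib[symmetric] sqi_mult L2D)
lemma inner_diff_left: "u \<in> L2 G ==> v \<in> L2 G ==> w \<in> L2 G ==> ip (u - v) w = ip u w - ip v w"
 by (simp add: L2_inner_def gfn_minus left_diff_distrib sum_subtractf[symmetric] sqi_mult L2D)
lemma inner_scl_left: "ip (scl c u) w = c*ip u w"
 by (simp add: L2_inner_def mult.assoc sum_distrib_left)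
lemma inner_zero_left[simp]: "ip 0 w = 0"
 by (simp add: L2_inner_def gfn_zero)
lemma inner_diff_right: "u \<in> L2 G ==> v \<in> L2 G ==> w \<in> L2 G ==> ip w (u - v) = ip w u - ip w v"
 using inner_diff_left by (simp add: inner_sym[of w])

lemma lin_comb_Suc: "lin_comb (Suc n) c \<psi> = lin_comb n c \<psi> + scl (c n) (\<psi> n)"
 by (auto simp: lin_comb_def gfn_plus fun_eq_iff)
lemma lin_comb_0: "lin_comb 0 c \<psi> = 0"
 by (auto simp: lin_comb_def gfn_zero)

lemma inner_lin_comb_left:
 assumes "w \<in> L2 G" "\<And>i. \<psi> i \<in> L2 G"
 shows "ip (lin_comb n c \<psi>) w = (\<Sum>i<n. c i*ip (\<psi> i) w)"
proof (induction n)
 case 0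
 show ?case unfolding lin_comb_0 inner_zero_left by simp
next
 case (Suc n)
 have "ip (lin_comb (Suc n) c \<psi>) w = ip (lin_comb n c \<psi>) w + ip (scl (c n) (\<psi> n)) w"
  unfolding lin_comb_Suc using assms by (intro inner_add_left L2_lin_comb L2_scl)
 thus ?case using Suc inner_scl_left[of "c n" "\<psi> n" w] by simp
qed

lemma inner_CS:
 assumes "u \<in> L2 G" "v \<in> L2 G"
 shows "\<bar>ip u v\<bar> \<le> nL u*nL v"
proof -
 have "\<bar>ip u v\<bar> \<le> (\<Sum>e\<in>edges G. \<bar>integral\<^sup>L (leb G e) (\<lambda>x. u e x * v e x)\<bar>)"
  unfolding L2_inner_def by (rule sum_abs)
 also have "... \<le> (\<Sum>e\<in>edges G. \<bar>nm (leb G e) (u e)\<bar>*\<bar>nm (leb G e) (v e)\<bar>)"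
  using assms by (intro sum_mono) (simp add: sqi_CS L2D)
 also have "... \<le> nL u*nL v"
  unfolding L2_norm_set by (rule L2_set_mult_ineq)
 finally show ?thesis .
qed

lemma L2_norm_add:
 assumes "u \<in> L2 G" "v \<in> L2 G"
 shows "nL (u + v) \<le> nL u + nL v"
proof -
 have "nL (u + v) \<le> L2_set (\<lambda>e. nm (leb G e) (u e) + nm (leb G e) (v e)) (edges G)"
  unfolding L2_norm_set using assms by (intro L2_set_mono) (auto simp: gfn_plus L2D intro!: nm_add)
 also have "... \<le> nL u + nL v" unfolding L2_norm_set by (rule L2_set_triangle_ineq)
 finally show ?thesis .
qed

lemma L2_norm_scl: "nL (scl c u) = \<bar>c\<bar>*nL u"
 by (simp add: L2_norm_set nm_scale L2_set_right_distrib)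

lemma L2_norm_minus_commute: "nL (u - v) = nL (v - u)"
 by (simp add: L2_norm_set nm_def gfn_minus power2_commute)

lemma L2_norm_diff:
 assumes "u \<in> L2 G" "v \<in> L2 G"
 shows "nL (u - v) \<le> nL u + nL v"
proof -
 have "u - v = u + scl (-1) v" by (auto simp: gfn_plus gfn_minus)
 hence "nL (u - v) \<le> nL u + nL (scl (-1) v)"
  using L2_norm_add[OF assms(1) L2_scl[OF assms(2)]] by metis
 also have "nL (scl (-1) v) = nL v" using L2_norm_scl[of "-1" v] by simp
 finally show ?thesis .
qed

lemma L2_norm_zero[simp]: "nL 0 = 0"
 by (simp add: L2_norm_set gfn_zero L2_set_def)

lemma aeq_refl[simp]: "aeq G u u" by (simp add: aeq_def)
lemma aeq_sym: "aeq G u v ==> aeq G v u" by (auto simp: aeq_def elim: eventually_mono)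
lemma aeq_trans: "aeq G u v ==> aeq G v w ==> aeq G u w"
 unfolding aeq_def by (fastforce elim: eventually_elim2)
lemma aeq_add: "aeq G u u' ==> aeq G v v' ==> aeq G (u + v) (u' + v')"
 unfolding aeq_def gfn_plus by (fastforce elim: eventually_elim2)
lemma aeq_diff: "aeq G u u' ==> aeq G v v' ==> aeq G (u - v) (u' - v')"
 unfolding aeq_def gfn_minus by (fastforce elim: eventually_elim2)
lemma aeq_scl: "aeq G u u' ==> aeq G (scl c u) (scl c u')"
 unfolding aeq_def by (auto elim: eventually_mono)

lemma aeqD: "aeq G u v ==> e \<in> edges G ==> AE x in leb G e. u e x = v e x"
 by (simp add: aeq_def)

lemma L2_norm_aeq:
 assumes "aeq G u v" "u \<in> L2 G" "v \<in> L2 G" shows "nL u = nL v"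
 unfolding L2_norm_set using nm_eq_AE[OF aeqD[OF assms(1)] L2D[OF assms(2)] L2D[OF assms(3)]]
 by (intro L2_set_cong) auto

lemma L2_norm_zero_aeq: "u \<in> L2 G ==> nL u = 0 ==> aeq G u 0"
 unfolding aeq_def gfn_zero
 using nm_zero_AE[OF L2D] nm_le_L2_norm[of _ u] by (metis nm_nonneg order_antisym)

lemma inner_aeq:
 assumes "aeq G u v" "u \<in> L2 G" "v \<in> L2 G" "w \<in> L2 G" shows "ip u w = ip v w"
proof -
 have 1: "aeq G (u - v) 0" using aeq_diff[OF assms(1) aeq_refl[of v]] by simp
 have "nL (u - v) = 0" using L2_norm_aeq[OF 1 L2_diff L2_zero] assms by simp
 hence "ip (u - v) w = 0" using inner_CS[of "u - v" w] L2_diff assms by simp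
 thus ?thesis using inner_diff_left assms by simp
qed

lemma L2_complete:
 fixes S :: "nat => 'e gfn"
 assumes S: "\<And>n. S n \<in> L2 G"
  and C: "\<And>e. e > 0 ==> \<exists>N. \<forall>m\<ge>N. \<forall>n\<ge>N. nL (S m - S n) < e"
 obtains u where "u \<in> L2 G" "(\<lambda>n. nL (S n - u)) \<longlonglongrightarrow> 0"
proof -
 have "\<exists>v. sqi (leb G e) v \<and> (\<lambda>n. nm (leb G e) (\<lambda>x. S n e x - v x)) \<longlonglongrightarrow> 0" if e: "e \<in> edges G" for e
 proof -
  have "\<exists>N. \<forall>m\<ge>N. \<forall>n\<ge>N. nm (leb G e) (\<lambda>x. S m e x - S n e x) < r" if r: "r > 0" for r
  proof -
   obtain N where N: "\<forall>m\<ge>N. \<forall>n\<ge>N. nL (S m - S n) < r" using C[OF r] by blast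
   have "nm (leb G e) (\<lambda>x. S m e x - S n e x) < r" if "m \<ge> N" "n \<ge> N" for m n
    using nm_le_L2_norm[OF e, of "S m - S n"] N that by (auto simp: gfn_minus intro: le_less_trans)
   thus ?thesis by blast
  qed
  from Riesz_Fischer[of "leb G e" "\<lambda>n. S n e", OF finite_Leb L2D[OF S e] this] show ?thesis by blast
 qed
 hence "\<forall>e\<in>edges G. \<exists>v. sqi (leb G e) v \<and> (\<lambda>n. nm (leb G e) (\<lambda>x. S n e x - v x)) \<longlonglongrightarrow> 0" by blast
 from bchoice[OF this] obtain u where u: "\<And>e. e \<in> edges G ==> sqi (leb G e) (u e)"
  "\<And>e. e \<in> edges G ==> (\<lambda>n. nm (leb G e) (\<lambda>x. S n e x - u e x)) \<longlonglongrightarrow> 0"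
  by blast
 have "(\<lambda>n. sqrt (\<Sum>e\<in>edges G. (nm (leb G e) (\<lambda>x. S n e x - u e x))^2)) \<longlonglongrightarrow> sqrt (\<Sum>e\<in>edges G. 0^2)"
  by (intro tendsto_intros u(2))
 hence "(\<lambda>n. nL (S n - u)) \<longlonglongrightarrow> 0"
  by (simp add: L2_norm_set L2_set_def gfn_minus)
 moreover have "u \<in> L2 G" using u(1) by (simp add: L2_iff)
 ultimately show ?thesis using that by blast
qed

section \<open>Continuous representatives of functions that are H^1 on each edge\<close>

definition H1rep :: "'e gfn => 'e gfn => bool" where
 "H1rep u U \<longleftrightarrow> (\<forall>e\<in>edges G. abscont (len G e) (U e) (DG u e)) \<and> aeq G u U"

text \<open>The continuous representative, unique at the points of the edges. \<open>H1rep\<close>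
  pairs it with \<open>DG u\<close> itself rather than with some version of the derivative, so that
  the calculus of \<open>abscont\<close> applies to the derivative that enters the norms.\<close>

definition rp :: "'e gfn => 'e gfn" where "rp u = (SOME U. H1rep u U)"

lemma HkE_1_iff: "u \<in> H1E \<longleftrightarrow> u \<in> L2 G \<and> (\<exists>U. H1rep u U)"
proof
 assume u: "u \<in> H1E"
 hence "\<forall>e\<in>edges G. \<exists>U. abscont (len G e) U (DG u e) \<and> (AE x in leb G e. u e x = U x)"
  using Hk_int_1_iff[OF len_pos] unfolding HkE_def D_graph_def by blast
 then obtain U where "\<forall>e\<in>edges G. abscont (len G e) (U e) (DG u e) \<and> (AE x in leb G e. u e x = U e x)"
  by metis
 moreover have "u \<in> L2 G" unfolding L2_iff
 proof
  fix e assume e: "e \<in> edges G"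
  hence "u e \<in> Hk_int (len G e) 1" using u by (simp add: HkE_def del: One_nat_def)
  thus "sqi (leb G e) (u e)" using Hk_int_1_iff[OF len_pos[OF e]] by blast
 qed
 ultimately show "u \<in> L2 G \<and> (\<exists>U. H1rep u U)" unfolding H1rep_def aeq_def by blast
next
 assume "u \<in> L2 G \<and> (\<exists>U. H1rep u U)"
 then obtain U where u: "u \<in> L2 G" and U: "H1rep u U" by blast
 have "u e \<in> Hk_int (len G e) 1" if e: "e \<in> edges G" for e
  using Hk_int_1_iff[OF len_pos[OF e]] L2D[OF u e] U e unfolding H1rep_def aeq_def D_graph_def by blast
 thus "u \<in> H1E" by (simp add: HkE_def del: One_nat_def)
qed

lemma H1_L2: "u \<in> H1E ==> u \<in> L2 G" by (simp add: HkE_1_iff del: One_nat_def)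

lemma rp_H1rep: "u \<in> H1E ==> H1rep u (rp u)"
 unfolding HkE_1_iff rp_def by (metis someI_ex)

lemma rp_abscont: "u \<in> H1E ==> e \<in> edges G ==> abscont (len G e) (rp u e) (DG u e)"
 and rp_aeq: "u \<in> H1E ==> aeq G u (rp u)"
 using rp_H1rep unfolding H1rep_def by blast+

text \<open>Any concrete pair of a primitive and its density determines both \<open>DG u\<close> and
  \<open>rp u\<close>. The closure properties of the edgewise space reduce to this and to the
  calculus of \<open>abscont\<close>.\<close>

lemma H1I:
 assumes u: "u \<in> L2 G" and U: "\<And>e. e \<in> edges G ==> abscont (len G e) (U e) (g e)" and ae: "aeq G u U"
 shows "u \<in> H1E" "aeq G (DG u) g" "\<And>e x. e \<in> edges G ==> x \<in> seg e ==> rp u e x = U e x"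
proof -
 note w = wD_abscont[OF U len_pos L2D[OF u] aeqD[OF ae]]
 have "H1rep u U" unfolding H1rep_def D_graph_def using w(3) ae by blast
 thus 1: "u \<in> H1E" using u HkE_1_iff by blast
 show "aeq G (DG u) g" unfolding aeq_def D_graph_def using w(2) by blast
 fix e x assume e: "e \<in> edges G" and x: "x \<in> seg e"
 have "AE x in leb G e. rp u e x = U e x"
  using aeqD[OF rp_aeq[OF 1] e] aeqD[OF ae e] by eventually_elim simp
 thus "rp u e x = U e x"
  using abscont_AE_eq(1)[OF rp_abscont[OF 1 e] U[OF e] len_pos[OF e] _ x] by blast
qed

lemma D_L2: "u \<in> H1E ==> DG u \<in> L2 G"
 using abscont_sqi[OF rp_abscont] by (simp add: L2_iff)

lemma H1_aeq:
 assumes "u \<in> H1E" "v \<in> L2 G" "aeq G v u"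
 shows "v \<in> H1E" "aeq G (DG v) (DG u)"
  "\<And>e x. e \<in> edges G ==> x \<in> seg e ==> rp v e x = rp u e x"
 using H1I[OF assms(2) rp_abscont[OF assms(1)] aeq_trans[OF assms(3) rp_aeq[OF assms(1)]]] by blast+

lemma H1_add:
 assumes "u \<in> H1E" "v \<in> H1E"
 shows "u + v \<in> H1E" "aeq G (DG (u + v)) (DG u + DG v)"
  "\<And>e x. e \<in> edges G ==> x \<in> seg e ==> rp (u + v) e x = rp u e x + rp v e x"
proof -
 have a: "abscont (len G e) ((rp u + rp v) e) ((DG u + DG v) e)" if "e \<in> edges G" for e
  using abscont_add[OF rp_abscont[OF assms(1) that] rp_abscont[OF assms(2) that]] by (simp add: gfn_plus)
 note H = H1I[OF L2_add[OF H1_L2[OF assms(1)] H1_L2[OF assms(2)]] a aeq_add[OF rp_aeq[OF assms(1)] rp_aeq[OF assms(2)]]]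
 show "u + v \<in> H1E" "aeq G (DG (u + v)) (DG u + DG v)" using H by blast+
 show "\<And>e x. e \<in> edges G ==> x \<in> seg e ==> rp (u + v) e x = rp u e x + rp v e x"
  using H(3) by (simp add: gfn_plus)
qed

lemma H1_scl:
 assumes "u \<in> H1E"
 shows "scl c u \<in> H1E" "aeq G (DG (scl c u)) (scl c (DG u))"
  "\<And>e x. e \<in> edges G ==> x \<in> seg e ==> rp (scl c u) e x = c*rp u e x"
proof -
 have a: "abscont (len G e) (scl c (rp u) e) (scl c (DG u) e)" if "e \<in> edges G" for e
  using abscont_scale[OF rp_abscont[OF assms that]] by simp
 note H = H1I[OF L2_scl[OF H1_L2[OF assms]] a aeq_scl[OF rp_aeq[OF assms]]]
 show "scl c u \<in> H1E" "aeq G (DG (scl c u)) (scl c (DG u))" using H by blast+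
 show "\<And>e x. e \<in> edges G ==> x \<in> seg e ==> rp (scl c u) e x = c*rp u e x"
  using H(3) by simp
qed

lemma H1_diff:
 assumes "u \<in> H1E" "v \<in> H1E"
 shows "u - v \<in> H1E" "aeq G (DG (u - v)) (DG u - DG v)"
  "\<And>e x. e \<in> edges G ==> x \<in> seg e ==> rp (u - v) e x = rp u e x - rp v e x"
proof -
 have eq: "u - v = u + scl (-1) v" "DG u - DG v = DG u + scl (-1) (DG v)"
  by (auto simp: gfn_plus gfn_minus)
 note s = H1_scl[OF assms(2), where c = "-1"]
 note A = H1_add[OF assms(1) s(1)]
 show "u - v \<in> H1E" unfolding eq(1) by (rule A(1))
 show "aeq G (DG (u - v)) (DG u - DG v)"
  unfolding eq using aeq_trans[OF A(2) aeq_add[OF aeq_refl s(2)]] .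
 fix e x assume ex: "e \<in> edges G" "x \<in> seg e"
 have "rp (u - v) e x = rp u e x + rp (scl (-1) v) e x" unfolding eq(1) by (rule A(3)[OF ex])
 thus "rp (u - v) e x = rp u e x - rp v e x" using s(3)[OF ex] by simp
qed

lemma H1_zero: "0 \<in> H1E" "aeq G (DG 0) 0" "\<And>e x. e \<in> edges G ==> x \<in> seg e ==> rp 0 e x = 0"
 using H1I[of 0 0 0] by (auto simp: gfn_zero L2_iff abscont_const)

lemma H1_lin_comb:
 assumes "\<And>i. \<psi> i \<in> H1E"
 shows "lin_comb n c \<psi> \<in> H1E" "aeq G (DG (lin_comb n c \<psi>)) (lin_comb n c (\<lambda>i. DG (\<psi> i)))"
  "\<And>e x. e \<in> edges G ==> x \<in> seg e ==> rp (lin_comb n c \<psi>) e x = (\<Sum>i<n. c i*rp (\<psi> i) e x)"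
proof (induction n)
 case 0
 show "lin_comb 0 c \<psi> \<in> H1E" "aeq G (DG (lin_comb 0 c \<psi>)) (lin_comb 0 c (\<lambda>i. DG (\<psi> i)))"
  "\<And>e x. e \<in> edges G ==> x \<in> seg e ==> rp (lin_comb 0 c \<psi>) e x = (\<Sum>i<0. c i*rp (\<psi> i) e x)"
  using H1_zero by (simp_all add: lin_comb_0)
next
 case (Suc n)
 note s = H1_scl[OF assms[of n], where c = "c n"]
 note A = H1_add[OF Suc.IH(1) s(1)]
 show "lin_comb (Suc n) c \<psi> \<in> H1E" using A(1) by (simp add: lin_comb_Suc)
 show "aeq G (DG (lin_comb (Suc n) c \<psi>)) (lin_comb (Suc n) c (\<lambda>i. DG (\<psi> i)))"
  unfolding lin_comb_Suc by (rule aeq_trans[OF A(2) aeq_add[OF Suc.IH(2) s(2)]])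
 show "\<And>e x. e \<in> edges G ==> x \<in> seg e ==> rp (lin_comb (Suc n) c \<psi>) e x = (\<Sum>i<Suc n. c i*rp (\<psi> i) e x)"
  using A(3) Suc.IH(3) s(3) by (simp add: lin_comb_Suc)
qed

lemma H1_norm_sq: "(nH u)^2 = (nL u)^2 + (nL (DG u))^2"
proof -
 have "(nH u)^2 = (\<Sum>e\<in>edges G. Hk_int_nsq (len G e) 1 (u e))"
  unfolding HkE_norm_def by (intro real_sqrt_pow2 sum_nonneg) simp
 also have "... = (nL u)^2 + (nL (DG u))^2"
  by (simp add: L2_norm_sq nm_sq sum.distrib D_graph_def)
 finally show ?thesis .
qed

lemma H2_norm_sq: "(nHH u)^2 = (nL u)^2 + (nL (DG u))^2 + (nL (DG (DG u)))^2"
proof -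
 have "(nHH u)^2 = (HkE_norm G (Suc (Suc 0)) u)^2" by (simp only: numeral_2_eq_2)
 also have "... = (\<Sum>e\<in>edges G. Hk_int_nsq (len G e) (Suc (Suc 0)) (u e))"
  unfolding HkE_norm_def by (intro real_sqrt_pow2 sum_nonneg) simp
 also have "... = (nL u)^2 + (nL (DG u))^2 + (nL (DG (DG u)))^2"
  by (simp add: L2_norm_sq nm_sq sum.distrib D_graph_def)
 finally show ?thesis .
qed

lemma H1_norm_nonneg[simp]: "0 \<le> nH u"
 unfolding HkE_norm_def by (intro real_sqrt_ge_zero sum_nonneg) simp
lemma H2_norm_nonneg[simp]: "0 \<le> nHH u"
 unfolding HkE_norm_def by (intro real_sqrt_ge_zero sum_nonneg) (simp add: numeral_2_eq_2)

lemma L2_le_H1: "nL u \<le> nH u" "nL (DG u) \<le> nH u"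
 by (rule power2_le_imp_le; simp add: H1_norm_sq del: One_nat_def)+

lemma H1_norm_le: "nH u \<le> nL u + nL (DG u)"
 by (rule power2_le_imp_le) (simp_all add: H1_norm_sq power2_sum del: One_nat_def)

lemma H1_norm_add:
 assumes "u \<in> H1E" "v \<in> H1E" shows "nH (u + v) \<le> nH u + nH v"
proof -
 have D: "nL (DG (u + v)) \<le> nL (DG u) + nL (DG v)"
  using L2_norm_aeq[OF H1_add(2)[OF assms]] L2_norm_add D_L2 H1_add(1) L2_add assms by metis
 have N: "nH w = sqrt ((nL w)^2 + (nL (DG w))^2)" for w
  using H1_norm_sq[of w] by (simp add: real_sqrt_unique del: One_nat_def)
 have "nH (u + v) \<le> sqrt ((nL u + nL v)^2 + (nL (DG u) + nL (DG v))^2)"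
  unfolding N using L2_norm_add[OF H1_L2[OF assms(1)] H1_L2[OF assms(2)]] D
  by (intro real_sqrt_le_mono add_mono power_mono) auto
 also have "... \<le> nH u + nH v" unfolding N by (rule real_sqrt_sum_squares_triangle_ineq)
 finally show ?thesis .
qed

lemma H1_norm_scl: "u \<in> H1E ==> nH (scl c u) = \<bar>c\<bar>*nH u"
proof -
 assume u: "u \<in> H1E"
 have "(nH (scl c u))^2 = (\<bar>c\<bar>*nH u)^2"
  using L2_norm_aeq[OF H1_scl(2)[OF u] D_L2[OF H1_scl(1)[OF u]] L2_scl[OF D_L2[OF u]], of c]
  by (simp add: H1_norm_sq L2_norm_scl power_mult_distrib distrib_left del: One_nat_def)
 thus ?thesis by (metis H1_norm_nonneg abs_ge_zero mult_nonneg_nonneg power2_eq_iff_nonneg)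
qed

lemma HkE_2_iff: "u \<in> HkE G 2 \<longleftrightarrow> u \<in> H1E \<and> DG u \<in> H1E"
 by (auto simp: HkE_def D_graph_def numeral_2_eq_2)

text \<open>Dominates both coefficients in \<open>abscont_trace\<close>: the factor
  \<open>1/l\<close> of the mean and the factor 2 of the product.\<close>

definition Ctr :: real where "Ctr = (\<Sum>e\<in>edges G. 1/len G e) + 2"

lemma Ctr_pos: "Ctr > 0" "1/len G e \<le> Ctr" "2 \<le> Ctr" if "e \<in> edges G"
proof -
 have nn: "\<And>e. e \<in> edges G ==> 0 \<le> 1/len G e" using len_pos by (auto intro: less_imp_le)
 show "2 \<le> Ctr" unfolding Ctr_def using sum_nonneg[of "edges G" "\<lambda>e. 1/len G e"] nn by simp
 thus "Ctr > 0" by simp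
 show "1/len G e \<le> Ctr" unfolding Ctr_def
  using member_le_sum[OF that, of "\<lambda>e. 1/len G e"] nn fin_edges by simp
qed

lemma trace_bound:
 assumes u: "u \<in> H1E" and e: "e \<in> edges G" and x: "x \<in> seg e"
 shows "(rp u e x)^2 \<le> Ctr*(nL u*nH u)*2"
proof -
 let ?n = "nm (leb G e) (rp u e)" and ?d = "nm (leb G e) (DG u e)"
 have n: "?n = nm (leb G e) (u e)"
  using nm_eq_AE[OF aeqD[OF rp_aeq[OF u] e] L2D[OF H1_L2[OF u] e] abscont_sqi_fun[OF rp_abscont[OF u e]]] by simp
 have le: "?n \<le> nL u" "?d \<le> nH u" "?n \<le> nH u"
  using nm_le_L2_norm[OF e, of u] nm_le_L2_norm[OF e, of "DG u"] L2_le_H1[of u] n by auto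
 have "(rp u e x)^2 \<le> ?n^2/len G e + 2*?n*?d"
  by (rule abscont_trace[OF rp_abscont[OF u e] len_pos[OF e] x])
 also have "... = (1/len G e)*(?n*?n) + 2*(?n*?d)" by (simp add: power2_eq_square)
 also have "... \<le> Ctr*(nL u*nH u) + Ctr*(nL u*nH u)"
  using Ctr_pos[OF e] le by (intro add_mono mult_mono) auto
 finally show ?thesis by simp
qed

text \<open>The identity that defines the weak derivative passes to the limit against each fixed
  test function. Convergence of the point values follows from \<open>trace_bound\<close> applied to
  the differences.\<close>

lemma H1_closed:
 fixes S :: "nat => 'e gfn"
 assumes S: "\<And>n. S n \<in> H1E" and u: "u \<in> L2 G" and g: "g \<in> L2 G"
  and cu: "(\<lambda>n. nL (S n - u)) \<longlonglongrightarrow> 0" and cg: "(\<lambda>n. nL (DG (S n) - g)) \<longlonglongrightarrow> 0"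
 shows "u \<in> H1E" "aeq G (DG u) g"
  "\<And>e x. e \<in> edges G ==> x \<in> seg e ==> (\<lambda>n. rp (S n) e x) \<longlonglongrightarrow> rp u e x"
proof -
 have lim: "(\<lambda>n. integral\<^sup>L (leb G e) (\<lambda>x. T n e x*\<phi> x)) \<longlonglongrightarrow> integral\<^sup>L (leb G e) (\<lambda>x. v e x*\<phi> x)"
  if e: "e \<in> edges G" and T: "\<And>n. T n \<in> L2 G" and v: "v \<in> L2 G" and c: "(\<lambda>n. nL (T n - v)) \<longlonglongrightarrow> 0"
   and p: "sqi (leb G e) \<phi>" for T v e \<phi>
 proof -
  have b: "norm (integral\<^sup>L (leb G e) (\<lambda>x. T n e x*\<phi> x) - integral\<^sup>L (leb G e) (\<lambda>x. v e x*\<phi> x)) \<le> nL (T n - v)*nm (leb G e) \<phi>" for n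
  proof -
   have "integral\<^sup>L (leb G e) (\<lambda>x. T n e x*\<phi> x) - integral\<^sup>L (leb G e) (\<lambda>x. v e x*\<phi> x) = integral\<^sup>L (leb G e) (\<lambda>x. (T n - v) e x*\<phi> x)"
    using sqi_mult[OF L2D[OF T e] p] sqi_mult[OF L2D[OF v e] p] by (simp add: gfn_minus left_diff_distrib)
   also have "norm ... \<le> nm (leb G e) ((T n - v) e)*nm (leb G e) \<phi>"
    using sqi_CS[OF L2D[OF L2_diff[OF T v] e] p] by simp
   also have "... \<le> nL (T n - v)*nm (leb G e) \<phi>"
    using nm_le_L2_norm[OF e, of "T n - v"] by (intro mult_right_mono) auto
   finally show ?thesis .
  qed
  have z: "(\<lambda>n. nL (T n - v)*nm (leb G e) \<phi>) \<longlonglongrightarrow> 0"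
   using tendsto_mult_right[OF c, of "nm (leb G e) \<phi>"] by simp
  show ?thesis
   by (rule LIM_zero_cancel, rule Lim_null_comparison[OF always_eventually[OF allI[OF b]] z])
 qed
 have w: "weak_deriv (len G e) (u e) (g e)" if e: "e \<in> edges G" for e
  unfolding weak_deriv_def
 proof (intro conjI allI impI)
  show "g e \<in> L2_int (len G e)" using L2D[OF g e] by (simp add: L2_int_iff)
  fix \<phi> assume t: "test_fun (len G e) \<phi>"
  note sp = abscont_sqi_fun[OF abscont_test[OF t]] abscont_sqi[OF abscont_test[OF t]]
  have "integral\<^sup>L (leb G e) (\<lambda>x. S n e x*deriv \<phi> x) = - integral\<^sup>L (leb G e) (\<lambda>x. DG (S n) e x*\<phi> x)" for n
   using wD_abscont(1)[OF rp_abscont[OF S e] len_pos[OF e] L2D[OF H1_L2[OF S] e] aeqD[OF rp_aeq[OF S] e], of n] t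
   unfolding weak_deriv_def D_graph_def by blast
  hence "(\<lambda>n. - integral\<^sup>L (leb G e) (\<lambda>x. DG (S n) e x*\<phi> x)) \<longlonglongrightarrow> integral\<^sup>L (leb G e) (\<lambda>x. u e x*deriv \<phi> x)"
   using lim[OF e H1_L2[OF S] u cu sp(2)] by simp
  moreover have "(\<lambda>n. - integral\<^sup>L (leb G e) (\<lambda>x. DG (S n) e x*\<phi> x)) \<longlonglongrightarrow> - integral\<^sup>L (leb G e) (\<lambda>x. g e x*\<phi> x)"
   by (intro tendsto_minus lim[OF e D_L2[OF S] g cg sp(1)])
  ultimately show "integral\<^sup>L (leb G e) (\<lambda>x. u e x*deriv \<phi> x) = - integral\<^sup>L (leb G e) (\<lambda>x. g e x*\<phi> x)"
   using LIMSEQ_unique by blast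
 qed
 have "\<exists>U. abscont (len G e) U (g e) \<and> (AE x in leb G e. u e x = U x)" if "e \<in> edges G" for e
  using weak_deriv_imp_abscont[OF len_pos[OF that] L2D[OF u that] w[OF that]] by blast
 then obtain U where U: "\<And>e. e \<in> edges G ==> abscont (len G e) (U e) (g e)" "aeq G u U"
  unfolding aeq_def by metis
 show 1: "u \<in> H1E" and 2: "aeq G (DG u) g" using H1I[OF u U] by blast+
 fix e x assume e: "e \<in> edges G" and x: "x \<in> seg e"
 have d: "nL (DG (S n - u)) = nL (DG (S n) - g)" for n
  by (rule L2_norm_aeq[OF aeq_trans[OF H1_diff(2)[OF S 1] aeq_diff[OF aeq_refl 2]]])
   (auto intro: D_L2 H1_diff S 1 L2_diff g simp del: One_nat_def)
 have b: "(rp (S n) e x - rp u e x)^2 \<le> Ctr*(nL (S n - u)*(nL (S n - u) + nL (DG (S n) - g)))*2" for n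
 proof -
  have "(rp (S n) e x - rp u e x)^2 \<le> Ctr*(nL (S n - u)*nH (S n - u))*2"
   using trace_bound[OF H1_diff(1)[OF S 1] e x, of n] H1_diff(3)[OF S 1 e x, of n] by simp
  also have "... \<le> Ctr*(nL (S n - u)*(nL (S n - u) + nL (DG (S n) - g)))*2"
   using H1_norm_le[of "S n - u"] d[of n] Ctr_pos(1)[OF e] by (intro mult_right_mono mult_left_mono) auto
  finally show ?thesis .
 qed
 have "(\<lambda>n. Ctr*(nL (S n - u)*(nL (S n - u) + nL (DG (S n) - g)))*2) \<longlonglongrightarrow> Ctr*(0*(0 + 0))*2"
  by (intro tendsto_intros cu cg)
 hence z: "(\<lambda>n. Ctr*(nL (S n - u)*(nL (S n - u) + nL (DG (S n) - g)))*2) \<longlonglongrightarrow> 0" by simp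
 have b': "norm ((rp (S n) e x - rp u e x)^2) \<le> Ctr*(nL (S n - u)*(nL (S n - u) + nL (DG (S n) - g)))*2" for n
  using b[of n] by simp
 have "(\<lambda>n. (rp (S n) e x - rp u e x)^2) \<longlonglongrightarrow> 0"
  by (rule Lim_null_comparison[OF always_eventually[OF allI[OF b']] z])
 hence "(\<lambda>n. sqrt ((rp (S n) e x - rp u e x)^2)) \<longlonglongrightarrow> sqrt 0" by (rule tendsto_real_sqrt)
 thus "(\<lambda>n. rp (S n) e x) \<longlonglongrightarrow> rp u e x" by (simp add: Lim_null[of _ "rp u e x"] tendsto_rabs_zero_iff)
qed

section \<open>Vertex values\<close>

definition tr :: "'e gfn => 'e => bool => real" where
 "tr u e b = rp u e (param G e b 0)"

text \<open>The slope of \<open>param G e b\<close>: \<open>sgb b\<close> times the derivative along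
  \<open>e\<close> is the derivative pointing from the end \<open>(e, b)\<close> into the
  edge.\<close>

definition sgb :: "bool => real" where "sgb b = (if b then 1 else -1)"

definition ends :: "'v => ('e \<times> bool) set" where
 "ends p = {(e, b). e \<in> edges G \<and> origin G e b = p}"

definition Cont1 :: "'e gfn set" where
 "Cont1 = {u \<in> H1E. \<exists>c. \<forall>e\<in>edges G. \<forall>b. tr u e b = c (origin G e b)}"

definition Dir1 :: "'v set => 'e gfn set" where
 "Dir1 VD = {u \<in> Cont1. \<forall>e\<in>edges G. \<forall>b. origin G e b \<in> VD \<longrightarrow> tr u e b = 0}"

text \<open>Meant for \<open>w = DG u\<close>: the signs turn derivatives along the edges into
  derivatives leaving the vertex, and the condition becomes Kirchhoff's for
  \<open>u\<close>.\<close>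

definition Flux1 :: "'v set => 'e gfn set" where
 "Flux1 VK = {w \<in> H1E. \<forall>p\<in>VK. (\<Sum>(e, b)\<in>ends p. sgb b*tr w e b) = 0}"

lemma param_end: "e \<in> edges G ==> param G e b 0 \<in> seg e"
 using len_pos[of e] by (auto simp: param_def)

lemma fin_ends: "finite (ends p)"
 by (rule finite_subset[of _ "edges G \<times> UNIV"]) (auto simp: ends_def fin_edges)

lemma tr_add: "u \<in> H1E ==> v \<in> H1E ==> e \<in> edges G ==> tr (u + v) e b = tr u e b + tr v e b"
 unfolding tr_def by (rule H1_add(3)[OF _ _ _ param_end])
lemma tr_scl: "u \<in> H1E ==> e \<in> edges G ==> tr (scl c u) e b = c*tr u e b"
 unfolding tr_def by (rule H1_scl(3)[OF _ _ param_end])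
lemma tr_zero: "e \<in> edges G ==> tr 0 e b = 0"
 unfolding tr_def by (rule H1_zero(3)[OF _ param_end])
lemma tr_aeq: "u \<in> H1E ==> v \<in> L2 G ==> aeq G v u ==> e \<in> edges G ==> tr v e b = tr u e b"
 unfolding tr_def by (rule H1_aeq(3)[OF _ _ _ _ param_end])

lemma continuous_rep_eq:
 assumes u: "u \<in> H1E" and e: "e \<in> edges G" and v: "continuous_on (seg e) v"
  and ae: "AE x in leb G e. u e x = v x" and x: "x \<in> seg e"
 shows "v x = rp u e x"
proof -
 have "v x - rp u e x = 0"
 proof (rule continuous_AE_zero[OF _ _ len_pos[OF e] x])
  show "continuous_on (seg e) (\<lambda>x. v x - rp u e x)"
   by (intro continuous_intros v abscont_continuous[OF rp_abscont[OF u e]])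
  show "AE x in leb G e. v x - rp u e x = 0"
   using ae aeqD[OF rp_aeq[OF u] e] by eventually_elim simp
 qed
 thus ?thesis by simp
qed

lemma HkG_1_eq: "HkG G 1 = Cont1"
proof (intro set_eqI iffI)
 fix u assume "u \<in> HkG G 1"
 then obtain v c where u: "u \<in> H1E" and ae: "aeq G u v" and v: "\<forall>e\<in>edges G. continuous_on (seg e) (v e)"
  and c: "\<forall>e\<in>edges G. v e 0 = c (tail G e) \<and> v e (len G e) = c (head G e)"
  by (auto simp: HkG_def has_rep_def cont_graph_def)
 have "tr u e b = c (origin G e b)" if e: "e \<in> edges G" for e b
  using continuous_rep_eq[OF u e bspec[OF v e] aeqD[OF ae e] param_end[OF e, of b]] c e
  by (cases b) (auto simp: tr_def param_def origin_def)
 thus "u \<in> Cont1" using u by (auto simp: Cont1_def)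
next
 fix u assume "u \<in> Cont1"
 then obtain c where u: "u \<in> H1E" and c: "\<forall>e\<in>edges G. \<forall>b. tr u e b = c (origin G e b)" by (auto simp: Cont1_def)
 have "rp u e 0 = c (tail G e) \<and> rp u e (len G e) = c (head G e)" if "e \<in> edges G" for e
  using c[rule_format, OF that, of True] c[rule_format, OF that, of False] by (auto simp: tr_def param_def origin_def)
 hence "cont_graph G (rp u)"
  unfolding cont_graph_def using abscont_continuous[OF rp_abscont[OF u]] by blast
 thus "u \<in> HkG G 1" using u rp_aeq[OF u] by (auto simp: HkG_def has_rep_def)
qed

lemma Hs_int_1: "0 < l ==> Hs_int l 1 = Hk_int l 1"
 by (auto simp: Hs_int_def)

lemma incident_edges: "e \<in> incident G W ==> e \<in> edges G" by (simp add: incident_def)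

lemma H1_Dirichlet_iff:
 assumes u: "u \<in> H1E"
 shows "u \<in> Dirichlet G VD \<longleftrightarrow> (\<forall>e\<in>edges G. \<forall>b. origin G e b \<in> VD \<longrightarrow> tr u e b = 0)"
proof
 assume "u \<in> Dirichlet G VD"
 then obtain v where ae: "aeq G u v" and v: "\<forall>e\<in>incident G VD. continuous_on (seg e) (v e)"
  and z: "\<forall>e\<in>edges G. \<forall>b. origin G e b \<in> VD \<longrightarrow> v e (param G e b 0) = 0"
  by (auto simp: Dirichlet_def has_rep_def)
 have "tr u e b = 0" if e: "e \<in> edges G" and o: "origin G e b \<in> VD" for e b
 proof -
  have "e \<in> incident G VD" using e o by (auto simp: incident_def origin_def split: if_splits)
  thus ?thesis
   using continuous_rep_eq[OF u e _ aeqD[OF ae e] param_end[OF e, of b]] v z e o by (auto simp: tr_def)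
 qed
 thus "\<forall>e\<in>edges G. \<forall>b. origin G e b \<in> VD \<longrightarrow> tr u e b = 0" by blast
next
 assume z: "\<forall>e\<in>edges G. \<forall>b. origin G e b \<in> VD \<longrightarrow> tr u e b = 0"
 \<comment> \<open>The order 1 serves as the exponent above 1/2 that \<open>Dirichlet\<close> asks
   for.\<close>
 have "\<forall>e\<in>incident G VD. u e \<in> Hs_int (len G e) 1"
  using u Hs_int_1 len_pos incident_edges unfolding HkE_def by blast
 moreover have "has_rep G (\<lambda>v. (\<forall>e\<in>incident G VD. continuous_on (seg e) (v e)) \<and>
   (\<forall>e\<in>edges G. \<forall>b. origin G e b \<in> VD \<longrightarrow> v e (param G e b 0) = 0)) u"
  unfolding has_rep_def using rp_aeq[OF u] abscont_continuous[OF rp_abscont[OF u incident_edges]] z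
  unfolding tr_def by blast
 ultimately show "u \<in> Dirichlet G VD"
  unfolding Dirichlet_def using H1_L2[OF u] by (auto intro!: exI[of _ 1])
qed

lemma Dir1_eq: "HkG G 1 \<inter> Dirichlet G VD = Dir1 VD"
 unfolding HkG_1_eq using H1_Dirichlet_iff by (auto simp: Dir1_def Cont1_def simp del: One_nat_def)

text \<open>Integration by parts leaves one boundary term per edge end. Grouped by vertex, the terms
  vanish: at a vertex of \<open>VD\<close> because \<open>u\<close> is zero there, at a vertex of
  \<open>VK\<close> because the common value of \<open>u\<close> factors out of the flux
  sum.\<close>

lemma Green:
 assumes u: "u \<in> Dir1 VD" and w: "w \<in> Flux1 VK" and V: "VK \<union> VD = verts G"
 shows "ip (DG u) w + ip u (DG w) = 0"
proof -
 obtain c where u1: "u \<in> H1E" and c: "\<And>e b. e \<in> edges G ==> tr u e b = c (origin G e b)"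
  and uD: "\<And>e b. e \<in> edges G ==> origin G e b \<in> VD ==> tr u e b = 0"
  using u by (auto simp: Dir1_def Cont1_def)
 have w1: "w \<in> H1E" and wK: "\<And>p. p \<in> VK ==> (\<Sum>(e, b)\<in>ends p. sgb b*tr w e b) = 0"
  using w by (auto simp: Flux1_def)
 have edge: "integral\<^sup>L (leb G e) (\<lambda>x. DG u e x*w e x) + integral\<^sup>L (leb G e) (\<lambda>x. u e x*DG w e x)
   = - (\<Sum>b\<in>UNIV. sgb b*(tr u e b*tr w e b))" if e: "e \<in> edges G" for e
 proof -
  note au = rp_abscont[OF u1 e] and aw = rp_abscont[OF w1 e]
  note P = abscont_mult[OF au aw]
  have l: "0 < len G e" by (rule len_pos[OF e])
  have ae: "AE x in leb G e. u e x = rp u e x" "AE x in leb G e. w e x = rp w e x"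
   using aeqD[OF rp_aeq[OF u1] e] aeqD[OF rp_aeq[OF w1] e] by auto
  note sq = L2D[OF H1_L2[OF u1] e] L2D[OF H1_L2[OF w1] e] L2D[OF D_L2[OF u1] e] L2D[OF D_L2[OF w1] e]
   abscont_sqi_fun[OF au] abscont_sqi_fun[OF aw]
  have "integral\<^sup>L (leb G e) (\<lambda>x. DG u e x*w e x) = integral\<^sup>L (leb G e) (\<lambda>x. DG u e x*rp w e x)"
   by (rule integral_cong_AE) (use sq ae in \<open>auto intro!: borel_measurable_times sqi_borel elim: eventually_mono\<close>)
  moreover have "integral\<^sup>L (leb G e) (\<lambda>x. u e x*DG w e x) = integral\<^sup>L (leb G e) (\<lambda>x. rp u e x*DG w e x)"
   by (rule integral_cong_AE) (use sq ae in \<open>auto intro!: borel_measurable_times sqi_borel elim: eventually_mono\<close>)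
  moreover have "integral\<^sup>L (leb G e) (\<lambda>x. DG u e x*rp w e x) + integral\<^sup>L (leb G e) (\<lambda>x. rp u e x*DG w e x)
   = integral\<^sup>L (leb G e) (\<lambda>x. DG u e x*rp w e x + rp u e x*DG w e x)"
   using sq by (intro Bochner_Integration.integral_add[symmetric] sqi_mult)
  moreover have "... = integral (seg e) (\<lambda>x. DG u e x*rp w e x + rp u e x*DG w e x)"
   by (rule integral_HK(1)[OF sqi_integrable_Leb[OF abscont_sqi[OF P]]])
  moreover have "... = rp u e (len G e)*rp w e (len G e) - rp u e 0*rp w e 0"
   using abscontD[OF P, of "len G e"] l by simp
  ultimately show ?thesis by (simp add: UNIV_bool tr_def param_def sgb_def)
 qed
 have "ip (DG u) w + ip u (DG w) = (\<Sum>e\<in>edges G. - (\<Sum>b\<in>UNIV. sgb b*(tr u e b*tr w e b)))"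
  unfolding L2_inner_def sum.distrib[symmetric] by (intro sum.cong refl edge)
 also have "... = - (\<Sum>(e, b)\<in>edges G \<times> UNIV. sgb b*(tr u e b*tr w e b))"
  by (simp add: sum_negf sum.cartesian_product)
 also have "(\<Sum>(e, b)\<in>edges G \<times> UNIV. sgb b*(tr u e b*tr w e b)) =
   (\<Sum>p\<in>verts G. \<Sum>(e, b)\<in>{z \<in> edges G \<times> UNIV. (case z of (e, b) => origin G e b) = p}. sgb b*(tr u e b*tr w e b))"
  by (rule sum.group[symmetric]) (use fin_edges fin_verts origin_vert in auto)
 also have "... = (\<Sum>p\<in>verts G. 0)"
 proof (rule sum.cong[OF refl])
  fix p assume p: "p \<in> verts G"
  have eq: "{z \<in> edges G \<times> UNIV. (case z of (e, b) => origin G e b) = p} = ends p" by (auto simp: ends_def)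
  show "(\<Sum>(e, b)\<in>{z \<in> edges G \<times> UNIV. (case z of (e, b) => origin G e b) = p}. sgb b*(tr u e b*tr w e b)) = 0"
  proof (cases "p \<in> VD")
   case True
   thus ?thesis unfolding eq by (intro sum.neutral) (auto simp: ends_def uD)
  next
   case False
   hence "p \<in> VK" using p V by auto
   have "(\<Sum>(e, b)\<in>ends p. sgb b*(tr u e b*tr w e b)) = (\<Sum>(e, b)\<in>ends p. c p*(sgb b*tr w e b))"
    by (intro sum.cong) (auto simp: ends_def c)
   also have "... = c p*(\<Sum>(e, b)\<in>ends p. sgb b*tr w e b)" by (simp add: sum_distrib_left case_prod_unfold)
   also have "... = 0" using wK[OF \<open>p \<in> VK\<close>] by simp
   finally show ?thesis unfolding eq .
  qed
 qed
 finally show ?thesis by simp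
qed

end

section \<open>The operator\<close>

definition mlt :: "'e gfn => 'e gfn => 'e gfn" where
 "mlt m u = (\<lambda>e x. m e x*u e x)"

context mgr
begin

lemma L2_mlt:
 assumes u: "u \<in> L2 G" and m: "\<And>e. e \<in> edges G ==> continuous_on (seg e) (m e)"
  and B: "\<And>e x. e \<in> edges G ==> x \<in> seg e ==> \<bar>m e x\<bar> \<le> B"
 shows "mlt m u \<in> L2 G" "0 \<le> B ==> nL (mlt m u) \<le> B*nL u"
proof -
 have e: "sqi (leb G e) (\<lambda>x. m e x*u e x)"
  "integral\<^sup>L (leb G e) (\<lambda>x. (m e x*u e x)^2) \<le> B^2*integral\<^sup>L (leb G e) (\<lambda>x. (u e x)^2)" if "e \<in> edges G" for e
  using sqi_bounded_mult[OF L2D[OF u that], of "m e" B] sqi_continuous[OF m[OF that]] B[OF that]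
  by (auto simp: sqi_def)
 show "mlt m u \<in> L2 G" using e(1) by (simp add: L2_iff mlt_def)
 assume B0: "0 \<le> B"
 have "nm (leb G e) (mlt m u e) \<le> B*nm (leb G e) (u e)" if "e \<in> edges G" for e
  unfolding nm_def mlt_def using real_sqrt_le_mono[OF e(2)[OF that]] B0 by (simp add: real_sqrt_mult)
 hence "nL (mlt m u) \<le> L2_set (\<lambda>e. B*nm (leb G e) (u e)) (edges G)"
  unfolding L2_norm_set by (intro L2_set_mono) auto
 also have "... = B*nL u"
  unfolding L2_norm_set using B0 by (simp add: L2_set_right_distrib)
 finally show "nL (mlt m u) \<le> B*nL u" .
qed

lemma inner_mlt: "ip (mlt m u) v = ip u (mlt m v)"
 unfolding L2_inner_def mlt_def by (intro sum.cong refl Bochner_Integration.integral_cong) (auto simp: mult_ac)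

lemma inner_mlt_ge:
 assumes u: "u \<in> L2 G" and m: "\<And>e. e \<in> edges G ==> continuous_on (seg e) (m e)"
  and B: "\<And>e x. e \<in> edges G ==> x \<in> seg e ==> b \<le> m e x"
 shows "b*(nL u)^2 \<le> ip (mlt m u) u"
proof -
 have "b*(nm (leb G e) (u e))^2 \<le> integral\<^sup>L (leb G e) (\<lambda>x. mlt m u e x*u e x)" if e: "e \<in> edges G" for e
 proof -
  have "sqi (leb G e) (\<lambda>x. m e x*u e x)" by (rule sqi_mult_continuous[OF L2D[OF u e] m[OF e]])
  hence i: "integrable (leb G e) (\<lambda>x. m e x*u e x*u e x)" by (rule sqi_mult[OF _ L2D[OF u e]])
  have "b*(nm (leb G e) (u e))^2 = integral\<^sup>L (leb G e) (\<lambda>x. b*(u e x)^2)"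
   by (simp add: nm_sq)
  also have "... = integral\<^sup>L (leb G e) (\<lambda>x. b*(u e x*u e x))" by (simp only: power2_eq_square)
  also have "... \<le> integral\<^sup>L (leb G e) (\<lambda>x. m e x*u e x*u e x)"
   using sqi_mult[OF L2D[OF u e] L2D[OF u e]] i B[OF e]
   by (intro integral_mono) (auto simp: mult.assoc intro!: mult_right_mono)
  finally show ?thesis by (simp add: mlt_def)
 qed
 hence "(\<Sum>e\<in>edges G. b*(nm (leb G e) (u e))^2) \<le> ip (mlt m u) u"
  unfolding L2_inner_def by (rule sum_mono)
 thus ?thesis by (simp add: L2_norm_sq sum_distrib_left)
qed

lemma mlt_aeq: "aeq G u v ==> aeq G (mlt m u) (mlt m v)"
 unfolding aeq_def mlt_def by (auto elim: eventually_mono)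

lemma H1_mlt:
 assumes w: "w \<in> H1E" and m: "\<And>e. e \<in> edges G ==> abscont (len G e) (m e) (m' e)"
 shows "mlt m w \<in> H1E" "aeq G (DG (mlt m w)) (mlt m' w + mlt m (DG w))"
  "\<And>e b. e \<in> edges G ==> tr (mlt m w) e b = m e (param G e b 0)*tr w e b"
proof -
 have L: "mlt m w \<in> L2 G"
  unfolding L2_iff mlt_def using sqi_mult_continuous[OF L2D[OF H1_L2[OF w]] abscont_continuous[OF m]] by blast
 have A: "abscont (len G e) (\<lambda>x. m e x*rp w e x) (\<lambda>x. m' e x*rp w e x + m e x*DG w e x)" if "e \<in> edges G" for e
  by (rule abscont_mult[OF m[OF that] rp_abscont[OF w that]])
 note H = H1I[OF L A mlt_aeq[OF rp_aeq[OF w], of m, unfolded mlt_def[of m "rp w"]]]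
 show "mlt m w \<in> H1E" by (rule H(1))
 have "aeq G (\<lambda>e x. m' e x*rp w e x + m e x*DG w e x) (mlt m' w + mlt m (DG w))"
  using rp_aeq[OF w] unfolding aeq_def mlt_def by (auto elim: eventually_mono)
 from aeq_trans[OF H(2) this] show "aeq G (DG (mlt m w)) (mlt m' w + mlt m (DG w))" .
 show "\<And>e b. e \<in> edges G ==> tr (mlt m w) e b = m e (param G e b 0)*tr w e b"
  unfolding tr_def using H(3)[OF _ _ param_end] by blast
qed

text \<open>Comparing ends in pairs, without the vertex values \<open>c\<close>, suits sums and
  limits better. For the converse, \<open>c\<close> reads off the value at an arbitrary end of the
  vertex.\<close>

lemma Cont1_iff: "u \<in> Cont1 \<longleftrightarrow> u \<in> H1E \<and>
 (\<forall>e\<in>edges G. \<forall>e'\<in>edges G. \<forall>b b'. origin G e b = origin G e' b' \<longrightarrow> tr u e b = tr u e' b')"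
proof
 assume "u \<in> H1E \<and> (\<forall>e\<in>edges G. \<forall>e'\<in>edges G. \<forall>b b'. origin G e b = origin G e' b' \<longrightarrow> tr u e b = tr u e' b')"
 hence u: "u \<in> H1E" and *: "\<And>e e' b b'. e \<in> edges G ==> e' \<in> edges G ==> origin G e b = origin G e' b' ==> tr u e b = tr u e' b'"
  by blast+
 define c where "c p = (let z = SOME z. fst z \<in> edges G \<and> origin G (fst z) (snd z) = p in tr u (fst z) (snd z))" for p
 have "tr u e b = c (origin G e b)" if e: "e \<in> edges G" for e b
 proof -
  define z where "z = (SOME z. fst z \<in> edges G \<and> origin G (fst z) (snd z) = origin G e b)"
  have "fst z \<in> edges G \<and> origin G (fst z) (snd z) = origin G e b"
   unfolding z_def by (rule someI[of _ "(e, b)"]) (simp add: e)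
  thus ?thesis using *[OF e, of "fst z" b "snd z"] by (simp add: c_def z_def[symmetric] Let_def)
 qed
 thus "u \<in> Cont1" using u by (auto simp: Cont1_def)
qed (auto simp: Cont1_def)

lemma Cont1_H1: "u \<in> Cont1 ==> u \<in> H1E" by (simp add: Cont1_def)
lemma Dir1_H1: "u \<in> Dir1 VD ==> u \<in> H1E" by (simp add: Dir1_def Cont1_def)
lemma Flux1_H1: "u \<in> Flux1 VK ==> u \<in> H1E" by (simp add: Flux1_def)

lemma Dir1_iff: "u \<in> Dir1 VD \<longleftrightarrow> u \<in> H1E \<and>
 (\<forall>e\<in>edges G. \<forall>e'\<in>edges G. \<forall>b b'. origin G e b = origin G e' b' \<longrightarrow> tr u e b = tr u e' b') \<and>
 (\<forall>e\<in>edges G. \<forall>b. origin G e b \<in> VD \<longrightarrow> tr u e b = 0)"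
 unfolding Dir1_def using Cont1_iff[of u] by blast

lemma Dir1_I:
 assumes "w \<in> H1E"
  "\<And>e e' b b'. e \<in> edges G ==> e' \<in> edges G ==> origin G e b = origin G e' b' ==> tr w e b = tr w e' b'"
  "\<And>e b. e \<in> edges G ==> origin G e b \<in> VD ==> tr w e b = 0"
 shows "w \<in> Dir1 VD"
 unfolding Dir1_iff using assms by blast

lemma Dir1_E:
 assumes "w \<in> Dir1 VD" "e \<in> edges G"
 shows "e' \<in> edges G ==> origin G e b = origin G e' b' ==> tr w e b = tr w e' b'"
  "origin G e b \<in> VD ==> tr w e b = 0"
 using assms unfolding Dir1_iff by blast+

lemma Dir1_add:
 assumes u: "u \<in> Dir1 VD" and v: "v \<in> Dir1 VD" shows "u + v \<in> Dir1 VD"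
proof (rule Dir1_I[OF H1_add(1)[OF Dir1_H1[OF u] Dir1_H1[OF v]]])
 fix e e' b b' assume e: "e \<in> edges G" "e' \<in> edges G" and o: "origin G e b = origin G e' b'"
 show "tr (u + v) e b = tr (u + v) e' b'"
  unfolding tr_add[OF Dir1_H1[OF u] Dir1_H1[OF v] e(1)] tr_add[OF Dir1_H1[OF u] Dir1_H1[OF v] e(2)] Dir1_E(1)[OF u e(1) e(2) o] Dir1_E(1)[OF v e(1) e(2) o] ..
next
 fix e b assume e: "e \<in> edges G" and o: "origin G e b \<in> VD"
 show "tr (u + v) e b = 0" using Dir1_E(2)[OF u e o] Dir1_E(2)[OF v e o] by (simp add: tr_add[OF Dir1_H1[OF u] Dir1_H1[OF v] e])
qed
lemma Dir1_scl:
 assumes u: "u \<in> Dir1 VD" shows "scl c u \<in> Dir1 VD"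
proof (rule Dir1_I[OF H1_scl(1)[OF Dir1_H1[OF u]]])
 fix e e' b b' assume e: "e \<in> edges G" "e' \<in> edges G" and o: "origin G e b = origin G e' b'"
 show "tr (scl c u) e b = tr (scl c u) e' b'"
  unfolding tr_scl[OF Dir1_H1[OF u] e(1)] tr_scl[OF Dir1_H1[OF u] e(2)] Dir1_E(1)[OF u e(1) e(2) o] ..
next
 fix e b assume e: "e \<in> edges G" and o: "origin G e b \<in> VD"
 show "tr (scl c u) e b = 0" using Dir1_E(2)[OF u e o] by (simp add: tr_scl[OF Dir1_H1[OF u] e])
qed
lemma Dir1_zero: "0 \<in> Dir1 VD"
 unfolding Dir1_iff using H1_zero(1) by (simp add: tr_zero del: One_nat_def)
lemma Cont1_zero: "0 \<in> Cont1"
 using Dir1_zero[of "{}"] by (simp add: Dir1_def)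

lemma Flux1_add: "u \<in> Flux1 VK ==> v \<in> Flux1 VK ==> u + v \<in> Flux1 VK"
proof -
 assume u: "u \<in> Flux1 VK" and v: "v \<in> Flux1 VK"
 have "(\<Sum>(e, b)\<in>ends p. sgb b*tr (u + v) e b) = (\<Sum>(e, b)\<in>ends p. sgb b*tr u e b) + (\<Sum>(e, b)\<in>ends p. sgb b*tr v e b)" for p
  unfolding sum.distrib[symmetric]
  by (intro sum.cong refl) (auto simp: ends_def tr_add[OF Flux1_H1[OF u] Flux1_H1[OF v]] distrib_left)
 thus ?thesis using u v H1_add(1)[OF Flux1_H1[OF u] Flux1_H1[OF v]] unfolding Flux1_def by simp
qed
lemma Flux1_scl: "u \<in> Flux1 VK ==> scl c u \<in> Flux1 VK"
proof -
 assume u: "u \<in> Flux1 VK"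
 have "(\<Sum>(e, b)\<in>ends p. sgb b*tr (scl c u) e b) = c*(\<Sum>(e, b)\<in>ends p. sgb b*tr u e b)" for p
  unfolding sum_distrib_left
  by (intro sum.cong refl) (auto simp: ends_def tr_scl[OF Flux1_H1[OF u]])
 thus ?thesis using u H1_scl(1)[OF Flux1_H1[OF u]] unfolding Flux1_def by simp
qed
lemma Flux1_zero: "0 \<in> Flux1 VK"
proof -
 have "(\<Sum>(e, b)\<in>ends p. sgb b*tr 0 e b) = 0" for p
  by (intro sum.neutral) (auto simp: ends_def tr_zero)
 thus ?thesis using H1_zero(1) unfolding Flux1_def by simp
qed
lemma Flux1_aeq:
 assumes u: "u \<in> Flux1 VK" and v: "v \<in> L2 G" "aeq G v u" shows "v \<in> Flux1 VK"
proof -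
 have "(\<Sum>(e, b)\<in>ends p. sgb b*tr v e b) = (\<Sum>(e, b)\<in>ends p. sgb b*tr u e b)" for p
  by (intro sum.cong refl) (auto simp: ends_def tr_aeq[OF Flux1_H1[OF u] v])
 thus ?thesis using u H1_aeq(1)[OF Flux1_H1[OF u] v] unfolding Flux1_def by simp
qed

end

text \<open>\<open>q\<close> and \<open>a\<close> are regular representatives of the squared
  coefficient and of the leading coefficient, with bounds that hold everywhere instead of almost
  everywhere; \<open>a'\<close> is the derivative of \<open>a\<close>, and \<open>\<Lambda>\<close>
  is a Lipschitz constant common to \<open>q\<close>, \<open>a'\<close> and all edges.
  \<open>a_vert\<close> is what is kept of the Lipschitz condition across vertices.\<close>

locale kop = mgr G for G :: "('v, 'e) mgraph" +
 fixes VK VD :: "'v set" and a a' q :: "'e gfn" and k0 k1 a0 a1 a2 \<Lambda> :: real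
 assumes VKD: "VK \<union> VD = verts G" and VKD_disj: "VK \<inter> VD = {}" and edges_ne: "edges G \<noteq> {}"
  and k0: "0 < k0" and a0: "0 < a0"
  and q: "\<And>e x. e \<in> edges G ==> x \<in> seg e ==> k0 \<le> q e x \<and> q e x \<le> k1"
  and a: "\<And>e x. e \<in> edges G ==> x \<in> seg e ==> a0 \<le> a e x \<and> a e x \<le> a1"
  and a': "\<And>e x. e \<in> edges G ==> x \<in> seg e ==> \<bar>a' e x\<bar> \<le> a2"
  and a_deriv: "\<And>e x. e \<in> edges G ==> x \<in> seg e ==> (a e has_real_derivative a' e x) (at x within seg e)"
  and q_lip: "\<And>e. e \<in> edges G ==> \<Lambda>-lipschitz_on (seg e) (q e)"
  and a'_lip: "\<And>e. e \<in> edges G ==> \<Lambda>-lipschitz_on (seg e) (a' e)"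
  and a_vert: "\<And>e b e' b'. e \<in> edges G ==> e' \<in> edges G ==> origin G e b = origin G e' b' ==> a e (param G e b 0) = a e' (param G e' b' 0)"
begin

lemma q_cont: "e \<in> edges G ==> continuous_on (seg e) (q e)"
 using q_lip lipschitz_on_continuous_on by blast
lemma a'_cont: "e \<in> edges G ==> continuous_on (seg e) (a' e)"
 using a'_lip lipschitz_on_continuous_on by blast
lemma a_abscont: "e \<in> edges G ==> abscont (len G e) (a e) (a' e)"
 by (rule abscont_of_deriv[OF a'_cont a_deriv])
lemma a_cont: "e \<in> edges G ==> continuous_on (seg e) (a e)"
 by (rule abscont_continuous[OF a_abscont])

lemma some_edge: obtains e where "e \<in> edges G" "0 \<in> seg e"
 using edges_ne len_pos by force

lemma const_pos: "0 < k1" "k0 \<le> k1" "0 < a1" "a0 \<le> a1" "0 \<le> a2"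
proof -
 obtain e where e: "e \<in> edges G" "0 \<in> seg e" by (rule some_edge)
 thus "0 < k1" "k0 \<le> k1" "0 < a1" "a0 \<le> a1" "0 \<le> a2" using q[OF e] a[OF e] a'[OF e] k0 a0 by linarith+
qed

lemma mlt_q_L2: "u \<in> L2 G ==> mlt q u \<in> L2 G" "u \<in> L2 G ==> nL (mlt q u) \<le> k1*nL u"
proof -
 assume u: "u \<in> L2 G"
 have *: "\<bar>q e x\<bar> \<le> k1" if "e \<in> edges G" "x \<in> seg e" for e x using q[OF that] k0 by linarith
 show "mlt q u \<in> L2 G" "nL (mlt q u) \<le> k1*nL u" using L2_mlt[OF u q_cont *] const_pos by auto
qed
lemma mlt_a_L2: "u \<in> L2 G ==> mlt a u \<in> L2 G" "u \<in> L2 G ==> nL (mlt a u) \<le> a1*nL u"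
proof -
 assume u: "u \<in> L2 G"
 have *: "\<bar>a e x\<bar> \<le> a1" if "e \<in> edges G" "x \<in> seg e" for e x using a[OF that] a0 by linarith
 show "mlt a u \<in> L2 G" "nL (mlt a u) \<le> a1*nL u" using L2_mlt[OF u a_cont *] const_pos by auto
qed
lemma mlt_a'_L2: "u \<in> L2 G ==> mlt a' u \<in> L2 G" "u \<in> L2 G ==> nL (mlt a' u) \<le> a2*nL u"
 using L2_mlt[OF _ a'_cont a', of u] const_pos by auto

text \<open>The quadratic form of the operator; its diagonal is comparable to the square of
  \<open>nH\<close> with the constants \<open>b0\<close> and \<open>b1\<close>.\<close>

definition B :: "'e gfn => 'e gfn => real" where
 "B u v = ip (mlt q u) v + ip (mlt a (DG u)) (DG v)"

definition b0 :: real where "b0 = min k0 a0"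
definition b1 :: real where "b1 = max k1 a1"

lemma b_pos: "0 < b0" "0 < b1" using k0 a0 const_pos by (auto simp: b0_def b1_def)

lemma B_lower:
 assumes "u \<in> H1E" shows "b0*(nH u)^2 \<le> B u u"
proof -
 have "k0*(nL u)^2 \<le> ip (mlt q u) u"
  using q by (intro inner_mlt_ge H1_L2[OF assms] q_cont) auto
 moreover have "a0*(nL (DG u))^2 \<le> ip (mlt a (DG u)) (DG u)"
  using a by (intro inner_mlt_ge D_L2[OF assms] a_cont) auto
 moreover have "b0*(nL u)^2 \<le> k0*(nL u)^2" "b0*(nL (DG u))^2 \<le> a0*(nL (DG u))^2"
  by (auto intro!: mult_right_mono simp: b0_def)
 ultimately show ?thesis unfolding B_def H1_norm_sq by (simp add: distrib_left)
qed

lemma B_upper: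
 assumes "u \<in> H1E" shows "B u u \<le> b1*(nH u)^2"
proof -
 have "ip (mlt q u) u \<le> k1*(nL u)^2"
  using inner_CS[OF mlt_q_L2(1) H1_L2[OF assms], OF H1_L2[OF assms]]
   mult_right_mono[OF mlt_q_L2(2)[OF H1_L2[OF assms]] L2_norm_nonneg[of u]] by (simp add: power2_eq_square)
 moreover have "ip (mlt a (DG u)) (DG u) \<le> a1*(nL (DG u))^2"
  using inner_CS[OF mlt_a_L2(1) D_L2[OF assms], OF D_L2[OF assms]]
   mult_right_mono[OF mlt_a_L2(2)[OF D_L2[OF assms]] L2_norm_nonneg[of "DG u"]] by (simp add: power2_eq_square)
 moreover have "k1*(nL u)^2 \<le> b1*(nL u)^2" "a1*(nL (DG u))^2 \<le> b1*(nL (DG u))^2"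
  by (auto intro!: mult_right_mono simp: b1_def)
 ultimately show ?thesis unfolding B_def H1_norm_sq by (simp add: distrib_left)
qed

lemma B_sym: "B u v = B v u"
 unfolding B_def by (simp add: inner_mlt inner_sym[of u] inner_sym[of "DG u"])

lemma mlt_add: "mlt m (u + v) = mlt m u + mlt m v" and mlt_diff: "mlt m (u - v) = mlt m u - mlt m v"
 and mlt_scl: "mlt m (scl c u) = scl c (mlt m u)"
 by (auto simp: mlt_def fun_eq_iff algebra_simps)

lemma B_add_left:
 assumes "u \<in> H1E" "v \<in> H1E" "w \<in> H1E"
 shows "B (u + v) w = B u w + B v w"
proof -
 note L = H1_L2[OF assms(1)] H1_L2[OF assms(2)] H1_L2[OF assms(3)] D_L2[OF assms(1)] D_L2[OF assms(2)] D_L2[OF assms(3)]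
 have "ip (mlt a (DG (u + v))) (DG w) = ip (mlt a (DG u + DG v)) (DG w)"
  by (rule inner_aeq[OF mlt_aeq[OF H1_add(2)[OF assms(1,2)]]]) (intro mlt_a_L2 L2_add D_L2 H1_add assms)+
 thus ?thesis unfolding B_def mlt_add using L by (simp add: inner_add_left mlt_a_L2 mlt_q_L2)
qed

lemma B_scl_left:
 assumes "u \<in> H1E" "w \<in> H1E"
 shows "B (scl c u) w = c*B u w"
proof -
 have "ip (mlt a (DG (scl c u))) (DG w) = ip (mlt a (scl c (DG u))) (DG w)"
  by (rule inner_aeq[OF mlt_aeq[OF H1_scl(2)[OF assms(1)]]]) (intro mlt_a_L2 L2_scl D_L2 H1_scl assms)+
 thus ?thesis unfolding B_def mlt_scl by (simp add: inner_scl_left distrib_left)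
qed

lemma B_diff_left:
 assumes "u \<in> H1E" "v \<in> H1E" "w \<in> H1E"
 shows "B (u - v) w = B u w - B v w"
proof -
 have eq: "u - v = u + scl (-1) v" by (auto simp: fun_eq_iff)
 have "B (u - v) w = B u w + B (scl (-1) v) w"
  unfolding eq by (rule B_add_left[OF assms(1) H1_scl(1)[OF assms(2)] assms(3)])
 thus ?thesis using B_scl_left[OF assms(2,3), of "-1"] by linarith
qed

lemma B_lin_comb_left:
 assumes "\<And>i. \<psi> i \<in> H1E" "w \<in> H1E"
 shows "B (lin_comb n d \<psi>) w = (\<Sum>i<n. d i*B (\<psi> i) w)"
proof (induction n)
 case 0
 have z: "scl 0 (0 :: 'e gfn) = 0" by (auto simp: fun_eq_iff)
 have "B 0 w = 0" using B_scl_left[OF H1_zero(1) assms(2), of 0] unfolding z by linarith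
 thus ?case by (simp only: lin_comb_0 lessThan_0 sum.empty)
next
 case (Suc n)
 thus ?case
  using B_add_left[OF H1_lin_comb(1)[where \<psi> = \<psi> and n = n and c = d, OF assms(1)] H1_scl(1)[OF assms(1)[of n], where c = "d n"] assms(2)]
   B_scl_left[OF assms(1)[of n] assms(2), of "d n"]
  by (simp only: sum.lessThan_Suc lin_comb_Suc)
qed

definition Lop :: "'e gfn => 'e gfn" where
 "Lop u = mlt q u - DG (mlt a (DG u))"

definition Lp :: "'e gfn set" where
 "Lp = {u \<in> Dir1 VD. DG u \<in> Flux1 VK}"

lemma LpD: "u \<in> Lp ==> u \<in> Dir1 VD" "u \<in> Lp ==> DG u \<in> Flux1 VK" "u \<in> Lp ==> u \<in> H1E"
 "u \<in> Lp ==> DG u \<in> H1E"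
 using Dir1_H1 Flux1_H1 unfolding Lp_def by blast+

text \<open>At a vertex \<open>a\<close> has the same value at all ends by \<open>a_vert\<close>,
  and this value factors out of the flux sum. It is here that continuity of \<open>a\<close> at the
  vertices enters.\<close>

lemma Flux1_mlt_a:
 assumes w: "w \<in> Flux1 VK" shows "mlt a w \<in> Flux1 VK"
proof -
 note H = H1_mlt[OF Flux1_H1[OF w] a_abscont]
 have "(\<Sum>(e, b)\<in>ends p. sgb b*tr (mlt a w) e b) = 0" if p: "p \<in> VK" for p
 proof (cases "ends p = {}")
  case False
  then obtain e0 b0 where z: "(e0, b0) \<in> ends p" by auto
  have "(\<Sum>(e, b)\<in>ends p. sgb b*tr (mlt a w) e b) = (\<Sum>(e, b)\<in>ends p. a e0 (param G e0 b0 0)*(sgb b*tr w e b))"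
  proof (intro sum.cong refl, clarify)
   fix e b assume eb: "(e, b) \<in> ends p"
   have "a e (param G e b 0) = a e0 (param G e0 b0 0)" using eb z by (intro a_vert) (auto simp: ends_def)
   thus "sgb b*tr (mlt a w) e b = a e0 (param G e0 b0 0)*(sgb b*tr w e b)"
    using H(3)[of e b] eb by (simp add: ends_def)
  qed
  also have "... = a e0 (param G e0 b0 0)*(\<Sum>(e, b)\<in>ends p. sgb b*tr w e b)"
   by (simp add: sum_distrib_left case_prod_unfold)
  also have "... = 0" using w p by (simp add: Flux1_def)
  finally show ?thesis .
 qed simp
 thus ?thesis using H(1) by (simp add: Flux1_def)
qed

lemma Lop_L2: "u \<in> Lp ==> Lop u \<in> L2 G"
 unfolding Lop_def by (intro L2_diff mlt_q_L2 D_L2 Flux1_H1[OF Flux1_mlt_a] LpD H1_L2)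

lemma B_Lop:
 assumes u: "u \<in> Lp" and v: "v \<in> Dir1 VD" shows "B u v = ip (Lop u) v"
proof -
 note F = Flux1_mlt_a[OF LpD(2)[OF u]]
 note L = H1_L2[OF Dir1_H1[OF v]] D_L2[OF Dir1_H1[OF v]] D_L2[OF Flux1_H1[OF F]] mlt_q_L2(1)[OF H1_L2[OF LpD(3)[OF u]]]
 have "ip (mlt a (DG u)) (DG v) = - ip (DG (mlt a (DG u))) v"
  using Green[OF v F VKD] by (simp add: inner_sym[of v] inner_sym[of "DG v"])
 thus ?thesis unfolding B_def Lop_def using L by (simp add: inner_diff_left)
qed

lemma DD_aeq:
 assumes u: "u \<in> Lp"
 shows "aeq G (Lop u) (mlt q u - (mlt a' (DG u) + mlt a (DG (DG u))))"
 unfolding Lop_def by (intro aeq_diff aeq_refl H1_mlt(2)[OF LpD(4)[OF u] a_abscont])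

text \<open>The equation \<open>Lop u = q*u - a'*u' - a*u''\<close> is read in both directions; the
  second bound solves it for \<open>u''\<close>, using that \<open>a\<close> is bounded
  below.\<close>

lemma norm_DD:
 assumes u: "u \<in> Lp"
 shows "nL (Lop u) \<le> (k1 + a2 + a1)*nHH u"
  "a0*nL (DG (DG u)) \<le> nL (Lop u) + (k1 + a2)*nH u"
proof -
 let ?d = "DG u" and ?dd = "DG (DG u)"
 note L = H1_L2[OF LpD(3)[OF u]] D_L2[OF LpD(3)[OF u]] D_L2[OF LpD(4)[OF u]]
 note M = mlt_q_L2(1)[OF L(1)] mlt_a'_L2(1)[OF L(2)] mlt_a_L2(1)[OF L(3)]
 have eq: "nL (Lop u) = nL (mlt q u - (mlt a' ?d + mlt a ?dd))"
  by (rule L2_norm_aeq[OF DD_aeq[OF u] Lop_L2[OF u]]) (intro L2_diff L2_add M)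
 have le2: "nL u \<le> nHH u" "nL ?d \<le> nHH u" "nL ?dd \<le> nHH u"
  by (rule power2_le_imp_le; simp add: H2_norm_sq)+
 have le1: "nL u \<le> nH u" "nL ?d \<le> nH u" by (rule L2_le_H1)+
 have m: "nL (mlt q u) \<le> k1*nL u" "nL (mlt a' ?d) \<le> a2*nL ?d" "nL (mlt a ?dd) \<le> a1*nL ?dd"
  by (intro mlt_q_L2 mlt_a'_L2 mlt_a_L2 L)+
 have "nL (Lop u) \<le> nL (mlt q u) + (nL (mlt a' ?d) + nL (mlt a ?dd))"
  unfolding eq using L2_norm_diff[OF M(1) L2_add[OF M(2,3)]] L2_norm_add[OF M(2,3)] by linarith
 also have "... \<le> k1*nHH u + (a2*nHH u + a1*nHH u)"
  using m le2 const_pos by (intro add_mono order_trans[OF m(1)] order_trans[OF m(2)] order_trans[OF m(3)] mult_left_mono) auto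
 finally show "nL (Lop u) \<le> (k1 + a2 + a1)*nHH u" by (simp add: algebra_simps)
 have "a0*(nL ?dd)^2 \<le> ip (mlt a ?dd) ?dd"
  using a by (intro inner_mlt_ge L a_cont) auto
 also have "... \<le> nL (mlt a ?dd)*nL ?dd" using inner_CS[OF M(3) L(3)] by linarith
 finally have "a0*nL ?dd*nL ?dd \<le> nL (mlt a ?dd)*nL ?dd" by (simp add: power2_eq_square)
 hence 1: "a0*nL ?dd \<le> nL (mlt a ?dd)"
  by (cases "nL ?dd = 0") (auto simp: mult_le_cancel_right less_le)
 have "aeq G (mlt a ?dd) (mlt q u - (Lop u + mlt a' ?d))"
  using DD_aeq[OF u] unfolding aeq_def by (auto elim!: eventually_mono simp: algebra_simps)
 hence "nL (mlt a ?dd) = nL (mlt q u - (Lop u + mlt a' ?d))"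
  by (rule L2_norm_aeq[OF _ M(3)]) (intro L2_diff L2_add M Lop_L2 u)
 also have "... \<le> nL (mlt q u) + (nL (Lop u) + nL (mlt a' ?d))"
  using L2_norm_diff[OF M(1) L2_add[OF Lop_L2[OF u] M(2)]] L2_norm_add[OF Lop_L2[OF u] M(2)] by linarith
 also have "... \<le> k1*nH u + (nL (Lop u) + a2*nH u)"
  using m le1 const_pos by (intro add_mono order_trans[OF m(1)] order_trans[OF m(2)] mult_left_mono order_refl) auto
 finally show "a0*nL ?dd \<le> nL (Lop u) + (k1 + a2)*nH u"
  using 1 by (simp add: algebra_simps)
qed

definition Cell :: real where "Cell = 1/b0 + (1 + (k1 + a2)/b0)/a0"

lemma Cell_pos: "0 < Cell"
 unfolding Cell_def using b_pos a0 const_pos by (intro add_pos_nonneg divide_pos_pos divide_nonneg_pos add_nonneg_nonneg) auto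

text \<open>Coercivity of \<open>B\<close>, tested with \<open>u\<close> itself, bounds the norm of
  H^1; \<open>norm_DD\<close> then bounds the second derivative. \<open>Cell\<close> is the sum of
  the two resulting constants.\<close>

lemma elliptic:
 assumes u: "u \<in> Lp"
 shows "nH u \<le> nL (Lop u)/b0" "nHH u \<le> Cell*nL (Lop u)"
  "nH (DG u) \<le> Cell*nL (Lop u)"
proof -
 let ?h = "nH u" and ?n = "nL (Lop u)"
 have "b0*?h^2 \<le> B u u" by (rule B_lower[OF LpD(3)[OF u]])
 also have "... = ip (Lop u) u" by (rule B_Lop[OF u LpD(1)[OF u]])
 also have "... \<le> ?n*?h"
  using inner_CS[OF Lop_L2[OF u] H1_L2[OF LpD(3)[OF u]]] L2_le_H1(1)[of u] mult_left_mono[OF L2_le_H1(1)[of u], of ?n] by simp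
 finally have "b0*?h*?h \<le> ?n*?h" by (simp add: power2_eq_square)
 hence "b0*?h \<le> ?n"
  using H1_norm_nonneg[of u] by (cases "?h = 0") (auto simp: mult_le_cancel_right less_le simp del: One_nat_def)
 thus h: "?h \<le> ?n/b0" using b_pos by (simp add: field_simps)
 have "a0*nL (DG (DG u)) \<le> ?n + (k1 + a2)*(?n/b0)"
  using norm_DD(2)[OF u] mult_left_mono[OF h, of "k1 + a2"] const_pos by simp
 hence dd: "nL (DG (DG u)) \<le> (1 + (k1 + a2)/b0)/a0*?n"
  using a0 by (simp add: field_simps)
 have "(nHH u)^2 = ?h^2 + (nL (DG (DG u)))^2" by (simp only: H2_norm_sq H1_norm_sq)
 also have "... \<le> (?h + nL (DG (DG u)))^2" by (simp add: power2_sum del: One_nat_def)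
 finally have "nHH u \<le> ?h + nL (DG (DG u))"
  by (rule power2_le_imp_le) (simp del: One_nat_def)
 also have "... \<le> Cell*?n" using h dd unfolding Cell_def distrib_right by simp
 finally show 2: "nHH u \<le> Cell*?n" .
 have "nH (DG u) \<le> nHH u"
  by (rule power2_le_imp_le) (simp_all only: H2_norm_sq H1_norm_sq H2_norm_nonneg, simp)
 thus "nH (DG u) \<le> Cell*?n" using 2 by linarith
qed

lemma Lp_zero: "0 \<in> Lp"
 using Dir1_zero Flux1_aeq[OF Flux1_zero D_L2[OF H1_zero(1)] H1_zero(2)] by (simp add: Lp_def)
lemma Lp_add: "u \<in> Lp ==> v \<in> Lp ==> u + v \<in> Lp"
proof -
 assume u: "u \<in> Lp" and v: "v \<in> Lp"
 note h = LpD(3)[OF u] LpD(3)[OF v]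
 have "DG (u + v) \<in> Flux1 VK"
  by (rule Flux1_aeq[OF Flux1_add[OF LpD(2)[OF u] LpD(2)[OF v]] D_L2[OF H1_add(1)[OF h]] H1_add(2)[OF h]])
 thus ?thesis using Dir1_add[OF LpD(1)[OF u] LpD(1)[OF v]] by (simp add: Lp_def)
qed
lemma Lp_scl: "u \<in> Lp ==> scl c u \<in> Lp"
proof -
 assume u: "u \<in> Lp"
 note h = LpD(3)[OF u]
 have "DG (scl c u) \<in> Flux1 VK"
  by (rule Flux1_aeq[OF Flux1_scl[OF LpD(2)[OF u]] D_L2[OF H1_scl(1)[OF h]] H1_scl(2)[OF h]])
 thus ?thesis using Dir1_scl[OF LpD(1)[OF u]] by (simp add: Lp_def)
qed
lemma Lp_lin_comb: "(\<And>i. \<psi> i \<in> Lp) ==> lin_comb n d \<psi> \<in> Lp"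
 by (induction n) (auto simp only: lin_comb_0 lin_comb_Suc intro: Lp_zero Lp_add Lp_scl)

end

section \<open>Eigenfunction expansions\<close>

locale eigl = kop +
 fixes \<psi> :: "nat => 'b gfn" and \<mu> :: "nat => real"
 assumes psi: "\<And>i. \<psi> i \<in> Lp" and mu_pos: "\<And>i. 0 < \<mu> i" and eigen: "\<And>i. aeq G (Lop (\<psi> i)) (scl (\<mu> i) (\<psi> i))"
  and orth: "\<And>i j. ip (\<psi> i) (\<psi> j) = (if i = j then 1 else 0)"
  and complete: "\<And>u. u \<in> L2 G ==> (\<lambda>n. nL (u - lin_comb n (\<lambda>i. ip u (\<psi> i)) \<psi>)) \<longlonglongrightarrow> 0"
begin

abbreviation dfn :: "real => 'b gfn set" where "dfn \<equiv> dot_fn G \<psi> \<mu>"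
abbreviation cf :: "'b gfn => nat => real" where "cf u i \<equiv> ip u (\<psi> i)"

lemma psi_D: "\<psi> i \<in> Dir1 VD" "\<psi> i \<in> H1E" "\<psi> i \<in> L2 G" "DG (\<psi> i) \<in> H1E"
 using LpD[OF psi] H1_L2 by blast+

lemma LC: "lin_comb n d \<psi> \<in> Lp" "lin_comb n d \<psi> \<in> Dir1 VD" "lin_comb n d \<psi> \<in> H1E" "lin_comb n d \<psi> \<in> L2 G"
 using Lp_lin_comb[of \<psi>, OF psi] LpD H1_L2 by blast+

lemma cf_lin_comb: "cf (lin_comb n d \<psi>) i = (if i < n then d i else 0)"
proof -
 have "cf (lin_comb n d \<psi>) i = (\<Sum>j<n. d j*(if j = i then 1 else 0))"
  using inner_lin_comb_left[where \<psi> = \<psi>, OF psi_D(3)[of i] psi_D(3), of n d] by (simp add: orth)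
 thus ?thesis by (simp add: if_distrib[of "\<lambda>x. _*x"] sum.delta cong: if_cong)
qed

text \<open>Green's formula is applied to the eigenfunction, which lies in the domain, so that
  \<open>u\<close> only has to lie in \<open>Dir1 VD\<close>.\<close>

lemma B_psi:
 assumes u: "u \<in> Dir1 VD" shows "B u (\<psi> i) = \<mu> i*cf u i"
proof -
 have "B u (\<psi> i) = ip (Lop (\<psi> i)) u" using B_Lop[OF psi u] B_sym by metis
 also have "... = ip (scl (\<mu> i) (\<psi> i)) u"
  by (rule inner_aeq[OF eigen Lop_L2[OF psi] L2_scl[OF psi_D(3)] H1_L2[OF Dir1_H1[OF u]]])
 also have "... = \<mu> i*cf u i" by (simp add: inner_scl_left inner_sym[of _ u])
 finally show ?thesis .
qed

text \<open>Only the zero order part of the form is kept, whence \<open>k0\<close> and not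
  \<open>b0\<close>.\<close>

lemma mu_ge: "k0 \<le> \<mu> i"
proof -
 have "B (\<psi> i) (\<psi> i) = \<mu> i" using B_psi[OF psi_D(1)] orth by simp
 moreover have "k0*(nL (\<psi> i))^2 \<le> ip (mlt q (\<psi> i)) (\<psi> i)"
  using q by (intro inner_mlt_ge psi_D q_cont) auto
 moreover have "a0*(nL (DG (\<psi> i)))^2 \<le> ip (mlt a (DG (\<psi> i))) (DG (\<psi> i))"
  using a by (intro inner_mlt_ge D_L2[OF psi_D(2)] a_cont) auto
 moreover have "0 \<le> a0*(nL (DG (\<psi> i)))^2" using a0 by simp
 moreover have "(nL (\<psi> i))^2 = 1" using inner_self[of "\<psi> i"] orth by simp
 ultimately show ?thesis unfolding B_def by simp
qed

text \<open>The coefficients \<open>d\<close> are arbitrary because the K-functionals are estimated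
  with truncations at low frequencies and not only with partial Fourier sums.\<close>

lemma norm_diff_lin_comb:
 assumes u: "u \<in> L2 G"
 shows "(nL (u - lin_comb n d \<psi>))^2 = (nL u)^2 - 2*(\<Sum>i<n. d i*cf u i) + (\<Sum>i<n. (d i)^2)"
proof -
 let ?S = "lin_comb n d \<psi>"
 have 1: "ip ?S u = (\<Sum>i<n. d i*cf u i)"
  using inner_lin_comb_left[where \<psi> = \<psi>, OF u psi_D(3), of n d] by (simp add: inner_sym[of _ u])
 have 2: "ip ?S ?S = (\<Sum>i<n. (d i)^2)"
 proof -
  have c: "ip (\<psi> i) ?S = (if i < n then d i else 0)" for i
   by (subst inner_sym) (rule cf_lin_comb)
  show ?thesis
   unfolding inner_lin_comb_left[where \<psi> = \<psi>, OF LC(4)[of n d] psi_D(3), of n d] c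
   by (intro sum.cong) (auto simp: power2_eq_square)
 qed
 have "(nL (u - ?S))^2 = ip u u - ip ?S u - (ip ?S u - ip ?S ?S)"
  unfolding inner_self[symmetric] using u LC(4)[of n d]
  by (simp add: inner_diff_left inner_diff_right L2_diff inner_sym[of u ?S])
 thus ?thesis by (simp add: 1 2[unfolded inner_self] inner_self)
qed

lemma B_lin_comb_self: "B (lin_comb n d \<psi>) (lin_comb n d \<psi>) = (\<Sum>i<n. \<mu> i*(d i)^2)"
proof -
 have c: "B (\<psi> i) (lin_comb n d \<psi>) = \<mu> i*(if i < n then d i else 0)" for i
  unfolding B_sym[of "\<psi> i"] B_psi[OF LC(2)] cf_lin_comb ..
 show ?thesis
  unfolding B_lin_comb_left[where \<psi> = \<psi>, OF psi_D(2) LC(3)[of n d], of n d] c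
  by (intro sum.cong) (auto simp: power2_eq_square)
qed

lemma B_diff_lin_comb:
 assumes u: "u \<in> Dir1 VD"
 shows "B (u - lin_comb n d \<psi>) (u - lin_comb n d \<psi>) = B u u - 2*(\<Sum>i<n. \<mu> i*d i*cf u i) + (\<Sum>i<n. \<mu> i*(d i)^2)"
proof -
 let ?S = "lin_comb n d \<psi>"
 note u1 = Dir1_H1[OF u]
 have 1: "B ?S u = (\<Sum>i<n. \<mu> i*d i*cf u i)"
  using B_lin_comb_left[where \<psi> = \<psi>, OF psi_D(2) u1, of n d] B_psi[OF u] by (simp add: B_sym[of _ u] mult_ac)
 have 2: "B ?S ?S = (\<Sum>i<n. \<mu> i*(d i)^2)"
  by (rule B_lin_comb_self)
 have "B (u - ?S) (u - ?S) = B u u - B ?S u - (B ?S u - B ?S ?S)"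
  using B_diff_left[OF u1 LC(3)[of n d] H1_diff(1)[OF u1 LC(3)[of n d]]] B_diff_left[OF u1 LC(3)[of n d] u1] B_diff_left[OF u1 LC(3)[of n d] LC(3)[of n d]]
  by (simp add: B_sym[of u "u - ?S"] B_sym[of ?S "u - ?S"] B_sym[of u ?S])
 thus ?thesis by (simp add: 1 2)
qed

lemma Parseval:
 assumes u: "u \<in> L2 G" shows "(\<lambda>i. (cf u i)^2) sums (nL u)\<^sup>2"
proof -
 have eq: "(nL (u - lin_comb n (cf u) \<psi>))^2 = (nL u)^2 - (\<Sum>i<n. (cf u i)^2)" for n
  using norm_diff_lin_comb[OF u, of n "cf u"] by (simp add: power2_eq_square)
 have "(\<lambda>n. (nL (u - lin_comb n (cf u) \<psi>))^2) \<longlonglongrightarrow> 0^2"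
  by (intro tendsto_power complete[OF u])
 hence "(\<lambda>n. (nL u)^2 - ((nL u)^2 - (\<Sum>i<n. (cf u i)^2))) \<longlonglongrightarrow> (nL u)^2 - 0"
  unfolding eq by (intro tendsto_intros) simp
 thus ?thesis by (simp add: sums_def)
qed

lemma cf_zero_aeq: "u \<in> L2 G ==> (\<And>i. cf u i = 0) ==> aeq G u 0"
 using Parseval[of u] sums_unique2[OF _ sums_zero, of "nL u^2"] by (intro L2_norm_zero_aeq) auto

lemma Bessel_B:
 assumes u: "u \<in> Dir1 VD" shows "(\<Sum>i<n. \<mu> i*(cf u i)^2) \<le> B u u"
proof -
 have "0 \<le> b0*(nH (u - lin_comb n (cf u) \<psi>))^2" using b_pos by simp
 also have "... \<le> B (u - lin_comb n (cf u) \<psi>) (u - lin_comb n (cf u) \<psi>)"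
  by (rule B_lower[OF H1_diff(1)[OF Dir1_H1[OF u] LC(3)]])
 also have "... = B u u - (\<Sum>i<n. \<mu> i*(cf u i)^2)"
  using B_diff_lin_comb[OF u, of n "cf u"] by (simp add: power2_eq_square mult.assoc)
 finally show ?thesis by simp
qed

lemma cf_Lop:
 assumes u: "u \<in> Lp" shows "cf (Lop u) i = \<mu> i*cf u i"
 using B_Lop[OF u psi_D(1)[of i]] B_psi[OF LpD(1)[OF u], of i] by simp

lemma Lop_sums: "u \<in> Lp ==> (\<lambda>i. (\<mu> i)^2*(cf u i)^2) sums (nL (Lop u))\<^sup>2"
 using Parseval[OF Lop_L2, of u] by (simp add: cf_Lop power_mult_distrib)

lemma Lop_lin_comb: "(nL (Lop (lin_comb n d \<psi>)))^2 = (\<Sum>i<n. (\<mu> i)^2*(d i)^2)"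
proof -
 have "(\<lambda>i. (\<mu> i)^2*(cf (lin_comb n d \<psi>) i)^2) sums (\<Sum>i<n. (\<mu> i)^2*(d i)^2)"
  using sums_If_finite_set[of "{..<n}" "\<lambda>i. (\<mu> i)^2*(d i)^2"]
  by (simp add: cf_lin_comb if_distrib[of "\<lambda>x. _*x^2"] cong: if_cong)
 thus ?thesis using sums_unique2[OF Lop_sums[OF LC(1)]] by blast
qed

lemma lin_comb_diff:
 assumes "n \<le> m"
 shows "lin_comb m d \<psi> - lin_comb n d \<psi> = lin_comb m (\<lambda>i. if i < n then 0 else d i) \<psi>"
proof (intro ext)
 fix e x
 have "(\<Sum>i<m. d i*\<psi> i e x) = (\<Sum>i<n. d i*\<psi> i e x) + (\<Sum>i=n..<m. d i*\<psi> i e x)"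
  using assms by (simp add: sum.atLeastLessThan_concat lessThan_atLeast0)
 moreover have "(\<Sum>i<m. (if i < n then 0 else d i)*\<psi> i e x) = (\<Sum>i=n..<m. d i*\<psi> i e x)"
  by (rule sum.mono_neutral_cong_right) auto
 ultimately show "(lin_comb m d \<psi> - lin_comb n d \<psi>) e x = lin_comb m (\<lambda>i. if i < n then 0 else d i) \<psi> e x"
  by (simp add: lin_comb_def)
qed

lemma tail_Cauchy:
 assumes "summable (\<lambda>i. f i)" "\<And>i. 0 \<le> (f i :: real)" "0 < r"
 shows "\<exists>N. \<forall>m\<ge>N. \<forall>n\<ge>N. n \<le> m \<longrightarrow> (\<Sum>i=n..<m. f i) < r"
proof -
 obtain N where "\<forall>m\<ge>N. \<forall>n. norm (sum f {m..<n}) < r" using assms(1,3) unfolding summable_Cauchy by blast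
 thus ?thesis using assms(2) by (auto simp: sum_nonneg intro!: exI[of _ N])
qed

lemma sum_if_tail: "(n::nat) \<le> m ==> (\<Sum>i<m. w i*(if i < n then 0 else d i)^2) = (\<Sum>i=n..<m. w i*(d i)^2 :: real)"
 by (rule sum.mono_neutral_cong_right) auto

text \<open>The common pattern of the convergence proofs below: the squared distance of two partial
  sums is bounded by a block of a convergent series.\<close>

lemma Cauchy_sq:
 fixes F :: "nat => nat => real" and C :: real
 assumes s: "summable f" "\<And>i. 0 \<le> f i" and C: "0 < C"
  and F: "\<And>m n. n \<le> m ==> (F m n)^2 \<le> C*(\<Sum>i=n..<m. f i)" and sym: "\<And>m n. F m n = F n m" and r: "0 < r"
 shows "\<exists>N. \<forall>m\<ge>N. \<forall>n\<ge>N. F m n < r"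
proof -
 obtain N where N: "\<forall>m\<ge>N. \<forall>n\<ge>N. n \<le> m \<longrightarrow> (\<Sum>i=n..<m. f i) < r^2/C"
  using tail_Cauchy[OF s, of "r^2/C"] C r by auto
 have *: "F m n < r" if mn: "m \<ge> N" "n \<ge> N" "n \<le> m" for m n
 proof -
  have "(F m n)^2 \<le> C*(\<Sum>i=n..<m. f i)" by (rule F[OF mn(3)])
  also have "... < C*(r^2/C)" using N mn C by (intro mult_strict_left_mono) auto
  also have "... = r^2" using C by simp
  finally show ?thesis using r power2_less_imp_less by fastforce
 qed
 have "F m n < r" if "m \<ge> N" "n \<ge> N" for m n
  using *[of m n] *[of n m] that sym[of m n] by (cases "n \<le> m") auto
 thus ?thesis by blast
qed

lemma S_limit: "u \<in> L2 G ==> (\<lambda>n. nL (lin_comb n (cf u) \<psi> - u)) \<longlonglongrightarrow> 0"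
 using complete[of u] by (simp add: L2_norm_minus_commute[of u])

text \<open>Coercivity makes the partial sums Cauchy in H^1; their limit is \<open>u\<close> because
  they converge to \<open>u\<close> in L2, and each vertex condition is a closed condition on
  traces.\<close>

lemma summable_dot1_imp_Dir1:
 assumes u: "u \<in> L2 G" and s: "summable (\<lambda>i. \<mu> i*(cf u i)^2)"
 shows "u \<in> Dir1 VD" "(\<lambda>n. nL (DG (lin_comb n (cf u) \<psi>) - DG u)) \<longlonglongrightarrow> 0"
proof -
 have nn: "0 \<le> \<mu> i*(cf u i)^2" for i using mu_pos[of i] by simp
 define S where "S n = lin_comb n (cf u) \<psi>" for n
 have SH: "S n \<in> H1E" "S n \<in> Dir1 VD" for n unfolding S_def by (rule LC)+
 have bd: "(nL (DG (S m) - DG (S n)))^2 \<le> (1/b0)*(\<Sum>i=n..<m. \<mu> i*(cf u i)^2)" if "n \<le> m" for m n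
 proof -
  have "nL (DG (S m) - DG (S n)) = nL (DG (S m - S n))"
   by (rule L2_norm_aeq[OF aeq_sym[OF H1_diff(2)[OF SH(1) SH(1)]]]) (intro L2_diff D_L2 H1_diff SH)+
  hence "(nL (DG (S m) - DG (S n)))^2 \<le> (nH (S m - S n))^2"
   using L2_le_H1(2)[of "S m - S n"] by (auto intro: power_mono)
  also have "... \<le> (1/b0)*B (S m - S n) (S m - S n)"
   using B_lower[OF H1_diff(1)[OF SH(1) SH(1)], of m n] b_pos by (simp add: field_simps)
  also have "B (S m - S n) (S m - S n) = (\<Sum>i=n..<m. \<mu> i*(cf u i)^2)"
   unfolding S_def lin_comb_diff[OF that] B_lin_comb_self sum_if_tail[OF that] by simp
  finally show ?thesis .
 qed
 have "\<exists>N. \<forall>m\<ge>N. \<forall>n\<ge>N. nL (DG (S m) - DG (S n)) < r" if "r > 0" for r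
  by (rule Cauchy_sq[OF s nn _ bd L2_norm_minus_commute that]) (use b_pos in auto)
 then obtain g where g: "g \<in> L2 G" "(\<lambda>n. nL (DG (S n) - g)) \<longlonglongrightarrow> 0"
  using L2_complete[of "\<lambda>n. DG (S n)"] D_L2[OF SH(1)] by blast
 have cu: "(\<lambda>n. nL (S n - u)) \<longlonglongrightarrow> 0" unfolding S_def by (rule S_limit[OF u])
 note H = H1_closed[OF SH(1) u g(1) cu g(2)]
 have t: "(\<lambda>n. tr (S n) e b) \<longlonglongrightarrow> tr u e b" if "e \<in> edges G" for e b
  unfolding tr_def by (rule H(3)[OF that param_end[OF that]])
 show "u \<in> Dir1 VD"
  unfolding Dir1_iff
 proof (intro conjI ballI allI impI)
  show "u \<in> H1E" by (rule H(1))
  fix e b assume e: "e \<in> edges G"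
  { fix e' b' assume e': "e' \<in> edges G" and o: "origin G e b = origin G e' b'"
   have "tr (S n) e b = tr (S n) e' b'" for n using SH(2)[of n] e e' o unfolding Dir1_iff by blast
   thus "tr u e b = tr u e' b'" using LIMSEQ_unique[OF t[OF e] ] t[OF e'] by simp }
  { assume "origin G e b \<in> VD"
   hence "tr (S n) e b = 0" for n using SH(2)[of n] e unfolding Dir1_iff by blast
   thus "tr u e b = 0" using LIMSEQ_unique[OF t[OF e, of b], of 0] by simp }
 qed
 have "nL (DG (S n) - DG u) = nL (DG (S n) - g)" for n
  by (rule L2_norm_aeq[OF aeq_diff[OF aeq_refl H(2)]]) (intro L2_diff D_L2 SH H(1) g(1))+
 thus "(\<lambda>n. nL (DG (lin_comb n (cf u) \<psi>) - DG u)) \<longlonglongrightarrow> 0"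
  using g(2) by (simp add: S_def)
qed

text \<open>Bessel's inequality gives summability, hence convergence of the partial sums in H^1 by
  the preceding lemma; the form of the remainder then tends to 0, which turns the inequality into an
  equality.\<close>

lemma dot1_sums:
 assumes u: "u \<in> Dir1 VD" shows "(\<lambda>i. \<mu> i*(cf u i)^2) sums B u u"
proof -
 note u1 = Dir1_H1[OF u]
 have nn: "0 \<le> \<mu> i*(cf u i)^2" for i using mu_pos[of i] by simp
 have s: "summable (\<lambda>i. \<mu> i*(cf u i)^2)"
  by (rule summableI_nonneg_bounded[OF nn Bessel_B[OF u]])
 note d = summable_dot1_imp_Dir1(2)[OF H1_L2[OF u1] s]
 define S where "S n = lin_comb n (cf u) \<psi>" for n
 have eq: "B (u - S n) (u - S n) = B u u - (\<Sum>i<n. \<mu> i*(cf u i)^2)" for n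
  using B_diff_lin_comb[OF u, of n "cf u"] by (simp add: power2_eq_square mult.assoc S_def)
 have le: "norm (B (u - S n) (u - S n)) \<le> b1*((nL (S n - u))^2 + (nL (DG (S n) - DG u))^2)" for n
 proof -
  have S1: "S n \<in> H1E" unfolding S_def by (rule LC)
  have "nL (DG (u - S n)) = nL (DG u - DG (S n))"
   by (rule L2_norm_aeq[OF H1_diff(2)[OF u1 S1]]) (intro L2_diff D_L2 H1_diff u1 S1)+
  thus ?thesis
   using B_upper[OF H1_diff(1)[OF u1 S1]] Bessel_B[OF u, of n] eq[of n] unfolding H1_norm_sq
   by (simp add: L2_norm_minus_commute[of u] L2_norm_minus_commute[of "DG u"])
 qed
 have "(\<lambda>n. b1*((nL (S n - u))^2 + (nL (DG (S n) - DG u))^2)) \<longlonglongrightarrow> b1*(0^2 + 0^2)"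
  using S_limit[OF H1_L2[OF u1]] d unfolding S_def by (intro tendsto_intros)
 hence z: "(\<lambda>n. b1*((nL (S n - u))^2 + (nL (DG (S n) - DG u))^2)) \<longlonglongrightarrow> 0" by simp
 have "(\<lambda>n. B (u - S n) (u - S n)) \<longlonglongrightarrow> 0"
  by (rule Lim_null_comparison[OF always_eventually[OF allI[OF le]] z])
 hence "(\<lambda>n. B u u - (B u u - (\<Sum>i<n. \<mu> i*(cf u i)^2))) \<longlonglongrightarrow> B u u - 0"
  unfolding eq by (intro tendsto_intros) simp
 thus ?thesis by (simp add: sums_def)
qed

text \<open>The elliptic estimate for differences of partial sums makes their second derivatives
  Cauchy. The first derivatives therefore converge in H^1, and their fluxes at the vertices pass to
  the limit.\<close>

lemma summable_dot2_imp_Lp: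
 assumes u: "u \<in> L2 G" and s: "summable (\<lambda>i. (\<mu> i)^2*(cf u i)^2)"
 shows "u \<in> Lp"
proof -
 define S where "S n = lin_comb n (cf u) \<psi>" for n
 have SL: "S n \<in> Lp" "S n \<in> H1E" "DG (S n) \<in> H1E" "DG (S n) \<in> Flux1 VK" for n
  unfolding S_def using LC[of n "cf u"] LpD by blast+
 \<comment> \<open>As \<open>\<mu> i\<close> is at least \<open>k0\<close>, the weight of order two
   dominates that of order one.\<close>
 have s1: "summable (\<lambda>i. \<mu> i*(cf u i)^2)"
 proof (rule summable_comparison_test')
  show "summable (\<lambda>i. (1/k0)*((\<mu> i)^2*(cf u i)^2))" by (intro summable_mult s)
  fix i
  have "k0*(\<mu> i*(cf u i)^2) \<le> \<mu> i*(\<mu> i*(cf u i)^2)" using mu_ge[of i] mu_pos[of i] by (intro mult_right_mono) auto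
  thus "norm (\<mu> i*(cf u i)^2) \<le> (1/k0)*((\<mu> i)^2*(cf u i)^2)"
   using k0 mu_pos[of i] by (simp add: field_simps power2_eq_square)
 qed
 note D1 = summable_dot1_imp_Dir1[OF u s1]
 note u1 = Dir1_H1[OF D1(1)]
 have bd: "(nL (DG (DG (S m)) - DG (DG (S n))))^2 \<le> Cell^2*(\<Sum>i=n..<m. (\<mu> i)^2*(cf u i)^2)" if mn: "n \<le> m" for m n
 proof -
  have T: "S m - S n = lin_comb m (\<lambda>i. if i < n then 0 else cf u i) \<psi>" unfolding S_def by (rule lin_comb_diff[OF mn])
  have TL: "S m - S n \<in> Lp" unfolding T by (rule LC)
  have d1: "aeq G (DG (S m - S n)) (DG (S m) - DG (S n))" by (rule H1_diff(2)[OF SL(2) SL(2)])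
  have d2: "aeq G (DG (DG (S m - S n))) (DG (DG (S m) - DG (S n)))"
   by (rule H1_aeq(2)[OF H1_diff(1)[OF SL(3) SL(3)] D_L2[OF H1_diff(1)[OF SL(2) SL(2)]] d1])
  have "nL (DG (DG (S m)) - DG (DG (S n))) = nL (DG (DG (S m - S n)))"
   by (rule L2_norm_aeq[OF aeq_sym[OF aeq_trans[OF d2 H1_diff(2)[OF SL(3) SL(3)]]]]) (intro L2_diff D_L2 SL LpD TL)+
  also have "... \<le> nH (DG (S m - S n))" by (rule L2_le_H1)
  also have "... \<le> Cell*nL (Lop (S m - S n))" by (rule elliptic(3)[OF TL])
  finally have "(nL (DG (DG (S m)) - DG (DG (S n))))^2 \<le> (Cell*nL (Lop (S m - S n)))^2"
   by (intro power_mono) auto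
  also have "... = Cell^2*(\<Sum>i=n..<m. (\<mu> i)^2*(cf u i)^2)"
   unfolding power_mult_distrib T Lop_lin_comb sum_if_tail[OF mn] by simp
  finally show ?thesis .
 qed
 have "\<exists>N. \<forall>m\<ge>N. \<forall>n\<ge>N. nL (DG (DG (S m)) - DG (DG (S n))) < r" if "r > 0" for r
  by (rule Cauchy_sq[OF s _ _ bd L2_norm_minus_commute that]) (use Cell_pos in auto)
 then obtain h where h: "h \<in> L2 G" "(\<lambda>n. nL (DG (DG (S n)) - h)) \<longlonglongrightarrow> 0"
  using L2_complete[of "\<lambda>n. DG (DG (S n))"] D_L2[OF SL(3)] by blast
 note H = H1_closed[OF SL(3) D_L2[OF u1] h(1) D1(2)[folded S_def] h(2)]
 have t: "(\<lambda>n. tr (DG (S n)) e b) \<longlonglongrightarrow> tr (DG u) e b" if "e \<in> edges G" for e b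
  unfolding tr_def by (rule H(3)[OF that param_end[OF that]])
 have "(\<Sum>(e, b)\<in>ends p. sgb b*tr (DG u) e b) = 0" if p: "p \<in> VK" for p
 proof -
  have "(\<lambda>n. \<Sum>(e, b)\<in>ends p. sgb b*tr (DG (S n)) e b) \<longlonglongrightarrow> (\<Sum>(e, b)\<in>ends p. sgb b*tr (DG u) e b)"
   unfolding case_prod_unfold by (intro tendsto_sum tendsto_mult tendsto_const t) (auto simp: ends_def)
  moreover have "(\<Sum>(e, b)\<in>ends p. sgb b*tr (DG (S n)) e b) = 0" for n
   using SL(4)[of n] p by (simp add: Flux1_def)
  ultimately show ?thesis using LIMSEQ_unique[OF _ tendsto_const] by simp
 qed
 hence "DG u \<in> Flux1 VK" using H(1) by (simp add: Flux1_def)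
 thus ?thesis using D1(1) by (simp add: Lp_def)
qed

end

section \<open>Real interpolation\<close>

text \<open>The weighted integral of the K-method, detached from the K-functional so that one
  calculus serves squared K-functionals, the sums \<open>Qs\<close> and the collar norms.\<close>

definition J :: "real => (real => real) => ennreal" where
 "J \<theta> F = (\<integral>\<^sup>+t. ennreal (F t*t powr (- 2*\<theta> - 1))*indicator {0<..} t \<partial>lborel)"

text \<open>Only positive arguments matter. A nonnegative function that is monotone there, such as a
  K-functional, stays monotone after the extension by 0 and is therefore measurable.\<close>

abbreviation pos_part :: "(real => real) => real => real" where
 "pos_part F t \<equiv> (if 0 < t then F t else 0)"

lemma J_mono: "(\<And>t. 0 < t ==> F t \<le> H t) ==> J \<theta> F \<le> J \<theta> H"
 unfolding J_def by (intro nn_integral_mono) (auto simp: indicator_def intro!: ennreal_leI mult_right_mono)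

lemma J_pos_part: "J \<theta> (pos_part F) = J \<theta> F"
 unfolding J_def by (intro nn_integral_cong) (auto simp: indicator_def)

lemma J_add:
 assumes "pos_part F \<in> borel_measurable borel" "pos_part H \<in> borel_measurable borel" "\<And>t. 0 < t ==> 0 \<le> F t" "\<And>t. 0 < t ==> 0 \<le> H t"
 shows "J \<theta> (\<lambda>t. F t + H t) = J \<theta> F + J \<theta> H"
proof -
 have "J \<theta> (\<lambda>t. pos_part F t + pos_part H t) = J \<theta> (pos_part F) + J \<theta> (pos_part H)"
  unfolding J_def
  by (subst nn_integral_add[symmetric])
   (use assms in \<open>auto simp: indicator_def ennreal_plus[symmetric] distrib_right simp del: ennreal_plus intro!: nn_integral_cong\<close>)
 moreover have "J \<theta> (\<lambda>t. pos_part F t + pos_part H t) = J \<theta> (\<lambda>t. F t + H t)"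
  unfolding J_def by (intro nn_integral_cong) (auto simp: indicator_def)
 ultimately show ?thesis by (simp add: J_pos_part)
qed

lemma J_cmult:
 assumes "pos_part F \<in> borel_measurable borel" "0 \<le> c"
 shows "J \<theta> (\<lambda>t. c*F t) = ennreal c*J \<theta> F"
proof -
 have "J \<theta> (\<lambda>t. c*pos_part F t) = ennreal c*J \<theta> (pos_part F)"
  unfolding J_def using assms
  by (subst nn_integral_cmult[symmetric]) (auto simp: mult.assoc ennreal_mult'[symmetric] intro!: nn_integral_cong)
 moreover have "J \<theta> (\<lambda>t. c*pos_part F t) = J \<theta> (\<lambda>t. c*F t)"
  unfolding J_def by (intro nn_integral_cong) (auto simp: indicator_def)
 ultimately show ?thesis by (simp add: J_pos_part)
qed

definition cth :: "real => ennreal" where "cth \<theta> = J \<theta> (\<lambda>t. min 1 (t^2))"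

lemma has_integral_indicator_UNIV:
 fixes f :: "real => real"
 assumes "(f has_integral I) S" shows "((\<lambda>x. indicator S x*f x) has_integral I) UNIV"
proof -
 have "(\<lambda>x. indicator S x*f x) = (\<lambda>x. if x \<in> S then f x else 0)" by auto
 thus ?thesis using assms by (simp add: has_integral_restrict_UNIV)
qed

text \<open>The growth \<open>t^2\<close> secures integrability at 0 because
  \<open>\<theta> < 1\<close>, the cap 1 at infinity because \<open>\<theta> > 0\<close>.\<close>

lemma cth_finite:
 assumes "0 < \<theta>" "\<theta> < 1" shows "cth \<theta> < \<infinity>"
proof -
 have "cth \<theta> \<le> (\<integral>\<^sup>+t. ennreal (indicator {0..1} t*t powr (1 - 2*\<theta>)) + ennreal (indicator {1..} t*t powr (- 2*\<theta> - 1)) \<partial>lborel)"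
  unfolding cth_def J_def
 proof (intro nn_integral_mono)
  fix t :: real
  have "min 1 (t^2)*t powr (- 2*\<theta> - 1) \<le> indicator {0..1} t*t powr (1 - 2*\<theta>) + indicator {1..} t*t powr (- 2*\<theta> - 1)" if t: "0 < t"
  proof (cases "t \<le> 1")
   case True
   have "t^2*t powr (- 2*\<theta> - 1) = t powr 2*t powr (- 2*\<theta> - 1)" using t by (simp add: powr_numeral)
   also have "... = t powr (1 - 2*\<theta>)" by (simp add: powr_add[symmetric])
   finally show ?thesis using True t
    by (intro order_trans[OF mult_right_mono[of "min 1 (t^2)" "t^2"]]) (auto simp: indicator_def)
  next
   case False
   thus ?thesis using t by (auto simp: indicator_def intro!: mult_left_le_one_le)
  qed
  thus "ennreal (min 1 (t^2)*t powr (- 2*\<theta> - 1))*indicator {0<..} t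
   \<le> ennreal (indicator {0..1} t*t powr (1 - 2*\<theta>)) + ennreal (indicator {1..} t*t powr (- 2*\<theta> - 1))"
   by (auto simp: indicator_def ennreal_plus[symmetric] simp del: ennreal_plus intro!: ennreal_leI split: if_splits)
 qed
 also have "... = (\<integral>\<^sup>+t. ennreal (indicator {0..1} t*t powr (1 - 2*\<theta>)) \<partial>lborel) + (\<integral>\<^sup>+t. ennreal (indicator {1..} t*t powr (- 2*\<theta> - 1)) \<partial>lborel)"
  by (rule nn_integral_add) auto
 also have "(\<integral>\<^sup>+t. ennreal (indicator {0..1} t*t powr (1 - 2*\<theta>)) \<partial>lborel) = ennreal (1 powr (1 - 2*\<theta> + 1)/(1 - 2*\<theta> + 1))"
  using assms by (intro nn_integral_has_integral_lborel has_integral_indicator_UNIV has_integral_powr_from_0) auto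
 also have "(\<integral>\<^sup>+t. ennreal (indicator {1..} t*t powr (- 2*\<theta> - 1)) \<partial>lborel) = ennreal (- (1 powr (- 2*\<theta> - 1 + 1))/(- 2*\<theta> - 1 + 1))"
  using assms by (intro nn_integral_has_integral_lborel has_integral_indicator_UNIV has_integral_powr_to_inf) auto
 finally show ?thesis by (rule le_less_trans) (simp add: less_top[symmetric])
qed

lemma cth_pos: "0 < cth \<theta>"
proof -
 let ?c = "min (1 powr (- 2*\<theta> - 1)) (2 powr (- 2*\<theta> - 1)) :: real"
 have "(\<integral>\<^sup>+t. ennreal ?c*indicator {1..2::real} t \<partial>lborel) \<le> cth \<theta>"
  unfolding cth_def J_def
 proof (intro nn_integral_mono)
  fix t :: real
  have "?c \<le> min 1 (t^2)*t powr (- 2*\<theta> - 1)" if t: "1 \<le> t" "t \<le> 2"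
  proof -
   have "?c \<le> t powr (- 2*\<theta> - 1)"
   proof (cases "- 2*\<theta> - 1 \<ge> 0")
    case True
    hence "1 powr (- 2*\<theta> - 1) \<le> t powr (- 2*\<theta> - 1)" using t by (intro powr_mono2) auto
    thus ?thesis by linarith
   next
    case False
    hence "2 powr (- 2*\<theta> - 1) \<le> t powr (- 2*\<theta> - 1)" using t by (intro powr_mono2') auto
    thus ?thesis by linarith
   qed
   moreover have "min 1 (t^2) = 1" using t by (simp add: min_def)
   ultimately show ?thesis by simp
  qed
  thus "ennreal ?c*indicator {1..2} t \<le> ennreal (min 1 (t^2)*t powr (- 2*\<theta> - 1))*indicator {0<..} t"
   by (auto simp: indicator_def intro!: ennreal_leI)
 qed
 moreover have "(\<integral>\<^sup>+t. ennreal ?c*indicator {1..2::real} t \<partial>lborel) = ennreal ?c"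
  by (subst nn_integral_cmult_indicator) auto
 moreover have "0 < ennreal ?c" by simp
 ultimately show ?thesis by (metis less_le_trans)
qed

lemma min_sq_meas: "pos_part (\<lambda>t. min 1 (t^2*m)) \<in> borel_measurable borel"
 by measurable

text \<open>Replacing \<open>t\<close> by \<open>c*t\<close> with \<open>c^2*m = 1\<close> moves the
  kink to 1. The spectral weight \<open>m powr \<theta>\<close> originates here.\<close>

lemma J_min_scale:
 assumes m: "0 < m" shows "J \<theta> (\<lambda>t. min 1 (t^2*m)) = ennreal (m powr \<theta>)*cth \<theta>"
proof -
 define c where "c = 1/sqrt m"
 have c: "c > 0" "c^2*m = 1" using m by (auto simp: c_def power_divide)
 have "J \<theta> (\<lambda>t. min 1 (t^2*m)) = ennreal \<bar>c\<bar>*(\<integral>\<^sup>+t. ennreal (min 1 ((0 + c*t)^2*m)*(0 + c*t) powr (- 2*\<theta> - 1))*indicator {0<..} (0 + c*t) \<partial>lborel)"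
  unfolding J_def using c by (intro nn_integral_real_affine) auto
 also have "(\<lambda>t. ennreal (min 1 ((0 + c*t)^2*m)*(0 + c*t) powr (- 2*\<theta> - 1))*indicator {0<..} (0 + c*t)) =
   (\<lambda>t. ennreal (c powr (- 2*\<theta> - 1))*(ennreal (min 1 (t^2)*t powr (- 2*\<theta> - 1))*indicator {0<..} t))"
 proof
  fix t :: real
  have "(c*t)^2*m = t^2" using c(2) by (simp add: power_mult_distrib mult_ac)
  thus "ennreal (min 1 ((0 + c*t)^2*m)*(0 + c*t) powr (- 2*\<theta> - 1))*indicator {0<..} (0 + c*t) =
   ennreal (c powr (- 2*\<theta> - 1))*(ennreal (min 1 (t^2)*t powr (- 2*\<theta> - 1))*indicator {0<..} t)"
   using c(1) by (auto simp: indicator_def powr_mult zero_less_mult_iff ennreal_mult'[symmetric] mult_ac)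
 qed
 also have "(\<integral>\<^sup>+t. ennreal (c powr (- 2*\<theta> - 1))*(ennreal (min 1 (t^2)*t powr (- 2*\<theta> - 1))*indicator {0<..} t) \<partial>lborel) = ennreal (c powr (- 2*\<theta> - 1))*cth \<theta>"
  unfolding cth_def J_def by (rule nn_integral_cmult) auto
 also have "ennreal \<bar>c\<bar>*(ennreal (c powr (- 2*\<theta> - 1))*cth \<theta>) = ennreal (c*c powr (- 2*\<theta> - 1))*cth \<theta>"
  using c(1) by (simp add: ennreal_mult mult.assoc)
 also have "c*c powr (- 2*\<theta> - 1) = m powr \<theta>"
 proof -
  have "c = m powr (- 1/2)" using m by (simp add: c_def powr_minus_divide powr_half_sqrt)
  hence "c powr (- 2*\<theta>) = m powr \<theta>" by (simp add: powr_powr)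
  moreover have "c*c powr (- 2*\<theta> - 1) = c powr (- 2*\<theta>)"
   using powr_add[of c 1 "- 2*\<theta> - 1"] c(1) by simp
  ultimately show ?thesis by simp
 qed
 finally show ?thesis .
qed

section \<open>K-functionals between L2 and a space of edgewise H^1 functions\<close>

context mgr
begin

abbreviation KK :: "'e gfn set => real => 'e gfn => real" where
 "KK A t u \<equiv> K_functional (L2 G) (nL) A (nH) t u"

abbreviation NQ :: "real => 'e gfn set => 'e gfn => ennreal" where
 "NQ \<theta> A u \<equiv> interp_nsq \<theta> (L2 G) (nL) A (nH) u"

text \<open>Containing 0 makes every function of L2 decomposable; lying in \<open>H1E\<close> keeps
  both summands in L2.\<close>

definition gd :: "'e gfn set => bool" where "gd A \<longleftrightarrow> A \<subseteq> H1E \<and> 0 \<in> A"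

lemma gd_spaces: "gd (H1E)" "gd Cont1" "gd (Dir1 VD)" "gd (Flux1 VK)"
 using H1_zero(1) Cont1_zero Dir1_zero Flux1_zero Cont1_H1 Dir1_H1 Flux1_H1 by (auto simp: gd_def simp del: One_nat_def)

lemma K_bdd: "0 \<le> t ==> bdd_below {nL v + t*nH w |v w. v \<in> L2 G \<and> w \<in> A \<and> u = v + w}"
 by (intro bdd_belowI[of _ 0]) (auto simp del: One_nat_def)

lemma K_le: "0 \<le> t ==> v \<in> L2 G ==> w \<in> A ==> KK A t (v + w) \<le> nL v + t*nH w"
 unfolding K_functional_def by (intro cInf_lower K_bdd) blast

lemma K_greatest:
 assumes "u \<in> L2 G" "gd A"
  and "\<And>v w. v \<in> L2 G ==> w \<in> A ==> u = v + w ==> z \<le> nL v + t*nH w"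
 shows "z \<le> KK A t u"
 unfolding K_functional_def
proof (rule cInf_greatest)
 have "u = u + 0" by simp
 thus "{nL v + t*nH w |v w. v \<in> L2 G \<and> w \<in> A \<and> u = v + w} \<noteq> {}"
  using assms(1,2) unfolding gd_def by blast
qed (use assms(3) in auto)

lemma K_nonneg: "u \<in> L2 G ==> gd A ==> 0 \<le> t ==> 0 \<le> KK A t u"
 by (rule K_greatest) (auto simp del: One_nat_def)

lemma H1_norm_zero: "nH 0 = 0"
 using H1_norm_scl[OF H1_zero(1), of 0] by (simp add: zero_fun_def del: One_nat_def)

lemma K_le_norm: "u \<in> L2 G ==> gd A ==> 0 \<le> t ==> KK A t u \<le> nL u"
 using K_le[of t u 0 A] H1_norm_zero by (simp add: gd_def del: One_nat_def)

lemma K_mono: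
 assumes u: "u \<in> L2 G" and A: "gd A" and st: "0 \<le> s" "s \<le> t" shows "KK A s u \<le> KK A t u"
proof (rule K_greatest[OF u A])
 fix v w assume vw: "v \<in> L2 G" "w \<in> A" "u = v + w"
 have "KK A s u \<le> nL v + s*nH w" using K_le[OF st(1) vw(1,2)] vw(3) by simp
 also have "... \<le> nL v + t*nH w" using st H1_norm_nonneg[of w] by (intro add_left_mono mult_right_mono)
 finally show "KK A s u \<le> nL v + t*nH w" .
qed

text \<open>Carries a quadratic bound, valid for every decomposition, through the infimum. The
  infimum runs over sums of norms and not of squares, so a square root is taken first.\<close>

lemma K_sq_greatest:
 assumes u: "u \<in> L2 G" and A: "gd A" and C: "0 < C" and t: "0 \<le> t"
  and le: "\<And>v w. v \<in> L2 G ==> w \<in> A ==> u = v + w ==> z \<le> C*(nL v + t*nH w)^2"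
 shows "z \<le> C*(KK A t u)^2"
proof (cases "z \<le> 0")
 case True
 thus ?thesis using C by (smt (verit) mult_nonneg_nonneg zero_le_power2)
next
 case False
 have "sqrt (z/C) \<le> KK A t u"
 proof (rule K_greatest[OF u A])
  fix v w assume vw: "v \<in> L2 G" "w \<in> A" "u = v + w"
  have "z/C \<le> (nL v + t*nH w)^2" using le[OF vw] C by (simp add: field_simps del: One_nat_def)
  thus "sqrt (z/C) \<le> nL v + t*nH w"
   using t H1_norm_nonneg[of w] by (intro real_le_lsqrt) (auto simp del: One_nat_def)
 qed
 hence "(sqrt (z/C))^2 \<le> (KK A t u)^2" using False C by (intro power_mono) auto
 thus ?thesis using False C by (simp add: field_simps)
qed

lemma K_sq_le:
 assumes t: "0 \<le> t" and A: "gd A" and v: "v \<in> L2 G" and w: "w \<in> A"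
 shows "(KK A t (v + w))^2 \<le> 2*(nL v)^2 + 2*t^2*(nH w)^2"
proof -
 have w1: "w \<in> L2 G" using A w H1_L2 unfolding gd_def by blast
 have "(KK A t (v + w))^2 \<le> (nL v + t*nH w)^2"
  using K_le[OF t v w] K_nonneg[OF L2_add[OF v w1] A t] by (intro power_mono) auto
 also have "... \<le> 2*(nL v)^2 + 2*(t*nH w)^2"
  using sum_squares_bound[of "nL v" "t*nH w"] by (simp add: power2_sum del: One_nat_def)
 finally show ?thesis by (simp add: power_mult_distrib del: One_nat_def)
qed

lemma K_meas:
 assumes "u \<in> L2 G" "gd A"
 shows "pos_part (\<lambda>t. KK A t u) \<in> borel_measurable borel" "pos_part (\<lambda>t. (KK A t u)^2) \<in> borel_measurable borel"
proof -
 have "mono (pos_part (\<lambda>t. KK A t u))"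
  using K_mono[OF assms] K_nonneg[OF assms] by (intro monoI) auto
 thus m: "pos_part (\<lambda>t. KK A t u) \<in> borel_measurable borel" by (rule borel_measurable_mono)
 have "pos_part (\<lambda>t. (KK A t u)^2) = (\<lambda>t. (pos_part (\<lambda>t. KK A t u) t)^2)" by auto
 thus "pos_part (\<lambda>t. (KK A t u)^2) \<in> borel_measurable borel" using m by simp
qed

lemma NQ_J: "NQ \<theta> A u = J \<theta> (\<lambda>t. (KK A t u)^2)"
 unfolding interp_nsq_def J_def
proof (intro nn_integral_cong)
 fix t :: real
 have "(t powr (- \<theta>)*KK A t u)^2/t = (KK A t u)^2*t powr (- 2*\<theta> - 1)" if "t > 0"
 proof -
  have "(t powr (- \<theta>))^2 = t powr (- 2*\<theta>)" by (simp add: power2_eq_square powr_add[symmetric])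
  moreover have "t powr (- 2*\<theta> - 1) = t powr (- 2*\<theta>)/t" using that by (simp add: powr_diff)
  ultimately show ?thesis by (simp add: power_mult_distrib)
 qed
 thus "ennreal ((t powr (- \<theta>)*KK A t u)^2/t)*indicator {0<..} t = ennreal ((KK A t u)^2*t powr (- 2*\<theta> - 1))*indicator {0<..} t"
  by (auto simp: indicator_def)
qed

lemma J_le_combine:
 assumes u: "u \<in> L2 G" and A: "gd A" and C: "0 \<le> C" and D: "0 \<le> D"
  and le: "\<And>t. 0 < t ==> F t \<le> C*(KK A t u)^2 + D*min 1 (t^2)"
 shows "J \<theta> F \<le> ennreal C*NQ \<theta> A u + ennreal D*cth \<theta>"
proof -
 have m: "pos_part (\<lambda>t. min 1 (t^2)) \<in> borel_measurable borel" by measurable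
 have m1: "pos_part (\<lambda>t. C*(KK A t u)^2) \<in> borel_measurable borel"
 proof -
  have "pos_part (\<lambda>t. C*(KK A t u)^2) = (\<lambda>t. C*pos_part (\<lambda>t. (KK A t u)^2) t)" by auto
  thus ?thesis using K_meas(2)[OF u A] by simp
 qed
 have m2: "pos_part (\<lambda>t. D*min 1 (t^2)) \<in> borel_measurable borel" by measurable
 have "J \<theta> F \<le> J \<theta> (\<lambda>t. C*(KK A t u)^2 + D*min 1 (t^2))" by (rule J_mono[OF le])
 also have "... = J \<theta> (\<lambda>t. C*(KK A t u)^2) + J \<theta> (\<lambda>t. D*min 1 (t^2))"
  by (rule J_add[OF m1 m2]) (use C D in auto)
 also have "... = ennreal C*NQ \<theta> A u + ennreal D*cth \<theta>"
  unfolding J_cmult[OF K_meas(2)[OF u A] C] J_cmult[OF m D] NQ_J cth_def ..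
 finally show ?thesis .
qed

lemma NQ_le:
 assumes "u \<in> L2 G" "gd A" "0 \<le> C" "0 \<le> D"
  and "\<And>t. 0 < t ==> (KK A' t u')^2 \<le> C*(KK A t u)^2 + D*min 1 (t^2)"
 shows "NQ \<theta> A' u' \<le> ennreal C*NQ \<theta> A u + ennreal D*cth \<theta>"
 unfolding NQ_J[of \<theta> A' u'] by (rule J_le_combine[OF assms])

text \<open>The triangle inequality for a decomposition survives multiplication by
  \<open>min 1 t\<close>. Integrated, it lets the interpolation norm absorb the terms with
  \<open>(nL u)^2\<close> and \<open>min 1 (t^2)\<close> that appear below.\<close>

lemma K_lower:
 assumes u: "u \<in> L2 G" and A: "gd A" and t: "0 < t" shows "min 1 (t^2)*(nL u)^2 \<le> (KK A t u)^2"
proof -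
 have "min 1 t*nL u \<le> KK A t u"
 proof (rule K_greatest[OF u A])
  fix v w assume vw: "v \<in> L2 G" "w \<in> A" "u = v + w"
  have w1: "w \<in> L2 G" using A vw H1_L2 unfolding gd_def by blast
  have "min 1 t*nL u \<le> min 1 t*(nL v + nL w)"
   using L2_norm_add[OF vw(1) w1] vw(3) t by (intro mult_left_mono) auto
  also have "... \<le> nL v + t*nL w"
   unfolding distrib_left using t L2_norm_nonneg[of v] L2_norm_nonneg[of w]
   by (intro add_mono mult_right_mono) (auto simp: mult_left_le_one_le)
  also have "... \<le> nL v + t*nH w" using L2_le_H1(1)[of w] t by (intro add_left_mono mult_left_mono) auto
  finally show "min 1 t*nL u \<le> nL v + t*nH w" .
 qed
 hence "(min 1 t*nL u)^2 \<le> (KK A t u)^2" using t by (intro power_mono) auto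
 moreover have "(min 1 t)^2 = min 1 (t^2)"
  using t power_le_one[of t 2] one_le_power[of t 2] by (cases "t \<le> 1") auto
 ultimately show ?thesis by (simp add: power_mult_distrib)
qed

lemma norm_le_NQ:
 assumes "u \<in> L2 G" "gd A" shows "ennreal ((nL u)^2)*cth \<theta> \<le> NQ \<theta> A u"
proof -
 have m: "pos_part (\<lambda>t. min 1 (t^2)) \<in> borel_measurable borel" by measurable
 have "ennreal ((nL u)^2)*cth \<theta> = J \<theta> (\<lambda>t. (nL u)^2*min 1 (t^2))"
  unfolding cth_def by (rule J_cmult[OF m, symmetric]) simp
 also have "... \<le> NQ \<theta> A u"
  unfolding NQ_J by (rule J_mono) (use K_lower[OF assms] in \<open>simp add: mult.commute\<close>)
 finally show ?thesis .
qed

text \<open>A larger second space offers more decompositions.\<close>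

lemma K_anti: "u \<in> L2 G ==> gd A ==> A \<subseteq> A' ==> gd A' ==> 0 \<le> t ==> KK A' t u \<le> KK A t u"
proof (rule K_greatest)
 fix v w assume "A \<subseteq> A'" "0 \<le> t" "v \<in> L2 G" "w \<in> A" "u = v + w"
 thus "KK A' t u \<le> nL v + t*nH w" using K_le[of t v w A'] by auto
qed

lemma NQ_anti: "u \<in> L2 G ==> gd A ==> A \<subseteq> A' ==> gd A' ==> NQ \<theta> A' u \<le> NQ \<theta> A u"
 unfolding NQ_J by (intro J_mono power_mono K_anti K_nonneg) auto

lemma interp_space_iff: "gd A ==> u \<in> interp_space \<theta> (L2 G) (nL) A (nH) \<longleftrightarrow> u \<in> L2 G \<and> NQ \<theta> A u < \<infinity>"
proof -
 assume A: "gd A"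
 have "{v + w |v w. v \<in> L2 G \<and> w \<in> A} = L2 G"
 proof (intro set_eqI iffI)
  fix x assume "x \<in> {v + w |v w. v \<in> L2 G \<and> w \<in> A}"
  thus "x \<in> L2 G" using A H1_L2 L2_add unfolding gd_def by blast
 next
  fix x assume "x \<in> L2 G"
  moreover have "x = x + 0" by simp
  ultimately show "x \<in> {v + w |v w. v \<in> L2 G \<and> w \<in> A}" using A unfolding gd_def by blast
 qed
 thus ?thesis unfolding interp_space_def by auto
qed

end

section \<open>K-functionals in terms of eigenfunction coefficients\<close>

context eigl
begin

lemma mu_nonneg: "0 \<le> \<mu> i"
 using mu_pos[of i] by simp

text \<open>Up to constants, the squared K-functional of a weighted couple of sequence spaces: the
  better summand for coefficient \<open>i\<close> is decided by whether \<open>t^2*\<mu> i\<close>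
  exceeds 1.\<close>

definition Qs :: "(nat => real) => real => real" where
 "Qs b t = (\<Sum>i. min 1 (t^2*\<mu> i)*b i)"

lemma Qs_summable:
 assumes "\<And>i. 0 \<le> b i" "summable b" shows "summable (\<lambda>i. min 1 (t^2*\<mu> i)*b i)"
proof (rule summable_comparison_test'[OF assms(2)])
 fix i
 have "0 \<le> min 1 (t^2*\<mu> i)" using mu_pos[of i] by simp
 thus "norm (min 1 (t^2*\<mu> i)*b i) \<le> b i"
  using assms(1)[of i] by (auto simp: abs_mult intro!: mult_left_le_one_le)
qed

text \<open>Interchanging sum and integral reduces to a single frequency, where
  \<open>J_min_scale\<close> applies. The identity holds in \<open>ennreal\<close>, so finiteness of
  the right-hand side need not be known beforehand.\<close>

lemma Qs_J:
 assumes b: "\<And>i. 0 \<le> b i" "summable b"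
 shows "J \<theta> (Qs b) = cth \<theta>*(\<Sum>i. ennreal (\<mu> i powr \<theta>*b i))"
proof -
 have nn: "0 \<le> min 1 (t^2*\<mu> i)*b i" for t i using b(1)[of i] mu_pos[of i] by simp
 have "J \<theta> (Qs b) = (\<integral>\<^sup>+t. (\<Sum>i. ennreal (b i*min 1 (t^2*\<mu> i)*t powr (- 2*\<theta> - 1))*indicator {0<..} t) \<partial>lborel)"
  unfolding J_def
 proof (intro nn_integral_cong)
  fix t :: real
  have "ennreal (Qs b t*t powr (- 2*\<theta> - 1)) = (\<Sum>i. ennreal (min 1 (t^2*\<mu> i)*b i*t powr (- 2*\<theta> - 1)))"
   unfolding Qs_def using Qs_summable[OF b, of t] nn
   by (subst suminf_mult2) (auto intro!: suminf_ennreal2[symmetric] summable_mult2)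
  thus "ennreal (Qs b t*t powr (- 2*\<theta> - 1))*indicator {0<..} t = (\<Sum>i. ennreal (b i*min 1 (t^2*\<mu> i)*t powr (- 2*\<theta> - 1))*indicator {0<..} t)"
   by (simp add: mult.commute[of "b _"])
 qed
 also have "... = (\<Sum>i. \<integral>\<^sup>+t. ennreal (b i*min 1 (t^2*\<mu> i)*t powr (- 2*\<theta> - 1))*indicator {0<..} t \<partial>lborel)"
  by (rule nn_integral_suminf) measurable
 also have "... = (\<Sum>i. cth \<theta>*ennreal (\<mu> i powr \<theta>*b i))"
 proof (rule arg_cong[where f = suminf], rule ext)
  fix i
  have "(\<integral>\<^sup>+t. ennreal (b i*min 1 (t^2*\<mu> i)*t powr (- 2*\<theta> - 1))*indicator {0<..} t \<partial>lborel) = J \<theta> (\<lambda>t. b i*min 1 (t^2*\<mu> i))"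
   by (simp add: J_def)
  also have "... = ennreal (b i)*(ennreal (\<mu> i powr \<theta>)*cth \<theta>)"
   unfolding J_cmult[OF min_sq_meas b(1)] J_min_scale[OF mu_pos] ..
  finally show "(\<integral>\<^sup>+t. ennreal (b i*min 1 (t^2*\<mu> i)*t powr (- 2*\<theta> - 1))*indicator {0<..} t \<partial>lborel) = cth \<theta>*ennreal (\<mu> i powr \<theta>*b i)"
   using b(1)[of i] by (simp add: ennreal_mult mult_ac)
 qed
 also have "... = cth \<theta>*(\<Sum>i. ennreal (\<mu> i powr \<theta>*b i))" by simp
 finally show ?thesis .
qed

text \<open>Each decomposition uses finitely many frequencies, those with index below
  \<open>n\<close> and \<open>t^2*\<mu> i \<le> 1\<close>; the bound by \<open>Qs\<close> is the
  limit over \<open>n\<close>. No ordering of the eigenvalues is assumed.\<close>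

lemma Qs_upper:
 assumes b: "\<And>i. 0 \<le> b i" "summable b"
  and le: "\<And>n. z \<le> C*((\<Sum>i. b i) - (\<Sum>i<n. if t^2*\<mu> i \<le> 1 then b i else 0) + t^2*(\<Sum>i<n. if t^2*\<mu> i \<le> 1 then \<mu> i*b i else 0))"
 shows "z \<le> C*Qs b t"
proof -
 define f where "f i = b i - min 1 (t^2*\<mu> i)*b i" for i
 have fs: "summable f" unfolding f_def by (intro summable_diff b(2) Qs_summable b)
 have "z \<le> C*((\<Sum>i. b i) - (\<Sum>i<n. f i))" for n
 proof -
  have "(\<Sum>i<n. f i) = (\<Sum>i<n. (if t^2*\<mu> i \<le> 1 then b i else 0) - t^2*(if t^2*\<mu> i \<le> 1 then \<mu> i*b i else 0))"
   by (rule sum.cong) (auto simp: f_def min_def)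
  also have "... = (\<Sum>i<n. if t^2*\<mu> i \<le> 1 then b i else 0) - t^2*(\<Sum>i<n. if t^2*\<mu> i \<le> 1 then \<mu> i*b i else 0)"
   by (simp add: sum_subtractf sum_distrib_left)
  finally have eq: "(\<Sum>i. b i) - (\<Sum>i<n. f i) = (\<Sum>i. b i) - (\<Sum>i<n. if t^2*\<mu> i \<le> 1 then b i else 0) + t^2*(\<Sum>i<n. if t^2*\<mu> i \<le> 1 then \<mu> i*b i else 0)"
   by linarith
  show ?thesis unfolding eq by (rule le)
 qed
 moreover have "(\<lambda>n. C*((\<Sum>i. b i) - (\<Sum>i<n. f i))) \<longlonglongrightarrow> C*((\<Sum>i. b i) - (\<Sum>i. f i))"
  by (intro tendsto_intros summable_LIMSEQ fs)
 ultimately have "z \<le> C*((\<Sum>i. b i) - (\<Sum>i. f i))" using LIMSEQ_le_const by blast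
 also have "(\<Sum>i. b i) - (\<Sum>i. f i) = Qs b t"
  unfolding f_def Qs_def using suminf_diff[OF b(2) Qs_summable[OF b, of t]] by simp
 finally show ?thesis .
qed

lemma Qs_lower:
 assumes b: "\<And>i. 0 \<le> b i" "summable b" and le: "\<And>n. (\<Sum>i<n. min 1 (t^2*\<mu> i)*b i) \<le> z"
 shows "Qs b t \<le> z"
 unfolding Qs_def by (rule suminf_le_const[OF Qs_summable[OF b] le])

text \<open>The coefficients \<open>l\<close> retain the low frequencies among the first
  \<open>n\<close>; the norms of this truncation and of the remainder that enter the K-functionals
  come out as finite sums.\<close>

lemma low_sums:
 fixes t :: real and d :: "nat => real"
 defines "l \<equiv> (\<lambda>i. if t^2*\<mu> i \<le> 1 then d i else 0)"
 shows "u \<in> L2 G ==> d = cf u ==> (nL (u - lin_comb n l \<psi>))^2 = (nL u)^2 - (\<Sum>i<n. if t^2*\<mu> i \<le> 1 then (d i)^2 else 0)"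
  "u \<in> Dir1 VD ==> d = cf u ==> B (u - lin_comb n l \<psi>) (u - lin_comb n l \<psi>) = B u u - (\<Sum>i<n. if t^2*\<mu> i \<le> 1 then \<mu> i*(d i)^2 else 0)"
  "B (lin_comb n l \<psi>) (lin_comb n l \<psi>) = (\<Sum>i<n. if t^2*\<mu> i \<le> 1 then \<mu> i*(d i)^2 else 0)"
  "(nL (Lop (lin_comb n l \<psi>)))^2 = (\<Sum>i<n. if t^2*\<mu> i \<le> 1 then \<mu> i*(\<mu> i*(d i)^2) else 0)"
proof -
 have 1: "(\<Sum>i<n. w i*(l i)^2) = (\<Sum>i<n. if t^2*\<mu> i \<le> 1 then w i*(d i)^2 else 0)" for w
  by (rule sum.cong) (auto simp: l_def)
 have 2: "(\<Sum>i<n. w i*(l i*d i)) = (\<Sum>i<n. if t^2*\<mu> i \<le> 1 then w i*(d i)^2 else 0)" for w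
  by (rule sum.cong) (auto simp: l_def power2_eq_square)
 show "(nL (u - lin_comb n l \<psi>))^2 = (nL u)^2 - (\<Sum>i<n. if t^2*\<mu> i \<le> 1 then (d i)^2 else 0)" if "u \<in> L2 G" "d = cf u"
  using norm_diff_lin_comb[OF that(1), of n l] 1[of "\<lambda>i. 1"] 2[of "\<lambda>i. 1"] that(2) by simp
 show "B (u - lin_comb n l \<psi>) (u - lin_comb n l \<psi>) = B u u - (\<Sum>i<n. if t^2*\<mu> i \<le> 1 then \<mu> i*(d i)^2 else 0)" if "u \<in> Dir1 VD" "d = cf u"
  using B_diff_lin_comb[OF that(1), of n l] 1[of \<mu>] 2[of \<mu>] that(2) by (simp add: mult.assoc)
 show "B (lin_comb n l \<psi>) (lin_comb n l \<psi>) = (\<Sum>i<n. if t^2*\<mu> i \<le> 1 then \<mu> i*(d i)^2 else 0)"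
  unfolding B_lin_comb_self by (rule 1)
 show "(nL (Lop (lin_comb n l \<psi>)))^2 = (\<Sum>i<n. if t^2*\<mu> i \<le> 1 then \<mu> i*(\<mu> i*(d i)^2) else 0)"
  unfolding Lop_lin_comb 1 by (rule sum.cong) (auto simp: power2_eq_square)
qed

text \<open>The low-frequency part is the summand in \<open>Dir1\<close>: coercivity of the form
  bounds its H^1 norm, and the remainder carries the high frequencies in L2.\<close>

lemma K_Dir1_upper:
 assumes u: "u \<in> L2 G" and t: "0 < t"
 shows "(KK (Dir1 VD) t u)^2 \<le> 2*(1 + 1/b0)*Qs (\<lambda>i. (cf u i)^2) t"
proof (rule Qs_upper)
 note P = Parseval[OF u]
 show "summable (\<lambda>i. (cf u i)^2)" using P by (rule sums_summable)
 fix n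
 let ?l = "\<lambda>i. if t^2*\<mu> i \<le> 1 then cf u i else 0"
 let ?S = "lin_comb n ?l \<psi>"
 let ?X = "(nL u)^2 - (\<Sum>i<n. if t^2*\<mu> i \<le> 1 then (cf u i)^2 else 0)"
 let ?Y = "\<Sum>i<n. if t^2*\<mu> i \<le> 1 then \<mu> i*(cf u i)^2 else 0"
 have X: "(nL (u - ?S))^2 = ?X" by (rule low_sums(1)[OF u refl])
 have X0: "0 \<le> ?X" using X by (metis zero_le_power2)
 have Y: "b0*(nH ?S)^2 \<le> ?Y" using B_lower[OF LC(3)[of n ?l]] low_sums(3)[of n t "cf u"] by simp
 have Y0: "0 \<le> ?Y" by (intro sum_nonneg) (auto intro!: mult_nonneg_nonneg mu_nonneg)
 have "(KK (Dir1 VD) t ((u - ?S) + ?S))^2 \<le> 2*(nL (u - ?S))^2 + 2*t^2*(nH ?S)^2"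
  using t by (intro K_sq_le gd_spaces L2_diff u LC) auto
 also have "... \<le> 2*?X + 2*t^2*(?Y/b0)"
  unfolding X using Y b_pos by (intro add_left_mono mult_left_mono) (auto simp: field_simps)
 also have "... = 2*(?X + (1/b0)*(t^2*?Y))" by (simp add: field_simps)
 also have "... \<le> 2*((1 + 1/b0)*?X + (1 + 1/b0)*(t^2*?Y))"
  using X0 Y0 b_pos mult_nonneg_nonneg[of "t^2" ?Y] by (intro mult_left_mono add_mono) (auto simp: distrib_right)
 also have "... = 2*(1 + 1/b0)*(?X + t^2*?Y)" by (simp add: algebra_simps)
 finally show "(KK (Dir1 VD) t u)^2 \<le> 2*(1 + 1/b0)*((\<Sum>i. (cf u i)^2) - (\<Sum>i<n. if t^2*\<mu> i \<le> 1 then (cf u i)^2 else 0) + t^2*?Y)"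
  using sums_unique[OF P] by simp
qed simp

text \<open>In any decomposition the coefficients add. Those of \<open>v\<close> are charged to L2
  by Parseval, those of \<open>w\<close> to H^1 by Bessel's inequality for \<open>B\<close>; in each
  case the weight is bounded by the matching entry of the minimum.\<close>

lemma K_Dir1_lower:
 assumes u: "u \<in> L2 G" and t: "0 < t"
 shows "Qs (\<lambda>i. (cf u i)^2) t \<le> 2*(1 + b1)*(KK (Dir1 VD) t u)^2"
proof (rule Qs_lower)
 note P = Parseval[OF u]
 show "summable (\<lambda>i. (cf u i)^2)" using P by (rule sums_summable)
 fix n
 show "(\<Sum>i<n. min 1 (t^2*\<mu> i)*(cf u i)^2) \<le> 2*(1 + b1)*(KK (Dir1 VD) t u)^2"
 proof (rule K_sq_greatest[OF u gd_spaces(3)])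
  fix v w assume v: "v \<in> L2 G" and w: "w \<in> Dir1 VD" and eq: "u = v + w"
  note w1 = Dir1_H1[OF w]
  have "min 1 (t^2*\<mu> i)*(cf u i)^2 \<le> 2*(cf v i)^2 + 2*t^2*(\<mu> i*(cf w i)^2)" for i
  proof -
   have c: "cf u i = cf v i + cf w i" unfolding eq by (rule inner_add_left[OF v H1_L2[OF w1] psi_D(3)])
   have "(cf u i)^2 \<le> 2*(cf v i)^2 + 2*(cf w i)^2"
    unfolding c using sum_squares_bound[of "cf v i" "cf w i"] by (simp add: power2_sum)
   hence "min 1 (t^2*\<mu> i)*(cf u i)^2 \<le> min 1 (t^2*\<mu> i)*(2*(cf v i)^2) + min 1 (t^2*\<mu> i)*(2*(cf w i)^2)"
    using mu_pos[of i] unfolding distrib_left[symmetric] by (intro mult_left_mono) auto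
   also have "... \<le> 1*(2*(cf v i)^2) + t^2*\<mu> i*(2*(cf w i)^2)"
    by (intro add_mono mult_right_mono) auto
   finally show ?thesis by (simp add: mult_ac)
  qed
  hence "(\<Sum>i<n. min 1 (t^2*\<mu> i)*(cf u i)^2) \<le> (\<Sum>i<n. 2*(cf v i)^2 + 2*t^2*(\<mu> i*(cf w i)^2))"
   by (intro sum_mono)
  also have "... = 2*(\<Sum>i<n. (cf v i)^2) + 2*t^2*(\<Sum>i<n. \<mu> i*(cf w i)^2)"
   by (simp add: sum.distrib sum_distrib_left)
  also have "... \<le> 2*(nL v)^2 + 2*t^2*(b1*(nH w)^2)"
  proof (intro add_mono mult_left_mono)
   show "(\<Sum>i<n. (cf v i)^2) \<le> (nL v)^2"
    using sum_le_suminf[of "\<lambda>i. (cf v i)^2" "{..<n}"] Parseval[OF v] by (simp add: sums_iff)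
   show "(\<Sum>i<n. \<mu> i*(cf w i)^2) \<le> b1*(nH w)^2"
    by (rule order_trans[OF Bessel_B[OF w] B_upper[OF w1]])
  qed auto
  also have "... \<le> 2*(1 + b1)*((nL v)^2 + (t*nH w)^2)"
   using b_pos by (simp add: algebra_simps power_mult_distrib del: One_nat_def)
  also have "... \<le> 2*(1 + b1)*(nL v + t*nH w)^2"
   using b_pos t mult_nonneg_nonneg[OF L2_norm_nonneg[of v] mult_nonneg_nonneg[of t "nH w"]] H1_norm_nonneg[of w]
   by (intro mult_left_mono) (auto simp: power2_sum simp del: One_nat_def)
  finally show "(\<Sum>i<n. min 1 (t^2*\<mu> i)*(cf u i)^2) \<le> 2*(1 + b1)*(nL v + t*nH w)^2" .
 qed (use b_pos t in auto)
qed simp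

text \<open>The low-frequency part lies in \<open>Lp\<close>, so its derivative satisfies the flux
  condition, and the elliptic estimate controls the H^1 norm of that derivative.\<close>

lemma K_Flux1_upper:
 assumes u: "u \<in> Dir1 VD" and t: "0 < t"
 shows "(KK (Flux1 VK) t (DG u))^2 \<le> 2*(1/b0 + Cell^2)*Qs (\<lambda>i. \<mu> i*(cf u i)^2) t"
proof (rule Qs_upper)
 note P = dot1_sums[OF u] and u1 = Dir1_H1[OF u]
 show "summable (\<lambda>i. \<mu> i*(cf u i)^2)" using P by (rule sums_summable)
 show "0 \<le> \<mu> i*(cf u i)^2" for i using mu_pos[of i] by simp
 fix n
 let ?l = "\<lambda>i. if t^2*\<mu> i \<le> 1 then cf u i else 0"
 let ?S = "lin_comb n ?l \<psi>"
 let ?X = "B u u - (\<Sum>i<n. if t^2*\<mu> i \<le> 1 then \<mu> i*(cf u i)^2 else 0)"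
 let ?Y = "\<Sum>i<n. if t^2*\<mu> i \<le> 1 then \<mu> i*(\<mu> i*(cf u i)^2) else 0"
 have X: "(nL (DG u - DG ?S))^2 \<le> ?X/b0"
 proof -
  have "nL (DG u - DG ?S) = nL (DG (u - ?S))"
   by (rule L2_norm_aeq[OF aeq_sym[OF H1_diff(2)[OF u1 LC(3)]]]) (intro L2_diff D_L2 H1_diff u1 LC)+
  also have "... \<le> nH (u - ?S)" by (rule L2_le_H1)
  finally have "(nL (DG u - DG ?S))^2 \<le> (nH (u - ?S))^2" by (intro power_mono) auto
  also have "... \<le> B (u - ?S) (u - ?S)/b0"
   using B_lower[OF H1_diff(1)[OF u1 LC(3)[of n ?l]]] b_pos by (simp add: field_simps del: One_nat_def)
  also have "B (u - ?S) (u - ?S) = ?X" by (rule low_sums(2)[OF u refl])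
  finally show ?thesis .
 qed
 have X0: "0 \<le> ?X" using order_trans[OF zero_le_power2 X] b_pos by (simp add: zero_le_divide_iff)
 have Y: "(nH (DG ?S))^2 \<le> Cell^2*?Y"
 proof -
  have "(nH (DG ?S))^2 \<le> (Cell*nL (Lop ?S))^2"
   by (intro power_mono elliptic LC) (rule H1_norm_nonneg)
  thus ?thesis using low_sums(4)[of n t "cf u"] by (simp add: power_mult_distrib del: One_nat_def)
 qed
 have Y0: "0 \<le> ?Y" by (intro sum_nonneg) (auto intro!: mult_nonneg_nonneg mu_nonneg)
 have "(KK (Flux1 VK) t ((DG u - DG ?S) + DG ?S))^2 \<le> 2*(nL (DG u - DG ?S))^2 + 2*t^2*(nH (DG ?S))^2"
  using t by (intro K_sq_le gd_spaces L2_diff D_L2 u1 LC LpD(2)[OF LC(1)]) auto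
 also have "... \<le> 2*(?X/b0) + 2*t^2*(Cell^2*?Y)"
  by (intro add_mono mult_left_mono X Y) auto
 also have "... = 2*((1/b0)*?X + Cell^2*(t^2*?Y))" by (simp add: field_simps)
 also have "... \<le> 2*((1/b0 + Cell^2)*?X + (1/b0 + Cell^2)*(t^2*?Y))"
  using X0 Y0 b_pos by (intro mult_left_mono add_mono mult_right_mono) auto
 also have "... = 2*(1/b0 + Cell^2)*(?X + t^2*?Y)" by (simp add: algebra_simps)
 finally show "(KK (Flux1 VK) t (DG u))^2 \<le> 2*(1/b0 + Cell^2)*((\<Sum>i. \<mu> i*(cf u i)^2) - (\<Sum>i<n. if t^2*\<mu> i \<le> 1 then \<mu> i*(cf u i)^2 else 0) + t^2*?Y)"
  using sums_unique[OF P] by simp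
qed

text \<open>By duality: with \<open>S\<close> as below, \<open>X\<close> is both the pairing of
  \<open>mlt a v\<close> with \<open>DG S\<close> and the energy \<open>B S S\<close>, so
  Cauchy-Schwarz and coercivity give a quadratic inequality for \<open>X\<close>.\<close>

lemma Bessel_dual:
 assumes v: "v \<in> L2 G"
 shows "(\<Sum>i<n. (ip (mlt a v) (DG (\<psi> i)))^2/\<mu> i) \<le> a1^2/b0*(nL v)^2"
proof -
 define p where "p i = ip (mlt a v) (DG (\<psi> i))" for i
 define X where "X = (\<Sum>i<n. (p i)^2/\<mu> i)"
 define S where "S = lin_comb n (\<lambda>i. p i/\<mu> i) \<psi>"
 note av = mlt_a_L2[OF v]
 have S1: "S \<in> H1E" unfolding S_def by (rule LC)
 have "aeq G (DG S) (lin_comb n (\<lambda>i. p i/\<mu> i) (\<lambda>i. DG (\<psi> i)))"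
  unfolding S_def by (rule H1_lin_comb(2)[OF psi_D(2)])
 from inner_aeq[OF this D_L2[OF S1] L2_lin_comb[OF D_L2[OF psi_D(2)]] av(1)]
 have "ip (DG S) (mlt a v) = ip (lin_comb n (\<lambda>i. p i/\<mu> i) (\<lambda>i. DG (\<psi> i))) (mlt a v)" .
 also have "... = (\<Sum>i<n. p i/\<mu> i*ip (DG (\<psi> i)) (mlt a v))"
  by (rule inner_lin_comb_left[OF av(1) D_L2[OF psi_D(2)]])
 also have "... = X"
  unfolding X_def by (rule sum.cong) (simp_all add: inner_sym[of "DG (\<psi> _)"] p_def[symmetric] power2_eq_square)
 finally have "X = ip (DG S) (mlt a v)" by simp
 also have "... \<le> nL (DG S)*nL (mlt a v)" using inner_CS[OF D_L2[OF S1] av(1)] by linarith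
 also have "... \<le> nH S*(a1*nL v)"
  using L2_le_H1(2)[of S] av(2) H1_norm_nonneg[of S] by (intro mult_mono) auto
 finally have 1: "X \<le> nH S*(a1*nL v)" .
 have X0: "0 \<le> X" unfolding X_def by (intro sum_nonneg) (auto intro!: divide_nonneg_nonneg mu_nonneg)
 have "B S S = X" unfolding S_def B_lin_comb_self X_def
 proof (rule sum.cong[OF refl])
  fix i show "\<mu> i*(p i/\<mu> i)^2 = (p i)^2/\<mu> i" using mu_pos[of i] by (simp add: power2_eq_square field_simps)
 qed
 hence 2: "b0*(nH S)^2 \<le> X" using B_lower[OF S1] by simp
 have "X^2 \<le> (nH S*(a1*nL v))^2" using 1 X0 by (rule power_mono)
 also have "... = (nH S)^2*(a1^2*(nL v)^2)" by (simp add: power_mult_distrib del: One_nat_def)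
 also have "... \<le> X/b0*(a1^2*(nL v)^2)" using 2 b_pos by (intro mult_right_mono) (auto simp: field_simps simp del: One_nat_def)
 finally have "X*X \<le> X*(a1^2/b0*(nL v)^2)" by (simp add: power2_eq_square mult_ac)
 hence "X \<le> a1^2/b0*(nL v)^2"
 proof (cases "X = 0")
  case False
  hence "0 < X" using X0 by simp
  with \<open>X*X \<le> X*(a1^2/b0*(nL v)^2)\<close> show ?thesis by (rule mult_left_le_imp_le)
 qed (use b_pos in simp)
 thus ?thesis by (simp add: X_def p_def)
qed

text \<open>The 3 here and in \<open>CD\<close> comes from squaring a sum of three terms;
  \<open>1 + 1/k0\<close> in \<open>CD\<close> bounds \<open>min 1 (t^2*\<mu> i)/\<mu> i\<close> by
  a multiple of \<open>min 1 (t^2)\<close>.\<close>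

definition CF :: real where "CF = 3*(a1^2/b0 + (a1 + a2)^2)"
definition CD :: real where "CD = 3*((1 + 1/k0) * k1^2)"

lemma CFD: "0 < CF" "0 < CD"
 unfolding CF_def CD_def using const_pos b_pos k0 by (auto intro!: add_pos_nonneg mult_pos_pos divide_pos_pos add_pos_pos)

text \<open>\<open>\<mu> i*cf u i\<close> is \<open>B u (\<psi> i)\<close>. For
  \<open>DG u = v + w\<close> it splits into the zero order term \<open>pp\<close>, the pairing
  \<open>qq\<close> of \<open>v\<close> with the derivative of the eigenfunction, and
  \<open>rr\<close>, where Green's formula moves the derivative onto \<open>w\<close> thanks to the
  flux condition. The term \<open>pp\<close> cannot be charged to \<open>DG u\<close> and leaves the
  remainder with \<open>CD\<close>.\<close>

lemma K_Flux1_lower: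
 assumes u: "u \<in> Dir1 VD" and t: "0 < t"
 shows "Qs (\<lambda>i. \<mu> i*(cf u i)^2) t \<le> CF*(KK (Flux1 VK) t (DG u))^2 + CD*(nL u)^2*min 1 (t^2)"
proof (rule Qs_lower)
 note P = dot1_sums[OF u] and u1 = Dir1_H1[OF u]
 show "summable (\<lambda>i. \<mu> i*(cf u i)^2)" using P by (rule sums_summable)
 show "0 \<le> \<mu> i*(cf u i)^2" for i using mu_pos[of i] by simp
 fix n
 have "(\<Sum>i<n. min 1 (t^2*\<mu> i)*(\<mu> i*(cf u i)^2)) - CD*(nL u)^2*min 1 (t^2) \<le> CF*(KK (Flux1 VK) t (DG u))^2"
 proof (rule K_sq_greatest[OF D_L2[OF u1] gd_spaces(4)])
  fix v w assume v: "v \<in> L2 G" and w: "w \<in> Flux1 VK" and eq: "DG u = v + w"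
  note w1 = Flux1_H1[OF w] and F = Flux1_mlt_a[OF w]
  have aw: "mlt a w \<in> H1E" "aeq G (DG (mlt a w)) (mlt a' w + mlt a (DG w))"
   by (rule Flux1_H1[OF F], rule H1_mlt(2)[OF w1 a_abscont])
  define pp where "pp i = cf (mlt q u) i" for i
  define qq where "qq i = ip (mlt a v) (DG (\<psi> i))" for i
  define rr where "rr i = cf (DG (mlt a w)) i" for i
  have split: "\<mu> i*cf u i = pp i + qq i - rr i" for i
  proof -
   have "ip (mlt a w) (DG (\<psi> i)) = - rr i"
    using Green[OF psi_D(1) F VKD, of i] by (simp add: rr_def inner_sym[of "\<psi> i"] inner_sym[of "DG (\<psi> i)"])
   moreover have "ip (mlt a (DG u)) (DG (\<psi> i)) = qq i + ip (mlt a w) (DG (\<psi> i))"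
    unfolding eq mlt_add qq_def by (intro inner_add_left mlt_a_L2 v H1_L2[OF w1] D_L2 psi_D)
   ultimately show ?thesis using B_psi[OF u, of i] by (simp add: B_def pp_def)
  qed
  have p: "(\<Sum>i<n. (pp i)^2) \<le> k1^2*(nL u)^2"
  proof -
   have "(\<Sum>i<n. (pp i)^2) \<le> (nL (mlt q u))^2"
    using sum_le_suminf[of "\<lambda>i. (pp i)^2" "{..<n}"] Parseval[OF mlt_q_L2(1)[OF H1_L2[OF u1]]] by (simp add: sums_iff pp_def)
   also have "... \<le> (k1*nL u)^2" by (intro power_mono mlt_q_L2 H1_L2 u1) simp
   finally show ?thesis by (simp add: power_mult_distrib)
  qed
  have r: "(\<Sum>i<n. (rr i)^2) \<le> (a1 + a2)^2*(nH w)^2"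
  proof -
   have 1: "(\<Sum>i<n. (rr i)^2) \<le> (nL (DG (mlt a w)))^2"
    using sum_le_suminf[of "\<lambda>i. (rr i)^2" "{..<n}"] Parseval[OF D_L2[OF aw(1)]] by (simp add: sums_iff rr_def)
   have "nL (DG (mlt a w)) = nL (mlt a' w + mlt a (DG w))"
    by (rule L2_norm_aeq[OF aw(2)]) (intro D_L2 aw L2_add mlt_a'_L2 mlt_a_L2 H1_L2 w1)+
   also have "... \<le> nL (mlt a' w) + nL (mlt a (DG w))"
    by (intro L2_norm_add mlt_a'_L2 mlt_a_L2 H1_L2 D_L2 w1)
   also have "... \<le> a2*nL w + a1*nL (DG w)"
    by (intro add_mono mlt_a'_L2 mlt_a_L2 H1_L2 D_L2 w1)
   also have "... \<le> a2*nH w + a1*nH w"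
    using L2_le_H1[of w] const_pos by (intro add_mono mult_left_mono) auto
   also have "... = (a1 + a2)*nH w" by (simp add: algebra_simps)
   finally have "(nL (DG (mlt a w)))^2 \<le> ((a1 + a2)*nH w)^2"
    by (intro power_mono) auto
   thus ?thesis using 1 by (simp add: power_mult_distrib del: One_nat_def)
  qed
  have qd: "(\<Sum>i<n. (qq i)^2/\<mu> i) \<le> a1^2/b0*(nL v)^2"
   unfolding qq_def by (rule Bessel_dual[OF v])
  define m where "m = (1 + 1/k0)*min 1 (t^2)"
  have term_le: "min 1 (t^2*\<mu> i)*(\<mu> i*(cf u i)^2) \<le> 3*(m*(pp i)^2 + (qq i)^2/\<mu> i + t^2*(rr i)^2)" for i
  proof -
   have mp: "0 < \<mu> i" by (rule mu_pos)
   \<comment> \<open>Dividing the weight by \<open>\<mu> i\<close> makes the square of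
     \<open>\<mu> i*cf u i\<close> appear; \<open>k\<close> is then bounded in three ways, one for
     each of the three terms.\<close>
   define k where "k = min 1 (t^2*\<mu> i)/\<mu> i"
   have k0': "0 \<le> k" "k \<le> 1/\<mu> i" "k \<le> t^2" using mp t by (auto simp: k_def field_simps min_def)
   have km: "k \<le> m"
   proof -
    have "1/\<mu> i \<le> 1/k0" using mu_ge[of i] k0 by (intro divide_left_mono) auto
    hence "k \<le> 1/k0" using k0'(2) by linarith
    show ?thesis
    proof (cases "t^2 \<le> 1")
     case True
     have "t^2 \<le> (1 + 1/k0)*t^2" using k0 by (simp add: algebra_simps)
     thus ?thesis unfolding m_def using k0'(3) True by (simp add: min_def)
    next
     case False
     thus ?thesis unfolding m_def using \<open>k \<le> 1/k0\<close> by (simp add: min_def)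
    qed
   qed
   have "min 1 (t^2*\<mu> i)*(\<mu> i*(cf u i)^2) = k*(\<mu> i*cf u i)^2"
    using mp by (simp add: k_def power2_eq_square)
   also have "... \<le> k*(3*((pp i)^2 + (qq i)^2 + (rr i)^2))"
   proof (intro mult_left_mono k0')
    have "(x + y - z)^2 \<le> 3*(x^2 + y^2 + z^2)" for x y z :: real
    proof -
     have "0 \<le> (x - y)^2 + (x + z)^2 + (y + z)^2" by simp
     thus ?thesis by (simp add: power2_eq_square algebra_simps)
    qed
    thus "(\<mu> i*cf u i)^2 \<le> 3*((pp i)^2 + (qq i)^2 + (rr i)^2)" unfolding split .
   qed
   also have "... = 3*(k*(pp i)^2 + k*(qq i)^2 + k*(rr i)^2)" by (simp add: algebra_simps)
   also have "... \<le> 3*(m*(pp i)^2 + 1/\<mu> i*(qq i)^2 + t^2*(rr i)^2)"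
    using km k0' by (intro mult_left_mono add_mono mult_right_mono) auto
   finally show ?thesis by simp
  qed
  have m0: "0 \<le> m" unfolding m_def using k0 t by simp
  have "(\<Sum>i<n. min 1 (t^2*\<mu> i)*(\<mu> i*(cf u i)^2)) \<le> (\<Sum>i<n. 3*(m*(pp i)^2 + (qq i)^2/\<mu> i + t^2*(rr i)^2))"
   by (intro sum_mono term_le)
  also have "... = 3*(m*(\<Sum>i<n. (pp i)^2) + (\<Sum>i<n. (qq i)^2/\<mu> i) + t^2*(\<Sum>i<n. (rr i)^2))"
   by (simp add: sum.distrib sum_distrib_left)
  also have "... \<le> 3*(m*(k1^2*(nL u)^2) + a1^2/b0*(nL v)^2 + t^2*((a1 + a2)^2*(nH w)^2))"
   using p r qd m0 by (intro mult_left_mono add_mono) auto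
  also have "... = CD*(nL u)^2*min 1 (t^2) + 3*(a1^2/b0*(nL v)^2 + (a1 + a2)^2*(t*nH w)^2)"
   by (simp add: CD_def m_def power_mult_distrib algebra_simps del: One_nat_def)
  also have "... \<le> CD*(nL u)^2*min 1 (t^2) + CF*(nL v + t*nH w)^2"
  proof -
   define x y where "x = nL v" and "y = t*nH w"
   have xy: "0 \<le> x" "0 \<le> y" using t H1_norm_nonneg[of w] by (auto simp: x_def y_def simp del: One_nat_def)
   have "x^2 \<le> (x + y)^2" "y^2 \<le> (x + y)^2" using xy by (auto intro: power_mono)
   hence "a1^2/b0*x^2 + (a1 + a2)^2*y^2 \<le> a1^2/b0*(x + y)^2 + (a1 + a2)^2*(x + y)^2"
    using b_pos by (intro add_mono mult_left_mono) auto
   thus ?thesis unfolding CF_def x_def[symmetric] y_def[symmetric] by (simp add: algebra_simps)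
  qed
  finally show "(\<Sum>i<n. min 1 (t^2*\<mu> i)*(\<mu> i*(cf u i)^2)) - CD*(nL u)^2*min 1 (t^2) \<le> CF*(nL v + t*nH w)^2"
   by linarith
 qed (use CFD t in auto)
 thus "(\<Sum>i<n. min 1 (t^2*\<mu> i)*(\<mu> i*(cf u i)^2)) \<le> CF*(KK (Flux1 VK) t (DG u))^2 + CD*(nL u)^2*min 1 (t^2)"
  by linarith
qed

end

section \<open>A discrete Hardy inequality\<close>

text \<open>Convexity of the square with weights \<open>q\<close> and \<open>1 - q\<close>, at the
  points \<open>a\<close> and \<open>s/(1 - q)\<close>.\<close>

lemma convex_sq:
 fixes q a s :: real
 assumes "0 \<le> q" "q < 1" shows "(q*a + s)^2 \<le> q*a^2 + s^2/(1 - q)"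
proof -
 have "(1 - q)*(q*a^2 + s^2/(1 - q) - (q*a + s)^2) = q*((1 - q)*a - s)^2"
  using assms by (simp add: field_simps power2_eq_square)
 also have "... \<ge> 0" using assms by simp
 finally show ?thesis using assms by (simp add: zero_le_mult_iff)
qed

text \<open>The recursion contracts forward in \<open>n\<close>, that is towards the vertex; after
  squaring by \<open>convex_sq\<close> and summing, the term \<open>q*?X\<close> is absorbed on the
  left.\<close>

lemma Hardy_low:
 fixes a k :: "nat => real"
 assumes q: "0 \<le> q" "q < 1" and a: "\<And>n. 0 \<le> a n" and r: "\<And>n. a (Suc n) \<le> q*a n + c * k (Suc n)"
  and s: "summable (\<lambda>n. (k n)^2)"
 shows "(\<Sum>n<N. (a n)^2) \<le> ((a 0)^2 + c^2/(1 - q)*(\<Sum>n. (k n)^2))/(1 - q)"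
proof -
 let ?\<kappa> = "\<Sum>n. (k n)^2" and ?X = "\<Sum>n<N. (a n)^2"
 have "?X \<le> (\<Sum>n<Suc N. (a n)^2)" by simp
 also have "... = (a 0)^2 + (\<Sum>n<N. (a (Suc n))^2)" by (rule sum.lessThan_Suc_shift)
 also have "(\<Sum>n<N. (a (Suc n))^2) \<le> (\<Sum>n<N. q*(a n)^2 + c^2/(1 - q)*(k (Suc n))^2)"
 proof (rule sum_mono)
  fix n
  have "(a (Suc n))^2 \<le> (q*a n + c * k (Suc n))^2" by (intro power_mono r a)
  also have "... \<le> q*(a n)^2 + (c * k (Suc n))^2/(1 - q)" by (rule convex_sq[OF q])
  finally show "(a (Suc n))^2 \<le> q*(a n)^2 + c^2/(1 - q)*(k (Suc n))^2" by (simp add: power_mult_distrib)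
 qed
 also have "... = q*?X + c^2/(1 - q)*(\<Sum>n<N. (k (Suc n))^2)" by (simp add: sum.distrib sum_distrib_left)
 also have "... \<le> q*?X + c^2/(1 - q)*?\<kappa>"
 proof (intro add_left_mono mult_left_mono)
  have "(\<Sum>n<N. (k (Suc n))^2) \<le> (\<Sum>n<Suc N. (k n)^2)" by (subst sum.lessThan_Suc_shift) simp
  also have "... \<le> ?\<kappa>" by (intro sum_le_suminf s) auto
  finally show "(\<Sum>n<N. (k (Suc n))^2) \<le> ?\<kappa>" .
 qed (use q in auto)
 finally have "?X \<le> (a 0)^2 + (q*?X + c^2/(1 - q)*?\<kappa>)" by simp
 moreover have "?X*(1 - q) = ?X - q*?X" by (simp add: algebra_simps)
 ultimately have "?X*(1 - q) \<le> (a 0)^2 + c^2/(1 - q)*?\<kappa>" by linarith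
 thus ?thesis using q by (subst pos_le_divide_eq) auto
qed

text \<open>Here the recursion contracts only away from the vertex, so a solution growing like the
  inverse of \<open>q^n\<close> has to be excluded; \<open>lim\<close> does this. Iterating to
  infinity first bounds every \<open>a n\<close>, which then controls the boundary term
  \<open>a N\<close> of the summation.\<close>

lemma Hardy_high:
 fixes a k :: "nat => real"
 assumes q: "0 < q" "q < 1" and c: "0 \<le> c" and a: "\<And>n. 0 \<le> a n" and k: "\<And>n. 0 \<le> k n"
  and r: "\<And>n. a n \<le> q*a (Suc n) + c * k (Suc n)"
  and s: "summable (\<lambda>n. (k n)^2)" and lim: "(\<lambda>n. q^n*a n) \<longlonglongrightarrow> 0"
 shows "(\<Sum>n<N. (a n)^2) \<le> (c^2/(1 - q)^2 + c^2/(1 - q))/(1 - q)*(\<Sum>n. (k n)^2)"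
proof -
 let ?\<kappa> = "\<Sum>n. (k n)^2"
 have \<kappa>0: "0 \<le> ?\<kappa>" by (rule suminf_nonneg[OF s]) simp
 have kb: "k n \<le> sqrt ?\<kappa>" for n
 proof -
  have "(k n)^2 \<le> ?\<kappa>" using sum_le_suminf[OF s, of "{n}"] by simp
  thus ?thesis by (rule real_le_rsqrt)
 qed
 have it: "a n \<le> q^m*a (n + m) + c * sqrt ?\<kappa>*(\<Sum>j<m. q^j)" for n m
 proof (induction m)
  case (Suc m)
  have "q^m*a (n + m) \<le> q^m*(q*a (n + Suc m) + c * sqrt ?\<kappa>)"
   using r[of "n + m"] kb[of "Suc (n + m)"] mult_left_mono[OF kb[of "Suc (n + m)"] c] q by (intro mult_left_mono) auto
  thus ?case using Suc by (simp add: algebra_simps)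
 qed simp
 have ab: "a n \<le> c * sqrt ?\<kappa>/(1 - q)" for n
 proof (rule LIMSEQ_le_const)
  have gs: "(\<lambda>m. \<Sum>j<m. q^j) \<longlonglongrightarrow> 1/(1 - q)"
   using geometric_sums[of q] q by (simp add: sums_def)
  have "(\<lambda>m. q^(m + n)*a (m + n)) \<longlonglongrightarrow> 0" by (rule LIMSEQ_ignore_initial_segment[OF lim])
  hence "(\<lambda>m. (1/q^n)*(q^(m + n)*a (m + n))) \<longlonglongrightarrow> (1/q^n)*0" by (rule tendsto_mult_left)
  hence z: "(\<lambda>m. q^m*a (n + m)) \<longlonglongrightarrow> 0" using q by (simp add: power_add add.commute)
  have "(\<lambda>m. q^m*a (n + m) + c * sqrt ?\<kappa>*(\<Sum>j<m. q^j)) \<longlonglongrightarrow> 0 + c * sqrt ?\<kappa>*(1/(1 - q))"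
   by (intro tendsto_intros z gs)
  thus "(\<lambda>m. q^m*a (n + m) + c * sqrt ?\<kappa>*(\<Sum>j<m. q^j)) \<longlonglongrightarrow> c * sqrt ?\<kappa>/(1 - q)" by simp
 qed (use it in blast)
 let ?X = "\<Sum>n<N. (a n)^2"
 have "?X \<le> (\<Sum>n<N. q*(a (Suc n))^2 + c^2/(1 - q)*(k (Suc n))^2)"
 proof (rule sum_mono)
  fix n
  have "(a n)^2 \<le> (q*a (Suc n) + c * k (Suc n))^2" by (intro power_mono r a)
  also have "... \<le> q*(a (Suc n))^2 + (c * k (Suc n))^2/(1 - q)" using q by (intro convex_sq) auto
  finally show "(a n)^2 \<le> q*(a (Suc n))^2 + c^2/(1 - q)*(k (Suc n))^2" by (simp add: power_mult_distrib)
 qed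
 also have "... = q*(\<Sum>n<N. (a (Suc n))^2) + c^2/(1 - q)*(\<Sum>n<N. (k (Suc n))^2)" by (simp add: sum.distrib sum_distrib_left)
 also have "... \<le> q*(?X + (a N)^2) + c^2/(1 - q)*?\<kappa>"
 proof (intro add_mono mult_left_mono)
  have "(\<Sum>n<N. (a (Suc n))^2) \<le> (\<Sum>n<Suc N. (a n)^2)" by (subst sum.lessThan_Suc_shift) simp
  thus "(\<Sum>n<N. (a (Suc n))^2) \<le> ?X + (a N)^2" by simp
  have "(\<Sum>n<N. (k (Suc n))^2) \<le> (\<Sum>n<Suc N. (k n)^2)" by (subst sum.lessThan_Suc_shift) simp
  also have "... \<le> ?\<kappa>" by (intro sum_le_suminf s) auto
  finally show "(\<Sum>n<N. (k (Suc n))^2) \<le> ?\<kappa>" .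
 qed (use q in auto)
 finally have "(1 - q)*?X \<le> q*(a N)^2 + c^2/(1 - q)*?\<kappa>" by (simp add: algebra_simps)
 also have "... \<le> 1*(c * sqrt ?\<kappa>/(1 - q))^2 + c^2/(1 - q)*?\<kappa>"
  using q by (intro add_right_mono mult_mono power_mono ab a) auto
 also have "... = (c^2/(1 - q)^2 + c^2/(1 - q))*?\<kappa>" using \<kappa>0 by (simp add: power_divide power_mult_distrib algebra_simps)
 finally have "?X \<le> (c^2/(1 - q)^2 + c^2/(1 - q))*?\<kappa>/(1 - q)" using q by (simp add: pos_le_divide_eq mult.commute)
 thus ?thesis by simp
qed

lemma pow_div_powr: "T/2^n = T*2 powr (- real n)"
 by (simp add: powr_minus powr_realpow divide_inverse)

text \<open>On the disjoint dyadic intervals \<open>K\<close> is at least its value at the left end,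
  while the decreasing weight is at least its value at the right end.\<close>

lemma J_dyadic_lower:
 assumes T: "0 < T" and K: "\<And>t. 0 < t ==> 0 \<le> K t" "\<And>s t. 0 < s ==> s \<le> t ==> K s \<le> K t" and th: "0 < \<theta>"
 shows "(\<Sum>n. ennreal (2 powr (- 2*\<theta> - 1)*T powr (- 2*\<theta>)*(2 powr (real n*\<theta>)*K (T/2^n))^2)) \<le> J \<theta> (\<lambda>t. (K t)^2)"
proof -
 define tn where "tn n = T/2^n" for n :: nat
 have tp: "0 < tn n" for n using T by (simp add: tn_def)
 define f where "f n = (K (tn n))^2*(2*tn n) powr (- 2*\<theta> - 1)" for n
 have "(\<Sum>n. ennreal (2 powr (- 2*\<theta> - 1)*T powr (- 2*\<theta>)*(2 powr (real n*\<theta>)*K (T/2^n))^2)) =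
   (\<Sum>n. \<integral>\<^sup>+t. ennreal (f n)*indicator {tn n<..2*tn n} t \<partial>lborel)"
 proof (rule arg_cong[where f = suminf], rule ext)
  fix n
  have "tn n powr (- 2*\<theta>) = T powr (- 2*\<theta>)*(2 powr (real n*\<theta>))^2"
  proof -
   have "tn n = T*2 powr (- real n)" unfolding tn_def by (rule pow_div_powr)
   thus ?thesis using T by (simp add: powr_mult powr_powr power2_eq_square powr_add[symmetric] algebra_simps)
  qed
  moreover have "(2*tn n) powr (- 2*\<theta> - 1)*tn n = 2 powr (- 2*\<theta> - 1)*tn n powr (- 2*\<theta>)"
  proof -
   have "tn n powr (- 2*\<theta>) = tn n powr (- 2*\<theta> - 1)*tn n"
    using powr_add[of "tn n" "- 2*\<theta> - 1" 1] tp[of n] by simp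
   thus ?thesis using tp[of n] by (simp add: powr_mult)
  qed
  ultimately have "f n*tn n = 2 powr (- 2*\<theta> - 1)*T powr (- 2*\<theta>)*(2 powr (real n*\<theta>)*K (T/2^n))^2"
   unfolding f_def by (simp add: tn_def[symmetric] power_mult_distrib mult_ac)
  moreover have "(\<integral>\<^sup>+t. ennreal (f n)*indicator {tn n<..2*tn n} t \<partial>lborel) = ennreal (f n*tn n)"
   using tp[of n] by (subst nn_integral_cmult_indicator) (auto simp: f_def ennreal_mult)
  ultimately show "ennreal (2 powr (- 2*\<theta> - 1)*T powr (- 2*\<theta>)*(2 powr (real n*\<theta>)*K (T/2^n))^2) = (\<integral>\<^sup>+t. ennreal (f n)*indicator {tn n<..2*tn n} t \<partial>lborel)"
   by simp
 qed
 also have "... = (\<integral>\<^sup>+t. (\<Sum>n. ennreal (f n)*indicator {tn n<..2*tn n} t) \<partial>lborel)"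
  by (rule nn_integral_suminf[symmetric]) measurable
 also have "... \<le> J \<theta> (\<lambda>t. (K t)^2)"
  unfolding J_def
 proof (intro nn_integral_mono)
  fix t :: real
  show "(\<Sum>n. ennreal (f n)*indicator {tn n<..2*tn n} t) \<le> ennreal ((K t)^2*t powr (- 2*\<theta> - 1))*indicator {0<..} t"
  proof (cases "\<exists>n. t \<in> {tn n<..2*tn n}")
   case True
   then obtain n where n: "t \<in> {tn n<..2*tn n}" by blast
   have uniq: "t \<notin> {tn m<..2*tn m}" if "m \<noteq> n" for m
   proof (cases "m < n")
    case True
    hence "2*tn n \<le> tn m" using T power_increasing[of "Suc m" n "2::real"] by (simp add: tn_def field_simps)
    thus ?thesis using n by auto
   next
    case False
    hence "2*tn m \<le> tn n" using T power_increasing[of "Suc n" m "2::real"] that by (simp add: tn_def field_simps)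
    thus ?thesis using n by auto
   qed
   have "(\<Sum>n. ennreal (f n)*indicator {tn n<..2*tn n} t) = (\<Sum>m\<in>{n}. ennreal (f m)*indicator {tn m<..2*tn m} t)"
    by (rule suminf_finite) (use uniq in auto)
   also have "... = ennreal (f n)" using n by simp
   also have "... \<le> ennreal ((K t)^2*t powr (- 2*\<theta> - 1))"
    unfolding f_def using n tp[of n] th K by (intro ennreal_leI mult_mono power_mono powr_mono2') auto
   finally show ?thesis using n tp[of n] by (simp add: indicator_def)
  next
   case False
   hence "(\<Sum>n. ennreal (f n)*indicator {tn n<..2*tn n} t) = 0" by auto
   thus ?thesis by simp
  qed
 qed
 finally show ?thesis .
qed

lemma dyadic_bracket:
 fixes t T :: real
 assumes "0 < t" "t \<le> T" obtains n :: nat where "T/2 ^ Suc n < t" "t \<le> T/2^n"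
proof -
 have "\<exists>n. T/2 ^ Suc n < t"
 proof -
  obtain n where "T/t < 2^n" using real_arch_pow[of 2 "T/t"] by auto
  hence "T < 2 ^ Suc n*t" using assms by (simp add: field_simps)
  thus ?thesis by (auto simp: field_simps)
 qed
 define n where "n = (LEAST n. T/2 ^ Suc n < t)"
 have 1: "T/2 ^ Suc n < t" unfolding n_def using \<open>\<exists>n. T/2 ^ Suc n < t\<close> by (rule LeastI_ex)
 have 2: "t \<le> T/2^n"
 proof (cases n)
  case (Suc m)
  hence "\<not> T/2 ^ Suc m < t" using not_less_Least[of m "\<lambda>n. T/2 ^ Suc n < t"] unfolding n_def by simp
  thus ?thesis using Suc by simp
 qed (use assms in simp)
 show ?thesis using that 1 2 by blast
qed

text \<open>The intervals cover everything up to \<open>T\<close>, and \<open>F\<close> is at most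
  its value at the right end.\<close>

lemma J_dyadic_upper:
 assumes T: "0 < T" and F: "\<And>t. 0 < t ==> 0 \<le> F t" "\<And>s t. 0 < s ==> s \<le> t ==> t \<le> T ==> F s \<le> F t" and th: "0 < \<theta>"
 shows "J \<theta> (\<lambda>t. if t \<le> T then (F t)^2 else 0) \<le> (\<Sum>n. ennreal (2 powr (2*\<theta>)*T powr (- 2*\<theta>)*(2 powr (real n*\<theta>)*F (T/2^n))^2))"
proof -
 define tn where "tn n = T/2^n" for n :: nat
 have tp: "0 < tn n" for n using T by (simp add: tn_def)
 define f where "f n = (F (tn n))^2*(tn (Suc n)) powr (- 2*\<theta> - 1)" for n
 have "J \<theta> (\<lambda>t. if t \<le> T then (F t)^2 else 0) \<le> (\<integral>\<^sup>+t. (\<Sum>n. ennreal (f n)*indicator {tn (Suc n)<..tn n} t) \<partial>lborel)"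
  unfolding J_def
 proof (intro nn_integral_mono)
  fix t :: real
  show "ennreal ((if t \<le> T then (F t)^2 else 0)*t powr (- 2*\<theta> - 1))*indicator {0<..} t \<le> (\<Sum>n. ennreal (f n)*indicator {tn (Suc n)<..tn n} t)"
  proof (cases "0 < t \<and> t \<le> T")
   case True
   then obtain n where n: "tn (Suc n) < t" "t \<le> tn n" using dyadic_bracket[of t T] unfolding tn_def by blast
   have "tn n \<le> T" using T by (simp add: tn_def field_simps)
   hence "ennreal ((if t \<le> T then (F t)^2 else 0)*t powr (- 2*\<theta> - 1))*indicator {0<..} t \<le> ennreal (f n)"
    using True n tp[of "Suc n"] th F unfolding f_def by (auto simp: indicator_def intro!: ennreal_leI mult_mono power_mono powr_mono2')
   also have "... = (\<Sum>m\<in>{n}. ennreal (f m)*indicator {tn (Suc m)<..tn m} t)" using n by simp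
   also have "... \<le> (\<Sum>m. ennreal (f m)*indicator {tn (Suc m)<..tn m} t)" by (rule sum_le_suminf) auto
   finally show ?thesis .
  qed (auto simp: indicator_def)
 qed
 also have "... = (\<Sum>n. \<integral>\<^sup>+t. ennreal (f n)*indicator {tn (Suc n)<..tn n} t \<partial>lborel)"
  by (rule nn_integral_suminf) measurable
 also have "... = (\<Sum>n. ennreal (2 powr (2*\<theta>)*T powr (- 2*\<theta>)*(2 powr (real n*\<theta>)*F (T/2^n))^2))"
 proof (rule arg_cong[where f = suminf], rule ext)
  fix n
  have half: "tn n - tn (Suc n) = tn (Suc n)" by (simp add: tn_def field_simps)
  have "tn (Suc n) powr (- 2*\<theta>) = tn (Suc n) powr (- 2*\<theta> - 1)*tn (Suc n)"
   using powr_add[of "tn (Suc n)" "- 2*\<theta> - 1" 1] tp[of "Suc n"] by simp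
  moreover have "tn (Suc n) powr (- 2*\<theta>) = 2 powr (2*\<theta>)*T powr (- 2*\<theta>)*(2 powr (real n*\<theta>))^2"
  proof -
   have "tn (Suc n) = T*2 powr (- real (Suc n))" unfolding tn_def by (rule pow_div_powr)
   hence "tn (Suc n) powr (- 2*\<theta>) = T powr (- 2*\<theta>)*2 powr (2*\<theta>*real (Suc n))"
    using T by (simp add: powr_mult powr_powr mult_ac del: of_nat_Suc)
   also have "2 powr (2*\<theta>*real (Suc n)) = 2 powr (2*\<theta>)*(2 powr (real n*\<theta>))^2"
    by (simp add: power2_eq_square powr_add[symmetric] algebra_simps)
   finally show ?thesis by simp
  qed
  ultimately have "f n*tn (Suc n) = 2 powr (2*\<theta>)*T powr (- 2*\<theta>)*(2 powr (real n*\<theta>)*F (T/2^n))^2"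
   unfolding f_def by (simp add: tn_def[symmetric] power_mult_distrib mult_ac)
  moreover have "(\<integral>\<^sup>+t. ennreal (f n)*indicator {tn (Suc n)<..tn n} t \<partial>lborel) = ennreal (f n*tn (Suc n))"
   using tp[of "Suc n"] half by (subst nn_integral_cmult_indicator) (auto simp: f_def ennreal_mult)
  ultimately show "(\<integral>\<^sup>+t. ennreal (f n)*indicator {tn (Suc n)<..tn n} t \<partial>lborel) = ennreal (2 powr (2*\<theta>)*T powr (- 2*\<theta>)*(2 powr (real n*\<theta>)*F (T/2^n))^2)"
   by simp
 qed
 finally show ?thesis .
qed

text \<open>\<open>F\<close> stands for an L2 norm over a collar of width \<open>t\<close>,
  \<open>K\<close> for a K-functional. A constant has \<open>F t = F (2*t)/sqrt 2\<close> exactly,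
  so the doubling conjunct measures the deviation from constants. Above 1/2, the sequence
  \<open>m\<close> stands for the means over shrinking collars, which have to disappear in the
  limit.\<close>

definition Hcond :: "real => real => real => (real => real) => (real => real) => bool" where
 "Hcond \<theta> T c F K \<longleftrightarrow>
  (\<forall>t>0. 0 \<le> F t) \<and> (\<forall>s t. 0 < s \<longrightarrow> s \<le> t \<longrightarrow> t \<le> T \<longrightarrow> F s \<le> F t) \<and>
  (\<forall>t>0. 0 \<le> K t) \<and> (\<forall>s t. 0 < s \<longrightarrow> s \<le> t \<longrightarrow> K s \<le> K t) \<and>
  (\<forall>t>0. 2*t \<le> T \<longrightarrow> \<bar>F t - F (2*t)/sqrt 2\<bar> \<le> c*K t) \<and>
  (\<theta> < 1/2 \<or> 1/2 < \<theta> \<and> (\<exists>m. m \<longlonglongrightarrow> 0 \<and> (\<forall>n::nat. F (T/2^n) \<le> sqrt (T/2^n)*m n + c*K (T/2^n))))"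

text \<open>For \<open>a n = 2 powr (real n*\<theta>)*F (T/2^n)\<close> the doubling condition is a
  recursion with factor \<open>2 powr (\<theta> - 1/2)\<close>, a contraction below 1/2 and, read
  backwards, above 1/2. The constant is fixed before \<open>F\<close> and \<open>K\<close>.\<close>

lemma Hardy:
 assumes th: "0 < \<theta>" "\<theta> < 1" and T: "0 < T" and c: "0 < c"
 obtains C where "0 < C" "\<And>F K. Hcond \<theta> T c F K ==>
  J \<theta> (\<lambda>t. if t \<le> T then (F t)^2 else 0) \<le> ennreal C*J \<theta> (\<lambda>t. (K t)^2) + ennreal (C*(F T)^2)"
proof -
 define q where "q = (if \<theta> < 1/2 then 2 powr (\<theta> - 1/2) else 2 powr (1/2 - \<theta>) :: real)"
 define c1 where "c1 = 2 powr (- 2*\<theta> - 1)*T powr (- 2*\<theta>)"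
 define c2 where "c2 = 2 powr (2*\<theta>)*T powr (- 2*\<theta>)"
 define d where "d = c*2"
 \<comment> \<open>One constant for both cases: the first two terms come from
   \<open>Hardy_low\<close>, the last from \<open>Hardy_high\<close>. At 1/2, where
   \<open>1 - q\<close> is zero, 1 is a default value that keeps \<open>M\<close> positive.\<close>
 define M where "M = (if \<theta> = 1/2 then 1 else 1/(1 - q) + d^2/(1 - q)^2 + (d^2/(1 - q)^2 + d^2/(1 - q))/(1 - q))"
 define C where "C = c2*M*(1 + 1/c1)"
 have c12: "0 < c1" "0 < c2" using T by (auto simp: c1_def c2_def)
 have q1: "0 < q" "q < 1" if "\<theta> \<noteq> 1/2"
  using that powr_less_mono[of "\<theta> - 1/2" 0 "2::real"] powr_less_mono[of "1/2 - \<theta>" 0 "2::real"] by (auto simp: q_def)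
 have M: "0 < M" using q1 by (auto simp: M_def intro!: add_pos_nonneg divide_nonneg_pos add_nonneg_nonneg)
 have C: "0 < C" unfolding C_def using c12 M by (intro mult_pos_pos add_pos_pos) auto
 have main: "J \<theta> (\<lambda>t. if t \<le> T then (F t)^2 else 0) \<le> ennreal C*J \<theta> (\<lambda>t. (K t)^2) + ennreal (C*(F T)^2)"
  if H: "Hcond \<theta> T c F K" for F K
 proof (cases "J \<theta> (\<lambda>t. (K t)^2) = \<infinity>")
  case True
  thus ?thesis using C by (simp add: ennreal_mult_top)
 next
  case False
  have F0: "\<And>t. 0 < t ==> 0 \<le> F t" and Fm: "\<And>s t. 0 < s ==> s \<le> t ==> t \<le> T ==> F s \<le> F t"
   and K0: "\<And>t. 0 < t ==> 0 \<le> K t" and Km: "\<And>s t. 0 < s ==> s \<le> t ==> K s \<le> K t"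
   and step: "\<And>t. 0 < t ==> 2*t \<le> T ==> \<bar>F t - F (2*t)/sqrt 2\<bar> \<le> c*K t"
   and alt: "\<theta> < 1/2 \<or> 1/2 < \<theta> \<and> (\<exists>m. m \<longlonglongrightarrow> 0 \<and> (\<forall>n::nat. F (T/2^n) \<le> sqrt (T/2^n)*m n + c*K (T/2^n)))"
   using H unfolding Hcond_def by blast+
  define a where "a n = 2 powr (real n*\<theta>)*F (T/2^n)" for n :: nat
  define k where "k n = 2 powr (real n*\<theta>)*K (T/2^n)" for n :: nat
  have a0: "0 \<le> a n" and k0: "0 \<le> k n" for n using F0 K0 T by (auto simp: a_def k_def)
  have low: "(\<Sum>n. ennreal (c1*(k n)^2)) \<le> J \<theta> (\<lambda>t. (K t)^2)"
   unfolding c1_def k_def by (rule J_dyadic_lower[OF T K0 Km th(1)])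
  have fin: "(\<Sum>n. ennreal (c1*(k n)^2)) \<noteq> top" using low False by (auto simp: top_unique)
  have "summable (\<lambda>n. c1*(k n)^2)" by (rule summable_suminf_not_top[OF _ fin]) (use c12 in auto)
  hence sk: "summable (\<lambda>n. (k n)^2)" using c12 by (simp add: summable_cmult_iff)
  define \<kappa> where "\<kappa> = (\<Sum>n. (k n)^2)"
  have \<kappa>0: "0 \<le> \<kappa>" unfolding \<kappa>_def by (rule suminf_nonneg[OF sk]) simp
  have \<kappa>J: "ennreal (c1*\<kappa>) \<le> J \<theta> (\<lambda>t. (K t)^2)"
  proof -
   have "(\<Sum>n. ennreal (c1*(k n)^2)) = ennreal (\<Sum>n. c1*(k n)^2)"
    by (rule suminf_ennreal2) (use c12 sk in \<open>auto intro: summable_mult\<close>)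
   also have "(\<Sum>n. c1*(k n)^2) = c1*\<kappa>" unfolding \<kappa>_def by (rule suminf_mult[OF sk])
   finally show ?thesis using low by simp
  qed
  have pw: "2 powr (real (Suc n)*\<theta>) = 2 powr (real n*\<theta>)*2 powr \<theta>" for n
   by (simp add: powr_add[symmetric] algebra_simps)
  have st: "\<bar>F (T/2 ^ Suc n) - F (T/2^n)/sqrt 2\<bar> \<le> c*K (T/2 ^ Suc n)" for n
  proof -
   have "2*(T/2 ^ Suc n) = T/2^n" by simp
   moreover have "T/2^n \<le> T" using T by (simp add: field_simps)
   ultimately show ?thesis using step[of "T/2 ^ Suc n"] T by simp
  qed
  have sq2: "1/sqrt 2 = 2 powr (- (1/2))" using powr_minus_divide[of "2::real" "1/2"] powr_half_sqrt[of 2] by simp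
  have bound: "(\<Sum>n<N. (a n)^2) \<le> M*((F T)^2 + \<kappa>)" for N
  proof (cases "\<theta> < 1/2")
   case True
   have qq: "q = 2 powr \<theta>*(1/sqrt 2)" unfolding sq2 using True by (simp add: q_def powr_add[symmetric])
   have r: "a (Suc n) \<le> q*a n + d * k (Suc n)" for n
   proof -
    have "F (T/2 ^ Suc n) \<le> F (T/2^n)/sqrt 2 + c*K (T/2 ^ Suc n)" using st[of n] by linarith
    hence "a (Suc n) \<le> 2 powr (real (Suc n)*\<theta>)*(F (T/2^n)/sqrt 2 + c*K (T/2 ^ Suc n))"
     unfolding a_def by (intro mult_left_mono) auto
    also have "... = q*a n + c * k (Suc n)" unfolding a_def k_def pw qq by (simp add: algebra_simps)
    also have "... \<le> q*a n + d * k (Suc n)" using k0[of "Suc n"] c by (simp add: d_def mult_right_mono)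
    finally show ?thesis .
   qed
   have q: "0 \<le> q" "q < 1" using q1 True by auto
   have "(\<Sum>n<N. (a n)^2) \<le> ((a 0)^2 + d^2/(1 - q)*\<kappa>)/(1 - q)"
    unfolding \<kappa>_def by (rule Hardy_low[OF q a0 r sk])
   also have "... = 1/(1 - q)*(F T)^2 + d^2/(1 - q)^2*\<kappa>"
    by (simp add: a_def add_divide_distrib power2_eq_square)
   also have "... \<le> M*(F T)^2 + M*\<kappa>"
    using True q \<kappa>0 by (intro add_mono mult_right_mono) (auto simp: M_def)
   finally show ?thesis by (simp add: algebra_simps)
  next
   case False
   hence th2: "1/2 < \<theta>" using alt by auto
   obtain m where m: "m \<longlonglongrightarrow> 0" and Fb: "\<And>n::nat. F (T/2^n) \<le> sqrt (T/2^n)*m n + c*K (T/2^n)"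
    using alt False by blast
   have q: "0 < q" "q < 1" using q1 th2 by auto
   have qq: "q*2 powr \<theta> = sqrt 2" unfolding q_def using False by (simp add: powr_add[symmetric] powr_half_sqrt)
   have r: "a n \<le> q*a (Suc n) + d * k (Suc n)" for n
   proof -
    have "F (T/2^n)/sqrt 2 \<le> F (T/2 ^ Suc n) + c*K (T/2 ^ Suc n)" using st[of n] by linarith
    hence "F (T/2^n) \<le> sqrt 2*(F (T/2 ^ Suc n) + c*K (T/2 ^ Suc n))" by (simp add: field_simps)
    hence "a n \<le> 2 powr (real n*\<theta>)*(sqrt 2*(F (T/2 ^ Suc n) + c*K (T/2 ^ Suc n)))"
     unfolding a_def by (intro mult_left_mono) auto
    also have "... = q*a (Suc n) + q*c * k (Suc n)" unfolding a_def k_def pw qq[symmetric] by (simp add: algebra_simps)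
    also have "q*c * k (Suc n) \<le> d * k (Suc n)" using k0[of "Suc n"] c q by (intro mult_right_mono) (auto simp: d_def mult.commute)
    finally show ?thesis by simp
   qed
   have kb: "k n \<le> sqrt \<kappa>" for n
   proof -
    have "(k n)^2 \<le> \<kappa>" using sum_le_suminf[OF sk, of "{n}"] by (simp add: \<kappa>_def)
    thus ?thesis by (rule real_le_rsqrt)
   qed
   have qn: "q^n*2 powr (real n*\<theta>) = sqrt 2^n" for n
    unfolding qq[symmetric] power_mult_distrib by (simp add: powr_realpow[symmetric] powr_powr mult.commute)
   \<comment> \<open>\<open>q^n*2 powr (real n*\<theta>)\<close> equals \<open>sqrt 2^n\<close> and
     cancels the decay of \<open>sqrt (T/2^n)\<close> in front of the means, so means tending to 0
     are just enough; the K-term carries the factor \<open>q^n\<close>.\<close>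
   have "(\<lambda>n. q^n*a n) \<longlonglongrightarrow> 0"
   proof (rule Lim_null_comparison[OF always_eventually[OF allI]])
    fix n
    have "q^n*a n = sqrt 2^n*F (T/2^n)" unfolding a_def using qn[of n] by (simp add: mult.assoc[symmetric])
    also have "... \<le> sqrt 2^n*(sqrt (T/2^n)*m n + c*K (T/2^n))" by (intro mult_left_mono Fb) simp
    also have "sqrt 2^n * sqrt (T/2^n) = sqrt T" using T by (simp add: real_sqrt_divide real_sqrt_power)
    hence "sqrt 2^n*(sqrt (T/2^n)*m n + c*K (T/2^n)) = sqrt T*m n + c*(q^n * k n)"
     unfolding k_def by (simp add: distrib_left mult.assoc[symmetric] qn[symmetric])
    also have "... \<le> sqrt T*m n + c*(q^n * sqrt \<kappa>)" using kb[of n] q c by (intro add_left_mono mult_left_mono) auto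
    finally show "norm (q^n*a n) \<le> sqrt T*m n + c*(q^n * sqrt \<kappa>)" using a0[of n] q by simp
   next
    have "(\<lambda>n. sqrt T*m n + c*(q^n * sqrt \<kappa>)) \<longlonglongrightarrow> sqrt T*0 + c*(0 * sqrt \<kappa>)"
     using q by (intro tendsto_intros m LIMSEQ_power_zero) auto
    thus "(\<lambda>n. sqrt T*m n + c*(q^n * sqrt \<kappa>)) \<longlonglongrightarrow> 0" by simp
   qed
   from Hardy_high[OF q _ a0 k0 r sk this, of N]
   have "(\<Sum>n<N. (a n)^2) \<le> (d^2/(1 - q)^2 + d^2/(1 - q))/(1 - q)*\<kappa>" using c by (simp add: \<kappa>_def d_def)
   also have "... \<le> M*\<kappa>" using th2 q \<kappa>0 by (intro mult_right_mono) (auto simp: M_def)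
   also have "... \<le> M*((F T)^2 + \<kappa>)" using M by (intro mult_left_mono) auto
   finally show ?thesis .
  qed
  have sa: "summable (\<lambda>n. (a n)^2)" by (rule summableI_nonneg_bounded[OF _ bound]) simp
  have sM: "(\<Sum>n. (a n)^2) \<le> M*((F T)^2 + \<kappa>)" by (rule suminf_le_const[OF sa bound])
  have "J \<theta> (\<lambda>t. if t \<le> T then (F t)^2 else 0) \<le> (\<Sum>n. ennreal (c2*(a n)^2))"
   unfolding c2_def a_def by (rule J_dyadic_upper[OF T F0 Fm th(1)])
  also have "... = ennreal (c2*(\<Sum>n. (a n)^2))"
  proof -
   have "(\<Sum>n. ennreal (c2*(a n)^2)) = ennreal (\<Sum>n. c2*(a n)^2)"
    by (rule suminf_ennreal2) (use c12 sa in \<open>auto intro: summable_mult\<close>)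
   also have "(\<Sum>n. c2*(a n)^2) = c2*(\<Sum>n. (a n)^2)" by (rule suminf_mult[OF sa])
   finally show ?thesis .
  qed
  also have "... \<le> ennreal (c2*(M*((F T)^2 + \<kappa>)))" using sM c12 by (intro ennreal_leI mult_left_mono) auto
  also have "... \<le> ennreal (C*(c1*\<kappa>) + C*(F T)^2)"
  proof (rule ennreal_leI)
   have "c2*M*(F T)^2 \<le> C*(F T)^2" unfolding C_def using c12 M by (intro mult_right_mono) (auto simp: algebra_simps)
   moreover have "c2*M*\<kappa> \<le> C*(c1*\<kappa>)"
   proof -
    have "C*(c1*\<kappa>) = c2*M*c1*\<kappa> + c2*M*\<kappa>" unfolding C_def using c12 by (simp add: field_simps)
    thus ?thesis using c12 M \<kappa>0 by simp
   qed
   ultimately show "c2*(M*((F T)^2 + \<kappa>)) \<le> C*(c1*\<kappa>) + C*(F T)^2" by (simp add: algebra_simps)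
  qed
  also have "... = ennreal C*ennreal (c1*\<kappa>) + ennreal (C*(F T)^2)"
   using C c12 \<kappa>0 by (simp add: ennreal_mult[symmetric] ennreal_plus[symmetric] del: ennreal_plus)
  also have "... \<le> ennreal C*J \<theta> (\<lambda>t. (K t)^2) + ennreal (C*(F T)^2)"
   by (intro add_right_mono mult_left_mono \<kappa>J) simp
  finally show ?thesis .
 qed
 show ?thesis by (rule that[OF C main])
qed

section \<open>Doubling estimates near an endpoint\<close>

lemma nm_le_const:
 assumes s: "sqi (lebesgue_on {0..t::real}) f" and b: "\<And>x. x \<in> {0..t} ==> \<bar>f x\<bar> \<le> c" and t: "0 \<le> t" and c: "0 \<le> c"
 shows "nm (Lb t) f \<le> c * sqrt t"
proof -
 have "integral\<^sup>L (Lb t) (\<lambda>x. (f x)^2) \<le> integral\<^sup>L (Lb t) (\<lambda>x. c^2)"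
 proof (intro integral_mono)
  show "integrable (Lb t) (\<lambda>x. (f x)^2)" using s by (simp add: sqi_def)
  show "integrable (Lb t) (\<lambda>x. c^2)" by (simp add: finite_measure.integrable_const)
  show "(f x)^2 \<le> c^2" if "x \<in> space (Lb t)" for x
   using b[of x] that c by (simp add: abs_le_square_iff[symmetric])
 qed
 also have "... = (c * sqrt t)^2" using t by (simp add: measure_restrict_space power_mult_distrib mult.commute)
 finally have "(nm (Lb t) f)^2 \<le> (c * sqrt t)^2" by (simp add: nm_sq)
 thus ?thesis using c t by (auto intro: power2_le_imp_le)
qed

lemma abscont_holder:
 assumes A: "abscont T h g" and xy: "0 \<le> x" "x \<le> y" "y \<le> T"
 shows "\<bar>h y - h x\<bar> \<le> nm (Lb T) g * sqrt (y - x)"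
proof -
 have i: "g integrable_on {x..y}" "(\<lambda>t. \<bar>g t\<bar>) integrable_on {x..y}"
  using integral_HK(2,3)[OF sqi_integrable_Leb[OF sqi_subinterval[OF abscont_sqi[OF A]]], of x y] xy by auto
 have "\<bar>h y - h x\<bar> = \<bar>integral {x..y} g\<bar>" using abscont_increment[OF A xy] by simp
 also have "... \<le> integral {x..y} (\<lambda>t. \<bar>g t\<bar>)" using integral_norm_bound_integral[OF i] by simp
 also have "... \<le> nm (Lb T) g * sqrt (y - x)"
  using xy by (intro integral_le_nm abscont_sqi[OF A]) auto
 finally show ?thesis .
qed

lemma nm_dilate:
 fixes t :: real
 assumes s: "sqi (Lb (2*t)) f" and t: "0 < t"
 shows "sqi (Lb t) (\<lambda>x. f (2*x))" "nm (Lb t) (\<lambda>x. f (2*x)) = nm (Lb (2*t)) f/sqrt 2"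
proof -
 show "sqi (Lb t) (\<lambda>x. f (2*x))"
  using sqi_affine(1)[of 2 "{0..2*t}" f "{0..t}" 0] s by auto
 have "integral\<^sup>L (Lb t) (\<lambda>x. (f (2*x))^2) = integral\<^sup>L (Lb (2*t)) (\<lambda>x. (f x)^2)/2"
  using sqi_affine(2)[of 2 "{0..2*t}" f "{0..t}" 0] s by auto
 thus "nm (Lb t) (\<lambda>x. f (2*x)) = nm (Lb (2*t)) f/sqrt 2"
  unfolding nm_def by (simp only: real_sqrt_divide)
qed

text \<open>Dilation by 2 rescales the norm over \<open>{0..2*t}\<close> by \<open>sqrt 2\<close>,
  so the left side is at most the norm of \<open>h x - h (2*x)\<close>. The rough part
  \<open>hv\<close> enters by its own norm. The part \<open>hw\<close> varies by the norm of
  \<open>g\<close> times \<open>sqrt t\<close>, and the length of the collar contributes the second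
  \<open>sqrt t\<close>.\<close>

lemma doubling:
 assumes v: "sqi (Lb T) hv" and A: "abscont T hw g" and t: "0 < t" "2*t \<le> T"
  and h: "\<And>x. h x = hv x + hw x"
 shows "\<bar>nm (Lb t) h - nm (Lb (2*t)) h/sqrt 2\<bar>
  \<le> 2*nm (Lb T) hv + t*nm (Lb T) g"
proof -
 let ?M = "Lb t" and ?L = "Lb T"
 have sub: "{0..t} \<subseteq> {0..T}" "{0..2*t} \<subseteq> {0..T}" using t by auto
 have sw: "sqi ?L hw" by (rule abscont_sqi_fun[OF A])
 have "h = (\<lambda>x. hv x + hw x)" using h by auto
 hence sh: "sqi ?L h" using sqi_add[OF v sw] by simp
 note s1 = sqi_subinterval[OF sh sub(1)] sqi_subinterval[OF v sub(1)] sqi_subinterval[OF sw sub(1)]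
 note d = nm_dilate[OF sqi_subinterval[OF sh sub(2)] t(1)] nm_dilate[OF sqi_subinterval[OF v sub(2)] t(1)] nm_dilate[OF sqi_subinterval[OF sw sub(2)] t(1)]
 have tri: "\<bar>nm ?M f - nm ?M g\<bar> \<le> nm ?M (\<lambda>x. f x - g x)" if "sqi ?M f" "sqi ?M g" for f g
 proof -
  have "nm ?M f \<le> nm ?M (\<lambda>x. f x - g x) + nm ?M g" using nm_add[OF sqi_diff[OF that] that(2)] by simp
  moreover have "nm ?M g \<le> nm ?M (\<lambda>x. g x - f x) + nm ?M f" using nm_add[OF sqi_diff[OF that(2,1)] that(1)] by simp
  moreover have "nm ?M (\<lambda>x. g x - f x) = nm ?M (\<lambda>x. f x - g x)" by (simp add: nm_def power2_commute)
  ultimately show ?thesis by linarith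
 qed
 have "\<bar>nm ?M h - nm (Lb (2*t)) h/sqrt 2\<bar> \<le> nm ?M (\<lambda>x. h x - h (2*x))"
  using tri[OF s1(1) d(1)] d(2) by simp
 also have "(\<lambda>x. h x - h (2*x)) = (\<lambda>x. (hv x - hv (2*x)) + (hw x - hw (2*x)))" using h by (auto simp: fun_eq_iff)
 also have "nm ?M ... \<le> nm ?M (\<lambda>x. hv x - hv (2*x)) + nm ?M (\<lambda>x. hw x - hw (2*x))"
  by (intro nm_add sqi_diff s1 d)
 also have "... \<le> 2*nm ?L hv + t*nm ?L g"
 proof (rule add_mono)
  have "nm ?M (\<lambda>x. hv x - hv (2*x)) \<le> nm ?M hv + nm (Lb (2*t)) hv/sqrt 2"
   using nm_diff[OF s1(2) d(3)] d(4) by simp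
  also have "... \<le> nm ?L hv + nm ?L hv"
  proof (rule add_mono)
   have "nm (Lb (2*t)) hv/sqrt 2 \<le> nm (Lb (2*t)) hv/1"
    by (intro divide_left_mono) auto
   thus "nm (Lb (2*t)) hv/sqrt 2 \<le> nm ?L hv" using nm_subinterval[OF v sub(2)] by simp
  qed (rule nm_subinterval[OF v sub(1)])
  finally show "nm ?M (\<lambda>x. hv x - hv (2*x)) \<le> 2*nm ?L hv" by simp
  have "\<bar>hw x - hw (2*x)\<bar> \<le> nm ?L g * sqrt t" if x: "x \<in> {0..t}" for x
  proof -
   have "\<bar>hw (2*x) - hw x\<bar> \<le> nm ?L g * sqrt (2*x - x)" using x t by (intro abscont_holder[OF A]) auto
   also have "... \<le> nm ?L g * sqrt t" using x by (intro mult_left_mono) auto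
   finally show ?thesis by (simp add: abs_minus_commute)
  qed
  hence "nm ?M (\<lambda>x. hw x - hw (2*x)) \<le> nm ?L g * sqrt t * sqrt t"
   using t by (intro nm_le_const sqi_diff s1 d) auto
  also have "... = t*nm ?L g" using t by (simp add: mult.assoc)
  finally show "nm ?M (\<lambda>x. hw x - hw (2*x)) \<le> t*nm ?L g" .
 qed
 finally show ?thesis .
qed

text \<open>On the collar \<open>hw\<close> is close to the constant \<open>hw 0\<close>, and
  \<open>hw 0\<close> is the mean of \<open>h\<close> up to the means of the small parts, which
  Cauchy-Schwarz bounds by their norms divided by \<open>sqrt t\<close>.\<close>

lemma mean_bound:
 assumes v: "sqi (Lb T) hv" and A: "abscont T hw g" and t: "0 < t" "t \<le> T"
  and h: "\<And>x. h x = hv x + hw x"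
 shows "nm (Lb t) h \<le> sqrt t*\<bar>integral {0..t} h/t\<bar> + (2*nm (Lb T) hv + 2*(t*nm (Lb T) g))"
proof -
 let ?M = "Lb t" and ?L = "Lb T"
 have sub: "{0..t} \<subseteq> {0..T}" using t by auto
 have sw: "sqi ?L hw" by (rule abscont_sqi_fun[OF A])
 note s1 = sqi_subinterval[OF v sub] sqi_subinterval[OF sw sub]
 have sc: "sqi ?M (\<lambda>x. c)" for c by (rule sqi_continuous) (rule continuous_on_const)
 have it: "\<bar>integral {0..t} f\<bar> \<le> nm ?M f * sqrt t" if "sqi ?M f" for f
 proof -
  have "\<bar>integral {0..t} f\<bar> = \<bar>integral\<^sup>L ?M f\<bar>" using integral_HK(1)[OF sqi_integrable_Leb[OF that]] by simp
  also have "... \<le> integral\<^sup>L ?M (\<lambda>x. \<bar>f x\<bar>)" by (rule integral_abs_bound)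
  also have "... \<le> nm ?M f * sqrt t" using nm_L1[OF finite_Leb that] t by (simp add: measure_restrict_space)
  finally show ?thesis .
 qed
 define r where "r x = hw x - hw 0" for x
 have rs: "sqi ?M r" unfolding r_def by (intro sqi_diff s1 sc)
 have rn: "nm ?M r \<le> t*nm ?L g"
 proof -
  have "nm ?M r \<le> nm ?L g * sqrt t * sqrt t"
  proof (rule nm_le_const[OF rs])
   fix x assume x: "x \<in> {0..t}"
   have "\<bar>r x\<bar> \<le> nm ?L g * sqrt (x - 0)" unfolding r_def using x t by (intro abscont_holder[OF A]) auto
   also have "... \<le> nm ?L g * sqrt t" using x by (intro mult_left_mono) auto
   finally show "\<bar>r x\<bar> \<le> nm ?L g * sqrt t" .
  qed (use t in auto)
  also have "... = t*nm ?L g" using t by (simp add: mult.assoc)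
  finally show ?thesis .
 qed
 have vn: "nm ?M hv \<le> nm ?L hv" by (rule nm_subinterval[OF v sub])
 have hdec: "h = (\<lambda>x. (hv x + r x) + hw 0)" using h by (auto simp: r_def)
 have ih: "integral {0..t} h = integral {0..t} hv + integral {0..t} r + t*hw 0"
 proof -
  note i = integral_HK(2)[OF sqi_integrable_Leb[OF s1(1)]] integral_HK(2)[OF sqi_integrable_Leb[OF rs]]
  show ?thesis unfolding hdec using i t
   by (simp add: Henstock_Kurzweil_Integration.integral_add integrable_add integrable_on_const)
 qed
 have "nm ?M h \<le> (nm ?M hv + nm ?M r) + nm ?M (\<lambda>x. hw 0)"
  unfolding hdec using nm_add[OF sqi_add[OF s1(1) rs] sc[of "hw 0"]] nm_add[OF s1(1) rs] by linarith
 also have "nm ?M (\<lambda>x. hw 0) \<le> \<bar>hw 0\<bar> * sqrt t" using t by (intro nm_le_const sc) auto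
 also have "\<bar>hw 0\<bar> * sqrt t \<le> sqrt t*\<bar>integral {0..t} h/t\<bar> + nm ?M hv + nm ?M r"
 proof -
  have "hw 0 = integral {0..t} h/t - integral {0..t} hv/t - integral {0..t} r/t"
   unfolding ih using t by (simp add: field_simps)
  hence "\<bar>hw 0\<bar> \<le> \<bar>integral {0..t} h/t\<bar> + \<bar>integral {0..t} hv\<bar>/t + \<bar>integral {0..t} r\<bar>/t"
  proof -
   have d: "\<bar>x\<bar>/t = \<bar>x/t\<bar>" for x using t by simp
   assume "hw 0 = integral {0..t} h/t - integral {0..t} hv/t - integral {0..t} r/t"
   thus ?thesis unfolding d by linarith
  qed
  also have "... \<le> \<bar>integral {0..t} h/t\<bar> + nm ?M hv * sqrt t/t + nm ?M r * sqrt t/t"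
   using it[OF s1(1)] it[OF rs] t by (intro add_mono divide_right_mono) auto
  finally have "\<bar>hw 0\<bar> * sqrt t \<le> (\<bar>integral {0..t} h/t\<bar> + nm ?M hv * sqrt t/t + nm ?M r * sqrt t/t) * sqrt t"
   by (rule mult_right_mono) (use t in auto)
  also have "... = sqrt t*\<bar>integral {0..t} h/t\<bar> + nm ?M hv + nm ?M r"
  proof -
   have "x * sqrt t/t * sqrt t = x" for x using t by (simp add: field_simps)
   thus ?thesis by (simp only: distrib_right) (simp add: mult.commute)
  qed
  finally show ?thesis .
 qed
 finally show ?thesis using rn vn by linarith
qed

section \<open>Interpolation and vertex conditions\<close>

text \<open>The linear cut-off keeps the value at 0 and vanishes at \<open>\<delta>\<close>. Its
  slope costs the norm of \<open>F\<close> divided by \<open>\<delta>\<close>, which the factor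
  \<open>t\<close> of the K-functional compensates when \<open>\<delta> = t\<close>.\<close>

lemma abscont_collar:
 assumes F: "abscont \<delta> F f" and d: "0 < \<delta>" "\<delta> \<le> l"
 defines "E \<equiv> (\<lambda>y. if y \<le> \<delta> then (1 - y/\<delta>)*F y else 0)"
  and "g \<equiv> (\<lambda>y. if y \<le> \<delta> then - (1/\<delta>)*F y + (1 - y/\<delta>)*f y else 0)"
 shows "abscont l E g" "nm (Lb l) E \<le> nm (Lb \<delta>) F"
  "nm (Lb l) g \<le> nm (Lb \<delta>) F/\<delta> + nm (Lb \<delta>) f"
proof -
 let ?M = "Lb \<delta>"
 have lin: "abscont \<delta> (\<lambda>y. 1 - y/\<delta>) (\<lambda>y. - (1/\<delta>))"
  by (rule abscont_of_deriv) (use d in \<open>auto intro!: derivative_eq_intros continuous_intros\<close>)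
 note P = abscont_mult[OF lin F]
 have "abscont l (\<lambda>y. if y \<le> \<delta> then (1 - y/\<delta>)*F y else 0) (\<lambda>y. if y \<le> \<delta> then - (1/\<delta>)*F y + (1 - y/\<delta>)*f y else 0)"
  by (rule abscont_extend_zero[OF P]) (use d in auto)
 thus "abscont l E g" by (simp add: E_def g_def)
 have b: "\<bar>1 - y/\<delta>\<bar> \<le> 1" if "y \<in> space ?M" for y using that d by (auto simp: field_simps abs_le_iff)
 have lm: "(\<lambda>y. 1 - y/\<delta>) \<in> borel_measurable ?M" using abscont_sqi_fun[OF lin] by (simp add: sqi_def)
 have shrink: "nm ?M (\<lambda>y. (1 - y/\<delta>)*h y) \<le> nm ?M h" if "sqi ?M h" for h
  using sqi_bounded_mult(2)[OF that lm b] by (simp add: nm_def)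
 note sF = abscont_sqi_fun[OF F] and sf = abscont_sqi[OF F]
 have s1: "sqi ?M (\<lambda>y. (1 - y/\<delta>)*F y)" "sqi ?M (\<lambda>y. (1 - y/\<delta>)*f y)"
  using sqi_bounded_mult(1)[OF sF lm b] sqi_bounded_mult(1)[OF sf lm b] by auto
 have "nm (Lb l) E = nm ?M (\<lambda>y. (1 - y/\<delta>)*F y)"
  unfolding E_def by (rule sqi_extend_zero(2)[OF s1(1)]) (use d in auto)
 thus "nm (Lb l) E \<le> nm ?M F" using shrink[OF sF] by simp
 have sg: "sqi ?M (\<lambda>y. - (1/\<delta>)*F y + (1 - y/\<delta>)*f y)" by (intro sqi_add sqi_scale sF s1)
 have "nm (Lb l) g = nm ?M (\<lambda>y. - (1/\<delta>)*F y + (1 - y/\<delta>)*f y)"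
  unfolding g_def by (rule sqi_extend_zero(2)[OF sg]) (use d in auto)
 also have "... \<le> nm ?M (\<lambda>y. - (1/\<delta>)*F y) + nm ?M (\<lambda>y. (1 - y/\<delta>)*f y)"
  by (intro nm_add sqi_scale sF s1)
 also have "... \<le> nm ?M F/\<delta> + nm ?M f" 
 proof -
  have "nm ?M (\<lambda>y. - (1/\<delta>)*F y) = nm ?M F/\<delta>" unfolding nm_scale[of ?M "- (1/\<delta>)" F] using d by simp
  thus ?thesis using shrink[OF sf] by linarith
 qed
 finally show "nm (Lb l) g \<le> nm ?M F/\<delta> + nm ?M f" .
qed

context kop
begin

definition EE :: "('e \<times> bool) set" where "EE = edges G \<times> UNIV"
text \<open>Half the shortest edge length, so that the collar at one end of an edge does not reach
  the other end.\<close>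

definition l0 :: real where "l0 = Min (len G ` edges G)/2"
definition NE :: real where "NE = real (card EE)"
text \<open>\<open>u\<close> read from the edge end \<open>k\<close> inwards: all collars become the
  same interval \<open>{0..l0}\<close>, and functions on different collars can be combined
  linearly.\<close>

definition ec :: "'e gfn => 'e \<times> bool => real => real" where
 "ec u k x = u (fst k) (param G (fst k) (snd k) x)"
text \<open>Row \<open>j\<close> of \<open>P\<close> describes what has to be subtracted from the
  trace at the end \<open>j\<close> to enforce a vertex condition; \<open>pu\<close> is the same
  combination throughout the collar.\<close>

definition pu :: "('e \<times> bool => 'e \<times> bool => real) => 'e gfn => 'e \<times> bool => real => real" where
 "pu P u j x = (\<Sum>k\<in>EE. P j k*ec u k x)"

lemma fin_EE: "finite EE" by (simp add: EE_def fin_edges)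
lemma NE_pos: "0 < NE" using edges_ne fin_EE unfolding NE_def EE_def by (auto simp: card_gt_0_iff)
lemma l0_pos: "0 < l0" unfolding l0_def using fin_edges edges_ne len_pos by (auto simp: Min_gr_iff)
lemma l0_le: "e \<in> edges G ==> 2*l0 \<le> len G e" unfolding l0_def using fin_edges by (auto intro: Min_le)
lemma l0_less: "e \<in> edges G ==> l0 < len G e" using l0_le[of e] l0_pos by linarith

lemma ec_sqi:
 assumes u: "u \<in> L2 G" and k: "k \<in> EE"
 shows "sqi (Lb l0) (ec u k)" "nm (Lb l0) (ec u k) \<le> nL u"
proof -
 obtain e b where eb: "k = (e, b)" and e: "e \<in> edges G" using k by (cases k) (auto simp: EE_def)
 have sub: "{0..l0} \<subseteq> seg e" using l0_less[OF e] by auto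
 have s: "sqi (leb G e) (\<lambda>x. u e (param G e b x))" "nm (leb G e) (\<lambda>x. u e (param G e b x)) = nm (leb G e) (u e)"
  using sqi_reflect[OF L2D[OF u e]] L2D[OF u e] by (cases b; simp add: param_def)+
 show "sqi (Lb l0) (ec u k)" using sqi_subinterval[OF s(1) sub] by (simp add: ec_def[abs_def] eb)
 have "nm (Lb l0) (ec u k) \<le> nm (leb G e) (u e)"
  using nm_subinterval[OF s(1) sub] s(2) by (simp add: ec_def[abs_def] eb)
 thus "nm (Lb l0) (ec u k) \<le> nL u" using nm_le_L2_norm[OF e, of u] by linarith
qed

lemma ec_abscont:
 assumes w: "w \<in> H1E" and k: "k \<in> EE"
 shows "abscont l0 (ec (rp w) k) (\<lambda>x. sgb (snd k)*ec (DG w) k x)"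
proof -
 obtain e b where eb: "k = (e, b)" and e: "e \<in> edges G" using k by (cases k) (auto simp: EE_def)
 show ?thesis
  using abscont_restrict[OF rp_abscont[OF w e], of l0] abscont_restrict[OF abscont_reflect[OF rp_abscont[OF w e]], of l0] l0_less[OF e]
  by (cases b) (auto simp: ec_def[abs_def] eb param_def sgb_def)
qed

definition Pok :: "('e \<times> bool => 'e \<times> bool => real) => bool" where
 "Pok P \<longleftrightarrow> (\<forall>j k. \<bar>P j k\<bar> \<le> 1)"

lemma PokD: "Pok P ==> \<bar>P j k\<bar> \<le> 1"
 unfolding Pok_def by blast

lemma pu_sqi:
 assumes P: "Pok P" and u: "u \<in> L2 G"
 shows "sqi (Lb l0) (pu P u j)" "nm (Lb l0) (pu P u j) \<le> NE*nL u"
proof -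
 show "sqi (Lb l0) (pu P u j)" unfolding pu_def[abs_def] by (intro sqi_sum sqi_scale ec_sqi u)
 have "nm (Lb l0) (pu P u j) \<le> (\<Sum>k\<in>EE. nm (Lb l0) (\<lambda>x. P j k*ec u k x))"
  unfolding pu_def[abs_def] by (intro nm_sum sqi_scale ec_sqi u)
 also have "... \<le> (\<Sum>k\<in>EE. nL u)"
 proof (rule sum_mono)
  fix k assume k: "k \<in> EE"
  have "\<bar>P j k\<bar>*nm (Lb l0) (ec u k) \<le> 1*nL u"
   by (intro mult_mono ec_sqi u k PokD[OF P]) auto
  thus "nm (Lb l0) (\<lambda>x. P j k*ec u k x) \<le> nL u" by (simp add: nm_scale)
 qed
 also have "... = NE*nL u" by (simp add: NE_def)
 finally show "nm (Lb l0) (pu P u j) \<le> NE*nL u" .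
qed

text \<open>The derivative of \<open>pu P (rp w) j\<close>. The signs from the reversed ends are
  absorbed into the matrix, whose entries remain bounded by 1.\<close>

definition pud :: "('e \<times> bool => 'e \<times> bool => real) => 'e gfn => 'e \<times> bool => real => real" where
 "pud P w j = pu (\<lambda>j k. P j k * sgb (snd k)) (DG w) j"

lemma Pok_sgb: "Pok P ==> Pok (\<lambda>j k. P j k * sgb (snd k))"
 unfolding Pok_def sgb_def by (auto simp: abs_mult simp del: split_paired_All)

lemma pu_abscont:
 assumes w: "w \<in> H1E"
 shows "abscont l0 (pu P (rp w) j) (pud P w j)"
proof -
 have "abscont l0 (\<lambda>x. \<Sum>k\<in>EE. P j k*ec (rp w) k x) (\<lambda>x. \<Sum>k\<in>EE. P j k*(sgb (snd k)*ec (DG w) k x))"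
  by (intro abscont_sum abscont_scale ec_abscont w)
 thus ?thesis by (simp add: pu_def[abs_def] pud_def mult.assoc)
qed

lemma pu_split: "pu P u j x = pu P (u - w) j x + pu P w j x"
 by (simp add: pu_def ec_def sum.distrib[symmetric] algebra_simps)

lemma rp_L2: "w \<in> H1E ==> rp w \<in> L2 G"
 using abscont_sqi_fun[OF rp_abscont] by (simp add: L2_iff)

text \<open>Replacing \<open>w\<close> by its continuous representative changes the other summand on
  a null set only.\<close>

lemma residual:
 assumes v: "v \<in> L2 G" and w: "w \<in> H1E" and eq: "u = v + w"
 shows "u - rp w \<in> L2 G" "nL (u - rp w) = nL v"
proof -
 have u: "u \<in> L2 G" unfolding eq by (intro L2_add v H1_L2 w)
 show *: "u - rp w \<in> L2 G" by (intro L2_diff u rp_L2 w)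
 have "aeq G (u - rp w) (u - w)" by (intro aeq_diff aeq_refl aeq_sym[OF rp_aeq[OF w]])
 moreover have "u - w = v" unfolding eq by simp
 ultimately show "nL (u - rp w) = nL v" using L2_norm_aeq * v by metis
qed

definition Phi :: "('e \<times> bool => 'e \<times> bool => real) => 'e gfn => 'e \<times> bool => real => real" where
 "Phi P u j t = nm (Lb t) (pu P u j)"

text \<open>\<open>doubling\<close> is applied to every decomposition of \<open>u\<close> before the
  infimum is taken; \<open>NE\<close> counts the entries of a row of \<open>P\<close>.\<close>

lemma Phi_doubling:
 assumes P: "Pok P" and A: "gd A" and u: "u \<in> L2 G" and t: "0 < t" "2*t \<le> l0"
 shows "\<bar>Phi P u j t - Phi P u j (2*t)/sqrt 2\<bar> \<le> 2*NE*KK A t u"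
proof -
 have "\<bar>Phi P u j t - Phi P u j (2*t)/sqrt 2\<bar>/(2*NE) \<le> KK A t u"
 proof (rule K_greatest[OF u A])
  fix v w assume v: "v \<in> L2 G" and w: "w \<in> A" and eq: "u = v + w"
  have w1: "w \<in> H1E" using A w by (auto simp: gd_def)
  note r = residual[OF v w1 eq]
  note n = pu_sqi(2)[OF P r(1), of j, unfolded r(2)]
  have n2: "nm (Lb l0) (pud P w j) \<le> NE*nH w"
   using pu_sqi(2)[OF Pok_sgb[OF P] D_L2[OF w1], of j] L2_le_H1(2)[of w] NE_pos mult_left_mono[OF L2_le_H1(2)[of w], of NE]
   unfolding pud_def by linarith
  have "\<bar>Phi P u j t - Phi P u j (2*t)/sqrt 2\<bar> \<le> 2*nm (Lb l0) (pu P (u - rp w) j) + t*nm (Lb l0) (pud P w j)"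
   unfolding Phi_def by (rule doubling[OF pu_sqi(1)[OF P r(1)] pu_abscont[OF w1] t pu_split])
  also have "... \<le> 2*(NE*nL v) + t*(NE*nH w)"
   using n n2 t by (intro add_mono mult_left_mono) auto
  also have "... \<le> 2*NE*(nL v + t*nH w)"
   using t NE_pos H1_norm_nonneg[of w] by (simp add: algebra_simps del: One_nat_def)
  finally show "\<bar>Phi P u j t - Phi P u j (2*t)/sqrt 2\<bar>/(2*NE) \<le> nL v + t*nH w"
   using NE_pos by (simp add: divide_le_eq mult.commute del: One_nat_def)
 qed
 thus ?thesis using NE_pos by (simp add: divide_le_eq mult_ac del: One_nat_def)
qed

lemma Phi_mean:
 assumes P: "Pok P" and A: "gd A" and u: "u \<in> L2 G" and t: "0 < t" "t \<le> l0"
 shows "Phi P u j t \<le> sqrt t*\<bar>integral {0..t} (pu P u j)/t\<bar> + 2*NE*KK A t u"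
proof -
 let ?m = "sqrt t*\<bar>integral {0..t} (pu P u j)/t\<bar>"
 have "(Phi P u j t - ?m)/(2*NE) \<le> KK A t u"
 proof (rule K_greatest[OF u A])
  fix v w assume v: "v \<in> L2 G" and w: "w \<in> A" and eq: "u = v + w"
  have w1: "w \<in> H1E" using A w by (auto simp: gd_def)
  note r = residual[OF v w1 eq]
  note n = pu_sqi(2)[OF P r(1), of j, unfolded r(2)]
  have n2: "nm (Lb l0) (pud P w j) \<le> NE*nH w"
   using pu_sqi(2)[OF Pok_sgb[OF P] D_L2[OF w1], of j] L2_le_H1(2)[of w] NE_pos mult_left_mono[OF L2_le_H1(2)[of w], of NE]
   unfolding pud_def by linarith
  have "Phi P u j t \<le> ?m + (2*nm (Lb l0) (pu P (u - rp w) j) + 2*(t*nm (Lb l0) (pud P w j)))"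
   unfolding Phi_def by (rule mean_bound[OF pu_sqi(1)[OF P r(1)] pu_abscont[OF w1] t pu_split])
  also have "... \<le> ?m + (2*(NE*nL v) + 2*(t*(NE*nH w)))"
   using n n2 t by (intro add_mono mult_left_mono) auto
  finally have "Phi P u j t - ?m \<le> 2*NE*(nL v + t*nH w)" by (simp add: algebra_simps del: One_nat_def)
  thus "(Phi P u j t - ?m)/(2*NE) \<le> nL v + t*nH w"
   using NE_pos by (simp add: divide_le_eq mult.commute del: One_nat_def)
 qed
 hence "Phi P u j t - ?m \<le> KK A t u*(2*NE)" using NE_pos by (simp add: pos_divide_le_eq del: One_nat_def)
 thus ?thesis by (simp add: mult_ac del: One_nat_def)
qed

lemma Phi_mono:
 assumes P: "Pok P" and u: "u \<in> L2 G" and st: "s \<le> t" "t \<le> l0"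
 shows "Phi P u j s \<le> Phi P u j t"
 unfolding Phi_def by (rule nm_subinterval[OF sqi_subinterval[OF pu_sqi(1)[OF P u]]]) (use st in auto)

definition corr :: "('e \<times> bool => 'e \<times> bool => real) => real => 'e gfn => 'e gfn" where
 "corr P \<delta> W e x = (\<Sum>b\<in>UNIV. if param G e b x \<le> \<delta> then (1 - param G e b x/\<delta>)*pu P W (e, b) (param G e b x) else 0)"

text \<open>In a decomposition \<open>u = v + w\<close> with \<open>w\<close> in \<open>A\<close>,
  the function \<open>Eg\<close>, which extends the offending traces of \<open>w\<close> over
  collars of width \<open>t\<close>, is moved to the other summand. What remains of \<open>w\<close>
  satisfies the conditions of \<open>A'\<close>. The price is the collar norm of the offending
  combination of \<open>w\<close>, which is that of \<open>u\<close> up to a multiple of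
  \<open>nL v\<close>.\<close>

lemma cutoff_step:
 assumes P: "Pok P" and A: "gd A" "gd A'" and u: "u \<in> L2 G" and t: "0 < t" "t \<le> l0"
  and cut: "\<And>w w'. w \<in> A ==> w' \<in> H1E ==>
   (\<And>e b. e \<in> edges G ==> tr w' e b = tr w e b - (\<Sum>k\<in>EE. P (e, b) k*tr w (fst k) (snd k))) ==> w' \<in> A'"
 shows "KK A' t u \<le> (2 + 4*NE^2 + l0*(1 + 2*NE^2))*(KK A t u + (\<Sum>j\<in>EE. Phi P u j t))"
proof -
 define Cc where "Cc = 2 + 4*NE^2 + l0*(1 + 2*NE^2)"
 have Cc: "0 < Cc" unfolding Cc_def using l0_pos by (intro add_pos_nonneg mult_nonneg_nonneg) auto
 define S where "S = (\<Sum>j\<in>EE. Phi P u j t)"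
 have "KK A' t u/Cc - S \<le> KK A t u"
 proof (rule K_greatest[OF u A(1)])
  fix v w assume v: "v \<in> L2 G" and w: "w \<in> A" and eq: "u = v + w"
  have w1: "w \<in> H1E" using A w by (auto simp: gd_def)
  note r = residual[OF v w1 eq]
  define W where "W = rp w"
  define p where "p j = nm (Lb t) (pu P W j)" for j
  define p' where "p' j = nm (Lb t) (pud P w j)" for j
  define \<Psi> where "\<Psi> = (\<Sum>j\<in>EE. p j)"
  define E where "E j y = (if y \<le> t then (1 - y/t)*pu P W j y else 0)" for j y
  define g where "g j y = (if y \<le> t then - (1/t)*pu P W j y + (1 - y/t)*pud P w j y else 0)" for j y
  have puW: "abscont t (pu P W j) (pud P w j)" for j
   unfolding W_def by (rule abscont_restrict[OF pu_abscont[OF w1] t(2)])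
  have coll: "abscont (len G e) (E j) (g j)" "nm (leb G e) (E j) \<le> p j" "nm (leb G e) (g j) \<le> p j/t + p' j" if e: "e \<in> edges G" for e j
   using abscont_collar[OF puW[of j] t(1), of "len G e"] l0_less[OF e] t(2) unfolding E_def[abs_def] g_def[abs_def] p_def p'_def by auto
  define Eg where "Eg = corr P t W"
  define gg where "gg e x = (\<Sum>b\<in>UNIV. sgb b*g (e, b) (param G e b x))" for e x
  have Eg_eq: "Eg e x = (\<Sum>b\<in>UNIV. E (e, b) (param G e b x))" for e x
   by (simp add: Eg_def corr_def E_def)
  have part: "abscont (len G e) (\<lambda>x. E j (param G e b x)) (\<lambda>x. sgb b*g j (param G e b x))"
   "nm (leb G e) (\<lambda>x. E j (param G e b x)) \<le> p j" "nm (leb G e) (\<lambda>x. sgb b*g j (param G e b x)) \<le> p j/t + p' j" if e: "e \<in> edges G" for e b j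
  proof -
   note c = coll[OF e, of j]
   show "abscont (len G e) (\<lambda>x. E j (param G e b x)) (\<lambda>x. sgb b*g j (param G e b x))"
    using c(1) abscont_reflect[OF c(1)] by (cases b) (simp_all add: param_def sgb_def)
   show "nm (leb G e) (\<lambda>x. E j (param G e b x)) \<le> p j"
    using c(2) sqi_reflect(2)[OF abscont_sqi_fun[OF c(1)]] by (cases b) (simp_all add: param_def)
   show "nm (leb G e) (\<lambda>x. sgb b*g j (param G e b x)) \<le> p j/t + p' j"
    using c(3) sqi_reflect(2)[OF abscont_sqi[OF c(1)]] by (cases b) (simp_all add: param_def sgb_def nm_uminus)
  qed
  have Eabs: "abscont (len G e) (Eg e) (gg e)" if e: "e \<in> edges G" for e
  proof -
   have "abscont (len G e) (\<lambda>x. \<Sum>b\<in>UNIV. E (e, b) (param G e b x)) (gg e)"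
    unfolding gg_def[abs_def] by (intro abscont_sum part(1)[OF e])
   thus ?thesis by (simp add: Eg_eq[abs_def])
  qed
  have EL: "Eg \<in> L2 G" and ggL: "gg \<in> L2 G"
   using abscont_sqi_fun[OF Eabs] abscont_sqi[OF Eabs] by (auto simp: L2_iff)
  have sumEE: "(\<Sum>e\<in>edges G. \<Sum>b\<in>UNIV. f (e, b)) = (\<Sum>j\<in>EE. f j)" for f :: "'e \<times> bool => real"
   unfolding EE_def by (simp add: sum.cartesian_product)
  have L2_sum: "nL f \<le> (\<Sum>e\<in>edges G. nm (leb G e) (f e))" for f
   unfolding L2_norm_set by (rule L2_set_le_sum) simp
  have nE: "nL Eg \<le> \<Psi>"
  proof -
   have "nm (leb G e) (Eg e) \<le> (\<Sum>b\<in>UNIV. p (e, b))" if e: "e \<in> edges G" for e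
   proof -
    have "nm (leb G e) (\<lambda>x. \<Sum>b\<in>UNIV. E (e, b) (param G e b x)) \<le> (\<Sum>b\<in>UNIV. nm (leb G e) (\<lambda>x. E (e, b) (param G e b x)))"
     by (rule nm_sum) (rule abscont_sqi_fun[OF part(1)[OF e]])
    also have "... \<le> (\<Sum>b\<in>UNIV. p (e, b))" by (intro sum_mono part(2)[OF e])
    finally show ?thesis by (simp add: Eg_eq[abs_def])
   qed
   hence "nL Eg \<le> (\<Sum>e\<in>edges G. \<Sum>b\<in>UNIV. p (e, b))" by (intro order_trans[OF L2_sum] sum_mono)
   thus ?thesis by (simp add: sumEE \<Psi>_def)
  qed
  have ng: "nL gg \<le> \<Psi>/t + (\<Sum>j\<in>EE. p' j)"
  proof -
   have "nm (leb G e) (gg e) \<le> (\<Sum>b\<in>UNIV. p (e, b)/t + p' (e, b))" if e: "e \<in> edges G" for e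
   proof -
    have "nm (leb G e) (gg e) \<le> (\<Sum>b\<in>UNIV. nm (leb G e) (\<lambda>x. sgb b*g (e, b) (param G e b x)))"
     unfolding gg_def[abs_def] by (rule nm_sum) (rule abscont_sqi[OF part(1)[OF e]])
    also have "... \<le> (\<Sum>b\<in>UNIV. p (e, b)/t + p' (e, b))" by (intro sum_mono part(3)[OF e])
    finally show ?thesis .
   qed
   hence "nL gg \<le> (\<Sum>e\<in>edges G. \<Sum>b\<in>UNIV. p (e, b)/t + p' (e, b))" by (intro order_trans[OF L2_sum] sum_mono)
   also have "... = (\<Sum>j\<in>EE. p j/t + p' j)" by (rule sumEE[of "\<lambda>j. p j/t + p' j"])
   finally show ?thesis by (simp add: \<Psi>_def sum.distrib sum_divide_distrib)
  qed
  define w' where "w' = W - Eg"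
  have w'L: "w' \<in> L2 G" unfolding w'_def W_def by (intro L2_diff rp_L2 w1 EL)
  have w'a: "abscont (len G e) (w' e) ((DG w - gg) e)" if e: "e \<in> edges G" for e
   using abscont_diff[OF rp_abscont[OF w1 e] Eabs[OF e]] by (simp add: w'_def W_def gfn_minus)
  note H = H1I[OF w'L w'a aeq_refl]
  have w'A: "w' \<in> A'"
  proof (rule cut[OF w H(1)])
   fix e b assume e: "e \<in> edges G"
   have "tr w' e b = w' e (param G e b 0)" unfolding tr_def using H(3)[OF _ e param_end[OF e]] by blast
   also have "... = tr w e b - Eg e (param G e b 0)" by (simp add: w'_def W_def tr_def)
   also have "Eg e (param G e b 0) = (\<Sum>b'\<in>UNIV. if b' = b then pu P W (e, b) 0 else 0)"
    unfolding Eg_eq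
   proof (rule sum.cong[OF refl])
    fix b' :: bool
    \<comment> \<open>The collar of the opposite end does not reach this vertex, as
      \<open>t \<le> l0\<close>; only \<open>b' = b\<close> contributes.\<close>
    have "param G e b' (param G e b 0) = (if b' = b then 0 else len G e)" by (cases b; cases b') (auto simp: param_def)
    thus "E (e, b') (param G e b' (param G e b 0)) = (if b' = b then pu P W (e, b) 0 else 0)"
     using t l0_less[OF e] by (simp add: E_def)
   qed
   also have "... = pu P W (e, b) 0" by simp
   also have "... = (\<Sum>k\<in>EE. P (e, b) k*tr w (fst k) (snd k))" by (simp add: pu_def ec_def tr_def W_def)
   finally show "tr w' e b = tr w e b - (\<Sum>k\<in>EE. P (e, b) k*tr w (fst k) (snd k))" .
  qed
  \<comment> \<open>The collar norms of \<open>w\<close> are traded for those of \<open>u\<close>,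
    since only a quantity independent of the decomposition can enter the Hardy inequality.\<close>
  have \<Psi>b: "\<Psi> \<le> S + NE^2*nL v"
  proof -
   have "p j \<le> Phi P u j t + NE*nL v" for j
   proof -
    have sub: "{0..t} \<subseteq> {0..l0}" using t by auto
    have "pu P W j = (\<lambda>x. pu P u j x - pu P (u - W) j x)" using pu_split[of P u j _ W] by (auto simp: fun_eq_iff)
    hence "p j \<le> nm (Lb t) (pu P u j) + nm (Lb t) (pu P (u - W) j)"
     unfolding p_def using nm_diff[OF sqi_subinterval[OF pu_sqi(1)[OF P u] sub] sqi_subinterval[OF pu_sqi(1)[OF P r(1)] sub], of j j]
     by (simp add: W_def)
    also have "nm (Lb t) (pu P (u - W) j) \<le> NE*nL v"
     using nm_subinterval[OF pu_sqi(1)[OF P r(1)] sub, of j] pu_sqi(2)[OF P r(1), of j] r(2) by (simp add: W_def)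
    finally show ?thesis by (simp add: Phi_def)
   qed
   hence "\<Psi> \<le> (\<Sum>j\<in>EE. Phi P u j t + NE*nL v)" unfolding \<Psi>_def by (intro sum_mono)
   also have "... = S + NE^2*nL v" by (simp add: sum.distrib S_def NE_def power2_eq_square)
   finally show ?thesis .
  qed
  have p'b: "(\<Sum>j\<in>EE. p' j) \<le> NE^2*nH w"
  proof -
   have "p' j \<le> NE*nH w" for j
   proof -
    have sub: "{0..t} \<subseteq> {0..l0}" using t by auto
    have "p' j \<le> nm (Lb l0) (pud P w j)"
     unfolding p'_def pud_def by (rule nm_subinterval[OF pu_sqi(1)[OF Pok_sgb[OF P] D_L2[OF w1]] sub])
    also have "... \<le> NE*nL (DG w)" unfolding pud_def by (rule pu_sqi(2)[OF Pok_sgb[OF P] D_L2[OF w1]])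
    also have "... \<le> NE*nH w" using L2_le_H1(2)[of w] NE_pos by (intro mult_left_mono) auto
    finally show ?thesis .
   qed
   hence "(\<Sum>j\<in>EE. p' j) \<le> (\<Sum>j\<in>EE. NE*nH w)" by (intro sum_mono)
   thus ?thesis by (simp add: NE_def power2_eq_square del: One_nat_def)
  qed
  define x where "x = nL v"
  define y where "y = nH w"
  have xy: "0 \<le> x" "0 \<le> y" by (simp_all add: x_def y_def del: One_nat_def)
  have S0: "0 \<le> S" unfolding S_def Phi_def by (intro sum_nonneg) simp
  have \<Psi>0: "0 \<le> \<Psi>" unfolding \<Psi>_def p_def by (intro sum_nonneg) simp
  have ueq: "u = (u - w') + w'" by simp
  have "KK A' t u \<le> nL (u - w') + t*nH w'"
   using K_le[of t "u - w'" w' A'] t L2_diff[OF u w'L] w'A ueq by simp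
  also have "nL (u - w') \<le> x + \<Psi>"
  proof -
   have "u - w' = (u - rp w) + Eg" by (simp add: w'_def W_def)
   hence "nL (u - w') \<le> nL (u - rp w) + nL Eg" using L2_norm_add[OF r(1) EL] by metis
   thus ?thesis using r(2) nE by (simp add: x_def)
  qed
  also have "nH w' \<le> 2*y + \<Psi> + (\<Psi>/t + NE^2*y)"
  proof -
   have "nH w' \<le> nL w' + nL (DG w')" by (rule H1_norm_le)
   also have "nL w' \<le> nL w + \<Psi>"
    unfolding w'_def W_def using L2_norm_diff[OF rp_L2[OF w1] EL] L2_norm_aeq[OF rp_aeq[OF w1] H1_L2[OF w1] rp_L2[OF w1]] nE by linarith
   also have "nL (DG w') = nL (DG w - gg)"
    by (rule L2_norm_aeq[OF H(2) D_L2[OF H(1)] L2_diff[OF D_L2[OF w1] ggL]])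
   also have "... \<le> nL (DG w) + (\<Psi>/t + NE^2*y)"
    using L2_norm_diff[OF D_L2[OF w1] ggL] ng p'b unfolding y_def by linarith
   finally show ?thesis using L2_le_H1[of w] unfolding y_def by linarith
  qed
  \<comment> \<open>The slope of the cut-off contributes \<open>\<Psi>/t\<close>, which the factor
    \<open>t\<close> turns into \<open>\<Psi>\<close>.\<close>
  also have "x + \<Psi> + t*(2*y + \<Psi> + (\<Psi>/t + NE^2*y)) = x + (2 + t)*\<Psi> + t*(2 + NE^2)*y"
   using t by (simp add: field_simps)
  also have "... \<le> x + (2 + l0)*(S + NE^2*x) + (2 + NE^2)*(t*y)"
  proof -
   have "(2 + t)*\<Psi> \<le> (2 + l0)*(S + NE^2*x)"
    using t \<Psi>0 \<Psi>b xy S0 unfolding x_def[symmetric] by (intro mult_mono) auto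
   moreover have "t*(2 + NE^2)*y = (2 + NE^2)*(t*y)" by (simp only: mult.commute mult.left_commute)
   ultimately show ?thesis by linarith
  qed
  also have "... \<le> Cc*(x + t*y + S)"
  proof -
   have 1: "x + (2 + l0)*(NE^2*x) \<le> Cc*x"
   proof -
    have "0 \<le> (1 + 2*NE^2 + l0 + l0*NE^2)*x" using xy l0_pos by (intro mult_nonneg_nonneg add_nonneg_nonneg) auto
    thus ?thesis by (simp add: Cc_def algebra_simps)
   qed
   have 2: "(2 + NE^2)*(t*y) \<le> Cc*(t*y)"
    unfolding Cc_def using t xy l0_pos by (intro mult_right_mono) auto
   have 3: "(2 + l0)*S \<le> Cc*S"
    unfolding Cc_def using S0 l0_pos by (intro mult_right_mono) (auto simp: algebra_simps)
   show ?thesis using 1 2 3 by (simp add: algebra_simps)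
  qed
  finally have "KK A' t u \<le> Cc*(x + t*y + S)" using t by (simp add: mult_left_mono)
  hence "KK A' t u/Cc \<le> x + t*y + S" using Cc by (simp add: pos_divide_le_eq mult.commute)
  thus "KK A' t u/Cc - S \<le> nL v + t*nH w" by (simp add: x_def y_def del: One_nat_def)
 qed
 hence "KK A' t u/Cc \<le> KK A t u + S" by linarith
 thus ?thesis using Cc unfolding Cc_def[symmetric] S_def by (simp add: pos_divide_le_eq mult.commute)
qed

text \<open>The weak form in which a vertex condition is used: means over shrinking collars instead
  of values at the vertex.\<close>

definition mean_zero :: "('e \<times> bool => 'e \<times> bool => real) => 'e gfn => bool" where
 "mean_zero P u \<longleftrightarrow> (\<forall>j\<in>EE. ((\<lambda>t. integral {0..t} (pu P u j)/t) \<longlongrightarrow> 0) (at_right 0))"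

text \<open>Squaring \<open>cutoff_step\<close> and integrating leaves the collar norms
  \<open>F\<close>, which the Hardy inequality bounds by the K-functional of \<open>A\<close>.
  Beyond \<open>l0\<close> no cut-off is available, but there the K-functional is at most
  \<open>nL u\<close>.\<close>

lemma cutoff:
 assumes th: "0 < \<theta>" "\<theta> < 1" and P: "Pok P" and A: "gd A" "gd A'"
  and cut: "\<And>w w'. w \<in> A ==> w' \<in> H1E ==>
   (\<And>e b. e \<in> edges G ==> tr w' e b = tr w e b - (\<Sum>k\<in>EE. P (e, b) k*tr w (fst k) (snd k))) ==> w' \<in> A'"
 obtains C where "0 < C" "\<And>u. u \<in> L2 G ==> (\<theta> < 1/2 \<or> 1/2 < \<theta> \<and> mean_zero P u) ==> NQ \<theta> A' u \<le> ennreal C*NQ \<theta> A u"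
proof -
 have c: "0 < NE*(2*NE)" using NE_pos by simp
 obtain C1 where C1: "0 < C1" and H: "\<And>F K. Hcond \<theta> l0 (NE*(2*NE)) F K ==>
   J \<theta> (\<lambda>t. if t \<le> l0 then (F t)^2 else 0) \<le> ennreal C1*J \<theta> (\<lambda>t. (K t)^2) + ennreal (C1*(F l0)^2)"
  using Hardy[OF th l0_pos c] by blast
 define Cc where "Cc = 2 + 4*NE^2 + l0*(1 + 2*NE^2)"
 define C2 where "C2 = 2*Cc^2"
 \<comment> \<open>Chosen so that \<open>D*min 1 (t^2)\<close> is at least 1 for
   \<open>t > l0\<close>.\<close>
 define D where "D = 1 + 1/l0^2"
 have Cc: "0 < Cc" unfolding Cc_def using l0_pos by (intro add_pos_nonneg mult_nonneg_nonneg) auto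
 have C2: "0 < C2" unfolding C2_def using Cc by simp
 have D: "0 < D" unfolding D_def by (intro add_pos_nonneg) auto
 obtain ci where ci: "0 < ci" "ennreal ci = cth \<theta>"
  using cth_finite[OF th] cth_pos[of \<theta>] by (cases "cth \<theta>") (auto simp: zero_less_iff_neq_zero ennreal_eq_0_iff)
 \<comment> \<open>The second summand converts the boundary value \<open>F l0\<close>, itself
   bounded by a multiple of \<open>nL u\<close>, into the interpolation norm by
   \<open>norm_le_NQ\<close>.\<close>
 define C3 where "C3 = C1 + C1*NE^4/ci"
 have C3: "0 < C3" unfolding C3_def using C1 ci(1) by (intro add_pos_nonneg) auto
 have C: "0 < C2 + D + C2*C3" using C2 D C3 by (simp add: add_pos_pos)
 have main: "NQ \<theta> A' u \<le> ennreal (C2 + D + C2*C3)*NQ \<theta> A u" if u: "u \<in> L2 G" and alt: "\<theta> < 1/2 \<or> 1/2 < \<theta> \<and> mean_zero P u" for u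
 proof -
  define F where "F t = (\<Sum>j\<in>EE. Phi P u j t)" for t
  have cNE: "(\<Sum>j\<in>EE. y) = NE*y" for y :: real by (simp add: NE_def)
  have F0: "0 \<le> F t" for t unfolding F_def Phi_def by (intro sum_nonneg) simp
  have Fm: "F s \<le> F t" if "s \<le> t" "t \<le> l0" for s t unfolding F_def by (intro sum_mono Phi_mono[OF P u that])
  have hc: "Hcond \<theta> l0 (NE*(2*NE)) F (\<lambda>t. KK A t u)"
   unfolding Hcond_def
  proof (intro conjI allI impI)
   fix t :: real assume t: "0 < t" "2*t \<le> l0"
   have "F t - F (2*t)/sqrt 2 = (\<Sum>j\<in>EE. Phi P u j t - Phi P u j (2*t)/sqrt 2)"
    by (simp add: F_def sum_subtractf sum_divide_distrib)
   also have "\<bar>...\<bar> \<le> (\<Sum>j\<in>EE. 2*NE*KK A t u)"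
    by (rule order_trans[OF sum_abs sum_mono]) (rule Phi_doubling[OF P A(1) u t])
   finally show "\<bar>F t - F (2*t)/sqrt 2\<bar> \<le> NE*(2*NE)*KK A t u" by (simp only: cNE mult.assoc)
  next
   show "\<theta> < 1/2 \<or> 1/2 < \<theta> \<and> (\<exists>m. m \<longlonglongrightarrow> 0 \<and> (\<forall>n::nat. F (l0/2^n) \<le> sqrt (l0/2^n)*m n + NE*(2*NE)*KK A (l0/2^n) u))"
    using alt
   proof
    assume a: "1/2 < \<theta> \<and> mean_zero P u"
    let ?t = "\<lambda>n. l0/2^n"
    define m where "m n = (\<Sum>j\<in>EE. \<bar>integral {0..?t n} (pu P u j)/?t n\<bar>)" for n :: nat
    have "filterlim ?t (at_right 0) sequentially"
    proof (rule tendsto_imp_filterlim_at_right)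
     have "(\<lambda>n. l0*(1/2)^n) \<longlonglongrightarrow> l0*0" by (intro tendsto_intros LIMSEQ_power_zero) auto
     thus "?t \<longlonglongrightarrow> 0" by (simp add: power_divide)
    qed (simp add: l0_pos)
    hence "(\<lambda>n. integral {0..?t n} (pu P u j)/?t n) \<longlonglongrightarrow> 0" if "j \<in> EE" for j
     using a that filterlim_compose unfolding mean_zero_def by blast
    hence "m \<longlonglongrightarrow> 0" unfolding m_def[abs_def] by (intro tendsto_null_sum tendsto_rabs_zero)
    moreover have "F (?t n) \<le> sqrt (?t n)*m n + NE*(2*NE)*KK A (?t n) u" for n :: nat
    proof -
     have "F (?t n) \<le> (\<Sum>j\<in>EE. sqrt (?t n)*\<bar>integral {0..?t n} (pu P u j)/?t n\<bar> + 2*NE*KK A (?t n) u)"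
      unfolding F_def by (intro sum_mono Phi_mean[OF P A(1) u]) (use l0_pos in \<open>auto simp: field_simps\<close>)
     thus ?thesis by (simp only: sum.distrib cNE m_def sum_distrib_left mult.assoc)
    qed
    ultimately show ?thesis using a by blast
   qed simp
  qed (use F0 Fm K_nonneg[OF u A(1)] K_mono[OF u A(1)] in auto)
  define Q where "Q t = (if t \<le> l0 then (F t)^2 else 0)" for t
  have QJ: "J \<theta> Q \<le> ennreal C3*NQ \<theta> A u"
  proof -
   have "J \<theta> Q \<le> ennreal C1*NQ \<theta> A u + ennreal (C1*(F l0)^2)"
    unfolding Q_def[abs_def] NQ_J by (rule H[OF hc])
   also have "ennreal (C1*(F l0)^2) \<le> ennreal (C1*NE^4/ci)*NQ \<theta> A u"
   proof -
    have "F l0 \<le> (\<Sum>j\<in>EE. NE*nL u)" unfolding F_def Phi_def by (intro sum_mono pu_sqi(2)[OF P u])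
    hence "(F l0)^2 \<le> (NE*(NE*nL u))^2" unfolding cNE by (rule power_mono[OF _ F0])
    also have "... = NE^4*(nL u)^2" by (simp add: power2_eq_square power4_eq_xxxx mult_ac)
    finally have "C1*(F l0)^2 \<le> C1*NE^4/ci*((nL u)^2*ci)"
     using C1 ci(1) by simp
    hence "ennreal (C1*(F l0)^2) \<le> ennreal (C1*NE^4/ci*((nL u)^2*ci))" by (rule ennreal_leI)
    also have "... = ennreal (C1*NE^4/ci)*(ennreal ((nL u)^2)*cth \<theta>)"
     using C1 ci by (simp add: ennreal_mult[symmetric] ci(2)[symmetric])
    also have "... \<le> ennreal (C1*NE^4/ci)*NQ \<theta> A u" by (intro mult_left_mono norm_le_NQ u A) simp
    finally show ?thesis .
   qed
   finally show ?thesis using C1 ci(1) by (simp add: C3_def distrib_right[symmetric])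
  qed
  define R where "R t = C2*(KK A t u)^2 + D*(nL u)^2*min 1 (t^2)" for t
  have pw: "(KK A' t u)^2 \<le> R t + C2*Q t" if t: "0 < t" for t
  proof (cases "t \<le> l0")
   case True
   have "KK A' t u \<le> Cc*(KK A t u + F t)"
    unfolding Cc_def F_def by (rule cutoff_step[OF P A u t True cut])
   hence "(KK A' t u)^2 \<le> (Cc*(KK A t u + F t))^2"
    using K_nonneg[OF u A(2)] t by (intro power_mono) auto
   also have "... \<le> Cc^2*(2*(KK A t u)^2 + 2*(F t)^2)"
    unfolding power_mult_distrib using sum_squares_bound[of "KK A t u" "F t"]
    by (intro mult_left_mono) (simp_all add: power2_sum del: One_nat_def)
   also have "... = C2*(KK A t u)^2 + C2*Q t" using True by (simp add: C2_def Q_def algebra_simps del: One_nat_def)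
   also have "... \<le> R t + C2*Q t" using D by (simp add: R_def)
   finally show ?thesis .
  next
   case False
   have "(KK A' t u)^2 \<le> (nL u)^2" using K_le_norm[OF u A(2)] K_nonneg[OF u A(2)] t by (intro power_mono) auto
   also have "... \<le> D*min 1 (t^2)*(nL u)^2"
   proof -
    have "1 \<le> D*min 1 (t^2)"
    proof (cases "1 \<le> t^2")
     case True thus ?thesis by (simp add: D_def)
    next
     case f: False
     have "l0^2 \<le> t^2" using False l0_pos by (intro power_mono) auto
     hence "1 \<le> 1/l0^2*t^2" using l0_pos by (simp add: field_simps)
     also have "... \<le> D*t^2" unfolding D_def by (intro mult_right_mono) auto
     finally show ?thesis using f by (simp add: min_def)
    qed
    from mult_right_mono[OF this, of "(nL u)^2"] show ?thesis by simp
   qed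
   also have "... \<le> R t + C2*Q t"
    using C2 False by (simp add: R_def Q_def mult_ac del: One_nat_def)
   finally show ?thesis .
  qed
  have Qm: "pos_part Q \<in> borel_measurable borel"
  proof -
   \<comment> \<open>\<open>Q\<close> drops to 0 beyond \<open>l0\<close> and need not be monotone;
     its constant continuation \<open>H\<close> is, hence measurable.\<close>
   define H where "H t = (if 0 < t then if t \<le> l0 then (F t)^2 else (F l0)^2 else 0)" for t
   have "mono H" unfolding H_def using Fm F0
    by (intro monoI) (auto intro!: power_mono)
   hence "H \<in> borel_measurable borel" by (rule borel_measurable_mono)
   moreover have "pos_part Q = (\<lambda>t. if t \<le> l0 then H t else 0)" by (auto simp: Q_def H_def)
   ultimately show ?thesis by simp
  qed
  have Rm: "pos_part R \<in> borel_measurable borel"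
  proof -
   have "pos_part R = (\<lambda>t. C2*pos_part (\<lambda>t. (KK A t u)^2) t + pos_part (\<lambda>t. D*(nL u)^2*min 1 (t^2)) t)"
    by (auto simp: R_def)
   moreover have "pos_part (\<lambda>t. D*(nL u)^2*min 1 (t^2)) \<in> borel_measurable borel" by measurable
   ultimately show ?thesis using K_meas(2)[OF u A(1)] by simp
  qed
  have RJ: "J \<theta> R \<le> ennreal C2*NQ \<theta> A u + ennreal (D*(nL u)^2)*cth \<theta>"
   unfolding R_def[abs_def] by (rule J_le_combine[OF u A(1)]) (use C2 D in auto)
  have DJ: "ennreal (D*(nL u)^2)*cth \<theta> \<le> ennreal D*NQ \<theta> A u"
   using norm_le_NQ[OF u A(1), of \<theta>] D by (simp add: ennreal_mult mult.assoc mult_left_mono)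
  have "pos_part (\<lambda>t. C2*Q t) = (\<lambda>t. C2*pos_part Q t)" by auto
  hence CQm: "pos_part (\<lambda>t. C2*Q t) \<in> borel_measurable borel" using Qm by simp
  have "NQ \<theta> A' u \<le> J \<theta> (\<lambda>t. R t + C2*Q t)" unfolding NQ_J by (rule J_mono[OF pw])
  also have "... = J \<theta> R + ennreal C2*J \<theta> Q"
   unfolding J_cmult[OF Qm less_imp_le[OF C2], symmetric] by (rule J_add[OF Rm CQm]) (use C2 D in \<open>auto simp: R_def Q_def\<close>)
  also have "... \<le> (ennreal C2*NQ \<theta> A u + ennreal D*NQ \<theta> A u) + ennreal C2*(ennreal C3*NQ \<theta> A u)"
   by (intro add_mono order_trans[OF RJ] order_refl DJ mult_left_mono QJ) simp
  also have "... = ennreal (C2 + D + C2*C3)*NQ \<theta> A u"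
   using C2 D C3 by (simp add: ennreal_mult ennreal_plus distrib_right mult.assoc)
  finally show ?thesis .
 qed
 show ?thesis by (rule that[OF C main])
qed

end

section \<open>Multipliers and interpolation spaces\<close>

context kop
begin

lemma K_aeq:
 assumes u: "u \<in> L2 G" and u': "u' \<in> L2 G" and ae: "aeq G u u'" and A: "gd A" and t: "0 \<le> t"
 shows "KK A t u' \<le> KK A t u"
proof (rule K_greatest[OF u A])
 fix v w assume v: "v \<in> L2 G" and w: "w \<in> A" and eq: "u = v + w"
 have v': "v + (u' - u) \<in> L2 G" by (intro L2_add L2_diff v u u')
 have "aeq G (v + (u' - u)) (v + (u - u))" by (intro aeq_add aeq_diff aeq_refl aeq_sym[OF ae])
 hence "aeq G (v + (u' - u)) v" by simp
 from L2_norm_aeq[OF this v' v] have n: "nL (v + (u' - u)) = nL v" .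
 have e: "(v + (u' - u)) + w = u'" using eq by (simp add: algebra_simps)
 show "KK A t u' \<le> nL v + t*nH w" using K_le[OF t v' w] unfolding e n .
qed

text \<open>The two infima are taken one after the other, hence the nested applications of
  \<open>K_greatest\<close>.\<close>

lemma K_E_add:
 assumes u: "u \<in> L2 G" and v: "v \<in> L2 G" and t: "0 \<le> t"
 shows "KK (H1E) t (u + v) \<le> KK (H1E) t u + KK (H1E) t v"
proof -
 have "KK (H1E) t (u + v) - KK (H1E) t v \<le> KK (H1E) t u"
 proof (rule K_greatest[OF u gd_spaces(1)])
  fix u0 u1 assume u01: "u0 \<in> L2 G" "u1 \<in> H1E" "u = u0 + u1"
  have "KK (H1E) t (u + v) - (nL u0 + t*nH u1) \<le> KK (H1E) t v"
  proof (rule K_greatest[OF v gd_spaces(1)])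
   fix v0 v1 assume v01: "v0 \<in> L2 G" "v1 \<in> H1E" "v = v0 + v1"
   have "u + v = (u0 + v0) + (u1 + v1)" using u01(3) v01(3) by (simp add: algebra_simps)
   hence "KK (H1E) t (u + v) \<le> nL (u0 + v0) + t*nH (u1 + v1)"
    using K_le[OF t L2_add[OF u01(1) v01(1)] H1_add(1)[OF u01(2) v01(2)]] by simp
   also have "... \<le> (nL u0 + nL v0) + t*(nH u1 + nH v1)"
    using t by (intro add_mono mult_left_mono L2_norm_add H1_norm_add u01 v01)
   finally show "KK (H1E) t (u + v) - (nL u0 + t*nH u1) \<le> nL v0 + t*nH v1"
    by (simp add: algebra_simps del: One_nat_def)
  qed
  thus "KK (H1E) t (u + v) - KK (H1E) t v \<le> nL u0 + t*nH u1" by linarith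
 qed
 thus ?thesis by linarith
qed

lemma K_E_sq_add:
 assumes u: "u \<in> L2 G" and v: "v \<in> L2 G" and t: "0 < t"
  and b: "KK (H1E) t v \<le> D*min 1 t" and D: "0 \<le> D"
 shows "(KK (H1E) t (u + v))^2 \<le> 2*(KK (H1E) t u)^2 + 2*D^2*min 1 (t^2)"
proof -
 have mm: "(min 1 t)^2 = min 1 (t^2)"
  using t power_le_one[of t 2] one_le_power[of t 2] by (cases "t \<le> 1") auto
 have "(KK (H1E) t (u + v))^2 \<le> (KK (H1E) t u + D*min 1 t)^2"
  using K_E_add[OF u v, of t] b K_nonneg[OF L2_add[OF u v] gd_spaces(1), of t] t by (intro power_mono) auto
 also have "... \<le> 2*(KK (H1E) t u)^2 + 2*(D*min 1 t)^2"
  using sum_squares_bound[of "KK (H1E) t u" "D*min 1 t"] by (simp add: power2_sum del: One_nat_def)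
 finally show ?thesis unfolding power_mult_distrib mm by (simp add: mult.assoc)
qed

lemma mlt_H1_norm:
 assumes w: "w \<in> H1E" and m: "\<And>e. e \<in> edges G ==> abscont (len G e) (m e) (m' e)"
  and c: "\<And>e. e \<in> edges G ==> continuous_on (seg e) (m' e)"
  and b: "\<And>e x. e \<in> edges G ==> x \<in> seg e ==> \<bar>m e x\<bar> \<le> \<beta>" "\<And>e x. e \<in> edges G ==> x \<in> seg e ==> \<bar>m' e x\<bar> \<le> \<beta>'"
  and nn: "0 \<le> \<beta>" "0 \<le> \<beta>'"
 shows "nH (mlt m w) \<le> (2*\<beta> + \<beta>')*nH w"
proof -
 have mw: "mlt m w \<in> H1E" by (rule H1_mlt(1)[OF w m])
 have ae: "aeq G (DG (mlt m w)) (mlt m' w + mlt m (DG w))" by (rule H1_mlt(2)[OF w m])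
 have L: "mlt m' w \<in> L2 G" by (rule L2_mlt(1)[OF H1_L2[OF w] c b(2)])
 have L': "mlt m (DG w) \<in> L2 G" by (rule L2_mlt(1)[OF D_L2[OF w] abscont_continuous[OF m] b(1)])
 have "nH (mlt m w) \<le> nL (mlt m w) + nL (DG (mlt m w))" by (rule H1_norm_le)
 also have "nL (mlt m w) \<le> \<beta>*nL w"
  by (rule L2_mlt(2)[OF H1_L2[OF w] abscont_continuous[OF m] b(1) nn(1)])
 also have "nL (DG (mlt m w)) = nL (mlt m' w + mlt m (DG w))"
  by (rule L2_norm_aeq[OF ae D_L2[OF mw] L2_add[OF L L']])
 also have "... \<le> nL (mlt m' w) + nL (mlt m (DG w))" by (rule L2_norm_add[OF L L'])
 also have "nL (mlt m' w) \<le> \<beta>'*nL w" by (rule L2_mlt(2)[OF H1_L2[OF w] c b(2) nn(2)])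
 also have "nL (mlt m (DG w)) \<le> \<beta>*nL (DG w)"
  by (rule L2_mlt(2)[OF D_L2[OF w] abscont_continuous[OF m] b(1) nn(1)])
 finally have "nH (mlt m w) \<le> \<beta>*nL w + (\<beta>'*nL w + \<beta>*nL (DG w))" by simp
 also have "... \<le> \<beta>*nH w + (\<beta>'*nH w + \<beta>*nH w)"
  using nn L2_le_H1[of w] by (intro add_mono mult_left_mono)
 finally show ?thesis by (simp add: algebra_simps del: One_nat_def)
qed

text \<open>The multiplier is bounded on L2 and on the edgewise H^1, so it maps decompositions to
  decompositions. It need not respect vertex conditions, hence the free space
  \<open>H1E\<close>.\<close>

lemma K_mlt:
 assumes u: "u \<in> L2 G" and t: "0 \<le> t" and m: "\<And>e. e \<in> edges G ==> abscont (len G e) (m e) (m' e)"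
  and c: "\<And>e. e \<in> edges G ==> continuous_on (seg e) (m' e)"
  and b: "\<And>e x. e \<in> edges G ==> x \<in> seg e ==> \<bar>m e x\<bar> \<le> \<beta>" "\<And>e x. e \<in> edges G ==> x \<in> seg e ==> \<bar>m' e x\<bar> \<le> \<beta>'"
  and nn: "0 < \<beta>" "0 \<le> \<beta>'"
 shows "KK (H1E) t (mlt m u) \<le> (2*\<beta> + \<beta>')*KK (H1E) t u"
proof -
 let ?c = "2*\<beta> + \<beta>'"
 have "KK (H1E) t (mlt m u)/?c \<le> KK (H1E) t u"
 proof (rule K_greatest[OF u gd_spaces(1)])
  fix v w assume v: "v \<in> L2 G" and w: "w \<in> H1E" and eq: "u = v + w"
  have mv: "mlt m v \<in> L2 G" by (rule L2_mlt(1)[OF v abscont_continuous[OF m] b(1)])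
  have mv2: "nL (mlt m v) \<le> \<beta>*nL v"
   by (rule L2_mlt(2)[OF v abscont_continuous[OF m] b(1)]) (use nn in auto)
  have mw: "mlt m w \<in> H1E" by (rule H1_mlt(1)[OF w m])
  have mwn: "nH (mlt m w) \<le> ?c*nH w"
   by (rule mlt_H1_norm[OF w m c b]) (use nn in auto)
  have "KK (H1E) t (mlt m u) \<le> nL (mlt m v) + t*nH (mlt m w)"
   unfolding eq mlt_add by (rule K_le[OF t mv mw])
  also have "... \<le> \<beta>*nL v + t*(?c*nH w)"
   by (intro add_mono mult_left_mono mv2 mwn t)
  also have "... \<le> ?c*nL v + t*(?c*nH w)"
   using nn by (intro add_right_mono mult_right_mono) auto
  also have "... = ?c*(nL v + t*nH w)" by (simp add: algebra_simps del: One_nat_def)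
  finally show "KK (H1E) t (mlt m u)/?c \<le> nL v + t*nH w"
   using nn by (simp add: pos_divide_le_eq mult.commute del: One_nat_def)
 qed
 thus ?thesis using nn by (simp add: pos_divide_le_eq mult.commute del: One_nat_def)
qed

text \<open>A Lipschitz multiplier is replaced at scale \<open>t\<close> by its Steklov average over \<open>t\<close>, so that no
 almost-everywhere derivative of a Lipschitz function is needed.\<close>

lemma Steklov:
 fixes m :: "real => real"
 assumes m: "\<Lambda>'-lipschitz_on {0..l} m" and l: "0 < l" and t: "0 < t"
 obtains n n' where "abscont l n n'" "continuous_on {0..l} n'" "\<And>x. x \<in> {0..l} ==> \<bar>n x - m x\<bar> \<le> \<Lambda>'*t"
  "\<And>x. x \<in> {0..l} ==> \<bar>n' x\<bar> \<le> \<Lambda>'"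
proof -
 \<comment> \<open>\<open>m\<close> is continued by constants, so that averages over
   \<open>{x..x + t}\<close> make sense up to the right end.\<close>
 define M where "M y = m (max 0 (min l y))" for y
 have L0: "0 \<le> \<Lambda>'" using m lipschitz_on_nonneg by blast
 have Mlip: "\<bar>M x - M y\<bar> \<le> \<Lambda>'*\<bar>x - y\<bar>" for x y
 proof -
  have "\<bar>M x - M y\<bar> \<le> \<Lambda>'*\<bar>max 0 (min l x) - max 0 (min l y)\<bar>"
   using lipschitz_onD[OF m, of "max 0 (min l x)" "max 0 (min l y)"] l by (simp add: M_def dist_real_def)
  also have "... \<le> \<Lambda>'*\<bar>x - y\<bar>" using L0 by (intro mult_left_mono) (auto simp: max_def min_def)
  finally show ?thesis .
 qed
 have "\<Lambda>'-lipschitz_on UNIV M" using Mlip L0 by (intro lipschitz_onI) (auto simp: dist_real_def)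
 hence Mc: "continuous_on A M" for A using lipschitz_on_continuous_on continuous_on_subset by blast
 define I where "I x = integral {0..x} M" for x
 have Id: "(I has_real_derivative M x) (at x within {0..l + t})" if "x \<in> {0..l + t}" for x
  unfolding I_def[abs_def] by (rule integral_has_real_derivative[OF Mc that])
 define n where "n x = (I (x + t) - I x)/t" for x
 define n' where "n' x = (M (x + t) - M x)/t" for x
 have nd: "(n has_real_derivative n' x) (at x within {0..l})" if x: "x \<in> {0..l}" for x
 proof -
  have 1: "(I has_real_derivative M x) (at x within {0..l})"
   by (rule DERIV_subset[OF Id]) (use x t in auto)
  have 2: "((\<lambda>x. I (x + t)) has_real_derivative M (x + t)*1) (at x within {0..l})"
  proof (rule DERIV_image_chain[of I _ "\<lambda>x. x + t", unfolded o_def])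
   show "(I has_real_derivative M (x + t)) (at (x + t) within (\<lambda>x. x + t) ` {0..l})"
    by (rule DERIV_subset[OF Id]) (use x t in auto)
   show "((\<lambda>x. x + t) has_real_derivative 1) (at x within {0..l})" by (auto intro!: derivative_eq_intros)
  qed
  have "((\<lambda>x. I (x + t) - I x) has_real_derivative M (x + t)*1 - M x) (at x within {0..l})"
   by (rule DERIV_diff[OF 2 1])
  from DERIV_cdivide[OF this, of t] show ?thesis by (simp add: n_def[abs_def] n'_def)
 qed
 have n'c: "continuous_on {0..l} n'"
  unfolding n'_def[abs_def] using t by (intro continuous_intros continuous_on_compose2[OF Mc[of UNIV]] Mc) auto
 show ?thesis
 proof (rule that)
  show "abscont l n n'" by (rule abscont_of_deriv[OF n'c nd])
  show "continuous_on {0..l} n'" by (rule n'c)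
  show "\<bar>n' x\<bar> \<le> \<Lambda>'" for x using Mlip[of "x + t" x] t by (simp add: n'_def pos_divide_le_eq)
  fix x assume x: "x \<in> {0..l}"
  have Mi: "M integrable_on {a..b}" for a b by (rule integrable_continuous_real[OF Mc])
  have "I (x + t) - I x = integral {x..x + t} M"
   unfolding I_def using Henstock_Kurzweil_Integration.integral_combine[of 0 x "x + t" M] Mi x t by auto
  hence "I (x + t) - I x - t*M x = integral {x..x + t} M - integral {x..x + t} (\<lambda>y. M x)" using t by simp
  also have "... = integral {x..x + t} (\<lambda>y. M y - M x)"
   by (rule Henstock_Kurzweil_Integration.integral_diff[symmetric, OF Mi integrable_const_ivl])
  finally have e: "I (x + t) - I x - t*M x = integral {x..x + t} (\<lambda>y. M y - M x)" .
  have "norm (integral {x..x + t} (\<lambda>y. M y - M x)) \<le> integral {x..x + t} (\<lambda>y. \<Lambda>'*t)"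
  proof (rule integral_norm_bound_integral)
   fix y assume "y \<in> {x..x + t}"
   hence "\<Lambda>'*\<bar>y - x\<bar> \<le> \<Lambda>'*t" using L0 by (intro mult_left_mono) auto
   thus "norm (M y - M x) \<le> \<Lambda>'*t" using Mlip[of y x] by simp
  qed (intro integrable_diff Mi integrable_const_ivl)+
  hence "\<bar>I (x + t) - I x - t*M x\<bar> \<le> t*(\<Lambda>'*t)" using e t by (simp add: mult_ac)
  moreover have "I (x + t) - I x - t*M x = t*(n x - M x)" using t by (simp add: n_def field_simps)
  ultimately have "t*\<bar>n x - M x\<bar> \<le> t*(\<Lambda>'*t)" using t by (simp add: abs_mult)
  hence "\<bar>n x - M x\<bar> \<le> \<Lambda>'*t" using t by simp
  thus "\<bar>n x - m x\<bar> \<le> \<Lambda>'*t" using x by (simp add: M_def)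
 qed
qed

text \<open>The difference between \<open>m\<close> and its average, of size
  \<open>\<Lambda>*t\<close>, is charged to L2 and the average to H^1; for \<open>t > 1\<close> the
  norm in L2 suffices. The resulting decay \<open>min 1 t\<close> is enough for every order below
  one.\<close>

lemma K_lipschitz:
 assumes w: "w \<in> H1E" and t: "0 < t" and m: "\<And>e. e \<in> edges G ==> \<Lambda>-lipschitz_on (seg e) (m e)"
  and b: "\<And>e x. e \<in> edges G ==> x \<in> seg e ==> \<bar>m e x\<bar> \<le> \<beta>" and nn: "0 \<le> \<beta>"
 shows "KK (H1E) t (mlt m w) \<le> (2*\<beta> + 4*\<Lambda>)*nH w*min 1 t"
proof -
 let ?h = "nH w"
 have L0: "0 \<le> \<Lambda>" using m some_edge lipschitz_on_nonneg by metis
 have mc: "continuous_on (seg e) (m e)" if "e \<in> edges G" for e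
  using m[OF that] lipschitz_on_continuous_on by blast
 have ml: "mlt m w \<in> L2 G" by (rule L2_mlt(1)[OF H1_L2[OF w] mc b])
 show ?thesis
 proof (cases "t \<le> 1")
  case False
  have "KK (H1E) t (mlt m w) \<le> nL (mlt m w)" using t by (intro K_le_norm ml gd_spaces) auto
  also have "... \<le> \<beta>*nL w" by (rule L2_mlt(2)[OF H1_L2[OF w] mc b nn])
  also have "... \<le> (2*\<beta> + 4*\<Lambda>)*?h" using nn L0 L2_le_H1(1)[of w] by (intro mult_mono) auto
  finally show ?thesis using False by simp
 next
  case True
  have "\<forall>e\<in>edges G. \<exists>nn'. abscont (len G e) (fst nn') (snd nn') \<and> continuous_on (seg e) (snd nn') \<and>
    (\<forall>x\<in>seg e. \<bar>fst nn' x - m e x\<bar> \<le> \<Lambda>*t) \<and> (\<forall>x\<in>seg e. \<bar>snd nn' x\<bar> \<le> \<Lambda>)"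
  proof
   fix e assume e: "e \<in> edges G"
   obtain n n' where "abscont (len G e) n n'" "continuous_on (seg e) n'" "\<And>x. x \<in> seg e ==> \<bar>n x - m e x\<bar> \<le> \<Lambda>*t"
    "\<And>x. x \<in> seg e ==> \<bar>n' x\<bar> \<le> \<Lambda>" using Steklov[OF m[OF e] len_pos[OF e] t] by blast
   thus "\<exists>nn'. abscont (len G e) (fst nn') (snd nn') \<and> continuous_on (seg e) (snd nn') \<and>
    (\<forall>x\<in>seg e. \<bar>fst nn' x - m e x\<bar> \<le> \<Lambda>*t) \<and> (\<forall>x\<in>seg e. \<bar>snd nn' x\<bar> \<le> \<Lambda>)"
    by (intro exI[of _ "(n, n')"]) auto
  qed
  from bchoice[OF this] obtain N where N: "\<And>e. e \<in> edges G ==> abscont (len G e) (fst (N e)) (snd (N e))"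
   "\<And>e. e \<in> edges G ==> continuous_on (seg e) (snd (N e))"
   "\<And>e x. e \<in> edges G ==> x \<in> seg e ==> \<bar>fst (N e) x - m e x\<bar> \<le> \<Lambda>*t"
   "\<And>e x. e \<in> edges G ==> x \<in> seg e ==> \<bar>snd (N e) x\<bar> \<le> \<Lambda>" by blast
  define n where "n e = fst (N e)" for e
  define r where "r e x = m e x - n e x" for e x
  have na: "abscont (len G e) (n e) (snd (N e))" if "e \<in> edges G" for e using N(1)[OF that] by (simp add: n_def)
  have nc: "continuous_on (seg e) (n e)" if "e \<in> edges G" for e by (rule abscont_continuous[OF na[OF that]])
  have nb: "\<bar>n e x\<bar> \<le> \<beta> + \<Lambda>" if "e \<in> edges G" "x \<in> seg e" for e x
  proof -
   have "\<Lambda>*t \<le> \<Lambda>*1" using True L0 by (intro mult_left_mono) auto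
   thus ?thesis using N(3)[OF that] b[OF that] by (simp add: n_def)
  qed
  have rc: "continuous_on (seg e) (r e)" if "e \<in> edges G" for e
   unfolding r_def[abs_def] by (intro continuous_intros mc nc that)
  have rb: "\<bar>r e x\<bar> \<le> \<Lambda>*t" if "e \<in> edges G" "x \<in> seg e" for e x
   using N(3)[OF that] by (simp add: r_def n_def abs_minus_commute)
  have rw: "mlt r w \<in> L2 G" by (rule L2_mlt(1)[OF H1_L2[OF w] rc rb])
  have rwn: "nL (mlt r w) \<le> \<Lambda>*t*nL w"
   by (rule L2_mlt(2)[OF H1_L2[OF w] rc rb]) (use L0 t in auto)
  have nw: "mlt n w \<in> H1E" by (rule H1_mlt(1)[OF w na])
  have nwn: "nH (mlt n w) \<le> (2*(\<beta> + \<Lambda>) + \<Lambda>)*?h"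
   by (rule mlt_H1_norm[OF w na N(2) nb N(4)]) (use nn L0 in auto)
  have "mlt m w = mlt r w + mlt n w" by (auto simp: mlt_def r_def fun_eq_iff algebra_simps)
  hence "KK (H1E) t (mlt m w) \<le> nL (mlt r w) + t*nH (mlt n w)"
   using K_le[of t "mlt r w" "mlt n w" "H1E"] t rw nw by simp
  also have "... \<le> \<Lambda>*t*?h + t*((2*(\<beta> + \<Lambda>) + \<Lambda>)*?h)"
   using rwn nwn mult_left_mono[OF L2_le_H1(1)[of w], of "\<Lambda>*t"] L0 t by (intro add_mono mult_left_mono) auto
  also have "... = (2*\<beta> + 4*\<Lambda>)*?h*t" by (simp add: algebra_simps del: One_nat_def)
  finally show ?thesis using True by simp
 qed
qed

text \<open>For \<open>u\<close> in the domain, \<open>L u\<close> and \<open>u''\<close> have the same regularity of order less than one, by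
 \<open>L u = q u - a' u' - a u''\<close>.\<close>

lemma K_Lop:
 assumes u: "u \<in> Lp" and t: "0 < t"
 shows "(KK (H1E) t (Lop u))^2 \<le> 2*(2*a1 + a2)^2*(KK (H1E) t (DG (DG u)))^2
   + 2*(4*(k1 + a2 + 4*\<Lambda>)*nHH u)^2*min 1 (t^2)"
  "(KK (H1E) t (DG (DG u)))^2 \<le> (2/a0 + a2/a0^2)^2*(2*(KK (H1E) t (Lop u))^2
   + 2*(4*(k1 + a2 + 4*\<Lambda>)*nHH u)^2*min 1 (t^2))"
proof -
 let ?E = "H1E" and ?d = "DG u" and ?dd = "DG (DG u)"
 let ?D = "4*(k1 + a2 + 4*\<Lambda>)*nHH u"
 note L = H1_L2[OF LpD(3)[OF u]] D_L2[OF LpD(3)[OF u]] D_L2[OF LpD(4)[OF u]]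
 note M = mlt_q_L2(1)[OF L(1)] mlt_a'_L2(1)[OF L(2)] mlt_a_L2(1)[OF L(3)] Lop_L2[OF u]
 have L0: "0 \<le> \<Lambda>" using q_lip some_edge lipschitz_on_nonneg by metis
 \<comment> \<open>\<open>Lop u\<close> is \<open>- a*u''\<close> plus the lower order part
   \<open>r\<close>, whose K-functional decays like \<open>min 1 t\<close>.\<close>
 define r where "r = mlt q u + scl (-1) (mlt a' ?d)"
 have rL: "r \<in> L2 G" unfolding r_def by (intro L2_add L2_scl M)
 have le: "nH u \<le> nHH u" "nH ?d \<le> nHH u"
  by (rule power2_le_imp_le; simp only: H2_norm_sq H1_norm_sq H2_norm_nonneg; simp)+
 have D0: "0 \<le> ?D" using const_pos L0 H2_norm_nonneg[of u] by auto
 have qb: "\<bar>q e x\<bar> \<le> k1" if "e \<in> edges G" "x \<in> seg e" for e x using q[OF that] k0 by linarith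
 have K1: "KK ?E t (mlt q u) \<le> (2 * k1 + 4*\<Lambda>)*nH u*min 1 t"
  by (rule K_lipschitz[OF LpD(3)[OF u] t q_lip qb]) (use const_pos in auto)
 have K2: "KK ?E t (mlt a' ?d) \<le> (2*a2 + 4*\<Lambda>)*nH ?d*min 1 t"
  by (rule K_lipschitz[OF LpD(4)[OF u] t a'_lip a' const_pos(5)])
 have neg: "KK ?E t (scl (-1) v) \<le> KK ?E t v" if v: "v \<in> L2 G" for v
 proof (rule K_greatest[OF v gd_spaces(1)])
  fix x w assume x: "x \<in> L2 G" and w: "w \<in> ?E" and eq: "v = x + w"
  have "scl (-1) v = scl (-1) x + scl (-1) w" unfolding eq by (auto simp: fun_eq_iff)
  moreover have "KK ?E t (scl (-1) x + scl (-1) w) \<le> nL (scl (-1) x) + t*nH (scl (-1) w)"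
   by (rule K_le[OF less_imp_le[OF t] L2_scl[OF x] H1_scl(1)[OF w]])
  ultimately have "KK ?E t (scl (-1) v) \<le> nL (scl (-1) x) + t*nH (scl (-1) w)" by (simp only:)
  thus "KK ?E t (scl (-1) v) \<le> nL x + t*nH w"
   unfolding L2_norm_scl H1_norm_scl[OF w] by simp
 qed
 have rK: "KK ?E t r \<le> ?D*min 1 t"
 proof -
  have "KK ?E t r \<le> KK ?E t (mlt q u) + KK ?E t (scl (-1) (mlt a' ?d))"
   unfolding r_def using t by (intro K_E_add M L2_scl) auto
  also have "... \<le> (2 * k1 + 4*\<Lambda>)*nH u*min 1 t + (2*a2 + 4*\<Lambda>)*nH ?d*min 1 t"
   using K1 K2 neg[OF M(2)] by linarith
  also have "... \<le> (2 * k1 + 4*\<Lambda>)*nHH u*min 1 t + (2*a2 + 4*\<Lambda>)*nHH u*min 1 t"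
   using le const_pos L0 t by (intro add_mono mult_right_mono mult_left_mono) auto
  also have "... = (2 * k1 + 2*a2 + 8*\<Lambda>)*nHH u*min 1 t" by (simp add: algebra_simps)
  also have "... \<le> ?D*min 1 t" using const_pos L0 t H2_norm_nonneg[of u] by (intro mult_right_mono) auto
  finally show ?thesis .
 qed
 have rneg: "KK ?E t (scl (-1) r) \<le> ?D*min 1 t" using neg[OF rL] rK by linarith
 have aab: "\<bar>a e x\<bar> \<le> a1" if "e \<in> edges G" "x \<in> seg e" for e x using a[OF that] a0 by linarith
 have Ka: "KK ?E t (mlt a ?dd) \<le> (2*a1 + a2)*KK ?E t ?dd"
  by (rule K_mlt[OF L(3) _ a_abscont a'_cont aab a']) (use t const_pos in auto)
 have ia: "abscont (len G e) (\<lambda>x. 1/a e x) (\<lambda>x. - a' e x/(a e x)^2)" and ic: "continuous_on (seg e) (\<lambda>x. - a' e x/(a e x)^2)" if e: "e \<in> edges G" for e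
 proof -
  have nz: "a e x \<noteq> 0" if "x \<in> seg e" for x using a[OF e that] a0 by auto
  show c: "continuous_on (seg e) (\<lambda>x. - a' e x/(a e x)^2)"
   using nz by (intro continuous_intros a'_cont a_cont e) auto
  show "abscont (len G e) (\<lambda>x. 1/a e x) (\<lambda>x. - a' e x/(a e x)^2)"
  proof (rule abscont_of_deriv[OF c])
   fix x assume x: "x \<in> seg e"
   show "((\<lambda>x. 1/a e x) has_real_derivative - a' e x/(a e x)^2) (at x within seg e)"
    using DERIV_inverse_fun[OF a_deriv[OF e x] nz[OF x]] nz[OF x]
    by (simp add: inverse_eq_divide power2_eq_square divide_simps)
  qed
 qed
 have ib: "\<bar>1/a e x\<bar> \<le> 1/a0" and ib': "\<bar>- a' e x/(a e x)^2\<bar> \<le> a2/a0^2" if "e \<in> edges G" "x \<in> seg e" for e x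
 proof -
  have ax: "a0 \<le> a e x" using a[OF that] by simp
  show "\<bar>1/a e x\<bar> \<le> 1/a0" using ax a0 by (simp add: frac_le)
  have "\<bar>a' e x\<bar>/(a e x)^2 \<le> a2/a0^2"
   using a'[OF that] ax a0 const_pos by (intro frac_le power_mono) auto
  thus "\<bar>- a' e x/(a e x)^2\<bar> \<le> a2/a0^2" by simp
 qed
 have Ki: "KK ?E t (mlt (\<lambda>e x. 1/a e x) v) \<le> (2*(1/a0) + a2/a0^2)*KK ?E t v" if v: "v \<in> L2 G" for v
  by (rule K_mlt[OF v _ ia ic ib ib']) (use t a0 const_pos in auto)
 show "(KK ?E t (Lop u))^2 \<le> 2*(2*a1 + a2)^2*(KK ?E t ?dd)^2 + 2*?D^2*min 1 (t^2)"
 proof -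
  have "aeq G (scl (-1) (mlt a ?dd) + r) (Lop u)"
   using DD_aeq[OF u] unfolding aeq_def r_def by (auto elim!: eventually_mono simp: algebra_simps)
  hence "KK ?E t (Lop u) \<le> KK ?E t (scl (-1) (mlt a ?dd) + r)"
   using t by (intro K_aeq L2_add L2_scl M rL gd_spaces) auto
  hence "(KK ?E t (Lop u))^2 \<le> (KK ?E t (scl (-1) (mlt a ?dd) + r))^2"
   using K_nonneg[OF M(4) gd_spaces(1)] t by (intro power_mono) auto
  also have "... \<le> 2*(KK ?E t (scl (-1) (mlt a ?dd)))^2 + 2*?D^2*min 1 (t^2)"
   by (rule K_E_sq_add[OF L2_scl[OF M(3)] rL t rK D0])
  also have "(KK ?E t (scl (-1) (mlt a ?dd)))^2 \<le> ((2*a1 + a2)*KK ?E t ?dd)^2"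
   by (intro power_mono order_trans[OF neg[OF M(3)] Ka] K_nonneg L2_scl M gd_spaces less_imp_le[OF t])
  finally show ?thesis by (simp add: power_mult_distrib mult.assoc)
 qed
 show "(KK ?E t ?dd)^2 \<le> (2/a0 + a2/a0^2)^2*(2*(KK ?E t (Lop u))^2 + 2*?D^2*min 1 (t^2))"
 proof -
  \<comment> \<open>\<open>z\<close> equals \<open>a*u''\<close> almost everywhere, so dividing by
    \<open>a\<close> recovers \<open>u''\<close>.\<close>
  define z where "z = scl (-1) (Lop u) + r"
  have zL: "z \<in> L2 G" unfolding z_def by (intro L2_add L2_scl M rL)
  have mz: "mlt (\<lambda>e x. 1/a e x) z \<in> L2 G" by (rule L2_mlt(1)[OF zL abscont_continuous[OF ia] ib])
  have "aeq G (mlt (\<lambda>e x. 1/a e x) z) ?dd"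
   unfolding aeq_def
  proof
   fix e assume e: "e \<in> edges G"
   have "AE x in leb G e. x \<in> seg e" by (rule AE_I2) simp
   thus "AE x in leb G e. mlt (\<lambda>e x. 1/a e x) z e x = ?dd e x"
    using aeqD[OF DD_aeq[OF u] e]
   proof eventually_elim
    case (elim x)
    have "a e x \<noteq> 0" using a[OF e elim(1)] a0 by auto
    moreover have "z e x = a e x*?dd e x" using elim(2) by (simp add: z_def r_def mlt_def)
    ultimately show ?case by (simp add: mlt_def)
   qed
  qed
  hence "KK ?E t ?dd \<le> KK ?E t (mlt (\<lambda>e x. 1/a e x) z)"
   using t by (intro K_aeq mz L gd_spaces) auto
  also have "... \<le> (2/a0 + a2/a0^2)*KK ?E t z" using Ki[OF zL] by simp
  finally have "(KK ?E t ?dd)^2 \<le> ((2/a0 + a2/a0^2)*KK ?E t z)^2"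
   using K_nonneg[OF L(3) gd_spaces(1)] t by (intro power_mono) auto
  also have "... = (2/a0 + a2/a0^2)^2*(KK ?E t z)^2" by (simp add: power_mult_distrib)
  also have "(KK ?E t z)^2 \<le> 2*(KK ?E t (scl (-1) (Lop u)))^2 + 2*?D^2*min 1 (t^2)"
   unfolding z_def by (rule K_E_sq_add[OF L2_scl[OF M(4)] rL t rK D0])
  also have "(KK ?E t (scl (-1) (Lop u)))^2 \<le> (KK ?E t (Lop u))^2"
   by (intro power_mono neg K_nonneg L2_scl M gd_spaces less_imp_le[OF t])
  finally show ?thesis by (simp add: mult_left_mono)
 qed
qed

end

section \<open>Uniform convergence of eigenfunction expansions\<close>

context eigl
begin

text \<open>Testing the pointwise bound with \<open>d i = val i\<close> on the indices with \<open>t^2 \<mu> i \<le> 1\<close> bounds the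
 partial sums of \<open>(val i)^2\<close> by \<open>1/t\<close>; integrating against \<open>t powr (2 \<sigma> - 1)\<close> gives the weighted sum.\<close>

lemma weighted_point_sum:
 assumes C: "0 < C" and b: "\<And>n d t. 0 < t ==> (\<Sum>i<n. d i * val i)^2 \<le> C/t*(\<Sum>i<n. (1 + t^2*\<mu> i)*(d i)^2)"
  and s: "1/2 < \<sigma>"
 shows "(\<Sum>i<n. \<mu> i powr (- \<sigma>)*(val i)^2) \<le> 2*\<sigma>*(2*C)*((1/sqrt k0) powr (2*\<sigma> - 1)/(2*\<sigma> - 1))"
proof -
 \<comment> \<open>Since \<open>\<mu> i \<ge> k0\<close>, no index satisfies
   \<open>t^2*\<mu> i \<le> 1\<close> beyond \<open>T\<close>, and the integration in
   \<open>t\<close> can stop there.\<close>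
 define T where "T = 1/sqrt k0"
 have T: "0 < T" using k0 by (simp add: T_def)
 define E where "E t = (\<Sum>i<n. if t^2*\<mu> i \<le> 1 then (val i)^2 else 0)" for t
 have E: "E t \<le> 2*C/t" if t: "0 < t" for t
 proof -
  define d where "d i = (if t^2*\<mu> i \<le> 1 then val i else 0)" for i
  have e1: "(\<Sum>i<n. d i * val i) = E t" unfolding E_def by (rule sum.cong) (auto simp: d_def power2_eq_square)
  have "(E t)^2 \<le> C/t*(\<Sum>i<n. (1 + t^2*\<mu> i)*(d i)^2)" using b[OF t, where n = n and d = d] e1 by simp
  also have "(\<Sum>i<n. (1 + t^2*\<mu> i)*(d i)^2) \<le> (\<Sum>i<n. 2*(if t^2*\<mu> i \<le> 1 then (val i)^2 else 0))"
   by (rule sum_mono) (auto simp: d_def intro!: mult_right_mono)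
  also have "... = 2*E t" by (simp add: E_def sum_distrib_left)
  finally have "E t*E t \<le> 2*C/t*E t" using C t by (simp add: power2_eq_square mult_left_mono mult_ac divide_right_mono)
  moreover have "0 \<le> E t" unfolding E_def by (intro sum_nonneg) auto
  ultimately show ?thesis using mult_right_le_imp_le[of "E t" "E t" "2*C/t"] C t by (cases "E t = 0") auto
 qed
 have each: "((\<lambda>t. (if t^2*\<mu> i \<le> 1 then (val i)^2 else 0)*t powr (2*\<sigma> - 1)) has_integral (\<mu> i powr (- \<sigma>)/(2*\<sigma>)*(val i)^2)) {0..T}" for i
 proof -
  define c where "c = 1/sqrt (\<mu> i)"
  have c: "0 < c" "c \<le> T" using mu_pos[of i] mu_ge[of i] k0 by (auto simp: c_def T_def intro!: divide_left_mono)
  have iff: "t^2*\<mu> i \<le> 1 \<longleftrightarrow> t \<le> c" if "0 \<le> t" for t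
  proof -
   have "t^2*\<mu> i = (t * sqrt (\<mu> i))^2" using mu_pos[of i] by (simp add: power_mult_distrib)
   hence "t^2*\<mu> i \<le> 1 \<longleftrightarrow> t * sqrt (\<mu> i) \<le> 1"
    using that mu_pos[of i] power2_le_iff_abs_le[of 1 "t * sqrt (\<mu> i)"] by (simp add: abs_of_nonneg)
   thus ?thesis using mu_pos[of i] by (simp add: c_def pos_le_divide_eq)
  qed
  have "((\<lambda>t. t powr (2*\<sigma> - 1)) has_integral (c powr (2*\<sigma> - 1 + 1)/(2*\<sigma> - 1 + 1))) {0..c}"
   using s c by (intro has_integral_powr_from_0) auto
  hence "((\<lambda>t. if t \<in> {0..c} then t powr (2*\<sigma> - 1) else 0) has_integral (c powr (2*\<sigma>)/(2*\<sigma>))) {0..T}"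
   using c by (subst has_integral_restrict) auto
  from has_integral_mult_right[OF this, of "(val i)^2"]
  have "((\<lambda>t. (val i)^2*(if t \<in> {0..c} then t powr (2*\<sigma> - 1) else 0)) has_integral ((val i)^2*(c powr (2*\<sigma>)/(2*\<sigma>)))) {0..T}" .
  moreover have "c powr (2*\<sigma>) = \<mu> i powr (- \<sigma>)"
  proof -
   have "c = \<mu> i powr (- (1/2))" unfolding c_def using powr_minus_divide[of "\<mu> i" "1/2"] powr_half_sqrt[of "\<mu> i"] mu_nonneg[of i] by simp
   thus ?thesis by (simp add: powr_powr)
  qed
  ultimately have h: "((\<lambda>t. (val i)^2*(if t \<in> {0..c} then t powr (2*\<sigma> - 1) else 0)) has_integral (\<mu> i powr (- \<sigma>)/(2*\<sigma>)*(val i)^2)) {0..T}"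
   by (simp add: mult.commute)
  show ?thesis by (rule has_integral_eq[OF _ h]) (use iff in auto)
 qed
 have "((\<lambda>t. \<Sum>i<n. (if t^2*\<mu> i \<le> 1 then (val i)^2 else 0)*t powr (2*\<sigma> - 1)) has_integral (\<Sum>i<n. \<mu> i powr (- \<sigma>)/(2*\<sigma>)*(val i)^2)) {0..T}"
  by (intro has_integral_sum each) simp
 hence L: "((\<lambda>t. E t*t powr (2*\<sigma> - 1)) has_integral (\<Sum>i<n. \<mu> i powr (- \<sigma>)/(2*\<sigma>)*(val i)^2)) {0..T}"
  by (simp add: E_def sum_distrib_right)
 have U: "((\<lambda>t. 2*C*t powr (2*\<sigma> - 2)) has_integral (2*C*(T powr (2*\<sigma> - 2 + 1)/(2*\<sigma> - 2 + 1)))) {0..T}"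
  using s T by (intro has_integral_mult_right has_integral_powr_from_0) auto
 have "(\<Sum>i<n. \<mu> i powr (- \<sigma>)/(2*\<sigma>)*(val i)^2) \<le> 2*C*(T powr (2*\<sigma> - 2 + 1)/(2*\<sigma> - 2 + 1))"
 proof (rule has_integral_le[OF L U])
  fix t assume t: "t \<in> {0..T}"
  show "E t*t powr (2*\<sigma> - 1) \<le> 2*C*t powr (2*\<sigma> - 2)"
  proof (cases "t = 0")
   case False
   hence tp: "0 < t" using t by auto
   have "E t*t powr (2*\<sigma> - 1) \<le> 2*C/t*t powr (2*\<sigma> - 1)" by (intro mult_right_mono E tp) simp
   also have "... = 2*C*(t powr (2*\<sigma> - 1)/t powr 1)" using tp by simp
   also have "... = 2*C*t powr (2*\<sigma> - 2)" by (simp only: powr_diff[symmetric]) simp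
   finally show ?thesis .
  qed simp
 qed
 hence "2*\<sigma>*(\<Sum>i<n. \<mu> i powr (- \<sigma>)/(2*\<sigma>)*(val i)^2) \<le> 2*\<sigma>*(2*C*(T powr (2*\<sigma> - 1)/(2*\<sigma> - 1)))"
  using s by (intro mult_left_mono) (auto simp: algebra_simps)
 moreover have "2*\<sigma>*(\<Sum>i<n. \<mu> i powr (- \<sigma>)/(2*\<sigma>)*(val i)^2) = (\<Sum>i<n. \<mu> i powr (- \<sigma>)*(val i)^2)"
  using s by (simp add: sum_distrib_left)
 ultimately show ?thesis by (simp add: T_def)
qed

text \<open>Cauchy-Schwarz with the weights \<open>\<mu> i powr \<sigma>\<close> and their inverses;
  the weighted squared point values have bounded sums because \<open>\<sigma>\<close> exceeds
  1/2.\<close>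

lemma point_sum_bound:
 assumes C: "0 < C" and b: "\<And>n d t. 0 < t ==> (\<Sum>i<n. d i * val i)^2 \<le> C/t*(\<Sum>i<n. (1 + t^2*\<mu> i)*(d i)^2)"
  and s: "1/2 < \<sigma>"
 shows "(\<Sum>i<n. d i * val i)^2 \<le> 2*\<sigma>*(2*C)*((1/sqrt k0) powr (2*\<sigma> - 1)/(2*\<sigma> - 1))*(\<Sum>i<n. \<mu> i powr \<sigma>*(d i)^2)"
proof -
 have "(\<Sum>i<n. d i * val i) = (\<Sum>i<n. (\<mu> i powr (- \<sigma>/2) * val i)*(\<mu> i powr (\<sigma>/2)*d i))"
 proof (rule sum.cong[OF refl])
  fix i
  have "\<mu> i powr (- \<sigma>/2)*\<mu> i powr (\<sigma>/2) = 1" using mu_pos[of i] by (simp add: powr_add[symmetric])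
  thus "d i * val i = (\<mu> i powr (- \<sigma>/2) * val i)*(\<mu> i powr (\<sigma>/2)*d i)" by (simp add: algebra_simps)
 qed
 hence "(\<Sum>i<n. d i * val i)^2 \<le> (\<Sum>i<n. (\<mu> i powr (- \<sigma>/2) * val i)^2)*(\<Sum>i<n. (\<mu> i powr (\<sigma>/2)*d i)^2)"
  by (simp only: Cauchy_Schwarz_ineq_sum)
 also have "... = (\<Sum>i<n. \<mu> i powr (- \<sigma>)*(val i)^2)*(\<Sum>i<n. \<mu> i powr \<sigma>*(d i)^2)"
  by (simp add: power_mult_distrib power2_eq_square[of "_ powr _"] powr_add[symmetric])
 also have "... \<le> 2*\<sigma>*(2*C)*((1/sqrt k0) powr (2*\<sigma> - 1)/(2*\<sigma> - 1))*(\<Sum>i<n. \<mu> i powr \<sigma>*(d i)^2)"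
  by (intro mult_right_mono weighted_point_sum[OF C b s] sum_nonneg) auto
 finally show ?thesis .
qed

text \<open>The trace bound is a product of two norms; the arithmetic-geometric mean inequality at
  scale \<open>t\<close> turns it into the premise shape of \<open>point_sum_bound\<close>.\<close>

lemma trace_scaled:
 assumes w: "w \<in> H1E" and e: "e \<in> edges G" "x \<in> seg e" and t: "0 < t" and c: "0 \<le> c" "0 \<le> c'"
  and X: "(nL w)^2 \<le> c*(\<Sum>i<n. (d i)^2)" and Y: "(nH w)^2 \<le> c'*(\<Sum>i<n. \<mu> i*(d i)^2)"
 shows "(rp w e x)^2 \<le> (Ctr*(c + c'))/t*(\<Sum>i<n. (1 + t^2*\<mu> i)*(d i)^2)"
proof -
 define A B where "A = (\<Sum>i<n. (d i)^2)" and "B = (\<Sum>i<n. \<mu> i*(d i)^2)"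
 let ?p = "nL w" and ?q = "nH w"
 have AB: "0 \<le> A" "0 \<le> B" unfolding A_def B_def by (auto intro!: sum_nonneg mult_nonneg_nonneg mu_nonneg)
 have "2*(?p*(t*?q)) \<le> ?p^2 + (t*?q)^2" using sum_squares_bound[of ?p "t*?q"] by simp
 also have "... \<le> c*A + t^2*(c'*B)"
  unfolding power_mult_distrib A_def B_def by (intro add_mono X mult_left_mono Y) simp
 also have "... \<le> c*A + t^2*(c'*B) + (c'*A + t^2*(c*B))" using AB c by simp
 finally have m: "t*(2*(?p*?q)) \<le> (c + c')*(A + t^2*B)" by (simp add: algebra_simps del: One_nat_def)
 have nn: "0 \<le> ?p*?q" by (intro mult_nonneg_nonneg L2_norm_nonneg H1_norm_nonneg)
 have "t*(rp w e x)^2 \<le> Ctr*(t*(2*(?p*?q)))"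
  using mult_left_mono[OF trace_bound[OF w e], of t] t by (simp add: mult_ac del: One_nat_def)
 also have "... \<le> Ctr*((c + c')*(A + t^2*B))" using m Ctr_pos(1)[OF e(1)] by (intro mult_left_mono) auto
 also have "A + t^2*B = (\<Sum>i<n. (1 + t^2*\<mu> i)*(d i)^2)"
  by (simp add: A_def B_def sum_distrib_left sum.distrib[symmetric] algebra_simps)
 finally show ?thesis using t by (simp add: pos_le_divide_eq mult_ac)
qed

lemma point_bound_value:
 assumes e: "e \<in> edges G" "x \<in> seg e" and t: "0 < t"
 shows "(\<Sum>i<n. d i*rp (\<psi> i) e x)^2 \<le> (Ctr*(1 + 1/b0))/t*(\<Sum>i<n. (1 + t^2*\<mu> i)*(d i)^2)"
 unfolding H1_lin_comb(3)[where \<psi> = \<psi>, OF psi_D(2) e, symmetric]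
proof (rule trace_scaled[OF LC(3) e t])
 show "(nL (lin_comb n d \<psi>))^2 \<le> 1*(\<Sum>i<n. (d i)^2)"
  using norm_diff_lin_comb[OF L2_zero, of n d] L2_norm_minus_commute[of 0 "lin_comb n d \<psi>"] by simp
 show "(nH (lin_comb n d \<psi>))^2 \<le> 1/b0*(\<Sum>i<n. \<mu> i*(d i)^2)"
  using B_lower[OF LC(3)[of n d]] b_pos unfolding B_lin_comb_self by (simp add: field_simps del: One_nat_def)
qed (use b_pos in auto)

text \<open>Dividing by \<open>sqrt (\<mu> i)\<close> normalizes the derivatives of the
  eigenfunctions, so that their point values obey a bound of the same shape as
  \<open>point_bound_value\<close>.\<close>

lemma point_bound_deriv:
 assumes e: "e \<in> edges G" "x \<in> seg e" and t: "0 < t"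
 shows "(\<Sum>i<n. d i*(rp (DG (\<psi> i)) e x/sqrt (\<mu> i)))^2 \<le> (Ctr*(1/b0 + Cell^2))/t*(\<Sum>i<n. (1 + t^2*\<mu> i)*(d i)^2)"
proof -
 let ?d = "\<lambda>i. d i/sqrt (\<mu> i)"
 let ?S = "lin_comb n ?d \<psi>"
 have m1: "\<mu> i*(?d i)^2 = (d i)^2" "(\<mu> i)^2*(?d i)^2 = \<mu> i*(d i)^2" for i
  using mu_pos[of i] by (auto simp: power_divide power2_eq_square)
 have "rp (DG ?S) e x = rp (lin_comb n ?d (\<lambda>i. DG (\<psi> i))) e x"
  by (rule H1_aeq(3)[OF H1_lin_comb(1)[OF psi_D(4)] D_L2[OF LC(3)] H1_lin_comb(2)[where \<psi> = \<psi>, OF psi_D(2)] e])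
 also have "... = (\<Sum>i<n. ?d i*rp (DG (\<psi> i)) e x)" by (rule H1_lin_comb(3)[OF psi_D(4) e])
 finally have r: "(\<Sum>i<n. d i*(rp (DG (\<psi> i)) e x/sqrt (\<mu> i))) = rp (DG ?S) e x" by simp
 show ?thesis unfolding r
 proof (rule trace_scaled[OF LpD(4)[OF LC(1)] e t])
  have "b0*(nH ?S)^2 \<le> (\<Sum>i<n. (d i)^2)" using B_lower[OF LC(3)[of n ?d]] unfolding B_lin_comb_self m1 .
  moreover have "b0*(nL (DG ?S))^2 \<le> b0*(nH ?S)^2"
   using b_pos by (intro mult_left_mono power_mono L2_le_H1) auto
  ultimately have "b0*(nL (DG ?S))^2 \<le> (\<Sum>i<n. (d i)^2)" by (rule order_trans[rotated])
  thus "(nL (DG ?S))^2 \<le> 1/b0*(\<Sum>i<n. (d i)^2)" using b_pos by (simp add: field_simps)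
  have "(nH (DG ?S))^2 \<le> (Cell*nL (Lop ?S))^2" by (intro power_mono elliptic LC H1_norm_nonneg)
  thus "(nH (DG ?S))^2 \<le> Cell^2*(\<Sum>i<n. \<mu> i*(d i)^2)"
   unfolding power_mult_distrib Lop_lin_comb m1 .
 qed (use b_pos in auto)
qed

text \<open>The uniform limit is continuous, and it agrees with the L2 limit since uniform
  convergence on a bounded interval implies convergence in L2.\<close>

lemma uniform_limit_rep:
 assumes T: "\<And>n. T n \<in> H1E" and f: "f \<in> L2 G" and c: "(\<lambda>n. nL (T n - f)) \<longlonglongrightarrow> 0"
  and U: "\<And>r. 0 < r ==> \<exists>N. \<forall>m\<ge>N. \<forall>n\<ge>N. \<forall>e\<in>edges G. \<forall>x\<in>seg e. \<bar>rp (T m) e x - rp (T n) e x\<bar> < r"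
 obtains W where "\<And>e. e \<in> edges G ==> continuous_on (seg e) (W e)" "aeq G f W"
  "\<And>e x. e \<in> edges G ==> x \<in> seg e ==> (\<lambda>n. rp (T n) e x) \<longlonglongrightarrow> W e x"
proof -
 have "\<exists>w. uniform_limit (seg e) (\<lambda>n. rp (T n) e) w sequentially" if e: "e \<in> edges G" for e
 proof -
  have "uniformly_Cauchy_on (seg e) (\<lambda>n. rp (T n) e)"
   unfolding uniformly_Cauchy_on_def dist_real_def using U e by metis
  thus ?thesis
   using Cauchy_uniformly_convergent uniformly_convergent_on_def by blast
 qed
 then obtain W where W: "\<And>e. e \<in> edges G ==> uniform_limit (seg e) (\<lambda>n. rp (T n) e) (W e) sequentially" by metis
 have Wc: "continuous_on (seg e) (W e)" if e: "e \<in> edges G" for e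
  by (rule uniform_limit_theorem[OF always_eventually[OF allI] W[OF e]]) (auto intro: abscont_continuous[OF rp_abscont[OF T e]])
 have ae: "AE x in leb G e. f e x = W e x" if e: "e \<in> edges G" for e
 proof -
  have sW: "sqi (leb G e) (W e)" by (rule sqi_continuous[OF Wc[OF e]])
  note sf = L2D[OF f e]
  have "nm (leb G e) (\<lambda>x. f e x - W e x) \<le> 0"
  proof (rule field_le_epsilon)
   fix r :: real assume r: "0 < r"
   define k where "k = sqrt (len G e) + 1"
   have k: "0 < k" "sqrt (len G e) \<le> k" unfolding k_def using len_pos[OF e] by (auto intro: add_pos_pos)
   have ev1: "\<forall>\<^sub>F n in sequentially. nL (T n - f) < r/2"
    using order_tendstoD(2)[OF c] r half_gt_zero by blast
   have ev2: "\<forall>\<^sub>F n in sequentially. \<forall>x\<in>seg e. dist (rp (T n) e x) (W e x) < r/(2 * k)"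
    using uniform_limitD[OF W[OF e], of "r/(2 * k)"] r k by simp
   obtain n where n1: "nL (T n - f) < r/2" and n2: "\<forall>x\<in>seg e. dist (rp (T n) e x) (W e x) < r/(2 * k)"
    using eventually_happens'[OF _ eventually_conj[OF ev1 ev2]] by auto
   note sr = abscont_sqi_fun[OF rp_abscont[OF T[of n] e]]
   have "nm (leb G e) (\<lambda>x. (f e x - rp (T n) e x) + (rp (T n) e x - W e x)) \<le> nm (leb G e) (\<lambda>x. f e x - rp (T n) e x) + nm (leb G e) (\<lambda>x. rp (T n) e x - W e x)"
    by (intro nm_add sqi_diff sf sr sW)
   also have "nm (leb G e) (\<lambda>x. f e x - rp (T n) e x) = nm (leb G e) ((T n - f) e)"
   proof -
    have "nm (leb G e) (\<lambda>x. f e x - rp (T n) e x) = nm (leb G e) (\<lambda>x. f e x - T n e x)"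
     by (rule nm_eq_AE) (use aeqD[OF rp_aeq[OF T] e, of n] sf sr L2D[OF H1_L2[OF T] e] in \<open>auto intro!: sqi_diff elim: eventually_mono\<close>)
    also have "... = nm (leb G e) ((T n - f) e)" by (simp add: nm_def gfn_minus power2_commute)
    finally show ?thesis .
   qed
   also have "... \<le> r/2" using nm_le_L2_norm[OF e, of "T n - f"] n1 by linarith
   also have "nm (leb G e) (\<lambda>x. rp (T n) e x - W e x) \<le> r/(2 * k) * sqrt (len G e)"
    by (rule nm_le_const) (use n2 sr sW r k len_pos[OF e] in \<open>auto intro!: sqi_diff less_imp_le simp: dist_real_def\<close>)
   also have "... \<le> r/(2 * k) * k" using r k by (intro mult_left_mono) auto
   also have "... = r/2" using k by simp
   finally show "nm (leb G e) (\<lambda>x. f e x - W e x) \<le> 0 + r" by simp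
  qed
  hence "nm (leb G e) (\<lambda>x. f e x - W e x) = 0" by (simp add: order_antisym)
  from nm_zero_AE[OF sqi_diff[OF sf sW] this] show ?thesis by simp
 qed
 show ?thesis
 proof (rule that)
  show "continuous_on (seg e) (W e)" if "e \<in> edges G" for e by (rule Wc[OF that])
  show "aeq G f W" using ae by (simp add: aeq_def)
  show "(\<lambda>n. rp (T n) e x) \<longlonglongrightarrow> W e x" if "e \<in> edges G" "x \<in> seg e" for e x
   by (rule tendsto_uniform_limitI[OF W[OF that(1)] that(2)])
 qed
qed

end

section \<open>Vertex conditions and one-sided means\<close>

lemma Hk_int_nsq_nonneg: "0 \<le> Hk_int_nsq l k u"
 by (induction k arbitrary: u) auto

context mgr
begin

text \<open>Restricting a decomposition to one edge does not increase either norm. This supplies the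
  edgewise order \<open>Hs_int\<close> that the definitions of the vertex conditions demand.\<close>

lemma edge_interp:
 assumes u: "u \<in> L2 G" and f: "NQ \<theta> (H1E) u < \<infinity>" and e: "e \<in> edges G"
 shows "u e \<in> interp_space \<theta> (Hk_int (len G e) 0) (\<lambda>v. sqrt (Hk_int_nsq (len G e) 0 v))
  (Hk_int (len G e) 1) (\<lambda>v. sqrt (Hk_int_nsq (len G e) 1 v))"
proof -
 let ?N = "\<lambda>k v. sqrt (Hk_int_nsq (len G e) k v)"
 let ?K = "\<lambda>t. K_functional (Hk_int (len G e) 0) (?N 0) (Hk_int (len G e) 1) (?N 1) t (u e)"
 let ?S = "\<lambda>t. {?N 0 v + t*?N 1 w |v w. v \<in> Hk_int (len G e) 0 \<and> w \<in> Hk_int (len G e) 1 \<and> u e = v + w}"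
 have nb: "?N k (v e) \<le> HkE_norm G k v" for k v
  unfolding HkE_norm_def by (intro real_sqrt_le_mono member_le_sum e fin_edges Hk_int_nsq_nonneg)
 have ue: "u e \<in> Hk_int (len G e) 0" using u e by (auto simp: HkE_def)
 have z: "0 \<in> Hk_int (len G e) 1" using H1_zero(1) e by (auto simp: HkE_def simp del: One_nat_def)
 have lb: "0 \<le> y" if "y \<in> ?S t" "0 < t" for y t
  using that by (auto intro!: add_nonneg_nonneg mult_nonneg_nonneg Hk_int_nsq_nonneg simp del: One_nat_def Hk_int_nsq.simps)
 have ne: "?S t \<noteq> {}" for t 
 proof -
  have "?N 0 (u e) + t*?N 1 0 \<in> ?S t" using ue z by (intro CollectI exI[of _ "u e"] exI[of _ 0] conjI) auto
  thus ?thesis by blast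
 qed
 have K0: "0 \<le> ?K t" if "0 < t" for t unfolding K_functional_def by (rule cInf_greatest[OF ne]) (rule lb[OF _ that])
 have Kle: "?K t \<le> KK (H1E) t u" if t: "0 < t" for t
 proof (rule K_greatest[OF u gd_spaces(1)])
  fix v w assume v: "v \<in> L2 G" and w: "w \<in> H1E" and eq: "u = v + w"
  have "?N 0 (v e) + t*?N 1 (w e) \<in> ?S t" using v w e eq by (auto simp: HkE_def simp del: One_nat_def)
  hence "?K t \<le> ?N 0 (v e) + t*?N 1 (w e)"
   unfolding K_functional_def by (rule cInf_lower) (rule bdd_belowI[OF lb[OF _ t]])
  also have "... \<le> nL v + t*nH w" using t by (intro add_mono mult_left_mono nb) auto
  finally show "?K t \<le> nL v + t*nH w" .
 qed
 have "interp_nsq \<theta> (Hk_int (len G e) 0) (?N 0) (Hk_int (len G e) 1) (?N 1) (u e) \<le> NQ \<theta> (H1E) u"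
  unfolding interp_nsq_def
 proof (rule nn_integral_mono)
  fix t :: real
  show "ennreal ((t powr - \<theta>*?K t)^2/t)*indicator {0<..} t
   \<le> ennreal ((t powr - \<theta>*KK (H1E) t u)^2/t)*indicator {0<..} t"
   using Kle[of t] K0[of t]
   by (cases "0 < t") (auto intro!: ennreal_leI divide_right_mono power_mono mult_left_mono simp del: One_nat_def)
 qed
 hence "interp_nsq \<theta> (Hk_int (len G e) 0) (?N 0) (Hk_int (len G e) 1) (?N 1) (u e) < \<infinity>" using f by (rule le_less_trans)
 moreover have "\<exists>v w. u e = v + w \<and> v \<in> Hk_int (len G e) 0 \<and> w \<in> Hk_int (len G e) 1"
  using ue z by (intro exI[of _ "u e"] exI[of _ 0]) simp
 ultimately show ?thesis unfolding interp_space_def by blast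
qed

lemma abscont_param:
 assumes "abscont (len G e) U g"
 shows "abscont (len G e) (\<lambda>t. U (param G e b t)) (\<lambda>t. sgb b*g (param G e b t))"
 using assms abscont_reflect[OF assms] by (cases b) (auto simp: param_def sgb_def)

text \<open>The fundamental theorem of calculus at the end point, with a sign for the reversed
  parameterization.\<close>

lemma end_deriv:
 assumes e: "e \<in> edges G" and U: "abscont (len G e) U g"
  and W: "continuous_on (seg e) W" and ae: "AE x in leb G e. g x = W x"
 shows "((\<lambda>t. U (param G e b t)) has_real_derivative sgb b*W (param G e b 0)) (at 0 within seg e)"
proof -
 let ?l = "len G e"
 have A: "abscont ?l U W" by (rule abscont_cong_deriv[OF U sqi_continuous[OF W] ae])
 have d: "(U has_real_derivative W x) (at x within {0..?l})" if x: "x \<in> {0..?l}" for x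
 proof (rule has_field_derivative_transform_within[where d = 1])
  show "((\<lambda>x. U 0 + integral {0..x} W) has_real_derivative W x) (at x within {0..?l})"
   using DERIV_add[OF DERIV_const integral_has_real_derivative[OF W x], of "U 0"] by simp
  show "U 0 + integral {0..y} W = U y" if "y \<in> {0..?l}" for y using abscontD[OF A, of y] that by simp
 qed (use x in auto)
 show ?thesis
 proof (cases b)
  case True
  thus ?thesis using d[of 0] len_pos[OF e] by (simp add: param_def sgb_def)
 next
  case False
  have "((\<lambda>t. U (?l - t)) has_real_derivative W (?l - 0)*(-1)) (at 0 within {0..?l})"
  proof (rule DERIV_image_chain[of U _ "\<lambda>t. ?l - t", unfolded o_def])
   show "(U has_real_derivative W (?l - 0)) (at (?l - 0) within (\<lambda>t. ?l - t) ` {0..?l})"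
    using DERIV_subset[OF d[of ?l], of "(\<lambda>t. ?l - t) ` {0..?l}"] len_pos[OF e] by auto
   show "((\<lambda>t. ?l - t) has_real_derivative -1) (at 0 within {0..?l})" by (auto intro!: derivative_eq_intros)
  qed
  thus ?thesis using False by (simp add: param_def sgb_def)
 qed
qed

text \<open>The difference quotient of \<open>U\<close> at the end is the mean of its density over
  the collar, so existence of the one-sided derivative alone, without continuity of
  \<open>g\<close>, yields convergence of the means.\<close>

lemma end_mean:
 assumes e: "e \<in> edges G" and U: "abscont (len G e) U g"
  and d: "((\<lambda>t. U (param G e b t)) has_real_derivative D) (at 0 within seg e)"
 shows "((\<lambda>t. integral {0..t} (\<lambda>x. sgb b*g (param G e b x))/t) \<longlongrightarrow> D) (at_right 0)"
proof -
 let ?l = "len G e"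
 have "((\<lambda>t. (U (param G e b t) - U (param G e b 0))/(t - 0)) \<longlongrightarrow> D) (at_right 0)"
  using d unfolding has_field_derivative_iff at_within_Icc_at_right[OF len_pos[OF e]] .
 moreover have "\<forall>\<^sub>F t in at_right 0. (U (param G e b t) - U (param G e b 0))/(t - 0) = integral {0..t} (\<lambda>x. sgb b*g (param G e b x))/t"
  using eventually_at_right_real[OF len_pos[OF e]]
 proof eventually_elim
  case (elim t)
  thus ?case using abscontD[OF abscont_param[OF U, of b], of t] by simp
 qed
 ultimately show ?thesis by (rule Lim_transform_eventually)
qed

lemma Kirchhoff_D:
 assumes u: "u \<in> H1E" and K: "u \<in> Kirchhoff G VK"
 obtains d where "\<And>e b. e \<in> edges G ==> origin G e b \<in> VK ==>
   ((\<lambda>t. rp u e (param G e b t)) has_real_derivative d e b) (at 0 within seg e)"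
  "\<And>p. p \<in> VK ==> (\<Sum>(e, b)\<in>ends p. d e b) = 0"
proof -
 obtain v d where v: "aeq G u v" "\<forall>e\<in>incident G VK. continuous_on (seg e) (v e)"
  and d: "\<forall>e\<in>edges G. \<forall>b. origin G e b \<in> VK \<longrightarrow> ((\<lambda>t. v e (param G e b t)) has_real_derivative d e b) (at 0 within seg e)"
   "\<forall>p\<in>VK. (\<Sum>(e, b)\<in>ends p. d e b) = 0"
  using K unfolding Kirchhoff_def has_rep_def ends_def by blast
 show thesis
 proof (rule that)
  fix e b assume e: "e \<in> edges G" and o: "origin G e b \<in> VK"
  hence i: "e \<in> incident G VK" by (cases b) (auto simp: incident_def origin_def)
  have eq: "v e x = rp u e x" if "x \<in> seg e" for x
   using v(2) i by (intro continuous_rep_eq[OF u e _ aeqD[OF v(1) e] that]) auto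
  show "((\<lambda>t. rp u e (param G e b t)) has_real_derivative d e b) (at 0 within seg e)"
  proof (rule has_field_derivative_transform_within[where d = 1])
   show "((\<lambda>t. v e (param G e b t)) has_real_derivative d e b) (at 0 within seg e)" using d(1) e o by blast
   show "v e (param G e b t) = rp u e (param G e b t)" if "t \<in> seg e" for t
    using that by (intro eq) (auto simp: param_def)
  qed (use len_pos[OF e] in auto)
 qed (use d(2) in blast)
qed

lemma Kirchhoff_I:
 assumes u: "u \<in> H1E" and r: "3/2 < r" "\<And>e. e \<in> edges G ==> u e \<in> Hs_int (len G e) r"
  and W: "\<And>e. e \<in> edges G ==> continuous_on (seg e) (W e)" "aeq G (DG u) W"
  and s: "\<And>p. p \<in> VK ==> (\<Sum>(e, b)\<in>ends p. sgb b*W e (param G e b 0)) = 0"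
 shows "u \<in> Kirchhoff G VK"
proof -
 have "has_rep G (\<lambda>v. (\<forall>e\<in>incident G VK. continuous_on (seg e) (v e)) \<and>
   (\<exists>d. (\<forall>e\<in>edges G. \<forall>b. origin G e b \<in> VK \<longrightarrow>
       ((\<lambda>t. v e (param G e b t)) has_real_derivative d e b) (at 0 within seg e)) \<and>
      (\<forall>p\<in>VK. (\<Sum>(e, b) \<in> ends p. d e b) = 0))) u"
  unfolding has_rep_def
 proof (intro exI[of _ "rp u"] conjI exI[of _ "\<lambda>e b. sgb b*W e (param G e b 0)"] ballI allI impI rp_aeq u s)
  show "continuous_on (seg e) (rp u e)" if "e \<in> incident G VK" for e
   using abscont_continuous[OF rp_abscont[OF u incident_edges[OF that]]] .
  show "((\<lambda>t. rp u e (param G e b t)) has_real_derivative sgb b*W e (param G e b 0)) (at 0 within seg e)"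
   if "e \<in> edges G" for e b
   by (rule end_deriv[OF that rp_abscont[OF u that] W(1)[OF that] aeqD[OF W(2) that]])
 qed
 thus ?thesis using r H1_L2[OF u] incident_edges unfolding Kirchhoff_def ends_def by blast
qed

lemma Hs_int_2: "e \<in> edges G ==> u \<in> HkE G 2 ==> u e \<in> Hs_int (len G e) 2"
 by (simp add: Hs_int_def HkE_def)

text \<open>The one-sided derivatives of \<open>u\<close> and the signed traces of
  \<open>DG u\<close> are limits of the same means, hence equal.\<close>

lemma H2_Kirchhoff_iff:
 assumes u: "u \<in> H1E" and du: "DG u \<in> H1E"
 shows "u \<in> Kirchhoff G VK \<longleftrightarrow> DG u \<in> Flux1 VK"
proof
 let ?W = "rp (DG u)"
 have W: "\<And>e. e \<in> edges G ==> continuous_on (seg e) (?W e)" by (rule abscont_continuous[OF rp_abscont[OF du]])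
 show "u \<in> Kirchhoff G VK" if "DG u \<in> Flux1 VK"
 proof (rule Kirchhoff_I[OF u _ _ W rp_aeq[OF du]])
  show "3/2 < (2::real)" by simp
  show "u e \<in> Hs_int (len G e) 2" if "e \<in> edges G" for e using Hs_int_2[OF that] u du HkE_2_iff by blast
  show "(\<Sum>(e, b)\<in>ends p. sgb b*?W e (param G e b 0)) = 0" if "p \<in> VK" for p
   using \<open>DG u \<in> Flux1 VK\<close> that by (simp add: Flux1_def tr_def)
 qed
 assume K: "u \<in> Kirchhoff G VK"
 obtain d where d: "\<And>e b. e \<in> edges G ==> origin G e b \<in> VK ==>
   ((\<lambda>t. rp u e (param G e b t)) has_real_derivative d e b) (at 0 within seg e)"
  "\<And>p. p \<in> VK ==> (\<Sum>(e, b)\<in>ends p. d e b) = 0"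
  using Kirchhoff_D[OF u K] by blast
 have eq: "d e b = sgb b*tr (DG u) e b" if e: "e \<in> edges G" and o: "origin G e b \<in> VK" for e b
  using tendsto_unique[OF trivial_limit_at_right_real end_mean[OF e rp_abscont[OF u e] d(1)[OF e o]]
   end_mean[OF e rp_abscont[OF u e] end_deriv[OF e rp_abscont[OF u e] W[OF e] aeqD[OF rp_aeq[OF du] e]]]]
  by (simp add: tr_def)
 have "(\<Sum>(e, b)\<in>ends p. sgb b*tr (DG u) e b) = 0" if p: "p \<in> VK" for p
 proof -
  have "(\<Sum>(e, b)\<in>ends p. sgb b*tr (DG u) e b) = (\<Sum>(e, b)\<in>ends p. d e b)"
   by (rule sum.cong[OF refl]) (use eq p in \<open>auto simp: ends_def\<close>)
  thus ?thesis using d(2)[OF p] by simp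
 qed
 thus "DG u \<in> Flux1 VK" using du by (simp add: Flux1_def)
qed

lemma HkG_2_iff: "u \<in> HkG G 2 \<longleftrightarrow> u \<in> Cont1 \<and> DG u \<in> H1E"
 using HkG_1_eq HkE_2_iff[of u] unfolding HkG_def by auto

end

context kop
begin

lemma L_dom_eq: "L_dom G VK VD = Lp"
proof (rule set_eqI)
 fix u
 have "u \<in> Cont1 \<and> u \<in> Dirichlet G VD \<longleftrightarrow> u \<in> Dir1 VD" using Dir1_eq[of VD] unfolding HkG_1_eq by blast
 thus "u \<in> L_dom G VK VD \<longleftrightarrow> u \<in> Lp"
  using H2_Kirchhoff_iff[OF Cont1_H1, of u VK] Flux1_H1 unfolding L_dom_def Lp_def by (auto simp: HkG_2_iff simp del: One_nat_def)
qed

section \<open>Projections onto the violated vertex conditions\<close>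

definition Pid :: "'e \<times> bool => 'e \<times> bool => real" where "Pid j k = (if j = k then 1 else 0)"

abbreviation og :: "'e \<times> bool => 'v" where "og k \<equiv> origin G (fst k) (snd k)"

definition PD :: "'e \<times> bool => 'e \<times> bool => real" where
 "PD j k = (if j = k \<and> og j \<in> VD then 1 else 0)"

text \<open>At a vertex of \<open>VK\<close>, the orthogonal projection of the traces onto the
  vector of signs \<open>sgb\<close>; subtracting it makes the signed sum vanish.\<close>

definition PK :: "'e \<times> bool => 'e \<times> bool => real" where
 "PK j k = (if k \<in> ends (og j) \<and> og j \<in> VK then sgb (snd j) * sgb (snd k)/real (card (ends (og j))) else 0)"

lemma Pok: "Pok Pid" "Pok PD" "Pok PK"
proof -
 show "Pok Pid" "Pok PD" by (auto simp: Pok_def Pid_def PD_def)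
 have "\<bar>PK j k\<bar> \<le> 1" for j k
 proof (cases "k \<in> ends (og j)")
  case True
  hence "1 \<le> card (ends (og j))" using fin_ends card_gt_0_iff by (metis One_nat_def Suc_leI empty_iff)
  thus ?thesis by (auto simp: PK_def sgb_def)
 qed (simp add: PK_def)
 thus "Pok PK" by (simp add: Pok_def)
qed

text \<open>Primitives with one-sided derivatives are asked for only at the ends of nonzero weight.
  Multiplying by \<open>sgb\<close> twice undoes the sign that \<open>end_mean\<close> attaches to
  the density.\<close>

lemma mean_pu:
 assumes u: "u \<in> L2 G"
  and U: "\<And>k. k \<in> EE ==> P j k \<noteq> 0 ==> abscont (len G (fst k)) (U k) (u (fst k)) \<and>
   ((\<lambda>t. U k (param G (fst k) (snd k) t)) has_real_derivative d k) (at 0 within {0..len G (fst k)})"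
  and s: "(\<Sum>k\<in>EE. P j k*(sgb (snd k)*d k)) = 0"
 shows "((\<lambda>t. integral {0..t} (pu P u j)/t) \<longlongrightarrow> 0) (at_right 0)"
proof -
 let ?F = "\<lambda>k t. P j k*(sgb (snd k)*(integral {0..t} (\<lambda>x. sgb (snd k)*ec u k x)/t))"
 have each: "(?F k \<longlongrightarrow> P j k*(sgb (snd k)*d k)) (at_right 0)" if k: "k \<in> EE" for k
 proof (cases "P j k = 0")
  case False
  thus ?thesis
   using end_mean[of "fst k" "U k" "u (fst k)" "snd k" "d k"] U[OF k False] k
   by (intro tendsto_mult_left) (auto simp: EE_def ec_def)
 qed simp
 have "((\<lambda>t. \<Sum>k\<in>EE. ?F k t) \<longlongrightarrow> (\<Sum>k\<in>EE. P j k*(sgb (snd k)*d k))) (at_right 0)" by (rule tendsto_sum[OF each])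
 hence lim: "((\<lambda>t. \<Sum>k\<in>EE. ?F k t) \<longlongrightarrow> 0) (at_right 0)" unfolding s .
 have "\<forall>\<^sub>F t in at_right 0. (\<Sum>k\<in>EE. ?F k t) = integral {0..t} (pu P u j)/t"
  using eventually_at_right_real[OF l0_pos]
 proof eventually_elim
  case (elim t)
  have i: "ec u k integrable_on {0..t}" if "k \<in> EE" for k
   by (rule integral_HK(2)[OF sqi_integrable_Leb[OF sqi_subinterval[OF ec_sqi(1)[OF u that]]]]) (use elim in auto)
  have "integral {0..t} (pu P u j) = (\<Sum>k\<in>EE. integral {0..t} (\<lambda>x. P j k*ec u k x))"
   unfolding pu_def by (intro integral_sum fin_EE integrable_on_mult_right i)
  also have "... = (\<Sum>k\<in>EE. P j k*(sgb (snd k)*integral {0..t} (\<lambda>x. sgb (snd k)*ec u k x)))"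
   by (rule sum.cong[OF refl]) (simp add: sgb_def)
  finally show ?case by (simp add: sum_divide_distrib)
 qed
 with lim show ?thesis by (rule Lim_transform_eventually)
qed

text \<open>A continuous function that is zero at the end has a primitive with one-sided derivative
  0 there, which fits the frame of \<open>mean_pu\<close>.\<close>

lemma Dirichlet_mean:
 assumes u: "u \<in> Dirichlet G VD" shows "mean_zero PD u"
 unfolding mean_zero_def
proof
 fix j assume j: "j \<in> EE"
 have uL: "u \<in> L2 G" using u by (simp add: Dirichlet_def)
 obtain v where v: "aeq G u v" "\<And>e. e \<in> incident G VD ==> continuous_on (seg e) (v e)"
  "\<And>e b. e \<in> edges G ==> origin G e b \<in> VD ==> v e (param G e b 0) = 0"
  using u unfolding Dirichlet_def has_rep_def by blast
 show "((\<lambda>t. integral {0..t} (pu PD u j)/t) \<longlongrightarrow> 0) (at_right 0)"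
 proof (rule mean_pu[OF uL, where U = "\<lambda>k x. integral {0..x} (v (fst k))" and d = "\<lambda>k. 0"])
  fix k assume k: "k \<in> EE" and "PD j k \<noteq> 0"
  hence e: "fst k \<in> edges G" and o: "og k \<in> VD" by (auto simp: EE_def PD_def split: if_splits)
  have vc: "continuous_on {0..len G (fst k)} (v (fst k))"
   by (rule v(2)) (use e o in \<open>cases "snd k"; auto simp: incident_def origin_def\<close>)
  have A: "abscont (len G (fst k)) (\<lambda>x. integral {0..x} (v (fst k))) (u (fst k))"
   by (rule abscont_cong_deriv[OF abscont_indefinite[OF sqi_continuous[OF vc]] L2D[OF uL e]])
    (use aeqD[OF v(1) e] in \<open>auto elim: eventually_mono\<close>)
  show "abscont (len G (fst k)) (\<lambda>x. integral {0..x} (v (fst k))) (u (fst k)) \<and>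
   ((\<lambda>t. integral {0..param G (fst k) (snd k) t} (v (fst k))) has_real_derivative 0) (at 0 within {0..len G (fst k)})"
   using A end_deriv[OF e A vc aeqD[OF v(1) e], of "snd k"] v(3)[OF e o] by simp
 qed simp
qed

lemma sum_ends: "(\<Sum>k\<in>EE. if k \<in> ends p then f k else 0) = (\<Sum>k\<in>ends p. f k)"
proof -
 have "ends p \<subseteq> EE" by (auto simp: ends_def EE_def)
 thus ?thesis using fin_EE by (simp add: sum.inter_restrict[symmetric] Int_absorb1)
qed

lemma sum_PK: "(\<Sum>k\<in>EE. PK j k*f k) = (if og j \<in> VK then sgb (snd j)/real (card (ends (og j)))*(\<Sum>k\<in>ends (og j). sgb (snd k)*f k) else 0)"
proof (cases "og j \<in> VK")
 case True
 have "(\<Sum>k\<in>EE. PK j k*f k) = (\<Sum>k\<in>EE. if k \<in> ends (og j) then sgb (snd j)/real (card (ends (og j)))*(sgb (snd k)*f k) else 0)"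
  by (rule sum.cong[OF refl]) (use True in \<open>auto simp: PK_def\<close>)
 thus ?thesis using True by (simp only: sum_ends sum_distrib_left if_True)
qed (simp add: PK_def)

lemma Kirchhoff_mean:
 assumes u: "u \<in> H1E" and K: "u \<in> Kirchhoff G VK" shows "mean_zero PK (DG u)"
 unfolding mean_zero_def
proof
 fix j assume j: "j \<in> EE"
 obtain d where d: "\<And>e b. e \<in> edges G ==> origin G e b \<in> VK ==>
   ((\<lambda>t. rp u e (param G e b t)) has_real_derivative d e b) (at 0 within seg e)"
  "\<And>p. p \<in> VK ==> (\<Sum>(e, b)\<in>ends p. d e b) = 0"
  using Kirchhoff_D[OF u K] by blast
 show "((\<lambda>t. integral {0..t} (pu PK (DG u) j)/t) \<longlongrightarrow> 0) (at_right 0)"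
 proof (rule mean_pu[OF D_L2[OF u], where U = "\<lambda>k. rp u (fst k)" and d = "\<lambda>k. d (fst k) (snd k)"])
  fix k assume k: "k \<in> EE" and "PK j k \<noteq> 0"
  hence "fst k \<in> edges G" "og k \<in> VK" by (auto simp: EE_def PK_def ends_def split: if_splits)
  thus "abscont (len G (fst k)) (rp u (fst k)) (DG u (fst k)) \<and>
   ((\<lambda>t. rp u (fst k) (param G (fst k) (snd k) t)) has_real_derivative d (fst k) (snd k)) (at 0 within {0..len G (fst k)})"
   using rp_abscont[OF u] d(1) by blast
 next
  have "(\<Sum>k\<in>ends p. sgb (snd k)*(sgb (snd k)*d (fst k) (snd k))) = (\<Sum>(e, b)\<in>ends p. d e b)" for p
   by (rule sum.cong[OF refl]) (auto simp: sgb_def)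
  thus "(\<Sum>k\<in>EE. PK j k*(sgb (snd k)*d (fst k) (snd k))) = 0" unfolding sum_PK using d(2) by simp
 qed
qed

text \<open>Below 1/2 the Hardy inequality asks for no condition, so all traces can be removed at
  once, and any \<open>A'\<close> that contains the functions with zero traces is as good as
  \<open>H1E\<close>.\<close>

lemma cut_id:
 assumes th: "0 < \<theta>" "\<theta> < 1/2" and A: "gd A'"
  and A': "\<And>w. w \<in> H1E ==> (\<And>e b. e \<in> edges G ==> tr w e b = 0) ==> w \<in> A'"
 obtains C where "0 < C" "\<And>u. u \<in> L2 G ==> NQ \<theta> A' u \<le> ennreal C*NQ \<theta> (H1E) u"
proof (rule cutoff[OF th(1) _ Pok(1) gd_spaces(1) A])
 fix w w' assume w: "w' \<in> H1E"
  and t: "\<And>e b. e \<in> edges G ==> tr w' e b = tr w e b - (\<Sum>k\<in>EE. Pid (e, b) k*tr w (fst k) (snd k))"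
 show "w' \<in> A'"
 proof (rule A'[OF w])
  fix e b assume e: "e \<in> edges G"
  hence "(e, b) \<in> EE" by (auto simp: EE_def)
  thus "tr w' e b = 0" using t[OF e, of b] fin_EE by (simp add: Pid_def if_distrib[of "\<lambda>x. x*_"] cong: if_cong)
 qed
qed (use th that in auto)

lemma zero_traces:
 assumes "w \<in> H1E" "\<And>e b. e \<in> edges G ==> tr w e b = 0"
 shows "w \<in> Cont1" "w \<in> Dir1 VD" "w \<in> Flux1 VK"
proof -
 have "(\<Sum>(e, b)\<in>ends p. sgb b*tr w e b) = 0" for p
  by (rule sum.neutral) (use assms(2) in \<open>auto simp: ends_def\<close>)
 thus "w \<in> Flux1 VK" using assms(1) by (simp add: Flux1_def)
qed (use assms in \<open>auto simp: Cont1_iff Dir1_iff\<close>)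

text \<open>The projection touches only the ends at \<open>VD\<close>, so continuity at the other
  vertices survives and the corrected function is again in \<open>Dir1\<close>.\<close>

lemma cut_D:
 assumes th: "1/2 < \<theta>" "\<theta> < 1"
 obtains C where "0 < C" "\<And>u. u \<in> Dirichlet G VD ==> NQ \<theta> (Dir1 VD) u \<le> ennreal C*NQ \<theta> Cont1 u"
proof (rule cutoff[OF _ th(2) Pok(2) gd_spaces(2) gd_spaces(3)[of VD]])
 fix w w' assume w: "w \<in> Cont1" "w' \<in> H1E"
  and t: "\<And>e b. e \<in> edges G ==> tr w' e b = tr w e b - (\<Sum>k\<in>EE. PD (e, b) k*tr w (fst k) (snd k))"
 have t': "tr w' e b = (if origin G e b \<in> VD then 0 else tr w e b)" if e: "e \<in> edges G" for e b
 proof -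
  have m: "(e, b) \<in> EE" using e by (auto simp: EE_def)
  have "(\<Sum>k\<in>EE. PD (e, b) k*tr w (fst k) (snd k)) = (\<Sum>k\<in>EE. if (e, b) = k then (if origin G e b \<in> VD then tr w e b else 0) else 0)"
   by (rule sum.cong[OF refl]) (auto simp: PD_def)
  thus ?thesis using t[OF e, of b] fin_EE m by (simp add: sum.delta')
 qed
 show "w' \<in> Dir1 VD"
 proof (rule Dir1_I[OF w(2)])
  fix e e' b b' assume e: "e \<in> edges G" "e' \<in> edges G" "origin G e b = origin G e' b'"
  hence "tr w e b = tr w e' b'" using w(1) unfolding Cont1_iff by blast
  thus "tr w' e b = tr w' e' b'" unfolding t'[OF e(1)] t'[OF e(2)] e(3) by simp
 qed (simp add: t')
next
 fix C assume "0 < C" "\<And>u. u \<in> L2 G ==> \<theta> < 1/2 \<or> 1/2 < \<theta> \<and> mean_zero PD u ==> NQ \<theta> (Dir1 VD) u \<le> ennreal C*NQ \<theta> Cont1 u"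
 thus thesis using that th Dirichlet_mean by (auto simp: Dirichlet_def)
qed (use th in auto)

text \<open>The derivative carries no continuity condition at the vertices, so the comparison starts
  from the free space \<open>H1E\<close>; Kirchhoff's condition provides the vanishing
  means.\<close>

lemma cut_K:
 assumes th: "1/2 < \<theta>" "\<theta> < 1"
 obtains C where "0 < C" "\<And>u. u \<in> H1E ==> u \<in> Kirchhoff G VK ==>
  NQ \<theta> (Flux1 VK) (DG u) \<le> ennreal C*NQ \<theta> (H1E) (DG u)"
proof (rule cutoff[OF _ th(2) Pok(3) gd_spaces(1) gd_spaces(4)[of VK]])
 fix w w' assume w: "w' \<in> H1E"
  and t: "\<And>e b. e \<in> edges G ==> tr w' e b = tr w e b - (\<Sum>k\<in>EE. PK (e, b) k*tr w (fst k) (snd k))"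
 have "(\<Sum>(e, b)\<in>ends p. sgb b*tr w' e b) = 0" if p: "p \<in> VK" for p
 proof (cases "ends p = {}")
  case False
  define S where "S = (\<Sum>k\<in>ends p. sgb (snd k)*tr w (fst k) (snd k))"
  have c: "0 < card (ends p)" using False fin_ends card_gt_0_iff by blast
  have "(\<Sum>(e, b)\<in>ends p. sgb b*tr w' e b) = (\<Sum>k\<in>ends p. sgb (snd k)*tr w (fst k) (snd k) - S/real (card (ends p)))"
  proof (rule sum.cong[OF refl], clarify)
   fix e b assume "(e, b) \<in> ends p"
   hence e: "e \<in> edges G" "origin G e b = p" by (auto simp: ends_def)
   show "sgb b*tr w' e b = sgb (snd (e, b))*tr w (fst (e, b)) (snd (e, b)) - S/real (card (ends p))"
    unfolding t[OF e(1)] sum_PK using e(2) p by (auto simp: S_def sgb_def)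
  qed
  also have "... = S - S" using c by (simp add: sum_subtractf S_def)
  finally show ?thesis by simp
 qed simp
 thus "w' \<in> Flux1 VK" using w by (simp add: Flux1_def)
next
 fix C assume "0 < C" "\<And>u. u \<in> L2 G ==> \<theta> < 1/2 \<or> 1/2 < \<theta> \<and> mean_zero PK u ==> NQ \<theta> (Flux1 VK) u \<le> ennreal C*NQ \<theta> (H1E) u"
 thus thesis using that th Kirchhoff_mean D_L2 by auto
qed (use th in auto)

end

section \<open>Spectral characterization of the fractional spaces\<close>

lemma le_chain:
 fixes X Y Z :: ennreal
 assumes "X \<le> ennreal a*Y" "Y \<le> ennreal b*Z" "0 \<le> a" "0 \<le> b"
 shows "X \<le> ennreal (a*b)*Z"
proof -
 have "X \<le> ennreal a*(ennreal b*Z)" using assms(1) by (rule order_trans) (intro mult_left_mono assms(2), simp)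
 thus ?thesis using assms(3,4) by (simp add: ennreal_mult mult.assoc)
qed

lemma fin_mult: "X \<le> ennreal a*Y ==> Y < \<infinity> ==> X < \<infinity>"
 by (rule le_less_trans, assumption) (simp add: ennreal_mult_less_top)

lemma le_plus:
 fixes X Y Z :: ennreal
 assumes "X \<le> ennreal a*Z" "Y \<le> ennreal b*Z" "0 \<le> a" "0 \<le> b"
 shows "X + Y \<le> ennreal (a + b)*Z"
 using add_mono[OF assms(1,2)] assms(3,4) by (simp add: ennreal_plus distrib_right)

definition ct :: "real => real" where "ct \<theta> = enn2real (cth \<theta>)"

lemma ct:
 assumes "0 < \<theta>" "\<theta> < 1" shows "ennreal (ct \<theta>) = cth \<theta>" "0 < ct \<theta>"
proof -
 show "ennreal (ct \<theta>) = cth \<theta>" using cth_finite[OF assms] by (simp add: ct_def)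
 thus "0 < ct \<theta>" using cth_pos[of \<theta>] by (metis ennreal_less_zero_iff)
qed

lemma ct_cancel:
 fixes X Y :: ennreal
 assumes th: "0 < \<theta>" "\<theta> < 1" and le: "cth \<theta>*X \<le> Y" shows "X \<le> ennreal (1/ct \<theta>)*Y"
proof -
 have "ennreal (1/ct \<theta>)*(cth \<theta>*X) = X"
  using ct[OF th] by (simp add: mult.assoc[symmetric] ct(1)[OF th, symmetric] ennreal_mult[symmetric])
 thus ?thesis using mult_left_mono[OF le, of "ennreal (1/ct \<theta>)"] by simp
qed

context mgr
begin

lemma interp_sq:
 assumes "NQ \<theta> A u < \<infinity>"
 shows "ennreal ((interp_norm \<theta> (L2 G) (nL) A (nH) u)^2) = NQ \<theta> A u"
 using assms unfolding interp_norm_def by (simp del: One_nat_def)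

lemma Hs_low:
 assumes "0 < s" "s < 1"
 shows "u \<in> Hs G s \<longleftrightarrow> u \<in> L2 G \<and> NQ s Cont1 u < \<infinity>"
  "u \<in> Hs G s ==> ennreal ((Hs_norm G s u)^2) = NQ s Cont1 u"
proof -
 show iff: "u \<in> Hs G s \<longleftrightarrow> u \<in> L2 G \<and> NQ s Cont1 u < \<infinity>"
  using assms interp_space_iff[OF gd_spaces(2)] by (simp add: Hs_def HkG_1_eq del: One_nat_def)
 assume "u \<in> Hs G s"
 thus "ennreal ((Hs_norm G s u)^2) = NQ s Cont1 u"
  using assms interp_sq[of s Cont1 u] iff by (simp add: Hs_norm_def HkG_1_eq del: One_nat_def)
qed

lemma Hs_mid:
 assumes "1 < s" "s < 2"
 shows "u \<in> Hs G s \<longleftrightarrow> u \<in> Cont1 \<and> NQ (s - 1) (H1E) (DG u) < \<infinity>"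
  "u \<in> Hs G s ==> ennreal ((Hs_norm G s u)^2) = ennreal ((nH u)^2) + NQ (s - 1) (H1E) (DG u)"
proof -
 show iff: "u \<in> Hs G s \<longleftrightarrow> u \<in> Cont1 \<and> NQ (s - 1) (H1E) (DG u) < \<infinity>"
  using assms interp_space_iff[OF gd_spaces(1)] D_L2[OF Cont1_H1, of u] by (auto simp: Hs_def HkG_1_eq simp del: One_nat_def)
 assume "u \<in> Hs G s"
 thus "ennreal ((Hs_norm G s u)^2) = ennreal ((nH u)^2) + NQ (s - 1) (H1E) (DG u)"
  using assms interp_sq[of "s - 1" "H1E" "DG u"] iff by (simp add: Hs_norm_def ennreal_plus del: One_nat_def)
qed

lemma Hs_high:
 assumes "2 < s"
 shows "u \<in> Hs G s \<longleftrightarrow> u \<in> HkG G 2 \<and> NQ (s - 2) Cont1 (DG (DG u)) < \<infinity>"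
  "u \<in> Hs G s ==> ennreal ((Hs_norm G s u)^2) = ennreal ((nHH u)^2) + NQ (s - 2) Cont1 (DG (DG u))"
proof -
 show iff: "u \<in> Hs G s \<longleftrightarrow> u \<in> HkG G 2 \<and> NQ (s - 2) Cont1 (DG (DG u)) < \<infinity>"
  using assms interp_space_iff[OF gd_spaces(2)] D_L2[of "DG u"] by (auto simp: Hs_def HkG_1_eq HkG_2_iff simp del: One_nat_def)
 assume "u \<in> Hs G s"
 thus "ennreal ((Hs_norm G s u)^2) = ennreal ((nHH u)^2) + NQ (s - 2) Cont1 (DG (DG u))"
  using assms interp_sq[of "s - 2" Cont1 "DG (DG u)"] iff by (simp add: Hs_norm_def HkG_1_eq ennreal_plus del: One_nat_def)
qed

end

section \<open>Weighted coefficient sums and interpolation norms\<close>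

context eigl
begin

text \<open>Kept in \<open>ennreal\<close>, so that belonging to the domain of a power is finiteness
  and all comparisons are plain inequalities.\<close>

definition ds :: "real => 'b gfn => ennreal" where
 "ds s u = (\<Sum>i. ennreal (\<mu> i powr s*(cf u i)^2))"

lemma dot_fn_iff: "u \<in> dfn s \<longleftrightarrow> u \<in> L2 G \<and> ds s u < \<infinity>"
proof -
 let ?f = "\<lambda>i. \<mu> i powr s*(cf u i)^2"
 have nn: "\<And>i. 0 \<le> ?f i" by simp
 have "summable ?f \<longleftrightarrow> (\<Sum>i. ennreal (?f i)) \<noteq> top"
  by (rule iffI) (erule ennreal_suminf_neq_top[OF _ nn], erule summable_suminf_not_top[OF nn])
 thus ?thesis unfolding dot_fn_def ds_def infinity_ennreal_def less_top by blast
qed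

lemma ds_dot_norm: "u \<in> dfn s ==> ds s u = ennreal ((dot_norm \<mu> s (cf u))^2)"
 by (simp add: dot_fn_def ds_def dot_norm_def suminf_ennreal2 suminf_nonneg)

lemma ds_0: "u \<in> L2 G ==> ds 0 u = ennreal ((nL u)^2)"
proof -
 assume u: "u \<in> L2 G"
 have "\<mu> i powr 0*(cf u i)^2 = (cf u i)^2" for i using mu_pos[of i] by simp
 thus ?thesis unfolding ds_def by (simp only:) (rule suminf_ennreal_eq[OF zero_le_power2 Parseval[OF u]])
qed

lemma ds_1: "u \<in> Dir1 VD ==> ds 1 u = ennreal (B u u)"
proof -
 assume u: "u \<in> Dir1 VD"
 have p: "\<mu> i powr 1*(cf u i)^2 = \<mu> i*(cf u i)^2" and nn: "0 \<le> \<mu> i*(cf u i)^2" for i using mu_pos[of i] by simp_all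
 show ?thesis unfolding ds_def p by (rule suminf_ennreal_eq[OF nn dot1_sums[OF u]])
qed

lemma ds_Lop:
 assumes u: "u \<in> Lp" shows "ds (2 + \<theta>) u = ds \<theta> (Lop u)"
proof -
 have "\<mu> i powr (2 + \<theta>)*(cf u i)^2 = \<mu> i powr \<theta>*(cf (Lop u) i)^2" for i
  unfolding cf_Lop[OF u] using mu_pos[of i] by (simp add: powr_add power_mult_distrib mult_ac)
 thus ?thesis by (simp add: ds_def)
qed

lemma ds_mono:
 assumes "s \<le> s'" shows "ds s u \<le> ennreal (k0 powr (s - s'))*ds s' u"
proof -
 have "ennreal (\<mu> i powr s*(cf u i)^2) \<le> ennreal (k0 powr (s - s'))*ennreal (\<mu> i powr s'*(cf u i)^2)" for i
 proof -
  have "\<mu> i powr s = \<mu> i powr (s - s')*\<mu> i powr s'" by (simp add: powr_add[symmetric])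
  also have "... \<le> k0 powr (s - s')*\<mu> i powr s'"
   using assms mu_ge[of i] k0 by (intro mult_right_mono powr_mono2') auto
  finally have "\<mu> i powr s*(cf u i)^2 \<le> k0 powr (s - s')*(\<mu> i powr s'*(cf u i)^2)"
   unfolding mult.assoc[symmetric] by (rule mult_right_mono) simp
  thus ?thesis by (simp add: ennreal_mult[symmetric] ennreal_leI)
 qed
 thus ?thesis unfolding ds_def ennreal_suminf_cmult[symmetric] by (intro suminf_le) auto
qed

lemma ds_mono_finite: "s \<le> s' ==> ds s' u < \<infinity> ==> ds s u < \<infinity>"
 by (rule fin_mult[OF ds_mono])

lemma ds_summable: "ds s u < \<infinity> ==> summable (\<lambda>i. \<mu> i powr s*(cf u i)^2)"
 unfolding ds_def by (rule summable_suminf_not_top) auto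

lemma ds1_Dir1:
 assumes "u \<in> L2 G" "ds s u < \<infinity>" "1 \<le> s" shows "u \<in> Dir1 VD"
 using summable_dot1_imp_Dir1(1)[OF assms(1)] ds_summable[OF ds_mono_finite[OF assms(3,2)]] mu_nonneg by simp

lemma ds2_Lp:
 assumes "u \<in> L2 G" "ds s u < \<infinity>" "2 \<le> s" shows "u \<in> Lp"
 using summable_dot2_imp_Lp[OF assms(1)] ds_summable[OF ds_mono_finite[OF assms(3,2)]] by (simp add: mu_nonneg)

lemma H1_le_ds:
 assumes "u \<in> Dir1 VD" shows "ennreal ((nH u)^2) \<le> ennreal (1/b0)*ds 1 u"
proof -
 have "(nH u)^2 \<le> 1/b0*B u u"
  using B_lower[OF Dir1_H1[OF assms]] b_pos by (simp add: field_simps del: One_nat_def)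
 thus ?thesis using ds_1[OF assms] b_pos by (simp add: ennreal_mult'[symmetric] ennreal_leI del: One_nat_def)
qed

lemma Qs_meas:
 assumes b: "\<And>i. 0 \<le> b i" "summable b"
 shows "pos_part (Qs b) \<in> borel_measurable borel"
proof (rule borel_measurable_mono, rule monoI)
 fix s t :: real assume st: "s \<le> t"
 have "0 \<le> Qs b t" unfolding Qs_def using b(1) mu_nonneg by (intro suminf_nonneg Qs_summable[OF b]) auto
 moreover have "Qs b s \<le> Qs b t" if "0 < s"
  unfolding Qs_def
 proof (rule suminf_le[OF _ Qs_summable[OF b] Qs_summable[OF b]])
  fix i
  have "s^2*\<mu> i \<le> t^2*\<mu> i" using that st mu_nonneg by (intro mult_right_mono power_mono) auto
  thus "min 1 (s^2*\<mu> i)*b i \<le> min 1 (t^2*\<mu> i)*b i" using b(1) by (intro mult_right_mono) auto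
 qed
 ultimately show "pos_part (Qs b) s \<le> pos_part (Qs b) t" using st by auto
qed

lemma NQ_Qs:
 assumes b: "\<And>i. 0 \<le> b i" "summable b" and c: "0 \<le> c" and th: "0 < \<theta>" "\<theta> < 1"
  and le: "\<And>t. 0 < t ==> (KK A t u)^2 \<le> c*Qs b t"
 shows "NQ \<theta> A u \<le> ennreal (c*ct \<theta>)*(\<Sum>i. ennreal (\<mu> i powr \<theta>*b i))"
proof -
 have "NQ \<theta> A u \<le> J \<theta> (\<lambda>t. c*Qs b t)" unfolding NQ_J by (rule J_mono[OF le])
 also have "... = ennreal c*(cth \<theta>*(\<Sum>i. ennreal (\<mu> i powr \<theta>*b i)))"
  using J_cmult[OF Qs_meas[OF b] c] Qs_J[OF b] by simp
 finally show ?thesis using c ct[OF th] by (simp add: ennreal_mult mult.assoc)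
qed

lemma sq_summable: "u \<in> L2 G ==> summable (\<lambda>i. (cf u i)^2)" "u \<in> Dir1 VD ==> summable (\<lambda>i. \<mu> i*(cf u i)^2)"
 using Parseval dot1_sums sums_summable by blast+

lemma NQ_Dir1:
 assumes u: "u \<in> L2 G" and th: "0 < \<theta>" "\<theta> < 1"
 shows "NQ \<theta> (Dir1 VD) u \<le> ennreal (2*(1 + 1/b0)*ct \<theta>)*ds \<theta> u"
  "ds \<theta> u \<le> ennreal (1/ct \<theta>*(2*(1 + b1)))*NQ \<theta> (Dir1 VD) u"
proof -
 show "NQ \<theta> (Dir1 VD) u \<le> ennreal (2*(1 + 1/b0)*ct \<theta>)*ds \<theta> u"
  unfolding ds_def by (rule NQ_Qs[OF _ sq_summable(1)[OF u] _ th K_Dir1_upper[OF u]]) (use b_pos in auto)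
 have "cth \<theta>*ds \<theta> u = J \<theta> (Qs (\<lambda>i. (cf u i)^2))" unfolding ds_def by (rule Qs_J[OF zero_le_power2 sq_summable(1)[OF u], symmetric])
 also have "... \<le> J \<theta> (\<lambda>t. 2*(1 + b1)*(KK (Dir1 VD) t u)^2)" by (rule J_mono[OF K_Dir1_lower[OF u]])
 also have "... = ennreal (2*(1 + b1))*NQ \<theta> (Dir1 VD) u"
  unfolding NQ_J using b_pos by (intro J_cmult K_meas(2)[OF u gd_spaces(3)]) auto
 finally have "ds \<theta> u \<le> ennreal (1/ct \<theta>)*(ennreal (2*(1 + b1))*NQ \<theta> (Dir1 VD) u)" by (rule ct_cancel[OF th])
 thus "ds \<theta> u \<le> ennreal (1/ct \<theta>*(2*(1 + b1)))*NQ \<theta> (Dir1 VD) u"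
  by (rule le_chain[OF _ order_refl]) (use ct[OF th] b_pos in auto)
qed

lemma NQ_Flux1:
 assumes u: "u \<in> Dir1 VD" and th: "0 < \<theta>" "\<theta> < 1"
 shows "NQ \<theta> (Flux1 VK) (DG u) \<le> ennreal (2*(1/b0 + Cell^2)*ct \<theta>)*ds (1 + \<theta>) u"
  "ds (1 + \<theta>) u \<le> ennreal (1/ct \<theta>*CF)*NQ \<theta> (Flux1 VK) (DG u) + ennreal (CD*(nL u)^2)"
proof -
 have e: "ds (1 + \<theta>) u = (\<Sum>i. ennreal (\<mu> i powr \<theta>*(\<mu> i*(cf u i)^2)))"
  unfolding ds_def using mu_nonneg by (simp add: powr_add mult_ac)
 have nn: "0 \<le> \<mu> i*(cf u i)^2" for i using mu_nonneg by simp
 show "NQ \<theta> (Flux1 VK) (DG u) \<le> ennreal (2*(1/b0 + Cell^2)*ct \<theta>)*ds (1 + \<theta>) u"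
  unfolding e by (rule NQ_Qs[OF nn sq_summable(2)[OF u] _ th K_Flux1_upper[OF u]]) (use b_pos in auto)
 let ?X = "CD*(nL u)^2"
 have X: "0 \<le> ?X" using CFD by simp
 have "cth \<theta>*ds (1 + \<theta>) u = J \<theta> (Qs (\<lambda>i. \<mu> i*(cf u i)^2))" unfolding e by (rule Qs_J[OF nn sq_summable(2)[OF u], symmetric])
 also have "... \<le> ennreal CF*NQ \<theta> (Flux1 VK) (DG u) + ennreal ?X*cth \<theta>"
  by (rule J_le_combine[OF D_L2[OF Dir1_H1[OF u]] gd_spaces(4) _ X K_Flux1_lower[OF u]]) (use CFD in auto)
 finally have "ds (1 + \<theta>) u \<le> ennreal (1/ct \<theta>)*(ennreal CF*NQ \<theta> (Flux1 VK) (DG u) + ennreal ?X*cth \<theta>)"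
  by (rule ct_cancel[OF th])
 also have "... = ennreal (1/ct \<theta>*CF)*NQ \<theta> (Flux1 VK) (DG u) + ennreal (1/ct \<theta>)*(ennreal ?X*cth \<theta>)"
 proof -
  have "ennreal (1/ct \<theta>*CF) = ennreal (1/ct \<theta>)*ennreal CF" by (rule ennreal_mult) (use CFD ct[OF th] in auto)
  thus ?thesis by (simp only: distrib_left mult.assoc)
 qed
 also have "ennreal (1/ct \<theta>)*(ennreal ?X*cth \<theta>) = ennreal ?X"
  using ct[OF th] X by (simp add: ct(1)[OF th, symmetric] ennreal_mult[symmetric])
 finally show "ds (1 + \<theta>) u \<le> ennreal (1/ct \<theta>*CF)*NQ \<theta> (Flux1 VK) (DG u) + ennreal ?X" .
qed

text \<open>\<open>point_sum_bound\<close>, applied to a block of the series, makes the partial sums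
  uniformly Cauchy. The abstract \<open>val\<close> covers both the expansion itself and, with
  normalized derivatives, the differentiated one.\<close>

lemma expansion_rep:
 assumes s: "1/2 < \<sigma>" and C: "0 < C"
  and pb: "\<And>n d t e x. e \<in> edges G ==> x \<in> seg e ==> 0 < t ==>
   (\<Sum>i<n. d i * val e x i)^2 \<le> C/t*(\<Sum>i<n. (1 + t^2*\<mu> i)*(d i)^2)"
  and sm: "summable (\<lambda>i. \<mu> i powr \<sigma>*(d i)^2)"
  and T: "\<And>n. T n \<in> H1E" "\<And>n e x. e \<in> edges G ==> x \<in> seg e ==> rp (T n) e x = (\<Sum>i<n. d i * val e x i)"
  and f: "f \<in> L2 G" and c: "(\<lambda>n. nL (T n - f)) \<longlonglongrightarrow> 0"
 obtains W where "\<And>e. e \<in> edges G ==> continuous_on (seg e) (W e)" "aeq G f W"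
  "\<And>e x. e \<in> edges G ==> x \<in> seg e ==> (\<lambda>n. rp (T n) e x) \<longlonglongrightarrow> W e x"
proof (rule uniform_limit_rep[OF T(1) f c])
 define K where "K = 2*\<sigma>*(2*C)*((1/sqrt k0) powr (2*\<sigma> - 1)/(2*\<sigma> - 1))"
 have K: "0 < K" unfolding K_def using s C k0 by (intro mult_pos_pos divide_pos_pos) auto
 let ?g = "\<lambda>i. \<mu> i powr \<sigma>*(d i)^2"
 let ?F = "\<lambda>m n. sqrt (K*(\<Sum>i=min m n..<max m n. ?g i))"
 have S0: "0 \<le> (\<Sum>i=m..<n. ?g i)" for m n by (intro sum_nonneg) auto
 have le: "\<bar>rp (T m) e x - rp (T n) e x\<bar> \<le> ?F m n" if e: "e \<in> edges G" "x \<in> seg e" and nm: "n \<le> m" for e x m n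
 proof -
  let ?d = "\<lambda>i. if i < n then 0 else d i"
  have "(\<Sum>i<m. ?d i * val e x i) = (\<Sum>i=n..<m. d i * val e x i)"
   by (rule sum.mono_neutral_cong_right) auto
  moreover have "(\<Sum>i<m. d i * val e x i) = (\<Sum>i<n. d i * val e x i) + (\<Sum>i=n..<m. d i * val e x i)"
   using sum.atLeastLessThan_concat[of 0 n m "\<lambda>i. d i * val e x i"] nm by (simp add: lessThan_atLeast0)
  ultimately have "rp (T m) e x - rp (T n) e x = (\<Sum>i<m. ?d i * val e x i)" by (simp add: T(2)[OF e])
  hence "(rp (T m) e x - rp (T n) e x)^2 \<le> K*(\<Sum>i<m. \<mu> i powr \<sigma>*(?d i)^2)"
   using point_sum_bound[OF C pb[OF e] s, where n = m and d = ?d] by (simp only: K_def)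
  also have "(\<Sum>i<m. \<mu> i powr \<sigma>*(?d i)^2) = (\<Sum>i=n..<m. ?g i)" by (rule sum_if_tail[OF nm])
  finally show ?thesis using nm by (intro real_le_rsqrt) (simp add: min_def max_def)
 qed
 fix r :: real assume r: "0 < r"
 have "\<exists>N. \<forall>m\<ge>N. \<forall>n\<ge>N. ?F m n < r"
 proof (rule Cauchy_sq[OF sm _ K _ _ r])
  show "(?F m n)^2 \<le> K*(\<Sum>i=n..<m. ?g i)" if "n \<le> m" for m n
   using that K S0[of n m] by (simp add: min_def max_def)
 qed (auto simp: min.commute max.commute)
 then obtain N where N: "\<And>m n. m \<ge> N ==> n \<ge> N ==> ?F m n < r" by blast
 have "\<bar>rp (T m) e x - rp (T n) e x\<bar> < r" if "m \<ge> N" "n \<ge> N" "e \<in> edges G" "x \<in> seg e" for m n e x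
  using le[OF that(3,4), of m n] le[OF that(3,4), of n m] N[OF that(1,2)] N[OF that(2,1)] by (cases "n \<le> m") (auto simp: abs_minus_commute)
 thus "\<exists>N. \<forall>m\<ge>N. \<forall>n\<ge>N. \<forall>e\<in>edges G. \<forall>x\<in>seg e. \<bar>rp (T m) e x - rp (T n) e x\<bar> < r" by blast
next
 fix W assume "\<And>e. e \<in> edges G ==> continuous_on (seg e) (W e)" "aeq G f W"
  "\<And>e x. e \<in> edges G ==> x \<in> seg e ==> (\<lambda>n. rp (T n) e x) \<longlonglongrightarrow> W e x"
 thus thesis by (rule that)
qed

text \<open>The partial sums vanish at \<open>VD\<close> and converge uniformly, so the continuous
  limit vanishes there.\<close>

lemma Dirichlet_dot:
 assumes u: "u \<in> L2 G" and s: "1/2 < s" "s < 1" and f: "ds s u < \<infinity>" and N: "NQ s (H1E) u < \<infinity>"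
 shows "u \<in> Dirichlet G VD"
proof -
 obtain e0 where e0: "e0 \<in> edges G" using some_edge by metis
 have C: "0 < Ctr*(1 + 1/b0)" using Ctr_pos(1)[OF e0] b_pos by (intro mult_pos_pos add_pos_pos) auto
 obtain W where W: "\<And>e. e \<in> edges G ==> continuous_on (seg e) (W e)" "aeq G u W"
  and lim: "\<And>e x. e \<in> edges G ==> x \<in> seg e ==> (\<lambda>n. rp (lin_comb n (cf u) \<psi>) e x) \<longlonglongrightarrow> W e x"
  using expansion_rep[OF s(1) C point_bound_value ds_summable[OF f] LC(3)
   H1_lin_comb(3)[where \<psi> = \<psi>, OF psi_D(2)] u S_limit[OF u]] by blast
 have z: "W e (param G e b 0) = 0" if e: "e \<in> edges G" and o: "origin G e b \<in> VD" for e b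
  using lim[OF e param_end[OF e, of b]] Dir1_E(2)[OF LC(2) e o] by (simp add: tr_def LIMSEQ_const_iff)
 have "u e \<in> Hs_int (len G e) s" if "e \<in> incident G VD" for e
 proof -
  have "nat \<lfloor>s\<rfloor> = 0" "frac s = s" using s by (auto simp: frac_eq floor_unique)
  thus ?thesis using edge_interp[OF u N incident_edges[OF that]] u incident_edges[OF that]
   by (simp add: Hs_int_def HkE_def del: One_nat_def Hk_int_nsq.simps)
 qed
 thus ?thesis using u s(1) W z incident_edges unfolding Dirichlet_def has_rep_def by blast
qed

text \<open>The differentiated expansion, normalized by \<open>sqrt (\<mu> i)\<close>, has
  coefficients summable with weight of order \<open>\<theta> > 1/2\<close> and so converges
  uniformly. The fluxes of its partial sums are 0 and pass to the limit.\<close>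

lemma Kirchhoff_dot:
 assumes u: "u \<in> Dir1 VD" and s: "1/2 < \<theta>" "\<theta> < 1" and f: "ds (1 + \<theta>) u < \<infinity>"
  and N: "NQ \<theta> (H1E) (DG u) < \<infinity>"
 shows "u \<in> Kirchhoff G VK"
proof -
 let ?T = "\<lambda>n. DG (lin_comb n (cf u) \<psi>)"
 note h = Dir1_H1[OF u]
 have uL: "u \<in> L2 G" by (rule H1_L2[OF h])
 obtain e0 where e0: "e0 \<in> edges G" using some_edge by metis
 have C: "0 < Ctr*(1/b0 + Cell^2)" using Ctr_pos(1)[OF e0] b_pos by (intro mult_pos_pos add_pos_nonneg) auto
 have sm: "summable (\<lambda>i. \<mu> i powr \<theta>*(cf u i * sqrt (\<mu> i))^2)"
  using ds_summable[OF f] mu_nonneg by (simp add: powr_add power_mult_distrib mult_ac)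
 have rT: "rp (?T n) e x = (\<Sum>i<n. cf u i * sqrt (\<mu> i)*(rp (DG (\<psi> i)) e x/sqrt (\<mu> i)))"
  if e: "e \<in> edges G" "x \<in> seg e" for n e x
 proof -
  let ?L = "lin_comb n (cf u) (\<lambda>i. DG (\<psi> i))"
  have m: "?L \<in> H1E" by (rule H1_lin_comb(1)[OF psi_D(4)])
  have "rp (?T n) e x = rp ?L e x"
   by (rule H1_aeq(3)[OF m D_L2[OF LC(3)] H1_lin_comb(2)[where \<psi> = \<psi>, OF psi_D(2)] e])
  also have "... = (\<Sum>i<n. cf u i*rp (DG (\<psi> i)) e x)" by (rule H1_lin_comb(3)[OF psi_D(4) e])
  also have "... = (\<Sum>i<n. cf u i * sqrt (\<mu> i)*(rp (DG (\<psi> i)) e x/sqrt (\<mu> i)))"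
   by (rule sum.cong[OF refl]) (use mu_pos in \<open>simp add: less_imp_neq[symmetric]\<close>)
  finally show ?thesis .
 qed
 obtain W where W: "\<And>e. e \<in> edges G ==> continuous_on (seg e) (W e)" "aeq G (DG u) W"
  and lim: "\<And>e x. e \<in> edges G ==> x \<in> seg e ==> (\<lambda>n. rp (?T n) e x) \<longlonglongrightarrow> W e x"
  using expansion_rep[OF s(1) C point_bound_deriv sm LpD(4)[OF LC(1)] rT D_L2[OF h]
   summable_dot1_imp_Dir1(2)[OF uL sq_summable(2)[OF u]]] by blast
 show ?thesis
 proof (rule Kirchhoff_I[OF h _ _ W])
  show "3/2 < 1 + \<theta>" using s by simp
  have "\<lfloor>1 + \<theta>\<rfloor> = 1" by (rule floor_unique) (use s in auto)
  hence fl: "nat \<lfloor>1 + \<theta>\<rfloor> = 1" "frac (1 + \<theta>) = \<theta>" unfolding frac_def by simp_all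
  show "u e \<in> Hs_int (len G e) (1 + \<theta>)" if "e \<in> edges G" for e
   unfolding Hs_int_def fl using edge_interp[OF D_L2[OF h] N that] h that
   by (simp add: HkE_def D_graph_def del: Hk_int.simps Hk_int_nsq.simps)
  show "(\<Sum>(e, b)\<in>ends p. sgb b*W e (param G e b 0)) = 0" if p: "p \<in> VK" for p
  proof -
   have "(\<lambda>n. \<Sum>(e, b)\<in>ends p. sgb b*rp (?T n) e (param G e b 0)) \<longlonglongrightarrow> (\<Sum>(e, b)\<in>ends p. sgb b*W e (param G e b 0))"
    unfolding case_prod_unfold by (intro tendsto_sum tendsto_mult_left lim) (auto simp: ends_def simp del: atLeastAtMost_iff intro!: param_end)
   moreover have "(\<Sum>(e, b)\<in>ends p. sgb b*rp (?T n) e (param G e b 0)) = 0" for n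
    using LpD(2)[OF LC(1)] p by (auto simp: Flux1_def tr_def)
   ultimately show ?thesis by (simp add: LIMSEQ_const_iff)
  qed
 qed
qed

text \<open>\<open>Hs_KD G VK VD s\<close> is the domain of the power \<open>s/2\<close> of the operator, with squared norms
 equivalent up to the constants \<open>Ca\<close> and \<open>Cb\<close>.\<close>

definition spectral :: "real => real => real => bool" where
 "spectral s Ca Cb \<longleftrightarrow>
  (\<forall>u\<in>Hs_KD G VK VD s. u \<in> L2 G \<and> ds s u \<le> ennreal Ca*ennreal ((Hs_norm G s u)^2)) \<and>
  (\<forall>u\<in>L2 G. ds s u < \<infinity> \<longrightarrow> u \<in> Hs_KD G VK VD s \<and> ennreal ((Hs_norm G s u)^2) \<le> ennreal Cb*ds s u)"

section \<open>Comparison of the norms, range by range of the order\<close>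

lemma spectral_0: "spectral 0 1 1"
 by (simp add: spectral_def Hs_KD_def Hs_def Hs_norm_def ds_0)

text \<open>\<open>cut\<close> leads from the couple with \<open>Cont1\<close>, which defines the
  space, to the one with \<open>Dir1\<close>, whose K-functional is diagonal. It is asked only for
  members of \<open>Hs_KD\<close>, so that the Dirichlet condition is at hand when
  \<open>s > 1/2\<close>. The other direction is mere inclusion of the spaces.\<close>

lemma spectral_low:
 assumes s: "0 < s" "s < 1" "s \<noteq> 1/2" and C: "0 < C"
  and cut: "\<And>u. u \<in> L2 G ==> u \<in> Hs_KD G VK VD s ==> NQ s (Dir1 VD) u \<le> ennreal C*NQ s Cont1 u"
 shows "spectral s (1/ct s*(2*(1 + b1))*C) (2*(1 + 1/b0)*ct s)"
 unfolding spectral_def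
proof (intro conjI ballI impI)
 note ctp = ct[OF s(1,2)]
 {
  fix u assume u: "u \<in> Hs_KD G VK VD s"
  hence h: "u \<in> Hs G s" by (auto simp: Hs_KD_def split: if_splits)
  thus uL: "u \<in> L2 G" using Hs_low(1)[OF s(1,2)] by blast
  show "ds s u \<le> ennreal (1/ct s*(2*(1 + b1))*C)*ennreal ((Hs_norm G s u)^2)"
   unfolding Hs_low(2)[OF s(1,2) h]
   by (rule le_chain[OF NQ_Dir1(2)[OF uL s(1,2)] cut[OF uL u]]) (use ctp b_pos C in auto)
 }
 fix u assume u: "u \<in> L2 G" and f: "ds s u < \<infinity>"
 note up = NQ_Dir1(1)[OF u s(1,2)]
 have "NQ s (Dir1 VD) u < \<infinity>" using up by (rule fin_mult) (rule f)
 moreover have CD: "NQ s Cont1 u \<le> NQ s (Dir1 VD) u" by (rule NQ_anti[OF u gd_spaces(3) _ gd_spaces(2)]) (auto simp: Dir1_def)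
 ultimately have c: "NQ s Cont1 u < \<infinity>" by (rule le_less_trans[rotated])
 have h: "u \<in> Hs G s" using Hs_low(1)[OF s(1,2)] u c by blast
 have "NQ s (H1E) u \<le> NQ s Cont1 u" by (rule NQ_anti[OF u gd_spaces(2) _ gd_spaces(1)]) (blast intro: Cont1_H1)
 hence "NQ s (H1E) u < \<infinity>" using c by (rule le_less_trans)
 thus "u \<in> Hs_KD G VK VD s" using h Dirichlet_dot[OF u _ s(2) f] s by (auto simp: Hs_KD_def)
 show "ennreal ((Hs_norm G s u)^2) \<le> ennreal (2*(1 + 1/b0)*ct s)*ds s u"
  unfolding Hs_low(2)[OF s(1,2) h] using CD up by (rule order_trans)
qed

lemma spectral_1: "spectral 1 b1 (1/b0)"
proof -
 have e: "Hs_KD G VK VD 1 = Dir1 VD" "Hs_norm G 1 = nH"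
  using Dir1_eq[of VD] by (auto simp: Hs_KD_def Hs_def Hs_norm_def fun_eq_iff)
 have "ds 1 u \<le> ennreal b1*ennreal ((nH u)^2)" if "u \<in> Dir1 VD" for u
  using B_upper[OF Dir1_H1[OF that]] ds_1[OF that] b_pos by (simp add: ennreal_mult'[symmetric] ennreal_leI del: One_nat_def)
 thus ?thesis unfolding spectral_def e using H1_L2[OF Dir1_H1] ds1_Dir1[of _ 1] H1_le_ds by auto
qed

text \<open>For \<open>DG u\<close> the free couple is compared with the one of
  \<open>Flux1\<close>, whose squared K-functional is essentially \<open>Qs\<close> of the energies
  \<open>\<mu> i*(cf u i)^2\<close>; the remainder \<open>CD*(nL u)^2\<close> is absorbed by the H^1
  part of the norm. Both constants are free of the eigenbasis.\<close>

lemma spectral_mid: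
 assumes s: "1 < s" "s < 2" "s \<noteq> 3/2" and C: "0 < C"
  and cut: "\<And>u. u \<in> H1E ==> u \<in> Hs_KD G VK VD s ==>
   NQ (s - 1) (Flux1 VK) (DG u) \<le> ennreal C*NQ (s - 1) (H1E) (DG u)"
 shows "spectral s (1/ct (s - 1)*(3*(a1^2/b0 + (a1 + a2)^2))*C + 3*((1 + 1/k0) * k1^2)) (1/b0 * k0 powr (1 - s) + 2*(1/b0 + Cell^2)*ct (s - 1))"
 unfolding spectral_def CF_def[symmetric] CD_def[symmetric]
proof (intro conjI ballI impI)
 have s1: "0 < s - 1" "s - 1 < 1" using s by auto
 note ctp = ct[OF s1]
 {
  fix u assume u: "u \<in> Hs_KD G VK VD s"
  hence h: "u \<in> Hs G s" and D: "u \<in> Dirichlet G VD" using s by (auto simp: Hs_KD_def split: if_splits)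
  have u1: "u \<in> Dir1 VD" using Hs_mid(1)[OF s(1,2)] h D Dir1_eq[of VD] HkG_1_eq by blast
  show uL: "u \<in> L2 G" by (rule H1_L2[OF Dir1_H1[OF u1]])
  let ?R = "ennreal ((Hs_norm G s u)^2)"
  note R = Hs_mid(2)[OF s(1,2) h]
  have "NQ (s - 1) (Flux1 VK) (DG u) \<le> ennreal C*?R"
   by (rule order_trans[OF cut[OF Dir1_H1[OF u1] u]]) (auto simp: R simp del: One_nat_def intro!: mult_left_mono)
  hence "ennreal (1/ct (s - 1)*CF)*NQ (s - 1) (Flux1 VK) (DG u) \<le> ennreal (1/ct (s - 1)*CF*C)*?R"
   by (intro le_chain[OF order_refl]) (use ctp CFD C in auto)
  moreover have "ennreal (CD*(nL u)^2) \<le> ennreal CD*?R"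
  proof -
   have "ennreal ((nL u)^2) \<le> ?R"
    unfolding R by (rule order_trans[OF ennreal_leI[OF power_mono[OF L2_le_H1(1)]]]) auto
   thus ?thesis using CFD by (simp add: ennreal_mult mult_left_mono)
  qed
  ultimately show "ds s u \<le> ennreal (1/ct (s - 1)*CF*C + CD)*?R"
   using order_trans[OF NQ_Flux1(2)[OF u1 s1] le_plus] ctp CFD C by simp
 }
 fix u assume u: "u \<in> L2 G" and f: "ds s u < \<infinity>"
 have u1: "u \<in> Dir1 VD" using ds1_Dir1[OF u f] s by simp
 note h1 = Dir1_H1[OF u1]
 have up: "NQ (s - 1) (Flux1 VK) (DG u) \<le> ennreal (2*(1/b0 + Cell^2)*ct (s - 1))*ds s u"
  using NQ_Flux1(1)[OF u1 s1] by simp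
 moreover have "NQ (s - 1) (H1E) (DG u) \<le> NQ (s - 1) (Flux1 VK) (DG u)"
  by (rule NQ_anti[OF D_L2[OF h1] gd_spaces(4) _ gd_spaces(1)]) (auto simp: Flux1_def)
 ultimately have le: "NQ (s - 1) (H1E) (DG u) \<le> ennreal (2*(1/b0 + Cell^2)*ct (s - 1))*ds s u" by (rule order_trans[rotated])
 hence N: "NQ (s - 1) (H1E) (DG u) < \<infinity>"
  by (rule fin_mult) (rule f)
 have h: "u \<in> Hs G s" and D: "u \<in> Dirichlet G VD"
  using Hs_mid(1)[OF s(1,2)] N u1 Dir1_eq[of VD] HkG_1_eq by blast+
 have "s > 3/2 ==> u \<in> Kirchhoff G VK" using Kirchhoff_dot[OF u1 _ s1(2)] f N by simp
 thus "u \<in> Hs_KD G VK VD s" using h D s by (auto simp: Hs_KD_def)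
 have "ennreal ((nH u)^2) \<le> ennreal (1/b0 * k0 powr (1 - s))*ds s u"
  by (rule le_chain[OF H1_le_ds[OF u1] ds_mono]) (use s b_pos in auto)
 thus "ennreal ((Hs_norm G s u)^2) \<le> ennreal (1/b0 * k0 powr (1 - s) + 2*(1/b0 + Cell^2)*ct (s - 1))*ds s u"
  unfolding Hs_mid(2)[OF s(1,2) h] using ctp b_pos by (intro le_plus le) auto
qed

lemma H2_ds:
 assumes u: "u \<in> Lp"
 shows "ds 2 u \<le> ennreal ((k1 + a2 + a1)^2)*ennreal ((nHH u)^2)"
  "ennreal ((nHH u)^2) \<le> ennreal (Cell^2)*ds 2 u"
proof -
 have e: "ds 2 u = ennreal ((nL (Lop u))^2)" using ds_Lop[OF u, of 0] ds_0[OF Lop_L2[OF u]] by simp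
 have "(nL (Lop u))^2 \<le> ((k1 + a2 + a1)*nHH u)^2" by (rule power_mono[OF norm_DD(1)[OF u]]) simp
 thus "ds 2 u \<le> ennreal ((k1 + a2 + a1)^2)*ennreal ((nHH u)^2)"
  unfolding e by (simp add: ennreal_mult[symmetric] ennreal_leI power_mult_distrib)
 have "(nHH u)^2 \<le> (Cell*nL (Lop u))^2" by (rule power_mono[OF elliptic(2)[OF u] H2_norm_nonneg])
 thus "ennreal ((nHH u)^2) \<le> ennreal (Cell^2)*ds 2 u"
  unfolding e by (simp add: ennreal_mult[symmetric] ennreal_leI power_mult_distrib)
qed

lemma spectral_2: "spectral 2 ((k1 + a2 + a1)^2) (Cell^2)"
proof -
 have e: "Hs_KD G VK VD 2 = Lp" "Hs_norm G 2 = nHH"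
  using L_dom_eq by (auto simp: Hs_KD_def Hs_def Hs_norm_def L_dom_def fun_eq_iff)
 thus ?thesis unfolding spectral_def e using H1_L2[OF LpD(3)] ds2_Lp[of _ 2] H2_ds by auto
qed

text \<open>The second derivative is exchanged for \<open>Lop u\<close>, of order
  \<open>\<theta> < 1/2\<close>. Multiplication by the coefficients need not respect vertex
  conditions, so the exchange takes place over \<open>H1E\<close>; the premises \<open>cut\<close>
  then lead to \<open>Dir1\<close> on the spectral side and to \<open>Cont1\<close> on the side of
  the definition.\<close>

lemma spectral_high:
 assumes s: "2 < s" "s < 5/2" and C: "0 < C1" "0 < C2"
  and cut: "\<And>u. u \<in> L2 G ==> NQ (s - 2) (Dir1 VD) u \<le> ennreal C1*NQ (s - 2) (H1E) u"
   "\<And>u. u \<in> L2 G ==> NQ (s - 2) Cont1 u \<le> ennreal C2*NQ (s - 2) (H1E) u"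
 defines "M \<equiv> 4*(k1 + a2 + 4*\<Lambda>)" and "g \<equiv> 2/a0 + a2/a0^2" and "\<theta> \<equiv> s - 2"
 shows "spectral s (1/ct \<theta>*(2*(1 + b1))*C1*(2*(2*a1 + a2)^2 + 2*M^2*ct \<theta>))
  (Cell^2 * k0 powr (2 - s) + C2*(2*g^2*(2*(1 + 1/b0)*ct \<theta>) + 2*g^2*M^2*ct \<theta>*(Cell^2 * k0 powr (2 - s))))"
proof -
 have th: "0 < \<theta>" "\<theta> < 1" "s = 2 + \<theta>" "0 \<le> s" "\<not> s < 3/2" using s by (auto simp: \<theta>_def)
 note ctp = ct[OF th(1,2)]
 have KD: "u \<in> Hs_KD G VK VD s \<longleftrightarrow> u \<in> Lp \<and> NQ \<theta> Cont1 (DG (DG u)) < \<infinity>" for u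
 proof -
  have "Hs_KD G VK VD s = Hs G s \<inter> Kirchhoff G VK \<inter> Dirichlet G VD" using s by (simp add: Hs_KD_def)
  thus ?thesis using Hs_high(1)[OF s(1)] L_dom_eq unfolding L_dom_def \<theta>_def by blast
 qed
 have R: "ennreal ((Hs_norm G s u)^2) = ennreal ((nHH u)^2) + NQ \<theta> Cont1 (DG (DG u))"
  if "u \<in> Hs_KD G VK VD s" for u
  unfolding \<theta>_def by (rule Hs_high(2)[OF s(1)]) (use that s in \<open>simp add: Hs_KD_def\<close>)
 have cc: "ennreal (c*(M*h)^2)*cth \<theta> = ennreal (c*M^2*ct \<theta>)*ennreal (h^2)" if "0 \<le> c" for c h
  using that ctp by (simp add: ctp(1)[symmetric] ennreal_mult[symmetric] power_mult_distrib mult_ac)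
 have K: "NQ \<theta> (H1E) (Lop u) \<le> ennreal (2*(2*a1 + a2)^2)*NQ \<theta> (H1E) (DG (DG u)) + ennreal (2*M^2*ct \<theta>)*ennreal ((nHH u)^2)"
  "NQ \<theta> (H1E) (DG (DG u)) \<le> ennreal (2*g^2)*NQ \<theta> (H1E) (Lop u) + ennreal (2*g^2*M^2*ct \<theta>)*ennreal ((nHH u)^2)"
  if u: "u \<in> Lp" for u
 proof -
  note L = Lop_L2[OF u] D_L2[OF LpD(4)[OF u]]
  show "NQ \<theta> (H1E) (Lop u) \<le> ennreal (2*(2*a1 + a2)^2)*NQ \<theta> (H1E) (DG (DG u)) + ennreal (2*M^2*ct \<theta>)*ennreal ((nHH u)^2)"
   unfolding cc[OF zero_le_numeral, symmetric] unfolding M_def by (rule NQ_le[OF L(2) gd_spaces(1) _ _ K_Lop(1)[OF u]]) auto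
  have "(KK (H1E) t (DG (DG u)))^2 \<le> (2*g^2)*(KK (H1E) t (Lop u))^2 + (2*g^2*(M*nHH u)^2)*min 1 (t^2)" if "0 < t" for t
   using K_Lop(2)[OF u that] unfolding g_def[symmetric] M_def[symmetric] by (simp add: algebra_simps del: One_nat_def)
  moreover have c2: "0 \<le> 2*g^2" by simp
  ultimately show "NQ \<theta> (H1E) (DG (DG u)) \<le> ennreal (2*g^2)*NQ \<theta> (H1E) (Lop u) + ennreal (2*g^2*M^2*ct \<theta>)*ennreal ((nHH u)^2)"
   unfolding cc[OF c2, symmetric] by (intro NQ_le[OF L(1) gd_spaces(1)]) auto
 qed
 show ?thesis unfolding spectral_def
 proof (intro conjI ballI impI)
  {
   fix u assume u: "u \<in> Hs_KD G VK VD s"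
   hence lp: "u \<in> Lp" using KD by blast
   show "u \<in> L2 G" by (rule H1_L2[OF LpD(3)[OF lp]])
   let ?R = "ennreal ((Hs_norm G s u)^2)" and ?dd = "DG (DG u)"
   note L = Lop_L2[OF lp] D_L2[OF LpD(4)[OF lp]]
   have "NQ \<theta> (H1E) ?dd \<le> NQ \<theta> Cont1 ?dd" by (rule NQ_anti[OF L(2) gd_spaces(2) _ gd_spaces(1)]) (blast intro: Cont1_H1)
   hence 1: "NQ \<theta> (H1E) ?dd \<le> ?R" and 2: "ennreal ((nHH u)^2) \<le> ?R"
    unfolding R[OF u] by (auto intro: add_increasing)
   have E: "NQ \<theta> (H1E) (Lop u) \<le> ennreal (2*(2*a1 + a2)^2 + 2*M^2*ct \<theta>)*?R"
    by (rule order_trans[OF K(1)[OF lp] le_plus[OF mult_left_mono[OF 1] mult_left_mono[OF 2]]]) (use ctp in auto)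
   have "ds s u \<le> ennreal (1/ct \<theta>*(2*(1 + b1))*C1)*NQ \<theta> (H1E) (Lop u)"
    unfolding th(3) ds_Lop[OF lp]
    by (rule le_chain[OF NQ_Dir1(2)[OF L(1) th(1,2)] cut(1)[OF L(1), folded \<theta>_def]]) (use ctp b_pos C in auto)
   thus "ds s u \<le> ennreal (1/ct \<theta>*(2*(1 + b1))*C1*(2*(2*a1 + a2)^2 + 2*M^2*ct \<theta>))*?R"
    by (rule le_chain[OF _ E]) (use ctp b_pos C in auto)
  }
  fix u assume u: "u \<in> L2 G" and f: "ds s u < \<infinity>"
  have lp: "u \<in> Lp" using ds2_Lp[OF u f] s by simp
  let ?dd = "DG (DG u)" and ?cA = "2*(1 + 1/b0)*ct \<theta>" and ?c2 = "Cell^2 * k0 powr (2 - s)"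
  note L = Lop_L2[OF lp] D_L2[OF LpD(4)[OF lp]]
  have H2: "ennreal ((nHH u)^2) \<le> ennreal ?c2*ds s u"
   by (rule le_chain[OF H2_ds(2)[OF lp] ds_mono]) (use s in auto)
  have "NQ \<theta> (H1E) (Lop u) \<le> NQ \<theta> (Dir1 VD) (Lop u)" by (rule NQ_anti[OF L(1) gd_spaces(3) _ gd_spaces(1)]) (blast intro: Dir1_H1)
  also have "... \<le> ennreal ?cA*ds s u" unfolding th(3) ds_Lop[OF lp] by (rule NQ_Dir1(1)[OF L(1) th(1,2)])
  finally have EL: "NQ \<theta> (H1E) (Lop u) \<le> ennreal ?cA*ds s u" .
  have "NQ \<theta> (H1E) ?dd \<le> ennreal (2*g^2*?cA + 2*g^2*M^2*ct \<theta>*?c2)*ds s u"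
   by (rule order_trans[OF K(2)[OF lp] le_plus[OF le_chain[OF order_refl EL] le_chain[OF order_refl H2]]]) (use ctp b_pos in auto)
  hence c: "NQ \<theta> Cont1 ?dd \<le> ennreal (C2*(2*g^2*?cA + 2*g^2*M^2*ct \<theta>*?c2))*ds s u"
   by (rule le_chain[OF cut(2)[OF L(2), folded \<theta>_def]]) (use ctp b_pos C in auto)
  hence "NQ \<theta> Cont1 ?dd < \<infinity>" by (rule fin_mult) (rule f)
  thus KDu: "u \<in> Hs_KD G VK VD s" using KD lp by blast
  show "ennreal ((Hs_norm G s u)^2) \<le> ennreal (?c2 + C2*(2*g^2*?cA + 2*g^2*M^2*ct \<theta>*?c2))*ds s u"
   unfolding R[OF KDu] by (rule le_plus[OF H2 c]) (use ctp b_pos C in auto)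
 qed
qed

end

definition norm_equiv :: "('v, 'e) mgraph => 'v set => 'v set => real => (nat => 'e gfn) => (nat => real) => real => bool" where
 "norm_equiv G VK VD s \<psi> \<mu> C \<longleftrightarrow> 0 < C \<and> Hs_KD G VK VD s = dot_fn G \<psi> \<mu> s \<and>
  (\<forall>u\<in>dot_fn G \<psi> \<mu> s. 0 \<le> Hs_norm G s u \<and>
   Hs_norm G s u \<le> C*dot_norm \<mu> s (\<lambda>i. L2_inner G u (\<psi> i)) \<and> dot_norm \<mu> s (\<lambda>i. L2_inner G u (\<psi> i)) \<le> C*Hs_norm G s u)"

lemma (in mgr) Hs_norm_nonneg: "0 \<le> Hs_norm G s u"
 by (simp add: Hs_norm_def interp_norm_def H2_norm_nonneg del: One_nat_def)

lemma (in eigl) spectral_norm_equiv: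
 assumes S: "spectral s Ca Cb" and c: "0 \<le> Ca" "0 \<le> Cb"
 shows "norm_equiv G VK VD s \<psi> \<mu> (1 + sqrt Ca + sqrt Cb)"
proof -
 let ?C = "1 + sqrt Ca + sqrt Cb"
 have "ds s u < \<infinity>" if "u \<in> Hs_KD G VK VD s" for u
  by (rule fin_mult[of _ Ca "ennreal ((Hs_norm G s u)^2)"]) (use S that in \<open>auto simp: spectral_def\<close>)
 hence KD: "Hs_KD G VK VD s = dfn s"
  using S dot_fn_iff unfolding spectral_def by blast
 have "Hs_norm G s u \<le> ?C*dot_norm \<mu> s (cf u) \<and> dot_norm \<mu> s (cf u) \<le> ?C*Hs_norm G s u" if u: "u \<in> dfn s" for u
 proof -
  let ?x = "Hs_norm G s u" and ?y = "dot_norm \<mu> s (cf u)"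
  have y: "0 \<le> ?y" using u unfolding dot_norm_def dot_fn_def by (simp add: suminf_nonneg)
  have x: "0 \<le> ?x" by (rule Hs_norm_nonneg)
  have "ennreal (?x^2) \<le> ennreal Cb*ennreal (?y^2)" "ennreal (?y^2) \<le> ennreal Ca*ennreal (?x^2)"
   using S u KD unfolding spectral_def ds_dot_norm[OF u, symmetric] by (auto simp: dot_fn_iff)
  hence sq: "?x^2 \<le> Cb*?y^2" "?y^2 \<le> Ca*?x^2" using c by (simp_all add: ennreal_mult[symmetric])
  have "?x \<le> sqrt Cb*?y" by (rule power2_le_imp_le) (use sq c y in \<open>auto simp: power_mult_distrib\<close>)
  moreover have "?y \<le> sqrt Ca*?x" by (rule power2_le_imp_le) (use sq c x in \<open>auto simp: power_mult_distrib\<close>)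
  moreover have "sqrt Cb*?y \<le> ?C*?y" "sqrt Ca*?x \<le> ?C*?x" using c x y by (auto intro!: mult_right_mono)
  ultimately show ?thesis by linarith
 qed
 moreover have "0 < ?C" using c by (simp add: add_pos_nonneg)
 ultimately show ?thesis unfolding norm_equiv_def using KD Hs_norm_nonneg by blast
qed

text \<open>One \<open>C\<close> serves all eigenbases, as every constant comes from
  \<open>kop\<close>. Below 1/2, between 1 and 3/2, and above 2 the conditions at the fractional
  level are removed by \<open>cut_id\<close>; in the two other fractional ranges they are used,
  through \<open>cut_D\<close> and \<open>cut_K\<close>.\<close>

lemma (in kop) norm_equiv_exists:
 assumes s: "0 \<le> s" "s < 5/2" "s \<noteq> 1/2" "s \<noteq> 3/2"
 obtains C where "\<And>\<psi> \<mu>. eigl G VK VD a a' q k0 k1 a0 a1 a2 \<Lambda> \<psi> \<mu> ==> norm_equiv G VK VD s \<psi> \<mu> C"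
proof -
 let ?E = "eigl G VK VD a a' q k0 k1 a0 a1 a2 \<Lambda>"
 note E = eigl.spectral_norm_equiv
 have ap: "0 \<le> b0" "0 \<le> b1" "0 \<le> k0" "0 \<le> a2" "0 \<le> a1" "0 \<le> k1" using b_pos const_pos k0 by auto
 consider "s = 0" | "0 < s" "s < 1/2" | "1/2 < s" "s < 1" | "s = 1" | "1 < s" "s < 3/2" | "3/2 < s" "s < 2" | "s = 2" | "2 < s"
  using s by linarith
 thus thesis
 proof cases
  case 1
  show ?thesis by (rule that) (use 1 E eigl.spectral_0 in \<open>fastforce\<close>)
 next
  case 2
  obtain C where C: "0 < C" "\<And>u. u \<in> L2 G ==> NQ s (Dir1 VD) u \<le> ennreal C*NQ s (H1E) u"
   using cut_id[OF 2 gd_spaces(3) zero_traces(2)] by blast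
  have C': "NQ s (Dir1 VD) u \<le> ennreal C*NQ s Cont1 u" if u: "u \<in> L2 G" for u
   using C(2)[OF u] by (rule order_trans) (intro mult_left_mono NQ_anti[OF u gd_spaces(2) _ gd_spaces(1)], auto intro: Cont1_H1 simp del: One_nat_def)
  show ?thesis
   by (rule that, rule E[OF _ eigl.spectral_low[OF _ _ _ _ C(1) C']]) (use 2 ct[of s] C(1) ap in auto)
 next
  case 3
  obtain C where C: "0 < C" "\<And>u. u \<in> Dirichlet G VD ==> NQ s (Dir1 VD) u \<le> ennreal C*NQ s Cont1 u"
   using cut_D[OF 3] by blast
  show ?thesis
   by (rule that, rule E[OF _ eigl.spectral_low[OF _ _ _ _ C(1) C(2)]]) (use 3 ct[of s] C(1) ap in \<open>auto simp: Hs_KD_def\<close>)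
 next
  case 4
  show ?thesis by (rule that, unfold 4, rule E[OF _ eigl.spectral_1]) (use ap in auto)
 next
  case 5
  have "0 < s - 1" "s - 1 < 1/2" using 5 by auto
  then obtain C where C: "0 < C" "\<And>u. u \<in> L2 G ==> NQ (s - 1) (Flux1 VK) u \<le> ennreal C*NQ (s - 1) (H1E) u"
   using cut_id[OF _ _ gd_spaces(4) zero_traces(3)] by blast
  show ?thesis
   by (rule that, rule E[OF _ eigl.spectral_mid[OF _ _ _ _ C(1) C(2)[OF D_L2]]]) (use 5 ct[of "s - 1"] C(1) ap in auto)
 next
  case 6
  have "1/2 < s - 1" "s - 1 < 1" using 6 by auto
  then obtain C where C: "0 < C" "\<And>u. u \<in> H1E ==> u \<in> Kirchhoff G VK ==>
    NQ (s - 1) (Flux1 VK) (DG u) \<le> ennreal C*NQ (s - 1) (H1E) (DG u)"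
   using cut_K by blast
  show ?thesis
   by (rule that, rule E[OF _ eigl.spectral_mid[OF _ _ _ _ C(1) C(2)]]) (use 6 ct[of "s - 1"] C(1) ap in \<open>auto simp: Hs_KD_def\<close>)
 next
  case 7
  show ?thesis by (rule that, unfold 7, rule E[OF _ eigl.spectral_2]) (use ap in auto)
 next
  case 8
  have th: "0 < s - 2" "s - 2 < 1/2" using 8 s by auto
  obtain C1 where C1: "0 < C1" "\<And>u. u \<in> L2 G ==> NQ (s - 2) (Dir1 VD) u \<le> ennreal C1*NQ (s - 2) (H1E) u"
   using cut_id[OF th gd_spaces(3) zero_traces(2)] by blast
  obtain C2 where C2: "0 < C2" "\<And>u. u \<in> L2 G ==> NQ (s - 2) Cont1 u \<le> ennreal C2*NQ (s - 2) (H1E) u"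
   using cut_id[OF th gd_spaces(2) zero_traces(1)] by blast
  show ?thesis
   by (rule that, rule E[OF _ eigl.spectral_high[OF _ _ _ C1(1) C2(1) C1(2) C2(2)]]) (use 8 s ct[of "s - 2"] C1(1) C2(1) ap in auto)
 qed
qed

section \<open>Coefficients of functionals\<close>

lemma dual_cong:
 assumes C: "0 < C" and eq: "\<And>u. u \<in> S ==> 0 \<le> N u \<and> N u \<le> C*M u \<and> M u \<le> C*N u"
 shows "dual S N = dual S M"
proof -
 have "(\<exists>c. \<forall>u\<in>S. \<bar>T u\<bar> \<le> c*N u) \<longleftrightarrow> (\<exists>c. \<forall>u\<in>S. \<bar>T u\<bar> \<le> c*M u)" for T
 proof (intro iffI; elim exE)
  fix c assume c: "\<forall>u\<in>S. \<bar>T u\<bar> \<le> c*N u"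
  have "\<bar>T u\<bar> \<le> (\<bar>c\<bar>*C)*M u" if u: "u \<in> S" for u
  proof -
   have "\<bar>T u\<bar> \<le> \<bar>c\<bar>*N u" using c u eq[OF u] by (meson abs_ge_self mult_right_mono order_trans)
   also have "... \<le> \<bar>c\<bar>*(C*M u)" using eq[OF u] by (intro mult_left_mono) auto
   finally show ?thesis by (simp add: mult.assoc)
  qed
  thus "\<exists>c. \<forall>u\<in>S. \<bar>T u\<bar> \<le> c*M u" by blast
 next
  fix c assume c: "\<forall>u\<in>S. \<bar>T u\<bar> \<le> c*M u"
  have "\<bar>T u\<bar> \<le> (\<bar>c\<bar>*C)*N u" if u: "u \<in> S" for u
  proof -
   have "0 \<le> C*M u" using eq[OF u] by linarith
   hence "0 \<le> M u" using C by (simp add: zero_le_mult_iff)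
   hence "\<bar>T u\<bar> \<le> \<bar>c\<bar>*M u" using c u by (meson abs_ge_self mult_right_mono order_trans)
   also have "... \<le> \<bar>c\<bar>*(C*N u)" using eq[OF u] by (intro mult_left_mono) auto
   finally show ?thesis by (simp add: mult.assoc)
  qed
  thus "\<exists>c. \<forall>u\<in>S. \<bar>T u\<bar> \<le> c*N u" by blast
 qed
 thus ?thesis unfolding dual_def by simp
qed

context eigl
begin

abbreviation dotn :: "real => 'b gfn => real" where "dotn s u \<equiv> dot_norm \<mu> s (cf u)"

lemma weight_nonneg: "0 \<le> \<mu> i powr s*(c i)^2"
 by simp

lemma dot_norm_sq: "summable (\<lambda>i. \<mu> i powr s*(c i)^2) ==> (dot_norm \<mu> s c)^2 = (\<Sum>i. \<mu> i powr s*(c i)^2)"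
 unfolding dot_norm_def by (simp add: suminf_nonneg)

lemma dot_norm_nonneg: "summable (\<lambda>i. \<mu> i powr s*(c i)^2) ==> 0 \<le> dot_norm \<mu> s c"
 unfolding dot_norm_def by (simp add: suminf_nonneg)

lemma dot_fnD: "u \<in> dfn s ==> u \<in> L2 G" "u \<in> dfn s ==> summable (\<lambda>i. \<mu> i powr s*(cf u i)^2)"
 by (auto simp: dot_fn_def)

lemma cf_diff: "u \<in> L2 G ==> v \<in> L2 G ==> cf (u - v) i = cf u i - cf v i"
 by (rule inner_diff_left[OF _ _ psi_D(3)])

lemma dot_fn_add:
 assumes u: "u \<in> dfn s" and v: "v \<in> dfn s" shows "u + v \<in> dfn s"
proof -
 have "summable (\<lambda>i. \<mu> i powr s*(cf u i + cf v i)^2)"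
 proof (rule summable_comparison_test'[where N = 0])
  show "summable (\<lambda>i. 2*(\<mu> i powr s*(cf u i)^2) + 2*(\<mu> i powr s*(cf v i)^2))"
   by (intro summable_add summable_mult dot_fnD u v)
  fix i
  have "(cf u i + cf v i)^2 \<le> 2*(cf u i)^2 + 2*(cf v i)^2" using sum_squares_bound[of "cf u i" "cf v i"] by (simp add: power2_sum)
  from mult_left_mono[OF this, of "\<mu> i powr s"]
  show "norm (\<mu> i powr s*(cf u i + cf v i)^2) \<le> 2*(\<mu> i powr s*(cf u i)^2) + 2*(\<mu> i powr s*(cf v i)^2)"
   by (simp add: algebra_simps)
 qed
 thus ?thesis using dot_fnD(1)[OF u] dot_fnD(1)[OF v] by (simp add: dot_fn_def L2_add inner_add_left psi_D(3))
qed

lemma dot_fn_scl: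
 assumes u: "u \<in> dfn s"
 shows "scl c u \<in> dfn s" "dotn s (scl c u) = \<bar>c\<bar>*dotn s u"
proof -
 have e: "\<mu> i powr s*(cf (scl c u) i)^2 = c^2*(\<mu> i powr s*(cf u i)^2)" for i
  unfolding inner_scl_left by (simp add: power_mult_distrib)
 show "scl c u \<in> dfn s"
  using dot_fnD[OF u] L2_scl[of u c] summable_mult[OF dot_fnD(2)[OF u], of "c^2"] by (simp add: dot_fn_def e)
 show "dotn s (scl c u) = \<bar>c\<bar>*dotn s u"
  unfolding dot_norm_def e suminf_mult[OF dot_fnD(2)[OF u]] by (simp add: real_sqrt_mult)
qed

lemma lin_comb_dot: "lin_comb n d \<psi> \<in> dfn s" "(dotn s (lin_comb n d \<psi>))^2 = (\<Sum>i<n. \<mu> i powr s*(d i)^2)"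
proof -
 let ?f = "\<lambda>i. \<mu> i powr s*(cf (lin_comb n d \<psi>) i)^2"
 have sm: "?f sums (\<Sum>i<n. ?f i)" by (rule sums_finite) (auto simp: cf_lin_comb)
 thus "lin_comb n d \<psi> \<in> dfn s" using LC(4) sums_summable by (simp add: dot_fn_def)
 have "(dotn s (lin_comb n d \<psi>))^2 = (\<Sum>i<n. ?f i)"
  using dot_norm_sq[OF sums_summable[OF sm]] sums_unique[OF sm] by simp
 thus "(dotn s (lin_comb n d \<psi>))^2 = (\<Sum>i<n. \<mu> i powr s*(d i)^2)" by (simp add: cf_lin_comb)
qed

lemma psi_dot: "\<psi> i \<in> dfn s"
proof -
 have "(\<lambda>j. \<mu> j powr s*(cf (\<psi> i) j)^2) sums (\<Sum>j\<in>{i}. \<mu> j powr s*(cf (\<psi> i) j)^2)"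
  by (rule sums_finite) (auto simp: orth)
 thus ?thesis using psi_D(3) sums_summable by (auto simp: dot_fn_def)
qed

lemma tail_dot:
 assumes sm: "summable (\<lambda>i. \<mu> i powr s*(c i)^2)"
 shows "(\<lambda>n. dot_norm \<mu> s (\<lambda>j. if j < n then 0 else c j)) \<longlonglongrightarrow> 0"
proof -
 let ?f = "\<lambda>i. \<mu> i powr s*(c i)^2"
 have "(\<Sum>j. \<mu> j powr s*(if j < n then 0 else c j)^2) = suminf ?f - (\<Sum>i<n. ?f i)" for n
 proof -
  have "(\<lambda>j. ?f j - (if j \<in> {..<n} then ?f j else 0)) sums (suminf ?f - (\<Sum>i<n. ?f i))"
   by (intro sums_diff summable_sums sm sums_If_finite_set) auto
  moreover have "(\<lambda>j. ?f j - (if j \<in> {..<n} then ?f j else 0)) = (\<lambda>j. \<mu> j powr s*(if j < n then 0 else c j)^2)" by auto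
  ultimately show ?thesis by (simp add: sums_iff)
 qed
 hence e: "(\<lambda>n. dot_norm \<mu> s (\<lambda>j. if j < n then 0 else c j)) = (\<lambda>n. sqrt (suminf ?f - (\<Sum>i<n. ?f i)))"
  by (simp add: dot_norm_def)
 have "(\<lambda>n. sqrt (suminf ?f - (\<Sum>i<n. ?f i))) \<longlonglongrightarrow> sqrt (suminf ?f - suminf ?f)"
  by (intro tendsto_intros summable_LIMSEQ sm)
 thus ?thesis unfolding e by simp
qed

text \<open>The weights of order \<open>s\<close> and \<open>- s\<close> are split evenly between
  the two factors and cancel in the product.\<close>

lemma dual_pairing:
 assumes h: "summable (\<lambda>i. \<mu> i powr s*(h i)^2)" and c: "summable (\<lambda>i. \<mu> i powr (- s)*(c i)^2)"
 shows "summable (\<lambda>i. h i*c i)" "\<bar>\<Sum>i. h i*c i\<bar> \<le> dot_norm \<mu> s h*dot_norm \<mu> (- s) c"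
proof -
 let ?a = "\<lambda>i. \<mu> i powr (s/2)*h i" and ?b = "\<lambda>i. \<mu> i powr (- s/2)*c i"
 have p: "h i*c i = ?a i*?b i" for i
 proof -
  have "\<mu> i powr (s/2)*\<mu> i powr (- s/2) = 1" using mu_pos[of i] by (simp add: powr_add[symmetric])
  thus ?thesis by (simp add: algebra_simps)
 qed
 have sq: "(?a i)^2 = \<mu> i powr s*(h i)^2" "(?b i)^2 = \<mu> i powr (- s)*(c i)^2" for i
  by (simp_all add: power_mult_distrib power2_eq_square[of "_ powr _"] powr_add[symmetric])
 have two_abs: "2*\<bar>x*y\<bar> \<le> x^2 + y^2" for x y :: real
  using sum_squares_bound[of "\<bar>x\<bar>" "\<bar>y\<bar>"] by (simp add: abs_mult mult.assoc)
 show sm: "summable (\<lambda>i. h i*c i)"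
 proof (rule summable_comparison_test'[OF summable_add[OF h c], where N = 0])
  fix i
  have "2*\<bar>?a i*?b i\<bar> \<le> (?a i)^2 + (?b i)^2" by (rule two_abs)
  thus "norm (h i*c i) \<le> \<mu> i powr s*(h i)^2 + \<mu> i powr (- s)*(c i)^2" unfolding p sq[symmetric] real_norm_def by linarith
 qed
 have "\<bar>\<Sum>i<n. h i*c i\<bar> \<le> dot_norm \<mu> s h*dot_norm \<mu> (- s) c" for n
 proof -
  have "(\<Sum>i<n. h i*c i)^2 \<le> (\<Sum>i<n. (?a i)^2)*(\<Sum>i<n. (?b i)^2)" unfolding p by (rule Cauchy_Schwarz_ineq_sum)
  also have "... \<le> (dot_norm \<mu> s h)^2*(dot_norm \<mu> (- s) c)^2"
   unfolding sq dot_norm_sq[OF h] dot_norm_sq[OF c]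
   by (intro mult_mono sum_le_suminf h c suminf_nonneg sum_nonneg) auto
  finally have "\<bar>\<Sum>i<n. h i*c i\<bar>\<^sup>2 \<le> (dot_norm \<mu> s h*dot_norm \<mu> (- s) c)^2" by (simp only: power2_abs power_mult_distrib)
  thus ?thesis by (rule power2_le_imp_le) (intro mult_nonneg_nonneg dot_norm_nonneg h c)
 qed
 thus "\<bar>\<Sum>i. h i*c i\<bar> \<le> dot_norm \<mu> s h*dot_norm \<mu> (- s) c"
  using LIMSEQ_le_const2[OF tendsto_rabs[OF summable_LIMSEQ[OF sm]]] by blast
qed

lemma dualD:
 assumes "T \<in> dual S N"
 shows "u \<in> S ==> v \<in> S ==> T (u + v) = T u + T v" "u \<in> S ==> T (scl c u) = c*T u" "u \<notin> S ==> T u = 0"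
 using assms unfolding dual_def by blast+

lemma dual_lin_comb:
 assumes T: "T \<in> dual (dfn s) N"
 shows "T (lin_comb n d \<psi>) = (\<Sum>i<n. d i*T (\<psi> i))"
proof (induction n)
 case 0
 have "lin_comb 0 d \<psi> = scl 0 (\<psi> 0)" by (simp add: lin_comb_def)
 thus ?case using dualD(2)[OF T psi_dot[of 0 s], of 0] by simp
next
 case (Suc n)
 show ?case unfolding lin_comb_Suc dualD(1)[OF T lin_comb_dot(1) dot_fn_scl(1)[OF psi_dot]] dualD(2)[OF T psi_dot] Suc.IH by simp
qed

text \<open>The remainders of the eigenfunction expansion tend to 0 in the norm for which
  \<open>T\<close> is bounded; a functional is thus determined by its values at the
  eigenfunctions.\<close>

lemma dual_expansion:
 assumes T: "T \<in> dual (dfn s) (dotn s)" and v: "v \<in> dfn s"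
 shows "(\<lambda>i. cf v i*T (\<psi> i)) sums T v"
proof -
 obtain C where C: "\<And>u. u \<in> dfn s ==> \<bar>T u\<bar> \<le> C*dotn s u" using T unfolding dual_def by blast
 let ?S = "\<lambda>n. lin_comb n (cf v) \<psi>"
 note vL = dot_fnD(1)[OF v]
 have b: "norm (T v - T (?S n)) \<le> C*dot_norm \<mu> s (\<lambda>j. if j < n then 0 else cf v j)" for n
 proof -
  have n: "scl (-1) (?S n) \<in> dfn s" by (rule dot_fn_scl(1)[OF lin_comb_dot(1)])
  have e: "v - ?S n = v + scl (-1) (?S n)" by (auto simp: fun_eq_iff)
  have m: "v - ?S n \<in> dfn s" unfolding e by (rule dot_fn_add[OF v n])
  have "T (v - ?S n) = T v - T (?S n)" unfolding e dualD(1)[OF T v n] dualD(2)[OF T lin_comb_dot(1)] by simp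
  moreover have "cf (v - ?S n) = (\<lambda>j. if j < n then 0 else cf v j)" by (auto simp: cf_diff[OF vL LC(4)] cf_lin_comb)
  ultimately show ?thesis using C[OF m] by simp
 qed
 have z: "(\<lambda>n. C*dot_norm \<mu> s (\<lambda>j. if j < n then 0 else cf v j)) \<longlonglongrightarrow> 0"
  using tendsto_mult_left[OF tail_dot[OF dot_fnD(2)[OF v]], of C] by simp
 have "(\<lambda>n. T v - T (?S n)) \<longlonglongrightarrow> 0" by (rule Lim_null_comparison[OF always_eventually[OF allI[OF b]] z])
 hence "(\<lambda>n. T v - (T v - T (?S n))) \<longlonglongrightarrow> T v - 0" by (intro tendsto_intros)
 thus ?thesis by (simp add: sums_def dual_lin_comb[OF T])
qed

section \<open>Elements of order \<open>s\<close> of either sign and their coefficients\<close>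

context
 fixes s C assumes ne: "norm_equiv G VK VD \<bar>s\<bar> \<psi> \<mu> C"
begin

lemma ne_D: "0 < C" "Hs_KD G VK VD \<bar>s\<bar> = dfn \<bar>s\<bar>" "0 \<le> Hs_norm G \<bar>s\<bar> u"
 "u \<in> dfn \<bar>s\<bar> ==> Hs_norm G \<bar>s\<bar> u \<le> C*dotn \<bar>s\<bar> u" "u \<in> dfn \<bar>s\<bar> ==> dotn \<bar>s\<bar> u \<le> C*Hs_norm G \<bar>s\<bar> u"
 using ne Hs_norm_nonneg unfolding norm_equiv_def by auto

lemma dual_eq: "dual (dfn \<bar>s\<bar>) (Hs_norm G \<bar>s\<bar>) = dual (dfn \<bar>s\<bar>) (dotn \<bar>s\<bar>)"
 by (rule dual_cong[OF ne_D(1)]) (use ne_D in auto)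

lemma H_KD_eq: "H_KD G VK VD s = dot_H G \<psi> \<mu> s"
proof (cases "0 \<le> s")
 case True
 thus ?thesis using ne_D(2) by (simp add: H_KD_def dot_H_def)
next
 case False
 hence "\<bar>s\<bar> = - s" by simp
 thus ?thesis using False ne_D(2) dual_eq by (simp add: H_KD_def dot_H_def)
qed

text \<open>For negative order, the functional is tested with the finite combination of coefficients
  \<open>\<mu> i powr s*T (\<psi> i)\<close>: its value there is the square of the norm of the test
  function, which bounds that norm and with it the partial sums.\<close>

lemma coefficients:
 assumes f: "f \<in> H_KD G VK VD s"
 shows "summable (\<lambda>i. \<mu> i powr s*(pairing G f (\<psi> i))^2)"
  "dot_norm \<mu> s (\<lambda>i. pairing G f (\<psi> i)) \<le> C*H_KD_norm G VK VD s f"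
proof -
 have "summable (\<lambda>i. \<mu> i powr s*(pairing G f (\<psi> i))^2) \<and> dot_norm \<mu> s (\<lambda>i. pairing G f (\<psi> i)) \<le> C*H_KD_norm G VK VD s f"
 proof (cases "0 \<le> s")
  case True
  then obtain w where "f = Fn w" "w \<in> dfn s" using f ne_D(2) by (auto simp: H_KD_def)
  thus ?thesis using True ne_D(5)[of w] dot_fnD(2)[of w s] by simp
 next
  case False
  hence as: "\<bar>s\<bar> = - s" by simp
  let ?S = "dfn (- s)" and ?N = "Hs_norm G (- s)"
  note D = ne_D[unfolded as]
  obtain T where fT: "f = Functional T" and T: "T \<in> dual ?S ?N" using f False D(2) by (auto simp: H_KD_def)
  let ?d = "H_KD_norm G VK VD s f"
  have d: "?d = Sup {\<bar>T u\<bar> |u. u \<in> ?S \<and> ?N u \<le> 1}" using fT D(2) by (simp add: dual_norm_def)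
  obtain c where c: "\<And>u. u \<in> ?S ==> \<bar>T u\<bar> \<le> c*?N u" using T unfolding dual_def by blast
  have bdd: "bdd_above {\<bar>T u\<bar> |u. u \<in> ?S \<and> ?N u \<le> 1}"
  proof (rule bdd_aboveI[of _ "\<bar>c\<bar>"], clarify)
   fix u assume u: "u \<in> ?S" "?N u \<le> 1"
   have "c*?N u \<le> \<bar>c\<bar>*1" using u(2) D(3)[of u] by (intro mult_mono) auto
   thus "\<bar>T u\<bar> \<le> \<bar>c\<bar>" using c[OF u(1)] by simp
  qed
  have Tb: "\<bar>T v\<bar> \<le> C*?d*dotn (- s) v" if v: "v \<in> ?S" for v
  proof (cases "dotn (- s) v = 0")
   case True
   hence "?N v = 0" using D(3)[of v] D(4)[OF v] by simp
   thus ?thesis using c[OF v] True by simp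
  next
   case False
   \<comment> \<open>The scaling is by the spectral norm and \<open>C\<close>, which brings the
     Sobolev norm below 1 and admits the function to the supremum.\<close>
   define r where "r = 1/(C*dotn (- s) v)"
   have dp: "0 < dotn (- s) v" using False dot_norm_nonneg[OF dot_fnD(2)[OF v]] by simp
   hence r: "0 < r" using D(1) by (simp add: r_def)
   have "?N (scl r v) \<le> C*dotn (- s) (scl r v)" by (rule D(4)[OF dot_fn_scl(1)[OF v]])
   also have "... = C*(r*dotn (- s) v)" using dot_fn_scl(2)[OF v, of r] r by simp
   also have "... = 1" using dp D(1) by (simp add: r_def)
   finally have "\<bar>T (scl r v)\<bar> \<le> ?d" unfolding d by (intro cSup_upper bdd) (use dot_fn_scl(1)[OF v] in blast)
   hence "r*\<bar>T v\<bar> \<le> ?d" using dualD(2)[OF T v] r by (simp add: abs_mult)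
   thus ?thesis using dp D(1) by (simp add: r_def field_simps)
  qed
  let ?g = "\<lambda>i. T (\<psi> i)"
  let ?X = "\<lambda>n. \<Sum>i<n. \<mu> i powr s*(?g i)^2"
  have d0: "0 \<le> ?d"
   using Tb[OF lin_comb_dot(1), of 1 "\<lambda>i. 1"] unfolding d
   by (intro cSup_upper2[OF _ _ bdd, of "\<bar>T (scl 0 (\<psi> 0))\<bar>"])
    (use psi_dot[of 0 "- s"] dot_fn_scl[of "\<psi> 0" "- s" 0] D(4)[of "scl 0 (\<psi> 0)"] in auto)
  have X: "?X n \<le> (C*?d)^2" for n
  proof -
   let ?v = "lin_comb n (\<lambda>i. \<mu> i powr s*?g i) \<psi>"
   have "T ?v = ?X n" unfolding dual_lin_comb[OF T] by (simp add: power2_eq_square mult.assoc)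
   moreover have "(dotn (- s) ?v)^2 = ?X n" unfolding lin_comb_dot(2)
   proof (rule sum.cong[OF refl])
    fix i
    have "\<mu> i powr (- s)*(\<mu> i powr s)^2 = \<mu> i powr s" using mu_pos[of i] by (simp add: power2_eq_square powr_add[symmetric])
    thus "\<mu> i powr - s*(\<mu> i powr s*?g i)^2 = \<mu> i powr s*(?g i)^2" by (simp add: power_mult_distrib mult.assoc[symmetric])
   qed
   ultimately have le: "(dotn (- s) ?v)^2 \<le> C*?d*dotn (- s) ?v" using Tb[OF lin_comb_dot(1), of n "\<lambda>i. \<mu> i powr s*?g i"] by simp
   have "dotn (- s) ?v \<le> C*?d"
   proof (cases "dotn (- s) ?v \<le> 0")
    case True
    moreover have "0 \<le> C*?d" using D(1) d0 by simp
    ultimately show ?thesis by linarith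
   next
    case False
    thus ?thesis using le mult_right_le_imp_le[of "dotn (- s) ?v" "dotn (- s) ?v" "C*?d"] by (simp add: power2_eq_square)
   qed
   hence "(dotn (- s) ?v)^2 \<le> (C*?d)^2" by (intro power_mono dot_norm_nonneg dot_fnD(2)[OF lin_comb_dot(1)])
   thus ?thesis using \<open>(dotn (- s) ?v)^2 = ?X n\<close> by simp
  qed
  have sm: "summable (\<lambda>i. \<mu> i powr s*(?g i)^2)"
   by (rule summableI_nonneg_bounded) (rule weight_nonneg, rule X)
  have "(dot_norm \<mu> s ?g)^2 \<le> (C*?d)^2" unfolding dot_norm_sq[OF sm] by (rule suminf_le_const[OF sm X])
  hence "dot_norm \<mu> s ?g \<le> C*?d" by (rule power2_le_imp_le) (use D(1) d0 in simp)
  thus ?thesis using sm fT by simp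
 qed
 thus "summable (\<lambda>i. \<mu> i powr s*(pairing G f (\<psi> i))^2)"
  "dot_norm \<mu> s (\<lambda>i. pairing G f (\<psi> i)) \<le> C*H_KD_norm G VK VD s f" by auto
qed

text \<open>The converse of \<open>coefficients\<close>: for order at least 0 the series converges
  in L2 by completeness, and for negative order it defines a functional through
  \<open>dual_pairing\<close>.\<close>

lemma realization:
 assumes h: "summable (\<lambda>i. \<mu> i powr s*(h i)^2)"
 obtains u where "u \<in> H_KD G VK VD s" "\<And>j. pairing G u (\<psi> j) = h j" "H_KD_norm G VK VD s u \<le> C*dot_norm \<mu> s h"
proof (cases "0 \<le> s")
 case True
 have hs: "summable (\<lambda>i. (h i)^2)"
 proof (rule summable_comparison_test'[OF summable_mult[OF h, of "k0 powr (- s)"], where N = 0])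
  fix i
  have "1 = \<mu> i powr (- s)*\<mu> i powr s" using mu_pos[of i] by (simp add: powr_add[symmetric])
  also have "... \<le> k0 powr (- s)*\<mu> i powr s" using True mu_ge[of i] k0 by (intro mult_right_mono powr_mono2') auto
  finally have "1*(h i)^2 \<le> k0 powr (- s)*\<mu> i powr s*(h i)^2" by (rule mult_right_mono) simp
  thus "norm ((h i)^2) \<le> k0 powr (- s)*(\<mu> i powr s*(h i)^2)" by (simp add: mult.assoc)
 qed
 let ?S = "\<lambda>n. lin_comb n h \<psi>"
 have nS: "(nL (?S m - ?S n))^2 = (\<Sum>i=n..<m. (h i)^2)" if "n \<le> m" for m n
  using norm_diff_lin_comb[OF L2_zero, where n = m and d = "\<lambda>i. if i < n then 0 else h i"] sum_if_tail[OF that, of "\<lambda>i. 1" h]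
   L2_norm_minus_commute[of 0 "lin_comb m (\<lambda>i. if i < n then 0 else h i) \<psi>"]
  by (simp add: lin_comb_diff[OF that] L2_inner_def)
 obtain w where w: "w \<in> L2 G" and lim: "(\<lambda>n. nL (?S n - w)) \<longlonglongrightarrow> 0"
 proof (rule L2_complete[OF LC(4)])
  show "\<exists>N. \<forall>m\<ge>N. \<forall>n\<ge>N. nL (?S m - ?S n) < r" if "0 < r" for r
   by (rule Cauchy_sq[OF hs _ zero_less_one _ L2_norm_minus_commute that]) (use nS in auto)
 qed
 have cw: "cf w j = h j" for j
 proof -
  have "\<bar>(if j < n then h j else 0) - cf w j\<bar> \<le> nL (?S n - w)" for n
   using inner_CS[OF L2_diff[OF LC(4) w] psi_D(3), of n h j] orth[of j j] inner_self[of "\<psi> j"] L2_norm_nonneg[of "\<psi> j"]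
   by (simp add: cf_diff[OF LC(4) w] cf_lin_comb power2_eq_1_iff)
  hence "(\<lambda>n. (if j < n then h j else 0) - cf w j) \<longlonglongrightarrow> 0"
   by (intro Lim_null_comparison[OF always_eventually lim] allI) auto
  moreover have "\<forall>\<^sub>F n in sequentially. (if j < n then h j else 0) - cf w j = h j - cf w j"
   using eventually_gt_at_top[of j] by eventually_elim simp
  hence "(\<lambda>n. (if j < n then h j else 0) - cf w j) \<longlonglongrightarrow> h j - cf w j" by (rule tendsto_eventually)
  ultimately show ?thesis using LIMSEQ_unique by fastforce
 qed
 have wd: "w \<in> dfn \<bar>s\<bar>" using True w h by (simp add: dot_fn_def cw)
 show thesis
  by (rule that[of "Fn w"]) (use True wd ne_D(2) ne_D(4)[OF wd] in \<open>auto simp: H_KD_def cw\<close>)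
next
 case False
 hence as: "\<bar>s\<bar> = - s" by simp
 let ?S = "dfn (- s)" and ?N = "Hs_norm G (- s)"
 note D = ne_D[unfolded as]
 define T where "T v = (if v \<in> ?S then \<Sum>i. h i*cf v i else 0)" for v
 note P = dual_pairing[OF h dot_fnD(2)]
 have Tb: "\<bar>T v\<bar> \<le> dot_norm \<mu> s h*dotn (- s) v" if "v \<in> ?S" for v using P(2)[OF that] that by (simp add: T_def)
 have "T \<in> dual ?S (dotn (- s))"
  unfolding dual_def
 proof (intro CollectI conjI ballI allI impI exI[of _ "dot_norm \<mu> s h"])
  show "T (u + v) = T u + T v" if "u \<in> ?S" "v \<in> ?S" for u v
   using that dot_fn_add[OF that] suminf_add[OF P(1)[OF that(1)] P(1)[OF that(2)]] dot_fnD(1)[OF that(1)] dot_fnD(1)[OF that(2)]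
   by (simp add: T_def inner_add_left psi_D(3) distrib_left)
  show "T (scl c u) = c*T u" if "u \<in> ?S" for c u
   using that dot_fn_scl(1)[OF that, of c] suminf_mult[OF P(1)[OF that], of c] by (simp add: T_def inner_scl_left mult.left_commute)
 qed (use Tb in \<open>auto simp: T_def\<close>)
 hence Td: "T \<in> dual ?S ?N" using dual_eq as by simp
 have Tp: "T (\<psi> j) = h j" for j
 proof -
  have "h i*cf (\<psi> j) i = (if i = j then h i else 0)" for i by (simp add: orth)
  thus ?thesis using sums_unique[OF sums_single[of j h]] psi_dot[of j "- s"] by (simp add: T_def)
 qed
 have h0: "0 \<le> dot_norm \<mu> s h" by (rule dot_norm_nonneg[OF h])
 have "dual_norm ?S ?N T \<le> C*dot_norm \<mu> s h"
  unfolding dual_norm_def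
 proof (rule cSup_least)
  have "scl 0 (\<psi> 0) \<in> ?S" "?N (scl 0 (\<psi> 0)) \<le> 1"
   using dot_fn_scl[OF psi_dot[of 0 "- s"], of 0] D(4)[of "scl 0 (\<psi> 0)"] by auto
  thus "{\<bar>T u\<bar> |u. u \<in> ?S \<and> ?N u \<le> 1} \<noteq> {}" by blast
  fix y assume "y \<in> {\<bar>T u\<bar> |u. u \<in> ?S \<and> ?N u \<le> 1}"
  then obtain u where u: "y = \<bar>T u\<bar>" "u \<in> ?S" "?N u \<le> 1" by blast
  have "dotn (- s) u \<le> C*1" using D(5)[OF u(2)] mult_left_mono[OF u(3), of C] D(1) by linarith
  thus "y \<le> C*dot_norm \<mu> s h" using Tb[OF u(2)] mult_left_mono[OF _ h0, of "dotn (- s) u" "C*1"] u(1) by (simp add: mult.commute)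
 qed
 thus thesis
  by (intro that[of "Functional T"]) (use False Td D(2) Tp in \<open>auto simp: H_KD_def\<close>)
qed

text \<open>For functions this is completeness of the eigenbasis, for functionals
  \<open>dual_expansion\<close>.\<close>

lemma coefficients_unique:
 assumes u: "u \<in> H_KD G VK VD s" and v: "v \<in> H_KD G VK VD s" and eq: "\<And>j. pairing G u (\<psi> j) = pairing G v (\<psi> j)"
 shows "elem_eq G u v"
proof (cases "0 \<le> s")
 case True
 then obtain x y where e: "u = Fn x" "v = Fn y" and xy: "x \<in> L2 G" "y \<in> L2 G"
  using u v ne_D(2) dot_fnD(1) by (auto simp: H_KD_def)
 have "aeq G (x - y) 0" by (rule cf_zero_aeq[OF L2_diff[OF xy]]) (use eq e cf_diff[OF xy] in auto)
 hence "aeq G x y" by (simp add: aeq_def)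
 thus ?thesis by (simp add: e)
next
 case False
 hence as: "\<bar>s\<bar> = - s" by simp
 obtain S T where e: "u = Functional S" "v = Functional T"
  and d: "S \<in> dual (dfn (- s)) (dotn (- s))" "T \<in> dual (dfn (- s)) (dotn (- s))"
  using u v False unfolding H_KD_eq by (auto simp: dot_H_def)
 have "S w = T w" for w
 proof (cases "w \<in> dfn (- s)")
  case True
  have "(\<lambda>i. cf w i*T (\<psi> i)) sums S w" using dual_expansion[OF d(1) True] eq e by simp
  thus ?thesis using dual_expansion[OF d(2) True] sums_unique2 by blast
 qed (use dualD(3) d in metis)
 thus ?thesis by (auto simp: e)
qed

end

text \<open>On coefficients the equation is multiplication by
  \<open>\<mu> i powr (\<alpha>/2)\<close>, so the solution has the coefficients \<open>h\<close>,
  and its spectral norm of order \<open>\<alpha> + \<beta>\<close> equals that of \<open>f\<close>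
  of order \<open>\<beta>\<close>. The constants enter only in the passage to the Sobolev
  norms.\<close>

lemma fractional_equation:
 assumes ns: "norm_equiv G VK VD \<bar>\<alpha> + \<beta>\<bar> \<psi> \<mu> C" and nb: "norm_equiv G VK VD \<bar>\<beta>\<bar> \<psi> \<mu> C'"
  and f: "f \<in> H_KD G VK VD \<beta>"
 shows "\<exists>u \<in> H_KD G VK VD (\<alpha> + \<beta>). frac_eq G \<psi> \<mu> \<alpha> (\<alpha> + \<beta>) u f \<and>
  (\<forall>u' \<in> H_KD G VK VD (\<alpha> + \<beta>). frac_eq G \<psi> \<mu> \<alpha> (\<alpha> + \<beta>) u' f \<longrightarrow> elem_eq G u' u) \<and>
  H_KD_norm G VK VD (\<alpha> + \<beta>) u \<le> C*C'*H_KD_norm G VK VD \<beta> f"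
proof -
 let ?s = "\<alpha> + \<beta>"
 define g where "g j = pairing G f (\<psi> j)" for j
 define h where "h j = \<mu> j powr (- \<alpha>/2)*g j" for j
 note cb = coefficients[OF nb f, folded g_def]
 have e: "\<mu> i powr ?s*(h i)^2 = \<mu> i powr \<beta>*(g i)^2" for i
 proof -
  have "\<mu> i powr ?s*(\<mu> i powr (- \<alpha>/2))^2 = \<mu> i powr \<beta>"
   by (simp add: power2_eq_square powr_add[symmetric])
  thus ?thesis by (simp add: h_def power_mult_distrib mult.assoc[symmetric])
 qed
 have gh: "\<mu> i powr (\<alpha>/2)*h i = g i" for i
  using mu_pos[of i] by (simp add: h_def mult.assoc[symmetric] powr_add[symmetric])
 have hs: "summable (\<lambda>i. \<mu> i powr ?s*(h i)^2)" unfolding e by (rule cb(1))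
 have nh: "dot_norm \<mu> ?s h = dot_norm \<mu> \<beta> g" unfolding dot_norm_def e ..
 obtain u where u: "u \<in> H_KD G VK VD ?s" "\<And>j. pairing G u (\<psi> j) = h j" "H_KD_norm G VK VD ?s u \<le> C*dot_norm \<mu> ?s h"
  using realization[OF ns hs] by blast
 have rem: "(\<lambda>j. pairing G f (\<psi> j) - ip (lin_comb n d \<psi>) (\<psi> j)) = (\<lambda>j. g j - (if j < n then d j else 0))" for n d
  by (simp add: g_def cf_lin_comb fun_eq_iff)
 have fe: "frac_eq G \<psi> \<mu> \<alpha> ?s u f"
  unfolding frac_eq_def
 proof (intro conjI)
  show "u \<in> dot_H G \<psi> \<mu> ?s" using u(1) H_KD_eq[OF ns] by simp
  show "f \<in> dot_H G \<psi> \<mu> (?s - \<alpha>)" using f H_KD_eq[OF nb] by simp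
  have "(\<lambda>j. g j - (if j < n then \<mu> j powr (\<alpha>/2)*pairing G u (\<psi> j) else 0)) = (\<lambda>j. if j < n then 0 else g j)" for n
   by (auto simp: u(2) gh)
  thus "(\<lambda>n. dot_norm \<mu> (?s - \<alpha>) (\<lambda>j. pairing G f (\<psi> j) -
    ip (lin_comb n (\<lambda>i. \<mu> i powr (\<alpha>/2)*pairing G u (\<psi> i)) \<psi>) (\<psi> j))) \<longlonglongrightarrow> 0"
   unfolding rem using tail_dot[OF cb(1)] by simp
 qed
 have uq: "elem_eq G u' u" if u': "u' \<in> H_KD G VK VD ?s" and fe': "frac_eq G \<psi> \<mu> \<alpha> ?s u' f" for u'
 proof (rule coefficients_unique[OF ns u' u(1)])
  fix j
  define h' where "h' i = \<mu> i powr (\<alpha>/2)*pairing G u' (\<psi> i)" for i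
  let ?r = "\<lambda>n j. g j - (if j < n then h' j else 0)"
  have lim: "(\<lambda>n. dot_norm \<mu> \<beta> (?r n)) \<longlonglongrightarrow> 0" using fe' unfolding frac_eq_def rem h'_def by simp
  \<comment> \<open>For \<open>n > j\<close> the coefficient \<open>j\<close> of the remainder no
    longer changes, and it is bounded by the norm that tends to 0.\<close>
  have b: "(\<mu> j powr \<beta>*(g j - h' j)^2) \<le> (dot_norm \<mu> \<beta> (?r n))^2" if n: "j < n" for n
  proof -
   have "summable (\<lambda>i. \<mu> i powr \<beta>*(?r n i)^2)"
    by (rule summable_cong[THEN iffD1, OF _ cb(1)]) (auto intro: eventually_mono[OF eventually_ge_at_top[of n]])
   from sum_le_suminf[OF this, of "{j}"] dot_norm_sq[OF this] n show ?thesis by simp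
  qed
  have "\<mu> j powr \<beta>*(g j - h' j)^2 \<le> 0^2"
   by (rule tendsto_le[OF _ tendsto_power[OF lim] tendsto_const]) (auto intro: eventually_mono[OF eventually_gt_at_top[of j] b])
  hence "g j = h' j" using mu_pos[of j] by (simp add: mult_le_0_iff)
  hence "\<mu> j powr (\<alpha>/2)*h j = \<mu> j powr (\<alpha>/2)*pairing G u' (\<psi> j)" by (simp add: gh h'_def)
  thus "pairing G u' (\<psi> j) = pairing G u (\<psi> j)" using mu_pos[of j] u(2) by simp
 qed
 have "C*dot_norm \<mu> ?s h \<le> C*(C'*H_KD_norm G VK VD \<beta> f)"
  unfolding nh using cb(2) ne_D(1)[OF ns] by (intro mult_left_mono) auto
 hence "H_KD_norm G VK VD ?s u \<le> C*C'*H_KD_norm G VK VD \<beta> f" using u(3) by (simp add: mult.assoc)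
 thus ?thesis using u(1) fe uq by blast
qed

end

section \<open>Coefficients of the operator\<close>

text \<open>The continuous function \<open>min (f x - c) 0\<close> is zero almost everywhere, hence
  everywhere.\<close>

lemma continuous_AE_le:
 fixes f :: "real => real"
 assumes f: "continuous_on {0..l} f" and ae: "AE x in Lb l. c \<le> f x" and l: "0 < l" and x: "x \<in> {0..l}"
 shows "c \<le> f x"
proof -
 have "min (f x - c) 0 = 0"
  by (rule continuous_AE_zero[OF _ _ l x]) (use ae in \<open>auto intro!: continuous_intros f elim: eventually_mono\<close>)
 thus ?thesis by (simp add: min_def split: if_splits)
qed

lemma continuous_AE_eq:
 fixes f g :: "real => real"
 assumes "continuous_on {0..l} f" "continuous_on {0..l} g" "AE x in Lb l. f x = g x" "0 < l" "x \<in> {0..l}"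
 shows "f x = g x"
 using continuous_AE_zero[of l "\<lambda>x. f x - g x", OF continuous_on_diff[OF assms(1,2)] _ assms(4,5)] assms(3) by simp

lemma walk_nonneg:
 assumes "metric_graph G" shows "walk G v w L ==> 0 \<le> L"
proof (induction rule: walk.induct)
 case (walk_step e b w L)
 hence "0 < len G e" using assms by (simp add: metric_graph_def)
 thus ?case using walk_step by simp
qed simp

context mgr
begin

lemma geodist_le:
 assumes e: "e \<in> edges G" "e' \<in> edges G" and x: "x \<in> seg e" "y \<in> {0..len G e'}"
 shows "0 \<le> geodist G (e, x) (e', y)" "e = e' ==> geodist G (e, x) (e', y) \<le> \<bar>x - y\<bar>"
  "walk G (origin G e b) (origin G e' b') L ==> geodist G (e, x) (e', y) \<le> param G e b x + L + param G e' b' y"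
proof -
 let ?S = "(if e = e' then {\<bar>x - y\<bar>} else {}) \<union>
     {param G e b x + L + param G e' b' y | b b' L. walk G (origin G e b) (origin G e' b') L}"
 have pn: "0 \<le> param G e b x" "0 \<le> param G e' b y" for b using x by (cases b; simp add: param_def)+
 have nn: "0 \<le> z" if "z \<in> ?S" for z
 proof -
  have "z \<in> (if e = e' then {\<bar>x - y\<bar>} else {}) \<or> (\<exists>b b' L. z = param G e b x + L + param G e' b' y \<and> walk G (origin G e b) (origin G e' b') L)"
   using that by blast
  thus ?thesis
  proof (elim disjE exE conjE)
   fix b b' L assume "z = param G e b x + L + param G e' b' y" "walk G (origin G e b) (origin G e' b') L"
   thus ?thesis using pn(1)[of b] pn(2)[of b'] walk_nonneg[OF mg] by fastforce
  qed (simp split: if_splits)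
 qed
 hence bb: "bdd_below ?S" by (rule bdd_belowI)
 obtain L0 where "walk G (origin G e True) (origin G e' True) L0"
  using mg origin_vert[OF e(1), of True] origin_vert[OF e(2), of True] unfolding metric_graph_def by blast
 hence "?S \<noteq> {}" by blast
 thus "0 \<le> geodist G (e, x) (e', y)" unfolding geodist_def by (simp only: prod.case) (rule cInf_greatest, assumption, rule nn)
 show "geodist G (e, x) (e', y) \<le> \<bar>x - y\<bar>" if "e = e'"
  unfolding geodist_def prod.case by (rule cInf_lower[OF _ bb]) (simp add: that)
 show "geodist G (e, x) (e', y) \<le> param G e b x + L + param G e' b' y" if "walk G (origin G e b) (origin G e' b') L"
  unfolding geodist_def prod.case by (rule cInf_lower[OF _ bb]) (use that in blast)
qed

text \<open>Two ends at the same vertex have geodesic distance 0, by the walk of length 0, so the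
  values there agree.\<close>

lemma lipschitz_graph:
 assumes "lipschitz_on_graph G u"
 shows "e \<in> edges G ==> continuous_on (seg e) (u e)"
  "e \<in> edges G ==> e' \<in> edges G ==> origin G e b = origin G e' b' ==> u e (param G e b 0) = u e' (param G e' b' 0)"
proof -
 obtain C where C: "\<And>e e' x y. e \<in> edges G ==> e' \<in> edges G ==> x \<in> seg e ==> y \<in> {0..len G e'} ==>
   \<bar>u e x - u e' y\<bar> \<le> C*geodist G (e, x) (e', y)"
  using assms unfolding lipschitz_on_graph_def by blast
 show "continuous_on (seg e) (u e)" if e: "e \<in> edges G"
 proof (rule lipschitz_on_continuous_on[of "\<bar>C\<bar>"], rule lipschitz_onI)
  fix x y assume xy: "x \<in> seg e" "y \<in> seg e"
  have "C*geodist G (e, x) (e, y) \<le> \<bar>C\<bar>*\<bar>x - y\<bar>"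
   by (rule mult_mono) (use geodist_le(1,2)[OF e e xy] in auto)
  thus "dist (u e x) (u e y) \<le> \<bar>C\<bar>*dist x y" using C[OF e e xy] by (simp add: dist_real_def)
 qed simp
 assume e: "e \<in> edges G" "e' \<in> edges G" and o: "origin G e b = origin G e' b'"
 have "walk G (origin G e b) (origin G e' b') 0" using walk_refl[OF origin_vert[OF e(1), of b]] o by simp
 from geodist_le(3)[OF e param_end[OF e(1), of b] param_end[OF e(2), of b'] this] geodist_le(1)[OF e param_end[OF e(1), of b] param_end[OF e(2), of b']]
 have "geodist G (e, param G e b 0) (e', param G e' b' 0) = 0" by (simp add: param_def split: if_splits)
 thus "u e (param G e b 0) = u e' (param G e' b' 0)" using C[OF e param_end[OF e(1), of b] param_end[OF e(2), of b']] by simp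
qed

text \<open>There are finitely many edges, and the property persists for larger constants.\<close>

lemma uniform_const:
 assumes "\<And>e. e \<in> edges G ==> \<exists>c::real. \<forall>c'\<ge>c. P e c'" obtains c where "\<And>e. e \<in> edges G ==> P e c"
proof -
 have "eventually (\<lambda>c. \<forall>e\<in>edges G. P e c) at_top"
  using assms by (intro eventually_ball_finite fin_edges) (simp add: eventually_at_top_linorder)
 thus thesis using that eventually_happens'[OF trivial_limit_at_top_linorder] by blast
qed

text \<open>The assumptions on \<open>a\<close> may concern different representatives: the Lipschitz
  one gives continuity at the vertices, the edgewise one the derivative. Both are continuous on the
  closed edges, hence equal there. Continuity also turns bounds almost everywhere into bounds
  everywhere.\<close>

lemma regular_coefficients:
 assumes V: "VK \<union> VD = verts G" "VK \<inter> VD = {}" and ne: "edges G \<noteq> {}"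
  and Linf: "Linf G a" "Linf G \<kappa>" and pos: "ess_inf_pos G a" "ess_inf_pos G \<kappa>"
  and lip: "has_rep G (lipschitz_on_graph G) a" and reg: "has_rep G (edgewise_Ck1 G 1) a" "has_rep G (edgewise_Ck1 G 0) (\<lambda>e x. (\<kappa> e x)^2)"
 obtains b b' q k0 k1 a0 a1 a2 \<Lambda> where "kop G VK VD b b' q k0 k1 a0 a1 a2 \<Lambda>" "aeq G a b" "aeq G (\<lambda>e x. (\<kappa> e x)^2) q"
proof -
 obtain aL where aL: "aeq G a aL" "lipschitz_on_graph G aL" using lip unfolding has_rep_def by blast
 obtain b where b: "aeq G a b" "edgewise_Ck1 G 1 b" using reg(1) unfolding has_rep_def by blast
 obtain q where q: "aeq G (\<lambda>e x. (\<kappa> e x)^2) q" "edgewise_Ck1 G 0 q" using reg(2) unfolding has_rep_def by blast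
 have "\<exists>d. (\<forall>x\<in>seg e. (b e has_real_derivative d x) (at x within seg e)) \<and> (\<exists>C. C-lipschitz_on (seg e) d)" if e: "e \<in> edges G" for e
 proof -
  have "Ck1 1 (seg e) (b e)" using b(2) e unfolding edgewise_Ck1_def by blast
  then obtain d C where d: "\<forall>x\<in>seg e. d 0 x = b e x"
   "\<forall>j<1. \<forall>x\<in>seg e. (d j has_real_derivative d (Suc j) x) (at x within seg e)" "C-lipschitz_on (seg e) (d 1)"
   unfolding Ck1_def by blast
  have "(b e has_real_derivative d 1 x) (at x within seg e)" if x: "x \<in> seg e" for x
   by (rule has_field_derivative_transform_within[of "d 0", OF _ zero_less_one x]) (use d(1) d(2)[rule_format, of 0 x] x in auto)
  thus ?thesis using d(3) by blast
 qed
 hence "\<exists>b'. \<forall>e\<in>edges G. (\<forall>x\<in>seg e. (b e has_real_derivative b' e x) (at x within seg e)) \<and> (\<exists>C. C-lipschitz_on (seg e) (b' e))"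
  by (intro bchoice ballI)
 then obtain b' where b': "\<And>e x. e \<in> edges G ==> x \<in> seg e ==> (b e has_real_derivative b' e x) (at x within seg e)"
  and b'l: "\<And>e. e \<in> edges G ==> \<exists>C. C-lipschitz_on (seg e) (b' e)" by blast
 have bc: "continuous_on (seg e) (b e)" if "e \<in> edges G" for e
  unfolding continuous_on_eq_continuous_within using DERIV_continuous[OF b'[OF that]] by blast
 have ql: "\<exists>C. C-lipschitz_on (seg e) (q e)" if e: "e \<in> edges G" for e
 proof -
  have "Ck1 0 (seg e) (q e)" using q(2) e unfolding edgewise_Ck1_def by blast
  then obtain d C where "\<forall>x\<in>seg e. d 0 x = q e x" "C-lipschitz_on (seg e) (d (0::nat))"
   unfolding Ck1_def by blast
  thus ?thesis by (auto simp: lipschitz_on_def)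
 qed
 obtain \<Lambda> where Lam: "\<And>e. e \<in> edges G ==> \<Lambda>-lipschitz_on (seg e) (q e) \<and> \<Lambda>-lipschitz_on (seg e) (b' e)"
 proof (rule uniform_const)
  fix e assume e: "e \<in> edges G"
  obtain C C' where "C-lipschitz_on (seg e) (q e)" "C'-lipschitz_on (seg e) (b' e)" using ql[OF e] b'l[OF e] by blast
  thus "\<exists>c. \<forall>c'\<ge>c. c'-lipschitz_on (seg e) (q e) \<and> c'-lipschitz_on (seg e) (b' e)"
   by (intro exI[of _ "max C C'"]) (auto intro: lipschitz_on_le)
 qed (rule that)
 have qc: "continuous_on (seg e) (q e)" and b'c: "continuous_on (seg e) (b' e)" if "e \<in> edges G" for e
  using Lam[OF that] lipschitz_on_continuous_on by blast+
 obtain a2 where a2: "\<And>e. e \<in> edges G ==> \<forall>x\<in>seg e. \<bar>b' e x\<bar> \<le> a2"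
 proof (rule uniform_const)
  fix e assume e: "e \<in> edges G"
  have "bounded (b' e ` seg e)" by (rule compact_imp_bounded[OF compact_continuous_image[OF b'c[OF e] compact_Icc]])
  thus "\<exists>c. \<forall>c'\<ge>c. \<forall>x\<in>seg e. \<bar>b' e x\<bar> \<le> c'" unfolding bounded_iff by (metis image_eqI order_trans real_norm_def)
 qed (rule that)
 obtain A where A: "\<And>e. e \<in> edges G ==> AE x in leb G e. \<bar>a e x\<bar> \<le> A" using Linf(1) unfolding Linf_def by blast
 obtain K where K: "\<And>e. e \<in> edges G ==> AE x in leb G e. \<bar>\<kappa> e x\<bar> \<le> K" using Linf(2) unfolding Linf_def by blast
 obtain c where c: "0 < c" "\<And>e. e \<in> edges G ==> AE x in leb G e. c \<le> a e x" using pos(1) unfolding ess_inf_pos_def by blast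
 obtain k where k: "0 < k" "\<And>e. e \<in> edges G ==> AE x in leb G e. k \<le> \<kappa> e x" using pos(2) unfolding ess_inf_pos_def by blast
 have bb: "c \<le> b e x \<and> b e x \<le> A" if e: "e \<in> edges G" and x: "x \<in> seg e" for e x
 proof
  show "c \<le> b e x"
   by (rule continuous_AE_le[OF bc[OF e] _ len_pos[OF e] x]) (use c(2)[OF e] aeqD[OF b(1) e] in eventually_elim, simp)
  have "- A \<le> - b e x"
   by (rule continuous_AE_le[OF continuous_on_minus[OF bc[OF e]] _ len_pos[OF e] x]) (use A[OF e] aeqD[OF b(1) e] in eventually_elim, simp)
  thus "b e x \<le> A" by simp
 qed
 have qb: "k^2 \<le> q e x \<and> q e x \<le> K^2" if e: "e \<in> edges G" and x: "x \<in> seg e" for e x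
 proof
  show "k^2 \<le> q e x"
  proof (rule continuous_AE_le[OF qc[OF e] _ len_pos[OF e] x])
   show "AE x in leb G e. k^2 \<le> q e x" using k(2)[OF e] aeqD[OF q(1) e]
    by eventually_elim (use k(1) in \<open>auto dest: power_mono[of k _ 2]\<close>)
  qed
  have "- (K^2) \<le> - q e x"
  proof (rule continuous_AE_le[OF continuous_on_minus[OF qc[OF e]] _ len_pos[OF e] x])
   show "AE x in leb G e. - (K^2) \<le> - q e x" using K[OF e] aeqD[OF q(1) e]
    by eventually_elim (auto dest: power_mono[of "\<bar>_\<bar>" _ 2])
  qed
  thus "q e x \<le> K^2" by simp
 qed
 have vert: "b e (param G e o1 0) = b e' (param G e' o2 0)" if e: "e \<in> edges G" "e' \<in> edges G" and o: "origin G e o1 = origin G e' o2" for e e' o1 o2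
 proof -
  have eq: "aL e x = b e x" if e: "e \<in> edges G" and x: "x \<in> seg e" for e x
   by (rule continuous_AE_eq[OF lipschitz_graph(1)[OF aL(2) e] bc[OF e] aeqD[OF aeq_trans[OF aeq_sym[OF aL(1)] b(1)] e] len_pos[OF e] x])
  show ?thesis using lipschitz_graph(2)[OF aL(2) e o] eq[OF e(1) param_end[OF e(1)]] eq[OF e(2) param_end[OF e(2)]] by simp
 qed
 have k2: "0 < k^2" using k(1) by simp
 have "kop G VK VD b b' q (k^2) (K^2) c A a2 \<Lambda>"
  by unfold_locales (rule V ne k2 c(1) qb bb bspec[OF a2] b' Lam[THEN conjunct1] Lam[THEN conjunct2] vert; assumption)+
 thus thesis using that b(1) q(1) by blast
qed

end

text \<open>\<open>L_op\<close> is formed with the given coefficients, \<open>Lop\<close> with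
  regular representatives. By \<open>wD_cong\<close> the weak derivative depends only on the class
  of its argument, so the two agree; \<open>Linf\<close> supplies the measurability.\<close>

lemma (in kop) eigenbasis_eigl:
 assumes b: "aeq G a0' a" and qk: "aeq G (\<lambda>e x. (\<kappa> e x)^2) q" and Linf: "Linf G a0'" and eb: "eigenbasis G VK VD a0' \<kappa> \<psi> \<mu>"
 shows "eigl G VK VD a a' q k0 k1 a0 a1 a2 \<Lambda> \<psi> \<mu>"
proof unfold_locales
 show lp: "\<psi> i \<in> Lp" and "0 < \<mu> i" for i using eb L_dom_eq unfolding eigenbasis_def by auto
 show "ip (\<psi> i) (\<psi> j) = (if i = j then 1 else 0)" for i j using eb unfolding eigenbasis_def by blast
 show "(\<lambda>n. nL (u - lin_comb n (\<lambda>i. ip u (\<psi> i)) \<psi>)) \<longlonglongrightarrow> 0" if "u \<in> L2 G" for u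
  using eb that unfolding eigenbasis_def by blast
 show "aeq G (Lop (\<psi> i)) (scl (\<mu> i) (\<psi> i))" for i
 proof -
  let ?u = "\<psi> i"
  have "aeq G (Lop ?u) (L_op G a0' \<kappa> ?u)"
   unfolding aeq_def
  proof
   fix e assume e: "e \<in> edges G"
   have s: "sqi (leb G e) (\<lambda>x. a e x*DG ?u e x)"
    using L2D[OF mlt_a_L2(1)[OF D_L2[OF LpD(3)[OF lp]]] e] by (simp add: mlt_def)
   have m: "(\<lambda>x. a0' e x*DG ?u e x) \<in> borel_measurable (leb G e)"
    using Linf e sqi_borel[OF L2D[OF D_L2[OF LpD(3)[OF lp]] e]] unfolding Linf_def by (intro borel_measurable_times) auto
   have ae: "AE x in leb G e. a e x*DG ?u e x = a0' e x*DG ?u e x"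
    using aeqD[OF b e] by eventually_elim simp
   have "wD (len G e) (\<lambda>x. a e x*DG ?u e x) = wD (len G e) (\<lambda>x. a0' e x*DG ?u e x)"
    by (rule wD_cong[OF s sqi_cong_AE[OF s m ae] ae])
   thus "AE x in leb G e. Lop ?u e x = L_op G a0' \<kappa> ?u e x"
    using aeqD[OF qk e] by (simp add: Lop_def L_op_def D_graph_def mlt_def gfn_minus) (auto elim: eventually_mono)
  qed
  moreover have "aeq G (L_op G a0' \<kappa> ?u) (scl (\<mu> i) ?u)" using eb unfolding eigenbasis_def by blast
  ultimately show ?thesis by (rule aeq_trans)
 qed
qed

theorem corollary6:
  fixes G :: "('v, 'e) mgraph" and VK VD :: "'v set"
    and a \<kappa> :: "'e \<Rightarrow> real \<Rightarrow> real" and \<alpha> \<beta> :: real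
  assumes "metric_graph G"
    and "VK \<union> VD = verts G" and "VK \<inter> VD = {}"
    and "Linf G a" and "Linf G \<kappa>"
    and "ess_inf_pos G a" and "ess_inf_pos G \<kappa>"
    and "has_rep G (lipschitz_on_graph G) a"
    and "has_rep G (edgewise_Ck1 G 1) a"
    and "has_rep G (edgewise_Ck1 G 0) (\<lambda>e x. (\<kappa> e x)\<^sup>2)"
    and "\<alpha> \<in> {-5<..<5}"
    and "\<beta> \<in> {-5/2<..<5/2} - {1/2, -1/2, 3/2, -3/2}"
    and "\<alpha> + \<beta> \<in> {-5/2<..<5/2} - {1/2, -1/2, 3/2, -3/2}"
  shows "\<exists>C. \<forall>\<psi> \<mu>. eigenbasis G VK VD a \<kappa> \<psi> \<mu> \<longrightarrow>
           (\<forall>f \<in> H_KD G VK VD \<beta>. \<exists>u \<in> H_KD G VK VD (\<alpha> + \<beta>).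
              frac_eq G \<psi> \<mu> \<alpha> (\<alpha> + \<beta>) u f \<and>
              (\<forall>u' \<in> H_KD G VK VD (\<alpha> + \<beta>). frac_eq G \<psi> \<mu> \<alpha> (\<alpha> + \<beta>) u' f \<longrightarrow> elem_eq G u' u) \<and>
              H_KD_norm G VK VD (\<alpha> + \<beta>) u \<le> C * H_KD_norm G VK VD \<beta> f)"
proof (cases "edges G = {}")
 \<comment> \<open>Without edges the inner product is 0, so no orthonormal family exists and any
   constant will do.\<close>
 case True
 have "\<not> eigenbasis G VK VD a \<kappa> \<psi> \<mu>" for \<psi> \<mu>
 proof
  assume "eigenbasis G VK VD a \<kappa> \<psi> \<mu>"
  hence "L2_inner G (\<psi> 0) (\<psi> 0) = 1" unfolding eigenbasis_def by auto
  thus False using True by (simp add: L2_inner_def)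
 qed
 thus ?thesis by blast
next
 case False
 interpret mgr G by unfold_locales (rule assms(1))
 obtain b b' q k0 k1 a0 a1 a2 \<Lambda> where kop: "kop G VK VD b b' q k0 k1 a0 a1 a2 \<Lambda>"
  and ae: "aeq G a b" "aeq G (\<lambda>e x. (\<kappa> e x)^2) q"
  using regular_coefficients[OF assms(2,3) False assms(4-10)] by blast
 interpret kop G VK VD b b' q k0 k1 a0 a1 a2 \<Lambda> by (rule kop)
 have ex: "\<exists>C. \<forall>\<psi> \<mu>. eigl G VK VD b b' q k0 k1 a0 a1 a2 \<Lambda> \<psi> \<mu> \<longrightarrow> norm_equiv G VK VD \<bar>s\<bar> \<psi> \<mu> C"
  if "s \<in> {-5/2<..<5/2} - {1/2, -1/2, 3/2, -3/2}" for s
 proof -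
  have "0 \<le> \<bar>s\<bar>" "\<bar>s\<bar> < 5/2" "\<bar>s\<bar> \<noteq> 1/2" "\<bar>s\<bar> \<noteq> 3/2" using that by (auto simp: abs_if split: if_splits)
  from norm_equiv_exists[OF this] show ?thesis by metis
 qed
 \<comment> \<open>The constants for the order of the solution and for that of the data are fixed
   before \<open>\<psi>\<close> and \<open>\<mu>\<close> are introduced.\<close>
 obtain C where C: "\<forall>\<psi> \<mu>. eigl G VK VD b b' q k0 k1 a0 a1 a2 \<Lambda> \<psi> \<mu> \<longrightarrow> norm_equiv G VK VD \<bar>\<alpha> + \<beta>\<bar> \<psi> \<mu> C"
  using ex[OF assms(13)] by (elim exE)
 obtain C' where C': "\<forall>\<psi> \<mu>. eigl G VK VD b b' q k0 k1 a0 a1 a2 \<Lambda> \<psi> \<mu> \<longrightarrow> norm_equiv G VK VD \<bar>\<beta>\<bar> \<psi> \<mu> C'"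
  using ex[OF assms(12)] by (elim exE)
 show ?thesis
 proof (intro exI[of _ "C*C'"] allI impI ballI)
  fix \<psi> \<mu> f assume "eigenbasis G VK VD a \<kappa> \<psi> \<mu>" and f: "f \<in> H_KD G VK VD \<beta>"
  hence E: "eigl G VK VD b b' q k0 k1 a0 a1 a2 \<Lambda> \<psi> \<mu>" using eigenbasis_eigl[OF ae assms(4)] by blast
  show "\<exists>u \<in> H_KD G VK VD (\<alpha> + \<beta>). frac_eq G \<psi> \<mu> \<alpha> (\<alpha> + \<beta>) u f \<and>
    (\<forall>u' \<in> H_KD G VK VD (\<alpha> + \<beta>). frac_eq G \<psi> \<mu> \<alpha> (\<alpha> + \<beta>) u' f \<longrightarrow> elem_eq G u' u) \<and>
    H_KD_norm G VK VD (\<alpha> + \<beta>) u \<le> C*C'*H_KD_norm G VK VD \<beta> f"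
   by (rule eigl.fractional_equation[OF E C[rule_format, OF E] C'[rule_format, OF E] f])
 qed
qed

end
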